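(* Let $H$ be a Hopf algebra over a field $\mathbf{k}$ with a bijective antipode. If $B/A$ is a faithfully flat $H$-Galois extension, then the Ehresmann–Schauenburg bialgebroid $\Gamma$ is a projective left $A^e$-module.
   Context: $\otimes=\otimes_{\mathbf k}$; $R^e=R\otimes R^{\mathrm{op}}$. $B$ is a right $H$-comodule algebra with coaction $\rho(b)=\sum b_{(0)}\otimes b_{(1)}$ and $A=B^{\mathrm{co}H}=\{b\in B\mid\rho(b)=b\otimes1\}$. $B/A$ is $H$-Galois if $\beta:B\otimes_AB\to B\otimes H$, $b\otimes_Ab'\mapsto\sum bb'_{(0)}\otimes b'_{(1)}$, is bijective; it is faithfully flat if moreover $B$ is faithfully flat as a left (equivalently, as a right) $A$-module. The Ehresmann–Schauenburg bialgebroid is $$\Gamma=\Bigl\{\sum_p b_p\otimes b_p'^{\mathrm{op}}\in B^e\ \Big|\ \sum_p(b_p)_{(0)}\otimes(b'_p)_{(0)}^{\mathrm{op}}\otimes(b_p)_{(1)}(b'_p)_{(1)}=\sum_pb_p\otimes b_p'^{\mathrm{op}}\otimes1_H\Bigr\},$$ a subalgebra of $B^e$ containing $A^e$; its left $A^e$-module structure is given by left multiplication. *)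

theory Defs
  imports "HOL-Algebra.Module" "HOL-Algebra.Free_Abelian_Groups"
begin

section \<open>Modules over arbitrary rings\<close>

definition opp :: "('a, 'x) ring_scheme \<Rightarrow> ('a, 'x) ring_scheme"
  where "opp R = R\<lparr>monoid.mult := \<lambda>x y. y \<otimes>\<^bsub>R\<^esub> x\<rparr>"

text \<open>The library's \<^locale>\<open>module\<close> requires a commutative ring of scalars. The ring-theoretic fields
  \<^term>\<open>monoid.mult\<close> and \<^term>\<open>one\<close> of a module record are irrelevant here, as in the library.\<close>

locale left_module = R: ring R + M: abelian_group M
  for R :: "('r, 'x) ring_scheme" (structure) and M :: "('r, 'm, 'y) module_scheme" (structure) +
  assumes smult_closed:
      "\<lbrakk>r \<in> carrier R; m \<in> carrier M\<rbrakk> \<Longrightarrow> r \<odot>\<^bsub>M\<^esub> m \<in> carrier M"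
    and smult_l_distr:
      "\<lbrakk>r \<in> carrier R; s \<in> carrier R; m \<in> carrier M\<rbrakk> \<Longrightarrow>
        (r \<oplus>\<^bsub>R\<^esub> s) \<odot>\<^bsub>M\<^esub> m = r \<odot>\<^bsub>M\<^esub> m \<oplus>\<^bsub>M\<^esub> s \<odot>\<^bsub>M\<^esub> m"
    and smult_r_distr:
      "\<lbrakk>r \<in> carrier R; m \<in> carrier M; n \<in> carrier M\<rbrakk> \<Longrightarrow>
        r \<odot>\<^bsub>M\<^esub> (m \<oplus>\<^bsub>M\<^esub> n) = r \<odot>\<^bsub>M\<^esub> m \<oplus>\<^bsub>M\<^esub> r \<odot>\<^bsub>M\<^esub> n"
    and smult_assoc:
      "\<lbrakk>r \<in> carrier R; s \<in> carrier R; m \<in> carrier M\<rbrakk> \<Longrightarrow>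
        (r \<otimes>\<^bsub>R\<^esub> s) \<odot>\<^bsub>M\<^esub> m = r \<odot>\<^bsub>M\<^esub> (s \<odot>\<^bsub>M\<^esub> m)"
    and smult_one:
      "m \<in> carrier M \<Longrightarrow> \<one>\<^bsub>R\<^esub> \<odot>\<^bsub>M\<^esub> m = m"

text \<open>In a right module the term \<open>r \<odot>\<^bsub>M\<^esub> m\<close> stands for \<open>m r\<close>.\<close>

abbreviation right_module :: "('r, 'x) ring_scheme \<Rightarrow> ('r, 'm, 'y) module_scheme \<Rightarrow> bool"
  where "right_module R M \<equiv> left_module (opp R) M"

text \<open>Homomorphisms of left modules or of right modules; the condition is the same for both.\<close>

definition module_hom ::
  "('r, 'x) ring_scheme \<Rightarrow> ('r, 'm, 'y) module_scheme \<Rightarrow> ('r, 'n, 'z) module_scheme \<Rightarrow> ('m \<Rightarrow> 'n) set"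
  where "module_hom R M N =
    {f \<in> hom (add_monoid M) (add_monoid N).
      \<forall>r \<in> carrier R. \<forall>m \<in> carrier M. f (r \<odot>\<^bsub>M\<^esub> m) = r \<odot>\<^bsub>N\<^esub> f m}"

text \<open>The test modules \<open>M\<close> and \<open>N\<close> range over two arbitrary types. Projectivity in the usual sense
  is this property for all types \<open>'m\<close> and \<open>'n\<close>.\<close>

definition projective_module ::
  "'m itself \<Rightarrow> 'n itself \<Rightarrow> ('r, 'x) ring_scheme \<Rightarrow> ('r, 'p, 'y) module_scheme \<Rightarrow> bool"
  where "projective_module TYPE('m) TYPE('n) R P \<longleftrightarrow>
    left_module R P \<and>
    (\<forall>(M :: ('r, 'm) module) (N :: ('r, 'n) module) g f.
      left_module R M \<and> left_module R N \<and>
      g \<in> module_hom R M N \<and> g ` carrier M = carrier N \<and> f \<in> module_hom R P N \<longrightarrow>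
      (\<exists>h \<in> module_hom R P M. \<forall>x \<in> carrier P. g (h x) = f x))"


section \<open>Tensor products\<close>

text \<open>\<open>M \<otimes>\<^sub>R N\<close> for a right module \<open>M\<close> and a left module \<open>N\<close>: the free abelian group on
  \<open>carrier M \<times> carrier N\<close> modulo the balancing relations.\<close>

definition tensor_relators ::
  "('r, 'x) ring_scheme \<Rightarrow> ('r, 'm, 'y) module_scheme \<Rightarrow> ('r, 'n, 'z) module_scheme
    \<Rightarrow> ('m \<times> 'n \<Rightarrow>\<^sub>0 int) set"
  where "tensor_relators R M N =
    {frag_of (m \<oplus>\<^bsub>M\<^esub> m', n) - frag_of (m, n) - frag_of (m', n) | m m' n.
      m \<in> carrier M \<and> m' \<in> carrier M \<and> n \<in> carrier N} \<union>
    {frag_of (m, n \<oplus>\<^bsub>N\<^esub> n') - frag_of (m, n) - frag_of (m, n') | m n n'.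
      m \<in> carrier M \<and> n \<in> carrier N \<and> n' \<in> carrier N} \<union>
    {frag_of (r \<odot>\<^bsub>M\<^esub> m, n) - frag_of (m, r \<odot>\<^bsub>N\<^esub> n) | r m n.
      r \<in> carrier R \<and> m \<in> carrier M \<and> n \<in> carrier N}"

definition tensor_kernel ::
  "('r, 'x) ring_scheme \<Rightarrow> ('r, 'm, 'y) module_scheme \<Rightarrow> ('r, 'n, 'z) module_scheme
    \<Rightarrow> ('m \<times> 'n \<Rightarrow>\<^sub>0 int) set"
  where "tensor_kernel R M N =
    generate (free_Abelian_group (carrier M \<times> carrier N)) (tensor_relators R M N)"

definition tensor_group ::
  "('r, 'x) ring_scheme \<Rightarrow> ('r, 'm, 'y) module_scheme \<Rightarrow> ('r, 'n, 'z) module_scheme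
    \<Rightarrow> ('m \<times> 'n \<Rightarrow>\<^sub>0 int) set monoid"
  where "tensor_group R M N =
    free_Abelian_group (carrier M \<times> carrier N) Mod tensor_kernel R M N"

definition pure_tensor ::
  "('r, 'x) ring_scheme \<Rightarrow> ('r, 'm, 'y) module_scheme \<Rightarrow> ('r, 'n, 'z) module_scheme
    \<Rightarrow> 'm \<Rightarrow> 'n \<Rightarrow> ('m \<times> 'n \<Rightarrow>\<^sub>0 int) set"
  where "pure_tensor R M N m n =
    tensor_kernel R M N #>\<^bsub>free_Abelian_group (carrier M \<times> carrier N)\<^esub> frag_of (m, n)"

text \<open>The value at \<open>t\<close> of the homomorphism from a tensor product to the abelian group \<open>G\<close> that sends
  \<open>m \<otimes> n\<close> to \<open>\<phi> m n\<close>. For balanced \<open>\<phi>\<close> it does not depend on the chosen representative \<open>x\<close>.\<close>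

definition tensor_lift :: "('g, 'x) monoid_scheme \<Rightarrow> ('m \<Rightarrow> 'n \<Rightarrow> 'g) \<Rightarrow> ('m \<times> 'n \<Rightarrow>\<^sub>0 int) set \<Rightarrow> 'g"
  where "tensor_lift G \<phi> t =
    (let x = (SOME x. x \<in> t) in
      finprod G (\<lambda>p. \<phi> (fst p) (snd p) [^]\<^bsub>G\<^esub> Poly_Mapping.lookup x p) (Poly_Mapping.keys x))"

text \<open>Sweedler notation: for \<open>t = \<Sum> t\<^sub>0 \<otimes> t\<^sub>1\<close>, the term \<open>tensor_sum M (\<lambda>t\<^sub>0 t\<^sub>1. \<phi> t\<^sub>0 t\<^sub>1) t\<close> is
  \<open>\<Sum> \<phi> t\<^sub>0 t\<^sub>1\<close>, computed in the additive group of \<open>M\<close>.\<close>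

abbreviation tensor_sum :: "('g, 'x) ring_scheme \<Rightarrow> ('m \<Rightarrow> 'n \<Rightarrow> 'g) \<Rightarrow> ('m \<times> 'n \<Rightarrow>\<^sub>0 int) set \<Rightarrow> 'g"
  where "tensor_sum M \<equiv> tensor_lift (add_monoid M)"


section \<open>Faithful flatness\<close>

definition exact_at ::
  "('a, 'x) monoid_scheme \<Rightarrow> ('a \<Rightarrow> 'b) \<Rightarrow> ('b, 'y) monoid_scheme \<Rightarrow> ('b \<Rightarrow> 'c)
    \<Rightarrow> ('c, 'z) monoid_scheme \<Rightarrow> bool"
  where "exact_at G\<^sub>1 f G\<^sub>2 g G\<^sub>3 \<longleftrightarrow> f ` carrier G\<^sub>1 = kernel G\<^sub>2 G\<^sub>3 g"

text \<open>A sequence \<open>M\<^sub>1 \<rightarrow> M\<^sub>2 \<rightarrow> M\<^sub>3\<close> of right modules is exact iff its tensor product with \<open>N\<close> is. The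
  test modules have their elements in the type \<open>'m\<close>.\<close>

definition faithfully_flat ::
  "'m itself \<Rightarrow> ('r, 'x) ring_scheme \<Rightarrow> ('r, 'n, 'y) module_scheme \<Rightarrow> bool"
  where "faithfully_flat TYPE('m) R N \<longleftrightarrow>
    left_module R N \<and>
    (\<forall>(M\<^sub>1 :: ('r, 'm) module) (M\<^sub>2 :: ('r, 'm) module) (M\<^sub>3 :: ('r, 'm) module) f g.
      right_module R M\<^sub>1 \<and> right_module R M\<^sub>2 \<and> right_module R M\<^sub>3 \<and>
      f \<in> module_hom R M\<^sub>1 M\<^sub>2 \<and> g \<in> module_hom R M\<^sub>2 M\<^sub>3 \<longrightarrow>
      (exact_at (add_monoid M\<^sub>1) f (add_monoid M\<^sub>2) g (add_monoid M\<^sub>3) \<longleftrightarrow>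
       exact_at
         (tensor_group R M\<^sub>1 N)
         (tensor_lift (tensor_group R M\<^sub>2 N) (\<lambda>m n. pure_tensor R M\<^sub>2 N (f m) n))
         (tensor_group R M\<^sub>2 N)
         (tensor_lift (tensor_group R M\<^sub>3 N) (\<lambda>m n. pure_tensor R M\<^sub>3 N (g m) n))
         (tensor_group R M\<^sub>3 N)))"


section \<open>Hopf algebras and comodule algebras\<close>

text \<open>The library's \<^locale>\<open>algebra\<close> is restricted to commutative algebras.\<close>

locale k_algebra = field K + module K A + ring A
  for K :: "('k, 'x) ring_scheme" (structure) and A :: "('k, 'a, 'y) module_scheme" (structure) +
  assumes smult_mult_left:
      "\<lbrakk>c \<in> carrier K; x \<in> carrier A; y \<in> carrier A\<rbrakk> \<Longrightarrow>
        (c \<odot>\<^bsub>A\<^esub> x) \<otimes>\<^bsub>A\<^esub> y = c \<odot>\<^bsub>A\<^esub> (x \<otimes>\<^bsub>A\<^esub> y)"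
    and smult_mult_right:
      "\<lbrakk>c \<in> carrier K; x \<in> carrier A; y \<in> carrier A\<rbrakk> \<Longrightarrow>
        x \<otimes>\<^bsub>A\<^esub> (c \<odot>\<^bsub>A\<^esub> y) = c \<odot>\<^bsub>A\<^esub> (x \<otimes>\<^bsub>A\<^esub> y)"

definition alg_hom ::
  "('k, 'x) ring_scheme \<Rightarrow> ('k, 'a, 'y) module_scheme \<Rightarrow> ('k, 'b, 'z) module_scheme \<Rightarrow> ('a \<Rightarrow> 'b) set"
  where "alg_hom K A B = ring_hom A B \<inter> module_hom K A B"

text \<open>The algebra \<open>A \<otimes>\<^sub>K B\<close>, with \<open>(a \<otimes> b) (a' \<otimes> b') = a a' \<otimes> b b'\<close>.\<close>

definition tensor_algebra ::
  "('k, 'x) ring_scheme \<Rightarrow> ('k, 'a, 'y) module_scheme \<Rightarrow> ('k, 'b, 'z) module_scheme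
    \<Rightarrow> ('k, ('a \<times> 'b \<Rightarrow>\<^sub>0 int) set) module"
  where "tensor_algebra K A B =
    \<lparr>carrier = carrier (tensor_group K A B),
     monoid.mult = (\<lambda>s t.
       tensor_lift (tensor_group K A B) (\<lambda>a b.
         tensor_lift (tensor_group K A B) (\<lambda>a' b'.
           pure_tensor K A B (a \<otimes>\<^bsub>A\<^esub> a') (b \<otimes>\<^bsub>B\<^esub> b')) t) s),
     one = pure_tensor K A B \<one>\<^bsub>A\<^esub> \<one>\<^bsub>B\<^esub>,
     ring.zero = \<one>\<^bsub>tensor_group K A B\<^esub>,
     add = monoid.mult (tensor_group K A B),
     smult = (\<lambda>c. tensor_lift (tensor_group K A B) (\<lambda>a b. pure_tensor K A B (c \<odot>\<^bsub>A\<^esub> a) b))\<rparr>"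

abbreviation enveloping_algebra ::
  "('k, 'x) ring_scheme \<Rightarrow> ('k, 'a, 'y) module_scheme \<Rightarrow> ('k, ('a \<times> 'a \<Rightarrow>\<^sub>0 int) set) module"
  where "enveloping_algebra K A \<equiv> tensor_algebra K A (opp A)"

definition scalar_algebra :: "('k, 'x) ring_scheme \<Rightarrow> ('k, 'k) module"
  where "scalar_algebra K =
    \<lparr>carrier = carrier K, monoid.mult = monoid.mult K, one = one K, ring.zero = ring.zero K, add = add K,
     smult = monoid.mult K\<rparr>"

locale hopf_algebra = k_algebra K H
  for K :: "('k, 'x) ring_scheme" (structure) and H :: "('k, 'h, 'y) module_scheme" (structure) +
  fixes \<Delta> :: "'h \<Rightarrow> ('h \<times> 'h \<Rightarrow>\<^sub>0 int) set" and \<epsilon> :: "'h \<Rightarrow> 'k" and S :: "'h \<Rightarrow> 'h"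
  assumes comult_hom: "\<Delta> \<in> alg_hom K H (tensor_algebra K H H)"
    and counit_hom: "\<epsilon> \<in> alg_hom K H (scalar_algebra K)"
    and antipode_linear: "S \<in> module_hom K H H"
    and coassoc:
      "h \<in> carrier H \<Longrightarrow>
        tensor_sum (tensor_algebra K (tensor_algebra K H H) H)
          (\<lambda>h\<^sub>1 h\<^sub>2. pure_tensor K (tensor_algebra K H H) H (\<Delta> h\<^sub>1) h\<^sub>2) (\<Delta> h) =
        tensor_sum (tensor_algebra K (tensor_algebra K H H) H)
          (\<lambda>h\<^sub>1 h\<^sub>2. tensor_sum (tensor_algebra K (tensor_algebra K H H) H)
            (\<lambda>h\<^sub>2\<^sub>1 h\<^sub>2\<^sub>2. pure_tensor K (tensor_algebra K H H) H (pure_tensor K H H h\<^sub>1 h\<^sub>2\<^sub>1) h\<^sub>2\<^sub>2) (\<Delta> h\<^sub>2))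
          (\<Delta> h)"
    and counit_left:
      "h \<in> carrier H \<Longrightarrow> tensor_sum H (\<lambda>h\<^sub>1 h\<^sub>2. \<epsilon> h\<^sub>1 \<odot>\<^bsub>H\<^esub> h\<^sub>2) (\<Delta> h) = h"
    and counit_right:
      "h \<in> carrier H \<Longrightarrow> tensor_sum H (\<lambda>h\<^sub>1 h\<^sub>2. \<epsilon> h\<^sub>2 \<odot>\<^bsub>H\<^esub> h\<^sub>1) (\<Delta> h) = h"
    and antipode_left:
      "h \<in> carrier H \<Longrightarrow> tensor_sum H (\<lambda>h\<^sub>1 h\<^sub>2. S h\<^sub>1 \<otimes>\<^bsub>H\<^esub> h\<^sub>2) (\<Delta> h) = \<epsilon> h \<odot>\<^bsub>H\<^esub> \<one>\<^bsub>H\<^esub>"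
    and antipode_right:
      "h \<in> carrier H \<Longrightarrow> tensor_sum H (\<lambda>h\<^sub>1 h\<^sub>2. h\<^sub>1 \<otimes>\<^bsub>H\<^esub> S h\<^sub>2) (\<Delta> h) = \<epsilon> h \<odot>\<^bsub>H\<^esub> \<one>\<^bsub>H\<^esub>"

locale comodule_algebra = H: hopf_algebra K H \<Delta> \<epsilon> S + B: k_algebra K B
  for K :: "('k, 'x) ring_scheme" (structure) and H :: "('k, 'h, 'y) module_scheme" (structure)
    and \<Delta> :: "'h \<Rightarrow> ('h \<times> 'h \<Rightarrow>\<^sub>0 int) set" and \<epsilon> :: "'h \<Rightarrow> 'k" and S :: "'h \<Rightarrow> 'h"
    and B :: "('k, 'b, 'z) module_scheme" (structure) +
  fixes \<rho> :: "'b \<Rightarrow> ('b \<times> 'h \<Rightarrow>\<^sub>0 int) set"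
  assumes coaction_hom: "\<rho> \<in> alg_hom K B (tensor_algebra K B H)"
    and coaction_coassoc:
      "b \<in> carrier B \<Longrightarrow>
        tensor_sum (tensor_algebra K (tensor_algebra K B H) H)
          (\<lambda>b\<^sub>0 b\<^sub>1. pure_tensor K (tensor_algebra K B H) H (\<rho> b\<^sub>0) b\<^sub>1) (\<rho> b) =
        tensor_sum (tensor_algebra K (tensor_algebra K B H) H)
          (\<lambda>b\<^sub>0 b\<^sub>1. tensor_sum (tensor_algebra K (tensor_algebra K B H) H)
            (\<lambda>b\<^sub>1\<^sub>1 b\<^sub>1\<^sub>2. pure_tensor K (tensor_algebra K B H) H (pure_tensor K B H b\<^sub>0 b\<^sub>1\<^sub>1) b\<^sub>1\<^sub>2) (\<Delta> b\<^sub>1))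
          (\<rho> b)"
    and coaction_counit:
      "b \<in> carrier B \<Longrightarrow> tensor_sum B (\<lambda>b\<^sub>0 b\<^sub>1. \<epsilon> b\<^sub>1 \<odot>\<^bsub>B\<^esub> b\<^sub>0) (\<rho> b) = b"


section \<open>Hopf-Galois extensions\<close>

text \<open>The algebra \<open>A = B\<^bsup>co H\<^esup>\<close>.\<close>

definition coinvariants ::
  "('k, 'x) ring_scheme \<Rightarrow> ('k, 'h, 'y) module_scheme \<Rightarrow> ('k, 'b, 'z) module_scheme
    \<Rightarrow> ('b \<Rightarrow> ('b \<times> 'h \<Rightarrow>\<^sub>0 int) set) \<Rightarrow> ('k, 'b, 'z) module_scheme"
  where "coinvariants K H B \<rho> =
    B\<lparr>carrier := {b \<in> carrier B. \<rho> b = pure_tensor K B H b \<one>\<^bsub>H\<^esub>}\<rparr>"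

text \<open>The ring \<open>B\<close> as a left and as a right module over its subrings.\<close>

definition left_mult_module :: "('b, 'x) ring_scheme \<Rightarrow> ('b, 'b) module"
  where "left_mult_module B =
    \<lparr>carrier = carrier B, monoid.mult = monoid.mult B, one = one B, ring.zero = ring.zero B, add = add B,
     smult = (\<lambda>a b. a \<otimes>\<^bsub>B\<^esub> b)\<rparr>"

definition right_mult_module :: "('b, 'x) ring_scheme \<Rightarrow> ('b, 'b) module"
  where "right_mult_module B =
    \<lparr>carrier = carrier B, monoid.mult = monoid.mult B, one = one B, ring.zero = ring.zero B, add = add B,
     smult = (\<lambda>a b. b \<otimes>\<^bsub>B\<^esub> a)\<rparr>"

definition galois_map ::
  "('k, 'x) ring_scheme \<Rightarrow> ('k, 'h, 'y) module_scheme \<Rightarrow> ('k, 'b, 'z) module_scheme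
    \<Rightarrow> ('b \<Rightarrow> ('b \<times> 'h \<Rightarrow>\<^sub>0 int) set) \<Rightarrow> ('b \<times> 'b \<Rightarrow>\<^sub>0 int) set \<Rightarrow> ('b \<times> 'h \<Rightarrow>\<^sub>0 int) set"
  where "galois_map K H B \<rho> =
    tensor_sum (tensor_algebra K B H) (\<lambda>b b'.
      tensor_sum (tensor_algebra K B H) (\<lambda>b'\<^sub>0 b'\<^sub>1. pure_tensor K B H (b \<otimes>\<^bsub>B\<^esub> b'\<^sub>0) b'\<^sub>1) (\<rho> b'))"

definition hopf_galois ::
  "('k, 'x) ring_scheme \<Rightarrow> ('k, 'h, 'y) module_scheme \<Rightarrow> ('k, 'b, 'z) module_scheme
    \<Rightarrow> ('b \<Rightarrow> ('b \<times> 'h \<Rightarrow>\<^sub>0 int) set) \<Rightarrow> bool"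
  where "hopf_galois K H B \<rho> \<longleftrightarrow>
    bij_betw (galois_map K H B \<rho>)
      (carrier (tensor_group (coinvariants K H B \<rho>) (right_mult_module B) (left_mult_module B)))
      (carrier (tensor_algebra K B H))"

text \<open>A formula cannot quantify over types, so the test modules for the faithful flatness of \<open>B\<close> as
  a left \<open>A\<close>-module are those with elements in one type, which is large enough: the elements of
  \<open>A\<^bsup>(\<nat>)\<^esup>\<close> are functions \<open>nat \<Rightarrow> 'b\<close>, so every subquotient of \<open>A\<^bsup>(\<nat>)\<^esup>\<close>, as a set of cosets, has its
  elements in \<open>(nat \<Rightarrow> 'b) set\<close>. This yields the usual notion: flatness is detected by the inclusions
  \<open>I \<subseteq> A\<close> of right ideals, and a flat \<open>B\<close> is faithfully flat iff \<open>A/I \<otimes>\<^sub>A B \<noteq> 0\<close> for all right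
  ideals \<open>I \<noteq> A\<close>.\<close>

definition faithfully_flat_galois ::
  "('k, 'x) ring_scheme \<Rightarrow> ('k, 'h, 'y) module_scheme \<Rightarrow> ('k, 'b, 'z) module_scheme
    \<Rightarrow> ('b \<Rightarrow> ('b \<times> 'h \<Rightarrow>\<^sub>0 int) set) \<Rightarrow> bool"
  where "faithfully_flat_galois K H B \<rho> \<longleftrightarrow>
    hopf_galois K H B \<rho> \<and>
    faithfully_flat TYPE((nat \<Rightarrow> 'b) set) (coinvariants K H B \<rho>) (left_mult_module B)"


section \<open>The Ehresmann-Schauenburg bialgebroid\<close>

text \<open>\<open>\<Sum> b \<otimes> b'\<^bsup>op\<^esup> \<mapsto> \<Sum> b\<^sub>0 \<otimes> b'\<^sub>0\<^bsup>op\<^esup> \<otimes> b\<^sub>1 b'\<^sub>1\<close>, as a map from \<open>B\<^bsup>e\<^esup>\<close> to \<open>B\<^bsup>e\<^esup> \<otimes> H\<close>.\<close>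

definition diagonal_coaction ::
  "('k, 'x) ring_scheme \<Rightarrow> ('k, 'h, 'y) module_scheme \<Rightarrow> ('k, 'b, 'z) module_scheme
    \<Rightarrow> ('b \<Rightarrow> ('b \<times> 'h \<Rightarrow>\<^sub>0 int) set)
    \<Rightarrow> ('b \<times> 'b \<Rightarrow>\<^sub>0 int) set \<Rightarrow> (('b \<times> 'b \<Rightarrow>\<^sub>0 int) set \<times> 'h \<Rightarrow>\<^sub>0 int) set"
  where "diagonal_coaction K H B \<rho> =
    tensor_sum (tensor_algebra K (enveloping_algebra K B) H) (\<lambda>b b'.
      tensor_sum (tensor_algebra K (enveloping_algebra K B) H) (\<lambda>b\<^sub>0 b\<^sub>1.
        tensor_sum (tensor_algebra K (enveloping_algebra K B) H) (\<lambda>b'\<^sub>0 b'\<^sub>1.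
          pure_tensor K (enveloping_algebra K B) H
            (pure_tensor K B (opp B) b\<^sub>0 b'\<^sub>0) (b\<^sub>1 \<otimes>\<^bsub>H\<^esub> b'\<^sub>1))
          (\<rho> b'))
        (\<rho> b))"

definition ehresmann_schauenburg ::
  "('k, 'x) ring_scheme \<Rightarrow> ('k, 'h, 'y) module_scheme \<Rightarrow> ('k, 'b, 'z) module_scheme
    \<Rightarrow> ('b \<Rightarrow> ('b \<times> 'h \<Rightarrow>\<^sub>0 int) set) \<Rightarrow> ('b \<times> 'b \<Rightarrow>\<^sub>0 int) set set"
  where "ehresmann_schauenburg K H B \<rho> =
    {t \<in> carrier (enveloping_algebra K B).
      diagonal_coaction K H B \<rho> t = pure_tensor K (enveloping_algebra K B) H t \<one>\<^bsub>H\<^esub>}"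

text \<open>The canonical map from \<open>A\<^bsup>e\<^esup>\<close> to \<open>B\<^bsup>e\<^esup>\<close> for a subalgebra \<open>A\<close> of \<open>B\<close>. It is injective, but not an
  inclusion of sets in this construction of the tensor product.\<close>

definition enveloping_map ::
  "('k, 'x) ring_scheme \<Rightarrow> ('k, 'b, 'z) module_scheme
    \<Rightarrow> ('b \<times> 'b \<Rightarrow>\<^sub>0 int) set \<Rightarrow> ('b \<times> 'b \<Rightarrow>\<^sub>0 int) set"
  where "enveloping_map K B =
    tensor_sum (enveloping_algebra K B) (\<lambda>a a'. pure_tensor K B (opp B) a a')"

definition ehresmann_schauenburg_module ::
  "('k, 'x) ring_scheme \<Rightarrow> ('k, 'h, 'y) module_scheme \<Rightarrow> ('k, 'b, 'z) module_scheme
    \<Rightarrow> ('b \<Rightarrow> ('b \<times> 'h \<Rightarrow>\<^sub>0 int) set)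
    \<Rightarrow> (('b \<times> 'b \<Rightarrow>\<^sub>0 int) set, ('b \<times> 'b \<Rightarrow>\<^sub>0 int) set) module"
  where "ehresmann_schauenburg_module K H B \<rho> =
    \<lparr>carrier = ehresmann_schauenburg K H B \<rho>,
     monoid.mult = monoid.mult (enveloping_algebra K B), one = one (enveloping_algebra K B),
     ring.zero = ring.zero (enveloping_algebra K B), add = add (enveloping_algebra K B),
     smult = (\<lambda>s t. enveloping_map K B s \<otimes>\<^bsub>enveloping_algebra K B\<^esub> t)\<rparr>"

end

theory Submission
  imports Defs
begin

text \<open>The bialgebroid \<open>\<Gamma>\<close> is a direct summand of \<open>B\<^bsup>e\<^esup>\<close> as an \<open>A\<^bsup>e\<^esup>\<close>-module, and \<open>B\<^bsup>e\<^esup>\<close> is projective over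
  \<open>A\<^bsup>e\<^esup>\<close> because \<open>B\<close> is projective over \<open>A\<close> from both sides. All of this rests on a \<^emph>\<open>total integral\<close>,
  that is, an \<open>H\<close>-colinear map \<open>j : H \<rightarrow> B\<close> with \<open>j 1 = 1\<close>.

  \<^item> The summand. The map \<open>q b g = \<Sum> b\<^sub>0 j (S b\<^sub>1 g)\<close> is colinear in \<open>g\<close> and satisfies \<open>\<Sum> q b\<^sub>0 b\<^sub>1 = b\<close>. It
    follows that \<open>P (b \<otimes> b') = \<Sum> q b (S\<^sup>-\<^sup>1 b'\<^sub>1) \<otimes> b'\<^sub>0\<close> is an \<open>A\<^bsup>e\<^esup>\<close>-linear projection of \<open>B\<^bsup>e\<^esup>\<close> onto \<open>\<Gamma>\<close>
    (\<open>P_Gamma\<close>, \<open>P_Gamma_id\<close>, \<open>P_iota\<close>).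

  \<^item> The dual bases. The multiplication of \<open>B\<close> maps \<open>\<Gamma>\<close> to \<open>A\<close>, so \<open>P\<close> followed by it is a map
    \<open>F : B \<times> B \<rightarrow> A\<close>, which is left \<open>A\<close>-linear in the first and right \<open>A\<close>-linear in the second argument. For
    \<open>e\<close> in a basis of \<open>H\<close> let \<open>\<Sum>\<^sub>i x\<^sub>i \<otimes> y\<^sub>i\<close> be the preimage of \<open>1 \<otimes> e\<close> under the Galois map. Then
    \<open>\<Sum>\<^sub>i F c x\<^sub>i y\<^sub>i = q c e\<close> (\<open>F_galois_left\<close>). Writing \<open>\<rho> b = \<Sum>\<^sub>e b\<^sub>e \<otimes> e\<close>, one obtains
    \<open>b = \<Sum>\<^sub>e q b\<^sub>e e = \<Sum> F b\<^sub>e x\<^sub>i y\<^sub>i\<close>, a dual basis of \<open>B\<close> as a left module. The right module is treated in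
    the same way with \<open>S\<^sup>-\<^sup>1\<close> (\<open>F_galois_right\<close>, \<open>right_expansion\<close>). The two dual bases combine to a dual basis
    of \<open>B\<^bsup>e\<^esup>\<close> (\<open>Be_dual_basis\<close>), and \<open>P\<close> carries it to a dual basis of \<open>\<Gamma>\<close> (\<open>projective_if_dual_bases\<close>).

  \<^item> The integral. By Zorn's lemma there is a maximal colinear map on a subcomodule of \<open>H\<close> that contains \<open>1\<close>
    and takes the value \<open>1\<close> there. If \<open>h\<close> is not in its domain, consider all linear extensions to \<open>H\<close> of a
    certain shape with undetermined coefficients in \<open>A\<close>. Colinearity on the subcomodule generated by \<open>h\<close> is
    a finite system of linear equations for them. It has a solution in \<open>B \<otimes>\<^sub>A B\<close>, which one can write down
    because the Galois map is bijective; hence it has a solution in \<open>A\<close>, since \<open>B\<close> is faithfully flat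
    (\<open>faithfully_flat_descent\<close>, \<open>extend_at\<close>, \<open>total_integral_exists\<close>).

  The computations with coactions use Sweedler's notation, with \<open>cosum\<close> for a single sum.\<close>

section \<open>Finite sums in abelian groups\<close>

lemma hom_finprod:
  assumes G: "comm_group G" and G': "comm_group G'" and f: "f \<in> hom G G'" and x: "x \<in> I \<rightarrow> carrier G"
  shows "f (finprod G x I) = finprod G' (\<lambda>i. f (x i)) I"
proof -
  interpret G: comm_group G by fact
  interpret G': comm_group G' by fact
  interpret f: group_hom G G' f
    by (intro group_hom.intro group_hom_axioms.intro f G.group_axioms G'.group_axioms)
  show ?thesis using x
  proof (induct I rule: infinite_finite_induct)
    case (insert a A)
    then show ?case by (simp add: Pi_iff)
  qed simp_all
qed

lemma (in comm_group) finprod_swap: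
  assumes "finite A" "finite B" "\<And>p q. \<lbrakk>p \<in> A; q \<in> B\<rbrakk> \<Longrightarrow> f p q \<in> carrier G"
  shows "finprod G (\<lambda>p. finprod G (f p) B) A = finprod G (\<lambda>q. finprod G (\<lambda>p. f p q) A) B"
  using assms
proof (induct A rule: finite_induct)
  case (insert a A)
  have "finprod G (\<lambda>q. finprod G (\<lambda>p. f p q) (insert a A)) B = finprod G (\<lambda>q. f a q \<otimes> finprod G (\<lambda>p. f p q) A) B"
    by (rule finprod_cong') (use insert in \<open>auto simp: Pi_iff\<close>)
  also have "\<dots> = finprod G (f a) B \<otimes> finprod G (\<lambda>q. finprod G (\<lambda>p. f p q) A) B"
    by (rule finprod_multf) (use insert in \<open>auto simp: Pi_iff\<close>)
  finally show ?case using insert by (simp add: Pi_iff)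
qed simp

lemma (in comm_monoid) finprod_Sigma:
  assumes "finite S" "\<And>e. e \<in> S \<Longrightarrow> finite (N e)" "\<And>e i. \<lbrakk>e \<in> S; i \<in> N e\<rbrakk> \<Longrightarrow> f (e, i) \<in> carrier G"
  shows "finprod G f (Sigma S N) = finprod G (\<lambda>e. finprod G (\<lambda>i. f (e, i)) (N e)) S"
  using assms
proof (induct S rule: finite_induct)
  case (insert e S)
  have "Sigma (insert e S) N = (\<lambda>i. (e, i)) ` N e \<union> Sigma S N" by auto
  then have "finprod G f (Sigma (insert e S) N) = finprod G f ((\<lambda>i. (e, i)) ` N e) \<otimes> finprod G f (Sigma S N)"
    using insert by (simp add: finprod_Un_disjoint Pi_iff disjoint_iff image_iff split_paired_All)
  also have "finprod G f ((\<lambda>i. (e, i)) ` N e) = finprod G (\<lambda>i. f (e, i)) (N e)"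
    using insert by (intro finprod_reindex) (auto simp: inj_on_def)
  finally show ?case using insert by (simp add: Pi_iff)
qed simp

lemma (in abelian_group) add_minus_cancel:
  assumes "x \<in> carrier G" "y \<in> carrier G" shows "x \<oplus> (y \<ominus> x) = y"
proof -
  have "x \<oplus> (y \<ominus> x) = y \<oplus> (x \<oplus> \<ominus> x)" using assms by (simp add: a_minus_def a_lcomm)
  then show ?thesis using assms by (simp add: r_neg)
qed

lemma (in abelian_group) minus_eq_minusI:
  assumes [simp]: "a \<in> carrier G" "b \<in> carrier G" "s \<in> carrier G" "t \<in> carrier G"
    and eq: "a \<oplus> s = b \<oplus> t"
  shows "t \<ominus> s = a \<ominus> b"
proof -
  have "t \<ominus> s = (\<ominus> b \<oplus> (b \<oplus> t)) \<oplus> \<ominus> s" by (simp add: a_minus_def r_neg1)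
  also have "\<dots> = (\<ominus> b \<oplus> (a \<oplus> s)) \<oplus> \<ominus> s" unfolding eq ..
  also have "\<dots> = (\<ominus> b \<oplus> a) \<oplus> (s \<oplus> \<ominus> s)" by (simp only: a_assoc assms(1-4) a_inv_closed a_closed)
  finally show ?thesis by (simp add: r_neg a_minus_def a_comm)
qed

section \<open>Tensor products over an arbitrary ring\<close>

text \<open>The sum in the definition of \<^const>\<open>tensor_lift\<close> is the value of this homomorphism at the chosen
  representative.\<close>

lemma (in comm_group) free_eval_hom:
  fixes f :: "'p \<Rightarrow> 'a"
  assumes f: "f \<in> S \<rightarrow> carrier G"
  shows "(\<lambda>x. finprod G (\<lambda>p. f p [^] Poly_Mapping.lookup x p) (Poly_Mapping.keys x))
    \<in> hom (free_Abelian_group S) G"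
proof (rule homI)
  let ?e = "\<lambda>(x :: 'p \<Rightarrow>\<^sub>0 int) p. f p [^] Poly_Mapping.lookup x p"
  have cl: "?e x \<in> Poly_Mapping.keys y \<rightarrow> carrier G" if "Poly_Mapping.keys y \<subseteq> S" for x y
    by (intro Pi_I int_pow_closed) (use f that in blast)
  show "finprod G (?e x) (Poly_Mapping.keys x) \<in> carrier G" if "x \<in> carrier (free_Abelian_group S)" for x
    using that by (intro finprod_closed cl) simp
  fix x y :: "'p \<Rightarrow>\<^sub>0 int"
  assume "x \<in> carrier (free_Abelian_group S)" "y \<in> carrier (free_Abelian_group S)"
  then have x: "Poly_Mapping.keys x \<subseteq> S" and y: "Poly_Mapping.keys y \<subseteq> S" by simp_all
  let ?U = "Poly_Mapping.keys x \<union> Poly_Mapping.keys y"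
  have ext: "finprod G (?e z) (Poly_Mapping.keys z) = finprod G (?e z) ?U"
    if "Poly_Mapping.keys z \<subseteq> ?U" for z
    by (rule finprod_mono_neutral_cong_left)
      (use that x y f in \<open>auto simp: Pi_iff in_keys_iff\<close>)
  have "finprod G (?e (x + y)) (Poly_Mapping.keys (x + y)) = finprod G (?e (x + y)) ?U"
    by (rule ext) (rule keys_add)
  also have "\<dots> = finprod G (\<lambda>p. ?e x p \<otimes> ?e y p) ?U"
    by (rule finprod_cong') (use x y f in \<open>auto simp: Pi_iff lookup_add int_pow_mult subset_iff\<close>)
  also have "\<dots> = finprod G (?e x) ?U \<otimes> finprod G (?e y) ?U"
    by (rule finprod_multf) (use x y f in \<open>auto simp: Pi_iff\<close>)
  finally show "finprod G (?e (x \<otimes>\<^bsub>free_Abelian_group S\<^esub> y))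
      (Poly_Mapping.keys (x \<otimes>\<^bsub>free_Abelian_group S\<^esub> y)) =
    finprod G (?e x) (Poly_Mapping.keys x) \<otimes> finprod G (?e y) (Poly_Mapping.keys y)"
    by (simp add: ext)
qed

definition balanced_map ::
  "('r, 'x) ring_scheme \<Rightarrow> ('r, 'm, 'y) module_scheme \<Rightarrow> ('r, 'n, 'z) module_scheme
    \<Rightarrow> ('g, 'w) monoid_scheme \<Rightarrow> ('m \<Rightarrow> 'n \<Rightarrow> 'g) \<Rightarrow> bool"
  where "balanced_map R M N G \<phi> \<longleftrightarrow>
    (\<forall>m \<in> carrier M. \<forall>n \<in> carrier N. \<phi> m n \<in> carrier G) \<and>
    (\<forall>m \<in> carrier M. \<forall>m' \<in> carrier M. \<forall>n \<in> carrier N. \<phi> (m \<oplus>\<^bsub>M\<^esub> m') n = \<phi> m n \<otimes>\<^bsub>G\<^esub> \<phi> m' n) \<and>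
    (\<forall>m \<in> carrier M. \<forall>n \<in> carrier N. \<forall>n' \<in> carrier N. \<phi> m (n \<oplus>\<^bsub>N\<^esub> n') = \<phi> m n \<otimes>\<^bsub>G\<^esub> \<phi> m n') \<and>
    (\<forall>r \<in> carrier R. \<forall>m \<in> carrier M. \<forall>n \<in> carrier N. \<phi> (r \<odot>\<^bsub>M\<^esub> m) n = \<phi> m (r \<odot>\<^bsub>N\<^esub> n))"

locale tensor_pair = M: abelian_group M + N: abelian_group N
  for R :: "('r, 'x) ring_scheme" and M :: "('r, 'm, 'y) module_scheme"
    and N :: "('r, 'n, 'z) module_scheme" +
  assumes smult_M: "\<lbrakk>r \<in> carrier R; m \<in> carrier M\<rbrakk> \<Longrightarrow> r \<odot>\<^bsub>M\<^esub> m \<in> carrier M"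
    and smult_N: "\<lbrakk>r \<in> carrier R; n \<in> carrier N\<rbrakk> \<Longrightarrow> r \<odot>\<^bsub>N\<^esub> n \<in> carrier N"
begin

abbreviation "FG \<equiv> free_Abelian_group (carrier M \<times> carrier N)"
abbreviation "TG \<equiv> tensor_group R M N"
abbreviation "TK \<equiv> tensor_kernel R M N"
abbreviation "ptens \<equiv> pure_tensor R M N"

lemma comm_FG: "comm_group FG"
  by (rule abelian_free_Abelian_group)

lemma keys_frag3:
  assumes "a \<in> S" "b \<in> S" "c \<in> S"
  shows "Poly_Mapping.keys (frag_of a - frag_of b - frag_of c) \<subseteq> S"
  using assms keys_diff[of "frag_of a - frag_of b" "frag_of c"] keys_diff[of "frag_of a" "frag_of b"]
  by (simp only: keys_frag_of) blast

lemma relators_closed: "tensor_relators R M N \<subseteq> carrier FG"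
proof -
  have 3: "frag_of a - frag_of b - frag_of c \<in> carrier FG"
    if "a \<in> carrier M \<times> carrier N" "b \<in> carrier M \<times> carrier N" "c \<in> carrier M \<times> carrier N" for a b c
    using keys_frag3[OF that] by simp
  have 2: "frag_of a - frag_of b \<in> carrier FG"
    if "a \<in> carrier M \<times> carrier N" "b \<in> carrier M \<times> carrier N" for a b
    using keys_diff[of "frag_of a" "frag_of b"] that
    by (simp only: keys_frag_of carrier_free_Abelian_group_iff) blast
  show ?thesis
    unfolding tensor_relators_def
    by (intro Un_least subsetI; elim CollectE exE conjE; hypsubst; (rule 3 | rule 2))
      (simp_all add: smult_M smult_N)
qed

lemma subgroup_TK: "subgroup TK FG"
  unfolding tensor_kernel_def
  by (rule group.generate_is_subgroup) (auto simp: relators_closed simp del: carrier_free_Abelian_group_iff)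

lemma normal_TK: "TK \<lhd> FG"
  using comm_group.normal_iff_subgroup[OF comm_FG] subgroup_TK by blast

lemma comm_group_TG: "comm_group TG"
  unfolding tensor_group_def by (rule comm_group.abelian_FactGroup[OF comm_FG subgroup_TK])

lemma coset_hom: "(\<lambda>x. TK #>\<^bsub>FG\<^esub> x) \<in> hom FG TG"
  unfolding tensor_group_def by (rule normal.r_coset_hom_Mod[OF normal_TK])

lemma coset_relator:
  assumes "x \<in> tensor_relators R M N" shows "TK #>\<^bsub>FG\<^esub> x = \<one>\<^bsub>TG\<^esub>"
proof -
  have "x \<in> TK" unfolding tensor_kernel_def by (rule generate.incl[OF assms])
  then show ?thesis
    unfolding tensor_group_def
    by (simp add: subgroup.rcos_const[OF subgroup_TK])
qed

lemma pure_closed: "\<lbrakk>m \<in> carrier M; n \<in> carrier N\<rbrakk> \<Longrightarrow> ptens m n \<in> carrier TG"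
  unfolding pure_tensor_def using hom_in_carrier[OF coset_hom] by simp

lemma coset_diff:
  assumes "x \<in> carrier FG" "y \<in> carrier FG" "TK #>\<^bsub>FG\<^esub> (x - y) = \<one>\<^bsub>TG\<^esub>"
  shows "TK #>\<^bsub>FG\<^esub> x = TK #>\<^bsub>FG\<^esub> y"
proof -
  interpret T: comm_group TG by (rule comm_group_TG)
  have d: "x - y \<in> carrier FG" using assms keys_diff[of x y] by auto
  have "TK #>\<^bsub>FG\<^esub> x = TK #>\<^bsub>FG\<^esub> ((x - y) \<otimes>\<^bsub>FG\<^esub> y)" by simp
  also have "\<dots> = (TK #>\<^bsub>FG\<^esub> (x - y)) \<otimes>\<^bsub>TG\<^esub> (TK #>\<^bsub>FG\<^esub> y)"
    by (rule hom_mult[OF coset_hom d assms(2)])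
  finally show ?thesis using assms(3) hom_in_carrier[OF coset_hom assms(2)] by simp
qed

lemma pure_balanced: "balanced_map R M N TG ptens"
proof -
  have fr: "frag_of (m, n) \<in> carrier FG" if "m \<in> carrier M" "n \<in> carrier N" for m n using that by simp
  have sum2: "frag_of p + frag_of q \<in> carrier FG"
    if "p \<in> carrier M \<times> carrier N" "q \<in> carrier M \<times> carrier N" for p q
    using that keys_add[of "frag_of p" "frag_of q"]
    by (simp only: keys_frag_of carrier_free_Abelian_group_iff) blast
  have mult: "TK #>\<^bsub>FG\<^esub> (frag_of p + frag_of q) = (TK #>\<^bsub>FG\<^esub> frag_of p) \<otimes>\<^bsub>TG\<^esub> (TK #>\<^bsub>FG\<^esub> frag_of q)"
    if "p \<in> carrier M \<times> carrier N" "q \<in> carrier M \<times> carrier N" for p q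
    using hom_mult[OF coset_hom, of "frag_of p" "frag_of q"] that by simp
  have "ptens (m \<oplus>\<^bsub>M\<^esub> m') n = ptens m n \<otimes>\<^bsub>TG\<^esub> ptens m' n"
    if c: "m \<in> carrier M" "m' \<in> carrier M" "n \<in> carrier N" for m m' n
  proof -
    have "TK #>\<^bsub>FG\<^esub> frag_of (m \<oplus>\<^bsub>M\<^esub> m', n) = TK #>\<^bsub>FG\<^esub> (frag_of (m, n) + frag_of (m', n))"
      by (rule coset_diff[OF fr sum2 coset_relator])
        (use c in \<open>auto simp: tensor_relators_def diff_diff_eq[symmetric]\<close>)
    then show ?thesis unfolding pure_tensor_def using mult c by simp
  qed
  moreover have "ptens m (n \<oplus>\<^bsub>N\<^esub> n') = ptens m n \<otimes>\<^bsub>TG\<^esub> ptens m n'"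
    if c: "m \<in> carrier M" "n \<in> carrier N" "n' \<in> carrier N" for m n n'
  proof -
    have "TK #>\<^bsub>FG\<^esub> frag_of (m, n \<oplus>\<^bsub>N\<^esub> n') = TK #>\<^bsub>FG\<^esub> (frag_of (m, n) + frag_of (m, n'))"
      by (rule coset_diff[OF fr sum2 coset_relator])
        (use c in \<open>auto simp: tensor_relators_def diff_diff_eq[symmetric]\<close>)
    then show ?thesis unfolding pure_tensor_def using mult c by simp
  qed
  moreover have "ptens (r \<odot>\<^bsub>M\<^esub> m) n = ptens m (r \<odot>\<^bsub>N\<^esub> n)"
    if c: "r \<in> carrier R" "m \<in> carrier M" "n \<in> carrier N" for r m n
    unfolding pure_tensor_def
    by (rule coset_diff[OF fr fr coset_relator])
      (use c smult_M smult_N in \<open>auto simp: tensor_relators_def\<close>)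
  ultimately show ?thesis unfolding balanced_map_def by (simp add: pure_closed)
qed

text \<open>The evaluation homomorphism of the free abelian group maps the relators of the tensor product to
  the neutral element, so it takes the same value at all representatives of a tensor.\<close>

lemma lift_coset:
  assumes G: "comm_group G" and \<phi>: "balanced_map R M N G \<phi>" and x: "x \<in> carrier FG"
  shows "tensor_lift G \<phi> (TK #>\<^bsub>FG\<^esub> x) =
    finprod G (\<lambda>p. \<phi> (fst p) (snd p) [^]\<^bsub>G\<^esub> Poly_Mapping.lookup x p) (Poly_Mapping.keys x)"
proof -
  interpret G: comm_group G by (rule G)
  let ?f = "\<lambda>p. \<phi> (fst p) (snd p)"
  define e where "e = (\<lambda>x :: ('m \<times> 'n) \<Rightarrow>\<^sub>0 int. finprod G (\<lambda>p. ?f p [^]\<^bsub>G\<^esub> Poly_Mapping.lookup x p) (Poly_Mapping.keys x))"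
  have f: "?f \<in> carrier M \<times> carrier N \<rightarrow> carrier G"
    using \<phi> by (auto simp: balanced_map_def)
  have hom: "e \<in> hom FG G" unfolding e_def by (rule G.free_eval_hom[OF f])
  interpret h: group_hom FG G e
    by (intro group_hom.intro group_hom_axioms.intro hom G.group_axioms comm_FG[THEN comm_group.axioms(2)])
  have single: "e (frag_of p) = ?f p" if "p \<in> carrier M \<times> carrier N" for p
  proof -
    have "?f p \<in> carrier G" using f that by blast
    then show ?thesis unfolding e_def by (simp add: keys_frag_of)
  qed
  have hd: "e (a - b) = e a \<otimes>\<^bsub>G\<^esub> inv\<^bsub>G\<^esub> e b" if "a \<in> carrier FG" "b \<in> carrier FG" for a b
  proof -
    have "a - b = a \<otimes>\<^bsub>FG\<^esub> inv\<^bsub>FG\<^esub> b" using that by simp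
    then show ?thesis using that by (simp only: h.hom_mult h.hom_inv h.G.inv_closed)
  qed
  have dcl: "a - b \<in> carrier FG" if "a \<in> carrier FG" "b \<in> carrier FG" for a b
    using that keys_diff[of a b] by auto
  have fr: "frag_of p \<in> carrier FG" if "p \<in> carrier M \<times> carrier N" for p using that by simp
  have r3: "e (frag_of a - frag_of b - frag_of c) = \<one>\<^bsub>G\<^esub>"
    if "a \<in> carrier M \<times> carrier N" "b \<in> carrier M \<times> carrier N" "c \<in> carrier M \<times> carrier N"
      "?f a = ?f b \<otimes>\<^bsub>G\<^esub> ?f c" for a b c
  proof -
    have cl: "?f b \<in> carrier G" "?f c \<in> carrier G" using f that by auto
    have "e (frag_of a - frag_of b - frag_of c) = ?f a \<otimes>\<^bsub>G\<^esub> inv\<^bsub>G\<^esub> ?f b \<otimes>\<^bsub>G\<^esub> inv\<^bsub>G\<^esub> ?f c"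
      using that by (simp only: hd dcl fr single)
    also have "\<dots> = (?f b \<otimes>\<^bsub>G\<^esub> ?f c) \<otimes>\<^bsub>G\<^esub> inv\<^bsub>G\<^esub> (?f b \<otimes>\<^bsub>G\<^esub> ?f c)"
      using cl by (simp only: that(4) G.inv_mult G.m_assoc G.m_closed G.inv_closed)
    also have "\<dots> = \<one>\<^bsub>G\<^esub>" using cl by (simp only: G.r_inv G.m_closed)
    finally show ?thesis .
  qed
  have r2: "e (frag_of a - frag_of b) = \<one>\<^bsub>G\<^esub>"
    if "a \<in> carrier M \<times> carrier N" "b \<in> carrier M \<times> carrier N" "?f a = ?f b" for a b
    proof -
    have "?f b \<in> carrier G" using f that by blast
    then show ?thesis using that by (simp only: hd fr single G.r_inv)
  qed
  have "tensor_relators R M N \<subseteq> kernel FG G e"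
  proof
    fix y assume y: "y \<in> tensor_relators R M N"
    then have "y \<in> carrier FG" using relators_closed by blast
    moreover have "e y = \<one>\<^bsub>G\<^esub>"
      using y unfolding tensor_relators_def Un_iff
    proof (elim disjE CollectE exE conjE)
      fix m m' n
      assume "y = frag_of (m \<oplus>\<^bsub>M\<^esub> m', n) - frag_of (m, n) - frag_of (m', n)"
        and c: "m \<in> carrier M" "m' \<in> carrier M" "n \<in> carrier N"
      then show ?thesis using r3[of "(m \<oplus>\<^bsub>M\<^esub> m', n)" "(m, n)" "(m', n)"] \<phi> c
        by (simp add: balanced_map_def)
    next
      fix m n n'
      assume "y = frag_of (m, n \<oplus>\<^bsub>N\<^esub> n') - frag_of (m, n) - frag_of (m, n')"
        and c: "m \<in> carrier M" "n \<in> carrier N" "n' \<in> carrier N"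
      then show ?thesis using r3[of "(m, n \<oplus>\<^bsub>N\<^esub> n')" "(m, n)" "(m, n')"] \<phi> c
        by (simp add: balanced_map_def)
    next
      fix r m n
      assume "y = frag_of (r \<odot>\<^bsub>M\<^esub> m, n) - frag_of (m, r \<odot>\<^bsub>N\<^esub> n)"
        and c: "r \<in> carrier R" "m \<in> carrier M" "n \<in> carrier N"
      then show ?thesis using r2[of "(r \<odot>\<^bsub>M\<^esub> m, n)" "(m, r \<odot>\<^bsub>N\<^esub> n)"] \<phi> c
        by (simp add: balanced_map_def smult_M smult_N)
    qed
    ultimately show "y \<in> kernel FG G e" by (simp only: kernel_def mem_Collect_eq simp_thms)
  qed
  then have ker: "TK \<subseteq> kernel FG G e"
    unfolding tensor_kernel_def
    by (rule group.generate_subgroup_incl[OF group_free_Abelian_group _ h.subgroup_kernel])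
  let ?t = "TK #>\<^bsub>FG\<^esub> x"
  have "x \<in> ?t" by (rule group.rcos_self[OF group_free_Abelian_group x subgroup_TK])
  then have "(SOME x. x \<in> ?t) \<in> ?t" by (rule someI)
  then obtain k where k: "k \<in> TK" "(SOME x. x \<in> ?t) = k \<otimes>\<^bsub>FG\<^esub> x"
    unfolding r_coset_def by blast
  have "k \<in> carrier FG" "e k = \<one>\<^bsub>G\<^esub>" using k(1) ker by (auto simp only: kernel_def)
  then have "e (k \<otimes>\<^bsub>FG\<^esub> x) = e x"
    using h.hom_mult[OF _ x, of k] h.hom_closed[OF x] by (simp only: G.l_one)
  then show ?thesis unfolding tensor_lift_def Let_def k(2) e_def .
qed

lemma tensor_lift_hom:
  assumes G: "comm_group G" and \<phi>: "balanced_map R M N G \<phi>"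
  shows "tensor_lift G \<phi> \<in> hom TG G"
proof -
  have f: "(\<lambda>p. \<phi> (fst p) (snd p)) \<in> carrier M \<times> carrier N \<rightarrow> carrier G"
    using \<phi> by (auto simp: balanced_map_def)
  note hom = comm_group.free_eval_hom[OF G f]
  have car: "carrier TG = (\<lambda>x. TK #>\<^bsub>FG\<^esub> x) ` carrier FG"
    unfolding tensor_group_def by (rule carrier_FactGroup)
  show ?thesis
  proof (rule homI)
    fix s assume "s \<in> carrier TG"
    then show "tensor_lift G \<phi> s \<in> carrier G"
      unfolding car by (auto simp only: lift_coset[OF G \<phi>] intro!: hom_in_carrier[OF hom])
  next
    fix s t assume "s \<in> carrier TG" "t \<in> carrier TG"
    then obtain x y where x: "x \<in> carrier FG" "s = TK #>\<^bsub>FG\<^esub> x"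
      and y: "y \<in> carrier FG" "t = TK #>\<^bsub>FG\<^esub> y"
      unfolding car by blast
    have xy: "x \<otimes>\<^bsub>FG\<^esub> y \<in> carrier FG"
      using x y comm_FG[THEN comm_group.axioms(1), THEN comm_monoid.axioms(1)] monoid.m_closed by metis
    have "s \<otimes>\<^bsub>TG\<^esub> t = TK #>\<^bsub>FG\<^esub> (x \<otimes>\<^bsub>FG\<^esub> y)"
      using hom_mult[OF coset_hom x(1) y(1)] x(2) y(2) by (simp only:)
    then show "tensor_lift G \<phi> (s \<otimes>\<^bsub>TG\<^esub> t) = tensor_lift G \<phi> s \<otimes>\<^bsub>G\<^esub> tensor_lift G \<phi> t"
      using hom_mult[OF hom x(1) y(1)] x y xy by (simp only: lift_coset[OF G \<phi>])
  qed
qed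

lemma tensor_lift_pure:
  assumes G: "comm_group G" and \<phi>: "balanced_map R M N G \<phi>"
    and m: "m \<in> carrier M" and n: "n \<in> carrier N"
  shows "tensor_lift G \<phi> (ptens m n) = \<phi> m n"
proof -
  interpret G: comm_group G by (rule G)
  have "\<phi> m n \<in> carrier G" using \<phi> m n by (auto simp: balanced_map_def)
  then show ?thesis
    unfolding pure_tensor_def using m n by (subst lift_coset[OF G \<phi>]) (auto simp: keys_frag_of)
qed

text \<open>Since \<open>- (m \<otimes> n) = (- m) \<otimes> n\<close>, pure tensors generate the tensor product as a monoid. The proof
  treats a tensor and its inverse together.\<close>

lemma tensor_induct [consumes 1, case_names pure add]:
  assumes t: "t \<in> carrier TG"
    and pure: "\<And>m n. \<lbrakk>m \<in> carrier M; n \<in> carrier N\<rbrakk> \<Longrightarrow> P (ptens m n)"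
    and add: "\<And>s t. \<lbrakk>s \<in> carrier TG; t \<in> carrier TG; P s; P t\<rbrakk> \<Longrightarrow> P (s \<otimes>\<^bsub>TG\<^esub> t)"
  shows "P t"
proof -
  interpret T: comm_group TG by (rule comm_group_TG)
  have zero: "ptens \<zero>\<^bsub>M\<^esub> n = \<one>\<^bsub>TG\<^esub>" if n: "n \<in> carrier N" for n
  proof -
    have "ptens (\<zero>\<^bsub>M\<^esub> \<oplus>\<^bsub>M\<^esub> \<zero>\<^bsub>M\<^esub>) n = ptens \<zero>\<^bsub>M\<^esub> n \<otimes>\<^bsub>TG\<^esub> ptens \<zero>\<^bsub>M\<^esub> n"
      using pure_balanced n M.zero_closed unfolding balanced_map_def by blast
    then show ?thesis using pure_closed[OF M.zero_closed n] by simp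
  qed
  have neg: "ptens (\<ominus>\<^bsub>M\<^esub> m) n = inv\<^bsub>TG\<^esub> ptens m n" if m: "m \<in> carrier M" and n: "n \<in> carrier N" for m n
  proof -
    have "ptens (\<ominus>\<^bsub>M\<^esub> m \<oplus>\<^bsub>M\<^esub> m) n = ptens (\<ominus>\<^bsub>M\<^esub> m) n \<otimes>\<^bsub>TG\<^esub> ptens m n"
      using pure_balanced m n M.a_inv_closed unfolding balanced_map_def by blast
    then have "ptens (\<ominus>\<^bsub>M\<^esub> m) n \<otimes>\<^bsub>TG\<^esub> ptens m n = \<one>\<^bsub>TG\<^esub>"
      using m zero[OF n] by (simp add: M.l_neg)
    then show ?thesis using m n by (metis T.inv_equality pure_closed M.a_inv_closed)
  qed
  obtain x where x: "x \<in> carrier FG" and tx: "t = TK #>\<^bsub>FG\<^esub> x"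
    using t unfolding tensor_group_def carrier_FactGroup by blast
  have cneg: "TK #>\<^bsub>FG\<^esub> (- x) = inv\<^bsub>TG\<^esub> (TK #>\<^bsub>FG\<^esub> x)" if "x \<in> carrier FG" for x
    using group_hom.hom_inv[of FG TG "\<lambda>x. TK #>\<^bsub>FG\<^esub> x" x] that coset_hom T.group_axioms
    by (simp add: group_hom_def group_hom_axioms_def)
  have "P (TK #>\<^bsub>FG\<^esub> x) \<and> P (inv\<^bsub>TG\<^esub> (TK #>\<^bsub>FG\<^esub> x))"
  proof (rule free_Abelian_group_induct[of x "carrier M \<times> carrier N"])
    show "Poly_Mapping.keys x \<subseteq> carrier M \<times> carrier N" using x by simp
  next
    have "TK #>\<^bsub>FG\<^esub> 0 = \<one>\<^bsub>TG\<^esub>"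
      using hom_one[OF coset_hom] T.group_axioms by simp
    moreover have "P \<one>\<^bsub>TG\<^esub>" using pure[OF M.zero_closed N.zero_closed] zero[OF N.zero_closed] by simp
    ultimately show "P (TK #>\<^bsub>FG\<^esub> 0) \<and> P (inv\<^bsub>TG\<^esub> (TK #>\<^bsub>FG\<^esub> 0))" by simp
  next
    fix a assume "a \<in> carrier M \<times> carrier N"
    then obtain m n where a: "a = (m, n)" and m: "m \<in> carrier M" and n: "n \<in> carrier N" by blast
    have "TK #>\<^bsub>FG\<^esub> frag_of a = ptens m n" unfolding a pure_tensor_def ..
    then show "P (TK #>\<^bsub>FG\<^esub> frag_of a) \<and> P (inv\<^bsub>TG\<^esub> (TK #>\<^bsub>FG\<^esub> frag_of a))"
      using pure[OF m n] pure[OF M.a_inv_closed[OF m] n] neg[OF m n] by simp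
  next
    fix x y
    assume k: "Poly_Mapping.keys x \<subseteq> carrier M \<times> carrier N" "Poly_Mapping.keys y \<subseteq> carrier M \<times> carrier N"
      and P: "P (TK #>\<^bsub>FG\<^esub> x) \<and> P (inv\<^bsub>TG\<^esub> (TK #>\<^bsub>FG\<^esub> x))" "P (TK #>\<^bsub>FG\<^esub> y) \<and> P (inv\<^bsub>TG\<^esub> (TK #>\<^bsub>FG\<^esub> y))"
    have xy: "x \<in> carrier FG" "y \<in> carrier FG" "- y \<in> carrier FG" using k by simp_all
    have c: "TK #>\<^bsub>FG\<^esub> x \<in> carrier TG" "TK #>\<^bsub>FG\<^esub> y \<in> carrier TG"
      using hom_in_carrier[OF coset_hom] xy by blast+
    have "TK #>\<^bsub>FG\<^esub> (x - y) = (TK #>\<^bsub>FG\<^esub> x) \<otimes>\<^bsub>TG\<^esub> inv\<^bsub>TG\<^esub> (TK #>\<^bsub>FG\<^esub> y)"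
      using hom_mult[OF coset_hom xy(1,3)] cneg[OF xy(2)] by simp
    then show "P (TK #>\<^bsub>FG\<^esub> (x - y)) \<and> P (inv\<^bsub>TG\<^esub> (TK #>\<^bsub>FG\<^esub> (x - y)))"
      using c P by (simp add: T.inv_mult add T.m_comm)
  qed
  then show ?thesis unfolding tx ..
qed

end

section \<open>Linear maps and tensor products over a commutative ring\<close>

lemma module_hom_closed: "\<lbrakk>f \<in> module_hom K M N; x \<in> carrier M\<rbrakk> \<Longrightarrow> f x \<in> carrier N"
  unfolding module_hom_def hom_def by auto

lemma module_hom_add:
  "\<lbrakk>f \<in> module_hom K M N; x \<in> carrier M; y \<in> carrier M\<rbrakk> \<Longrightarrow> f (x \<oplus>\<^bsub>M\<^esub> y) = f x \<oplus>\<^bsub>N\<^esub> f y"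
  unfolding module_hom_def hom_def by auto

lemma module_hom_smult:
  "\<lbrakk>f \<in> module_hom K M N; c \<in> carrier K; x \<in> carrier M\<rbrakk> \<Longrightarrow> f (c \<odot>\<^bsub>M\<^esub> x) = c \<odot>\<^bsub>N\<^esub> f x"
  unfolding module_hom_def by auto

lemma module_homI:
  assumes "\<And>x. x \<in> carrier M \<Longrightarrow> f x \<in> carrier N"
    and "\<And>x y. \<lbrakk>x \<in> carrier M; y \<in> carrier M\<rbrakk> \<Longrightarrow> f (x \<oplus>\<^bsub>M\<^esub> y) = f x \<oplus>\<^bsub>N\<^esub> f y"
    and "\<And>c x. \<lbrakk>c \<in> carrier K; x \<in> carrier M\<rbrakk> \<Longrightarrow> f (c \<odot>\<^bsub>M\<^esub> x) = c \<odot>\<^bsub>N\<^esub> f x"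
  shows "f \<in> module_hom K M N"
  unfolding module_hom_def hom_def using assms by auto

lemma module_hom_additive: "f \<in> module_hom K M N \<Longrightarrow> f \<in> hom (add_monoid M) (add_monoid N)"
  unfolding module_hom_def by auto

lemma add_hom_finsum:
  assumes M: "abelian_group M" and N: "abelian_group N" and f: "f \<in> hom (add_monoid M) (add_monoid N)"
    and x: "x \<in> I \<rightarrow> carrier M"
  shows "f (finsum M x I) = finsum N (\<lambda>i. f (x i)) I"
proof -
  interpret M: abelian_group M by (rule M)
  interpret N: abelian_group N by (rule N)
  have zero: "f \<zero>\<^bsub>M\<^esub> = \<zero>\<^bsub>N\<^esub>"
    using hom_one[OF f M.a_group N.a_group] by simp
  have cl: "f y \<in> carrier N" if "y \<in> carrier M" for y using f that by (auto simp: hom_def)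
  show ?thesis using x
  proof (induct I rule: infinite_finite_induct)
    case (insert i I)
    have "f (x i \<oplus>\<^bsub>M\<^esub> finsum M x I) = f (x i) \<oplus>\<^bsub>N\<^esub> f (finsum M x I)"
      using f insert(4) by (auto simp: hom_def Pi_iff)
    then show ?case using insert by (auto simp: Pi_iff cl)
  qed (simp_all add: zero)
qed

lemma module_hom_finsum:
  assumes "abelian_group M" "abelian_group N" "f \<in> module_hom K M N" "x \<in> I \<rightarrow> carrier M"
  shows "f (finsum M x I) = finsum N (\<lambda>i. f (x i)) I"
  by (rule add_hom_finsum[OF assms(1,2) module_hom_additive[OF assms(3)] assms(4)])

lemma module_hom_zero:
  assumes "abelian_group M" "abelian_group N" "f \<in> module_hom K M N"
  shows "f \<zero>\<^bsub>M\<^esub> = \<zero>\<^bsub>N\<^esub>"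
  using module_hom_finsum[OF assms, of _ "{}"] assms(1,2)
  by (simp add: abelian_monoid.finsum_empty abelian_group.axioms)

text \<open>In the following rules a linear map is written as an abstraction over a variable
  that occurs once in each summand, so that linearity can be proved by descending into the term.\<close>

lemma lin_id: "(\<lambda>x. x) \<in> module_hom K V V"
  by (intro module_homI) simp_all

lemma lin_comp:
  "\<lbrakk>F \<in> module_hom K M N; f \<in> module_hom K V M\<rbrakk> \<Longrightarrow> (\<lambda>x. F (f x)) \<in> module_hom K V N"
  by (intro module_homI) (simp_all add: module_hom_closed module_hom_add module_hom_smult)

context module
begin

lemma abgroup: "abelian_group M" by unfold_locales

lemma lin_add:
  assumes "f \<in> module_hom R V M" "g \<in> module_hom R V M"
  shows "(\<lambda>x. f x \<oplus>\<^bsub>M\<^esub> g x) \<in> module_hom R V M"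
  using assms
  by (intro module_homI) (simp_all add: module_hom_closed module_hom_add module_hom_smult smult_r_distr M.a_ac)

lemma lin_minus:
  assumes "f \<in> module_hom R V M"
  shows "(\<lambda>x. \<ominus>\<^bsub>M\<^esub> f x) \<in> module_hom R V M"
  using assms
  by (intro module_homI)
    (simp_all add: module_hom_closed module_hom_add module_hom_smult smult_r_minus M.minus_add)

lemma lin_diff:
  assumes "f \<in> module_hom R V M" "g \<in> module_hom R V M"
  shows "(\<lambda>x. f x \<ominus>\<^bsub>M\<^esub> g x) \<in> module_hom R V M"
  unfolding a_minus_def by (intro lin_add lin_minus assms)

lemma lin_zero: "(\<lambda>x. \<zero>\<^bsub>M\<^esub>) \<in> module_hom R V M"
  by (intro module_homI) simp_all

lemma lin_finsum:
  assumes "\<And>i. i \<in> I \<Longrightarrow> (\<lambda>x. f x i) \<in> module_hom R V M"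
  shows "(\<lambda>x. finsum M (f x) I) \<in> module_hom R V M"
  using assms
proof (induct I rule: infinite_finite_induct)
  case (insert i I)
  have cl: "f x j \<in> carrier M" if "x \<in> carrier V" "j \<in> insert i I" for x j
    using module_hom_closed[OF insert(4)[OF that(2)] that(1)] .
  have add: "f (x \<oplus>\<^bsub>V\<^esub> y) j = f x j \<oplus>\<^bsub>M\<^esub> f y j" if "x \<in> carrier V" "y \<in> carrier V" "j \<in> insert i I" for x y j
    using module_hom_add[OF insert(4)[OF that(3)] that(1,2)] .
  have sm: "f (c \<odot>\<^bsub>V\<^esub> x) j = c \<odot>\<^bsub>M\<^esub> f x j" if "c \<in> carrier R" "x \<in> carrier V" "j \<in> insert i I" for c x j
    using module_hom_smult[OF insert(4)[OF that(3)] that(1,2)] .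
  have IH: "(\<lambda>x. finsum M (f x) I) \<in> module_hom R V M" using insert by simp
  have eq: "finsum M (f z) (insert i I) = f z i \<oplus>\<^bsub>M\<^esub> finsum M (f z) I"
    if "\<And>j. j \<in> insert i I \<Longrightarrow> f z j \<in> carrier M" for z
    using that insert(1,2) by (intro M.finsum_insert) auto
  have lin: "(\<lambda>x. f x i \<oplus>\<^bsub>M\<^esub> finsum M (f x) I) \<in> module_hom R V M"
    by (intro lin_add IH insert(4)) simp
  show ?case
  proof (rule module_homI)
    fix x assume x: "x \<in> carrier V"
    show "finsum M (f x) (insert i I) \<in> carrier M" using cl[OF x] by (intro M.finsum_closed) auto
  next
    fix x y assume xy: "x \<in> carrier V" "y \<in> carrier V"
    have "finsum M (f (x \<oplus>\<^bsub>V\<^esub> y)) (insert i I) = f (x \<oplus>\<^bsub>V\<^esub> y) i \<oplus>\<^bsub>M\<^esub> finsum M (f (x \<oplus>\<^bsub>V\<^esub> y)) I"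
      by (rule eq) (simp add: add xy cl)
    then show "finsum M (f (x \<oplus>\<^bsub>V\<^esub> y)) (insert i I) = finsum M (f x) (insert i I) \<oplus>\<^bsub>M\<^esub> finsum M (f y) (insert i I)"
      using module_hom_add[OF lin xy] eq cl xy by simp
  next
    fix c x assume cx: "c \<in> carrier R" "x \<in> carrier V"
    have "finsum M (f (c \<odot>\<^bsub>V\<^esub> x)) (insert i I) = f (c \<odot>\<^bsub>V\<^esub> x) i \<oplus>\<^bsub>M\<^esub> finsum M (f (c \<odot>\<^bsub>V\<^esub> x)) I"
      by (rule eq) (simp add: sm cx cl)
    then show "finsum M (f (c \<odot>\<^bsub>V\<^esub> x)) (insert i I) = c \<odot>\<^bsub>M\<^esub> finsum M (f x) (insert i I)"
      using module_hom_smult[OF lin cx] eq cl cx by simp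
  qed
qed (simp_all add: lin_zero)

lemma lin_smult:
  assumes "c \<in> carrier R" "f \<in> module_hom R V M"
  shows "(\<lambda>x. c \<odot>\<^bsub>M\<^esub> f x) \<in> module_hom R V M"
proof (rule module_homI)
  show "c \<odot>\<^bsub>M\<^esub> f (d \<odot>\<^bsub>V\<^esub> x) = d \<odot>\<^bsub>M\<^esub> (c \<odot>\<^bsub>M\<^esub> f x)"
    if "d \<in> carrier R" "x \<in> carrier V" for d x
    using assms that smult_assoc1[of c d "f x"] smult_assoc1[of d c "f x"] R.m_comm[of c d]
    by (simp add: module_hom_smult module_hom_closed)
qed (use assms in \<open>simp_all add: module_hom_closed module_hom_add smult_r_distr\<close>)

lemma lin_scalar:
  assumes "f \<in> module_hom R V (scalar_algebra R)" "m \<in> carrier M"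
  shows "(\<lambda>x. f x \<odot>\<^bsub>M\<^esub> m) \<in> module_hom R V M"
  using assms module_hom_closed[OF assms(1)] module_hom_add[OF assms(1)] module_hom_smult[OF assms(1)]
  by (intro module_homI) (simp_all add: scalar_algebra_def smult_l_distr smult_assoc1)

end

lemma scalar_module:
  assumes "cring K" shows "module K (scalar_algebra K)"
proof -
  interpret K: cring K by fact
  have "\<exists>y \<in> carrier K. y \<oplus>\<^bsub>K\<^esub> x = \<zero>\<^bsub>K\<^esub>" if "x \<in> carrier K" for x
    using that K.l_neg by (intro bexI[of _ "\<ominus>\<^bsub>K\<^esub> x"]) auto
  then show ?thesis
    by (intro moduleI assms abelian_groupI)
      (simp_all add: scalar_algebra_def K.l_distr K.r_distr K.m_assoc K.a_ac)
qed

definition bilinear_map ::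
  "('k, 'x) ring_scheme \<Rightarrow> ('k, 'm, 'y) module_scheme \<Rightarrow> ('k, 'n, 'z) module_scheme
    \<Rightarrow> ('k, 'w, 'v) module_scheme \<Rightarrow> ('m \<Rightarrow> 'n \<Rightarrow> 'w) \<Rightarrow> bool"
  where "bilinear_map K M N W \<phi> \<longleftrightarrow>
    (\<forall>m \<in> carrier M. (\<lambda>n. \<phi> m n) \<in> module_hom K N W) \<and>
    (\<forall>n \<in> carrier N. (\<lambda>m. \<phi> m n) \<in> module_hom K M W)"

lemma bilinear_mapI:
  assumes "\<And>m. m \<in> carrier M \<Longrightarrow> (\<lambda>n. \<phi> m n) \<in> module_hom K N W"
    and "\<And>n. n \<in> carrier N \<Longrightarrow> (\<lambda>m. \<phi> m n) \<in> module_hom K M W"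
  shows "bilinear_map K M N W \<phi>"
  using assms unfolding bilinear_map_def by auto

lemma bilinear_map_closed:
  "\<lbrakk>bilinear_map K M N W \<phi>; m \<in> carrier M; n \<in> carrier N\<rbrakk> \<Longrightarrow> \<phi> m n \<in> carrier W"
  unfolding bilinear_map_def by (auto intro: module_hom_closed)

lemma bilinear_balanced: "bilinear_map K M N W \<phi> \<Longrightarrow> balanced_map K M N (add_monoid W) \<phi>"
  unfolding bilinear_map_def balanced_map_def
  by (intro conjI ballI)
    (simp_all add: module_hom_closed[of _ K N W] module_hom_add[of "\<lambda>m. \<phi> m _" K M W]
      module_hom_add[of _ K N W] module_hom_smult[of "\<lambda>m. \<phi> m _" K M W] module_hom_smult[of _ K N W])

lemma carrier_tensor_algebra: "carrier (tensor_algebra K M N) = carrier (tensor_group K M N)"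
  by (simp add: tensor_algebra_def)

lemma add_tensor_algebra: "x \<oplus>\<^bsub>tensor_algebra K M N\<^esub> y = x \<otimes>\<^bsub>tensor_group K M N\<^esub> y"
  by (simp add: tensor_algebra_def)

lemma zero_tensor_algebra: "\<zero>\<^bsub>tensor_algebra K M N\<^esub> = \<one>\<^bsub>tensor_group K M N\<^esub>"
  by (simp add: tensor_algebra_def)

text \<open>The two sides are computed in records of different types with the same addition.\<close>

lemma tensor_lift_tensor_group:
  "tensor_lift (tensor_group K M N) = tensor_sum (tensor_algebra K M N)"
proof -
  have pow: "x [^]\<^bsub>add_monoid (tensor_algebra K M N)\<^esub> (k :: int) = x [^]\<^bsub>tensor_group K M N\<^esub> k" for x k
    by (simp add: int_pow_def2 nat_pow_def m_inv_def tensor_algebra_def cong: if_cong)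
  show ?thesis
    by (simp add: fun_eq_iff tensor_lift_def pow) (simp add: finprod_def tensor_algebra_def)
qed

lemma smult_tensor_algebra:
  "c \<odot>\<^bsub>tensor_algebra K M N\<^esub> t =
    tensor_sum (tensor_algebra K M N) (\<lambda>a b. pure_tensor K M N (c \<odot>\<^bsub>M\<^esub> a) b) t"
  unfolding tensor_lift_tensor_group[symmetric] by (simp add: tensor_algebra_def)

lemma mult_tensor_algebra:
  "s \<otimes>\<^bsub>tensor_algebra K M N\<^esub> t =
    tensor_sum (tensor_algebra K M N) (\<lambda>a b. tensor_sum (tensor_algebra K M N)
      (\<lambda>a' b'. pure_tensor K M N (a \<otimes>\<^bsub>M\<^esub> a') (b \<otimes>\<^bsub>N\<^esub> b')) t) s"
  unfolding tensor_lift_tensor_group[symmetric] by (simp add: tensor_algebra_def)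

text \<open>The value of \<^const>\<open>tensor_lift\<close> is a finite sum over one fixed representative. Hence it can
  be transformed like a finite sum even when \<open>\<phi>\<close> is not balanced.\<close>

context tensor_pair
begin

abbreviation "rep t \<equiv> (SOME x. x \<in> t)"

lemma keys_rep:
  assumes "t \<in> carrier TG" shows "Poly_Mapping.keys (rep t) \<subseteq> carrier M \<times> carrier N"
proof -
  have "t \<in> rcosets\<^bsub>FG\<^esub> TK" using assms unfolding tensor_group_def FactGroup_def by simp
  then have "t \<noteq> {}" "t \<subseteq> carrier FG"
    using subgroup.rcosets_non_empty[OF subgroup_TK] subgroup.rcosets_carrier[OF subgroup_TK group_free_Abelian_group]
    by blast+
  then have "rep t \<in> carrier FG" by (metis some_in_eq subsetD)
  then show ?thesis by simp
qed

lemma lift_closed: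
  assumes "comm_group G" "t \<in> carrier TG"
    and \<phi>: "\<And>m n. \<lbrakk>m \<in> carrier M; n \<in> carrier N\<rbrakk> \<Longrightarrow> \<phi> m n \<in> carrier G"
  shows "tensor_lift G \<phi> t \<in> carrier G"
proof -
  interpret comm_group G by fact
  show ?thesis unfolding tensor_lift_def Let_def
    by (intro finprod_closed Pi_I int_pow_closed) (use keys_rep[OF assms(2)] \<phi> in auto)
qed

lemma lift_cong:
  assumes "comm_group G" "t \<in> carrier TG"
    and \<phi>: "\<And>m n. \<lbrakk>m \<in> carrier M; n \<in> carrier N\<rbrakk> \<Longrightarrow> \<phi> m n = \<psi> m n"
    and \<psi>: "\<And>m n. \<lbrakk>m \<in> carrier M; n \<in> carrier N\<rbrakk> \<Longrightarrow> \<psi> m n \<in> carrier G"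
  shows "tensor_lift G \<phi> t = tensor_lift G \<psi> t"
proof -
  interpret comm_group G by fact
  show ?thesis unfolding tensor_lift_def Let_def
    by (rule finprod_cong') (use keys_rep[OF assms(2)] \<phi> \<psi> in \<open>auto simp: Pi_iff subset_iff\<close>)
qed

lemma lift_hom:
  assumes "comm_group G" "comm_group G'" "t \<in> carrier TG" and f: "f \<in> hom G G'"
    and \<phi>: "\<And>m n. \<lbrakk>m \<in> carrier M; n \<in> carrier N\<rbrakk> \<Longrightarrow> \<phi> m n \<in> carrier G"
  shows "f (tensor_lift G \<phi> t) = tensor_lift G' (\<lambda>m n. f (\<phi> m n)) t"
proof -
  interpret G: comm_group G by fact
  interpret G': comm_group G' by fact
  interpret f: group_hom G G' f
    by (intro group_hom.intro group_hom_axioms.intro f G.group_axioms G'.group_axioms)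
  let ?K = "Poly_Mapping.keys (rep t)"
  have cl: "\<phi> (fst p) (snd p) \<in> carrier G" if "p \<in> ?K" for p
    using keys_rep[OF assms(3)] \<phi> that by (metis SigmaE fst_conv snd_conv subsetD)
  have "f (tensor_lift G \<phi> t) =
    finprod G' (\<lambda>p. f (\<phi> (fst p) (snd p) [^]\<^bsub>G\<^esub> Poly_Mapping.lookup (rep t) p)) ?K"
    unfolding tensor_lift_def Let_def by (intro hom_finprod[OF assms(1,2) f] Pi_I G.int_pow_closed cl)
  also have "\<dots> = tensor_lift G' (\<lambda>m n. f (\<phi> m n)) t"
    unfolding tensor_lift_def Let_def
    by (intro G'.finprod_cong') (simp_all add: cl f.hom_int_pow)
  finally show ?thesis .
qed

lemma sum_of_pures:
  assumes "t \<in> carrier TG"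
  shows "\<exists>(n :: nat) x y. x \<in> {..<n} \<rightarrow> carrier M \<and> y \<in> {..<n} \<rightarrow> carrier N \<and>
    t = finprod TG (\<lambda>i. ptens (x i) (y i)) {..<n}"
  using assms
proof (induct rule: tensor_induct)
  interpret T: comm_group TG by (rule comm_group_TG)
  case (pure m n)
  show ?case
    by (rule exI[of _ "Suc 0"], rule exI[of _ "\<lambda>_. m"], rule exI[of _ "\<lambda>_. n"])
      (use pure in \<open>simp add: lessThan_Suc pure_closed\<close>)
next
  interpret T: comm_group TG by (rule comm_group_TG)
  case (add s t)
  then obtain n x y k x' y' where
    s: "x \<in> {..<n} \<rightarrow> carrier M" "y \<in> {..<n} \<rightarrow> carrier N" "s = finprod TG (\<lambda>i. ptens (x i) (y i)) {..<n :: nat}" and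
    t: "x' \<in> {..<k} \<rightarrow> carrier M" "y' \<in> {..<k} \<rightarrow> carrier N" "t = finprod TG (\<lambda>i. ptens (x' i) (y' i)) {..<k :: nat}"
    by blast
  define X Y where "X = (\<lambda>i. if i < n then x i else x' (i - n))" and "Y = (\<lambda>i. if i < n then y i else y' (i - n))"
  have XY: "X \<in> {..<n + k} \<rightarrow> carrier M" "Y \<in> {..<n + k} \<rightarrow> carrier N"
    using s t unfolding X_def Y_def by (auto simp: Pi_iff)
  have U: "{..<n + k} = {..<n} \<union> (\<lambda>i. i + n) ` {..<k}"
  proof (rule Set.set_eqI)
    fix i show "i \<in> {..<n + k} \<longleftrightarrow> i \<in> {..<n} \<union> (\<lambda>i. i + n) ` {..<k}"
      by (cases "i < n") (auto simp: image_iff intro!: bexI[of _ "i - n"])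
  qed
  have "finprod TG (\<lambda>i. ptens (X i) (Y i)) {..<n + k} =
    finprod TG (\<lambda>i. ptens (X i) (Y i)) {..<n} \<otimes>\<^bsub>TG\<^esub> finprod TG (\<lambda>i. ptens (X i) (Y i)) ((\<lambda>i. i + n) ` {..<k})"
    unfolding U by (rule T.finprod_Un_disjoint) (use XY in \<open>auto simp: Pi_iff intro!: pure_closed\<close>)
  also have "finprod TG (\<lambda>i. ptens (X i) (Y i)) {..<n} = s"
    unfolding s(3) by (rule T.finprod_cong') (use s in \<open>auto simp: X_def Y_def Pi_iff intro!: pure_closed\<close>)
  also have "finprod TG (\<lambda>i. ptens (X i) (Y i)) ((\<lambda>i. i + n) ` {..<k}) =
      finprod TG (\<lambda>i. ptens (X (i + n)) (Y (i + n))) {..<k}"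
    by (rule T.finprod_reindex) (use XY in \<open>auto simp: Pi_iff inj_on_def intro!: pure_closed\<close>)
  also have "\<dots> = t"
    unfolding t(3) by (rule T.finprod_cong') (use t in \<open>auto simp: X_def Y_def Pi_iff intro!: pure_closed\<close>)
  finally show ?case using XY by (metis (no_types, lifting))
qed

end

text \<open>Both sides are finite double sums over the chosen representatives of \<open>t\<close> and \<open>s\<close>.\<close>

lemma tensor_lift_swap:
  assumes t: "tensor_pair R M N" "t \<in> carrier (tensor_group R M N)"
    and s: "tensor_pair R' M' N'" "s \<in> carrier (tensor_group R' M' N')"
    and G: "comm_group G"
    and \<phi>: "\<And>a b c d. \<lbrakk>a \<in> carrier M; b \<in> carrier N; c \<in> carrier M'; d \<in> carrier N'\<rbrakk> \<Longrightarrow> \<phi> a b c d \<in> carrier G"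
  shows "tensor_lift G (\<lambda>a b. tensor_lift G (\<lambda>c d. \<phi> a b c d) s) t =
    tensor_lift G (\<lambda>c d. tensor_lift G (\<lambda>a b. \<phi> a b c d) t) s"
proof -
  interpret G: comm_group G by fact
  interpret t: tensor_pair R M N by fact
  interpret s: tensor_pair R' M' N' by fact
  let ?k = "Poly_Mapping.lookup (t.rep t)" and ?l = "Poly_Mapping.lookup (s.rep s)"
  let ?A = "Poly_Mapping.keys (t.rep t)" and ?B = "Poly_Mapping.keys (s.rep s)"
  let ?\<phi> = "\<lambda>p q. \<phi> (fst p) (snd p) (fst q) (snd q)"
  have cl: "?\<phi> p q \<in> carrier G" if "p \<in> ?A" "q \<in> ?B" for p q
  proof -
    have "p \<in> carrier M \<times> carrier N" "q \<in> carrier M' \<times> carrier N'"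
      using t.keys_rep[OF t(2)] s.keys_rep[OF s(2)] that by blast+
    then show ?thesis using \<phi> by (cases p, cases q) simp
  qed
  have pow: "finprod G f A [^]\<^bsub>G\<^esub> (n :: int) = finprod G (\<lambda>i. f i [^]\<^bsub>G\<^esub> n) A" if "f \<in> A \<rightarrow> carrier G" for f n and A :: "'z set"
    using that by (induct A rule: infinite_finite_induct) (simp_all add: G.int_pow_distrib Pi_iff)
  have comm: "(x [^]\<^bsub>G\<^esub> (k :: int)) [^]\<^bsub>G\<^esub> (l :: int) = (x [^]\<^bsub>G\<^esub> l) [^]\<^bsub>G\<^esub> k" if "x \<in> carrier G" for x k l
    using that by (simp add: G.int_pow_pow mult.commute)
  have "tensor_lift G (\<lambda>a b. tensor_lift G (\<lambda>c d. \<phi> a b c d) s) t =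
      finprod G (\<lambda>p. finprod G (\<lambda>q. (?\<phi> p q [^]\<^bsub>G\<^esub> ?l q) [^]\<^bsub>G\<^esub> ?k p) ?B) ?A"
    unfolding tensor_lift_def Let_def
    by (rule G.finprod_cong'[OF refl]; (intro Pi_I G.finprod_closed)?; (rule pow)?)
      (auto intro!: G.int_pow_closed cl)
  also have "\<dots> = finprod G (\<lambda>q. finprod G (\<lambda>p. (?\<phi> p q [^]\<^bsub>G\<^esub> ?l q) [^]\<^bsub>G\<^esub> ?k p) ?A) ?B"
    by (intro G.finprod_swap G.int_pow_closed cl finite_keys)
  also have "\<dots> = finprod G (\<lambda>q. finprod G (\<lambda>p. (?\<phi> p q [^]\<^bsub>G\<^esub> ?k p) [^]\<^bsub>G\<^esub> ?l q) ?A) ?B"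
    by (rule G.finprod_cong'[OF refl] Pi_I G.finprod_closed G.int_pow_closed comm cl | assumption)+
  also have "\<dots> = tensor_lift G (\<lambda>c d. tensor_lift G (\<lambda>a b. \<phi> a b c d) t) s"
    unfolding tensor_lift_def Let_def
    by (rule G.finprod_cong'[OF refl]; (intro Pi_I G.int_pow_closed G.finprod_closed)?; (rule pow[symmetric])?)
      (auto intro!: G.int_pow_closed cl)
  finally show ?thesis .
qed

locale tensor_modules = M: module K M + N: module K N
  for K :: "('k, 'x) ring_scheme" and M :: "('k, 'm, 'y) module_scheme"
    and N :: "('k, 'n, 'z) module_scheme"
begin

sublocale tensor_pair K M N
  by unfold_locales simp_all

abbreviation "T \<equiv> tensor_algebra K M N"

lemma abelian_group_T: "abelian_group T"
proof -
  interpret C: comm_group TG by (rule comm_group_TG)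
  have "\<exists>y\<in>carrier TG. y \<otimes>\<^bsub>TG\<^esub> x = \<one>\<^bsub>TG\<^esub>" if "x \<in> carrier TG" for x
    using that by (intro bexI[of _ "inv\<^bsub>TG\<^esub> x"]) simp_all
  then show ?thesis
    by (intro abelian_groupI) (simp_all add: carrier_tensor_algebra add_tensor_algebra zero_tensor_algebra C.m_ac)
qed

lemma comm_group_add_T: "comm_group (add_monoid T)"
  using abelian_group_T by (rule abelian_group.a_comm_group)

lemma pure_T: "\<lbrakk>m \<in> carrier M; n \<in> carrier N\<rbrakk> \<Longrightarrow> ptens m n \<in> carrier T"
  unfolding carrier_tensor_algebra by (rule pure_closed)

lemma T_induct [consumes 1, case_names pure add]:
  assumes "t \<in> carrier T"
    and "\<And>m n. \<lbrakk>m \<in> carrier M; n \<in> carrier N\<rbrakk> \<Longrightarrow> P (ptens m n)"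
    and "\<And>s t. \<lbrakk>s \<in> carrier T; t \<in> carrier T; P s; P t\<rbrakk> \<Longrightarrow> P (s \<oplus>\<^bsub>T\<^esub> t)"
  shows "P t"
  using assms unfolding carrier_tensor_algebra add_tensor_algebra by (rule tensor_induct)

lemma pure_add_left: "\<lbrakk>m \<in> carrier M; m' \<in> carrier M; n \<in> carrier N\<rbrakk> \<Longrightarrow> ptens (m \<oplus>\<^bsub>M\<^esub> m') n = ptens m n \<oplus>\<^bsub>T\<^esub> ptens m' n"
  and pure_add_right: "\<lbrakk>m \<in> carrier M; n \<in> carrier N; n' \<in> carrier N\<rbrakk> \<Longrightarrow> ptens m (n \<oplus>\<^bsub>N\<^esub> n') = ptens m n \<oplus>\<^bsub>T\<^esub> ptens m n'"
  and pure_swap: "\<lbrakk>c \<in> carrier K; m \<in> carrier M; n \<in> carrier N\<rbrakk> \<Longrightarrow> ptens (c \<odot>\<^bsub>M\<^esub> m) n = ptens m (c \<odot>\<^bsub>N\<^esub> n)"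
  using pure_balanced unfolding balanced_map_def add_tensor_algebra by auto

lemma smult_balanced:
  assumes "c \<in> carrier K" shows "balanced_map K M N (add_monoid T) (\<lambda>a b. ptens (c \<odot>\<^bsub>M\<^esub> a) b)"
proof -
  have "ptens (c \<odot>\<^bsub>M\<^esub> (r \<odot>\<^bsub>M\<^esub> m)) n = ptens (c \<odot>\<^bsub>M\<^esub> m) (r \<odot>\<^bsub>N\<^esub> n)"
    if "r \<in> carrier K" "m \<in> carrier M" "n \<in> carrier N" for r m n
    using assms that M.smult_assoc1[of c r m] M.smult_assoc1[of r c m] M.R.m_comm[of c r]
      pure_swap[of r "c \<odot>\<^bsub>M\<^esub> m" n] by simp
  then show ?thesis
    using assms unfolding balanced_map_def by (simp add: pure_T pure_add_left pure_add_right M.smult_r_distr)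
qed

lemma smult_pure: "\<lbrakk>c \<in> carrier K; m \<in> carrier M; n \<in> carrier N\<rbrakk> \<Longrightarrow> c \<odot>\<^bsub>T\<^esub> ptens m n = ptens (c \<odot>\<^bsub>M\<^esub> m) n"
  unfolding smult_tensor_algebra by (rule tensor_lift_pure[OF comm_group_add_T smult_balanced])

lemma smult_T_closed: "\<lbrakk>c \<in> carrier K; t \<in> carrier T\<rbrakk> \<Longrightarrow> c \<odot>\<^bsub>T\<^esub> t \<in> carrier T"
  unfolding smult_tensor_algebra using hom_in_carrier[OF tensor_lift_hom[OF comm_group_add_T smult_balanced]]
  by (simp add: carrier_tensor_algebra)

lemma smult_T_add: "\<lbrakk>c \<in> carrier K; s \<in> carrier T; t \<in> carrier T\<rbrakk> \<Longrightarrow> c \<odot>\<^bsub>T\<^esub> (s \<oplus>\<^bsub>T\<^esub> t) = c \<odot>\<^bsub>T\<^esub> s \<oplus>\<^bsub>T\<^esub> c \<odot>\<^bsub>T\<^esub> t"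
  unfolding smult_tensor_algebra using hom_mult[OF tensor_lift_hom[OF comm_group_add_T smult_balanced]]
  by (simp add: carrier_tensor_algebra add_tensor_algebra)

lemma module_T: "module K T"
proof -
  interpret T: abelian_group T by (rule abelian_group_T)
  show ?thesis
  proof (rule moduleI)
    show "cring K" by (rule M.R.is_cring)
    show "abelian_group T" by (rule abelian_group_T)
    show "a \<odot>\<^bsub>T\<^esub> x \<in> carrier T" if "a \<in> carrier K" "x \<in> carrier T" for a x by (rule smult_T_closed[OF that])
    show "a \<odot>\<^bsub>T\<^esub> (x \<oplus>\<^bsub>T\<^esub> y) = a \<odot>\<^bsub>T\<^esub> x \<oplus>\<^bsub>T\<^esub> a \<odot>\<^bsub>T\<^esub> y"
      if "a \<in> carrier K" "x \<in> carrier T" "y \<in> carrier T" for a x y by (rule smult_T_add[OF that])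
    show "(a \<oplus>\<^bsub>K\<^esub> b) \<odot>\<^bsub>T\<^esub> x = a \<odot>\<^bsub>T\<^esub> x \<oplus>\<^bsub>T\<^esub> b \<odot>\<^bsub>T\<^esub> x"
      if ab: "a \<in> carrier K" "b \<in> carrier K" and x: "x \<in> carrier T" for a b x
      using x
    proof (induct rule: T_induct)
      case (pure m n)
      then show ?case using ab by (simp add: smult_pure M.smult_l_distr pure_add_left)
    next
      case (add s t)
      then show ?case using ab by (simp add: smult_T_add smult_T_closed T.a_ac)
    qed
    show "(a \<otimes>\<^bsub>K\<^esub> b) \<odot>\<^bsub>T\<^esub> x = a \<odot>\<^bsub>T\<^esub> (b \<odot>\<^bsub>T\<^esub> x)"
      if ab: "a \<in> carrier K" "b \<in> carrier K" and x: "x \<in> carrier T" for a b x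
      using x
    proof (induct rule: T_induct)
      case (pure m n)
      then show ?case using ab by (simp add: smult_pure M.smult_assoc1)
    next
      case (add s t)
      then show ?case using ab by (simp add: smult_T_add smult_T_closed)
    qed
    show "\<one>\<^bsub>K\<^esub> \<odot>\<^bsub>T\<^esub> x = x" if x: "x \<in> carrier T" for x
      using x
    proof (induct rule: T_induct)
      case (pure m n)
      then show ?case by (simp add: smult_pure)
    next
      case (add s t)
      then show ?case by (simp add: smult_T_add)
    qed
  qed
qed

lemma smult_pure_right:
  "\<lbrakk>c \<in> carrier K; m \<in> carrier M; n \<in> carrier N\<rbrakk> \<Longrightarrow> c \<odot>\<^bsub>T\<^esub> ptens m n = ptens m (c \<odot>\<^bsub>N\<^esub> n)"
  by (simp add: smult_pure pure_swap)

lemma lin_pure_left: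
  assumes "f \<in> module_hom K V M" "n \<in> carrier N"
  shows "(\<lambda>x. ptens (f x) n) \<in> module_hom K V T"
  using assms by (intro module_homI)
    (simp_all add: module_hom_closed module_hom_add module_hom_smult pure_T pure_add_left smult_pure)

lemma lin_pure_right:
  assumes "f \<in> module_hom K V N" "m \<in> carrier M"
  shows "(\<lambda>x. ptens m (f x)) \<in> module_hom K V T"
  using assms by (intro module_homI)
    (simp_all add: module_hom_closed module_hom_add module_hom_smult pure_T pure_add_right smult_pure_right)

lemma bilinear_pure: "bilinear_map K M N T ptens"
  by (intro bilinear_mapI lin_pure_left lin_pure_right lin_id)

lemma hom_eqI:
  assumes "f \<in> module_hom K T W" "g \<in> module_hom K T W" "t \<in> carrier T"
    and "\<And>m n. \<lbrakk>m \<in> carrier M; n \<in> carrier N\<rbrakk> \<Longrightarrow> f (ptens m n) = g (ptens m n)"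
  shows "f t = g t"
  using assms(3)
  by (induct rule: T_induct) (use assms in \<open>simp_all add: module_hom_add\<close>)

lemma tensor_sum_pure:
  assumes "module K W" "bilinear_map K M N W \<phi>" "m \<in> carrier M" "n \<in> carrier N"
  shows "tensor_sum W \<phi> (ptens m n) = \<phi> m n"
  by (rule tensor_lift_pure[OF abelian_group.a_comm_group[OF module.abgroup] bilinear_balanced]) fact+

lemma lin_tensor_sum:
  assumes W: "module K W" and \<phi>: "bilinear_map K M N W \<phi>"
  shows "tensor_sum W \<phi> \<in> module_hom K T W"
proof -
  interpret W: module K W by (rule W)
  have hom: "tensor_sum W \<phi> \<in> hom TG (add_monoid W)"
    by (rule tensor_lift_hom[OF W.a_comm_group bilinear_balanced[OF \<phi>]])
  have add: "tensor_sum W \<phi> (s \<oplus>\<^bsub>T\<^esub> t) = tensor_sum W \<phi> s \<oplus>\<^bsub>W\<^esub> tensor_sum W \<phi> t"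
    if "s \<in> carrier T" "t \<in> carrier T" for s t
    using hom_mult[OF hom] that by (simp add: carrier_tensor_algebra add_tensor_algebra)
  have cl: "tensor_sum W \<phi> t \<in> carrier W" if "t \<in> carrier T" for t
    using hom_in_carrier[OF hom] that by (simp add: carrier_tensor_algebra)
  show ?thesis
  proof (rule module_homI[OF cl add])
    fix c t assume c: "c \<in> carrier K" and "t \<in> carrier T"
    from this(2) show "tensor_sum W \<phi> (c \<odot>\<^bsub>T\<^esub> t) = c \<odot>\<^bsub>W\<^esub> tensor_sum W \<phi> t"
    proof (induct rule: T_induct)
      case (pure m n)
      have "\<phi> (c \<odot>\<^bsub>M\<^esub> m) n = c \<odot>\<^bsub>W\<^esub> \<phi> m n"
        using \<phi> pure c module_hom_smult[of "\<lambda>m. \<phi> m n" K M W c m] by (simp add: bilinear_map_def)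
      then show ?case using pure c by (simp add: smult_pure tensor_sum_pure[OF W \<phi>])
    next
      case (add s t)
      then show ?case using c by (simp add: smult_T_add smult_T_closed \<open>\<And>s t. _ \<Longrightarrow> _ \<Longrightarrow> tensor_sum W \<phi> (s \<oplus>\<^bsub>T\<^esub> t) = _\<close> cl W.smult_r_distr)
    qed
  qed
qed

lemma tensor_sum_closed:
  assumes "module K W" "t \<in> carrier T"
    and "\<And>m n. \<lbrakk>m \<in> carrier M; n \<in> carrier N\<rbrakk> \<Longrightarrow> \<phi> m n \<in> carrier W"
  shows "tensor_sum W \<phi> t \<in> carrier W"
  using lift_closed[of "add_monoid W" t \<phi>] assms abelian_group.a_comm_group[OF module.abgroup]
  by (auto simp: carrier_tensor_algebra)

lemma tensor_sum_cong:
  assumes "module K W" "t \<in> carrier T"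
    and "\<And>m n. \<lbrakk>m \<in> carrier M; n \<in> carrier N\<rbrakk> \<Longrightarrow> \<phi> m n = \<psi> m n"
    and "\<And>m n. \<lbrakk>m \<in> carrier M; n \<in> carrier N\<rbrakk> \<Longrightarrow> \<psi> m n \<in> carrier W"
  shows "tensor_sum W \<phi> t = tensor_sum W \<psi> t"
  using assms abelian_group.a_comm_group[OF module.abgroup[OF assms(1)]]
  by (intro lift_cong) (auto simp: carrier_tensor_algebra)

lemma hom_tensor_sum:
  assumes "module K W" "module K W'" "t \<in> carrier T" "f \<in> module_hom K W W'"
    and "\<And>m n. \<lbrakk>m \<in> carrier M; n \<in> carrier N\<rbrakk> \<Longrightarrow> \<phi> m n \<in> carrier W"
  shows "f (tensor_sum W \<phi> t) = tensor_sum W' (\<lambda>m n. f (\<phi> m n)) t"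
  by (rule lift_hom) (use assms in \<open>auto simp: carrier_tensor_algebra module_hom_additive
    intro!: abelian_group.a_comm_group module.abgroup\<close>)

lemma tensor_sum_id:
  assumes "t \<in> carrier T" shows "tensor_sum T ptens t = t"
  using lin_tensor_sum[OF module_T bilinear_pure] lin_id assms
  by (rule hom_eqI) (simp add: tensor_sum_pure[OF module_T bilinear_pure])

text \<open>The representative of \<open>t\<close> is the same for all \<open>x\<close>, so this is the linearity of a finite sum.\<close>

lemma lin_tensor_sum_param:
  assumes W: "module K W" and t: "t \<in> carrier T"
    and \<phi>: "\<And>m n. \<lbrakk>m \<in> carrier M; n \<in> carrier N\<rbrakk> \<Longrightarrow> (\<lambda>x. \<phi> x m n) \<in> module_hom K V W"
    and V: "abelian_group V" "\<And>c x. \<lbrakk>c \<in> carrier K; x \<in> carrier V\<rbrakk> \<Longrightarrow> c \<odot>\<^bsub>V\<^esub> x \<in> carrier V"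
  shows "(\<lambda>x. tensor_sum W (\<phi> x) t) \<in> module_hom K V W"
proof -
  interpret W: module K W by (rule W)
  interpret V: abelian_group V by (rule V)
  let ?A = "Poly_Mapping.keys (rep t)"
  have A: "fst p \<in> carrier M" "snd p \<in> carrier N" if "p \<in> ?A" for p
    using keys_rep[of t] t that unfolding carrier_tensor_algebra by auto
  have pow: "(\<lambda>w. w [^]\<^bsub>add_monoid W\<^esub> (k :: int)) \<in> module_hom K W W" for k
  proof -
    have "(\<lambda>w. w [^]\<^bsub>add_monoid W\<^esub> (n :: nat)) \<in> module_hom K W W" for n
    proof (induct n)
      case (Suc n)
      then show ?case using W.lin_add[OF Suc lin_id] by (simp add: nat_pow_def)
    qed (simp add: nat_pow_def W.lin_zero)
    then show ?thesis
      unfolding int_pow_def2 a_inv_def[symmetric]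
      by (cases "k < 0") (simp_all only: if_True if_False W.lin_minus)
  qed
  have "(\<lambda>x. finsum W (\<lambda>p. \<phi> x (fst p) (snd p) [^]\<^bsub>add_monoid W\<^esub> Poly_Mapping.lookup (rep t) p) ?A) \<in> module_hom K V W"
    by (intro W.lin_finsum lin_comp[OF pow] \<phi> A)
  then show ?thesis unfolding tensor_lift_def Let_def finsum_def by simp
qed

end

section \<open>Algebras over a field and their tensor products\<close>

context k_algebra
begin

lemma k_module: "module K A" by unfold_locales

lemma lin_mult_left:
  assumes "f \<in> module_hom K V A" "b \<in> carrier A"
  shows "(\<lambda>x. f x \<otimes>\<^bsub>A\<^esub> b) \<in> module_hom K V A"
  using assms by (intro module_homI)
    (simp_all add: module_hom_closed module_hom_add module_hom_smult l_distr smult_mult_left)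

lemma lin_mult_right:
  assumes "f \<in> module_hom K V A" "b \<in> carrier A"
  shows "(\<lambda>x. b \<otimes>\<^bsub>A\<^esub> f x) \<in> module_hom K V A"
  using assms by (intro module_homI)
    (simp_all add: module_hom_closed module_hom_add module_hom_smult r_distr smult_mult_right)

end

lemma opp_simps [simp]:
  "carrier (opp R) = carrier R" "x \<otimes>\<^bsub>opp R\<^esub> y = y \<otimes>\<^bsub>R\<^esub> x" "\<one>\<^bsub>opp R\<^esub> = \<one>\<^bsub>R\<^esub>"
  "\<zero>\<^bsub>opp R\<^esub> = \<zero>\<^bsub>R\<^esub>" "x \<oplus>\<^bsub>opp R\<^esub> y = x \<oplus>\<^bsub>R\<^esub> y"
  by (simp_all add: opp_def)

lemma opp_smult [simp]: "c \<odot>\<^bsub>opp A\<^esub> x = c \<odot>\<^bsub>A\<^esub> x"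
  by (simp add: opp_def)

lemma ring_opp: assumes "ring R" shows "ring (opp R)"
proof -
  interpret R: ring R by fact
  have "\<exists>y \<in> carrier R. y \<oplus>\<^bsub>R\<^esub> x = \<zero>\<^bsub>R\<^esub>" if "x \<in> carrier R" for x
    using that R.l_neg by (intro bexI[of _ "\<ominus>\<^bsub>R\<^esub> x"]) auto
  then show ?thesis
    by (intro ringI abelian_groupI monoidI) (simp_all add: R.l_distr R.r_distr R.m_assoc R.a_ac)
qed

lemma module_opp: assumes "module K A" shows "module K (opp A)"
proof -
  interpret A: module K A by fact
  have "\<exists>y \<in> carrier A. y \<oplus>\<^bsub>A\<^esub> x = \<zero>\<^bsub>A\<^esub>" if "x \<in> carrier A" for x
    using that A.M.l_neg by (intro bexI[of _ "\<ominus>\<^bsub>A\<^esub> x"]) auto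
  then show ?thesis
    by (intro moduleI abelian_groupI)
      (simp_all add: A.M.a_ac A.R.is_cring A.smult_l_distr A.smult_r_distr A.smult_assoc1)
qed

lemma k_algebra_opp: assumes "k_algebra K A" shows "k_algebra K (opp A)"
proof -
  interpret A: k_algebra K A by fact
  interpret o: module K "opp A" by (rule module_opp[OF A.k_module])
  interpret r: ring "opp A" by (rule ring_opp) unfold_locales
  show ?thesis
    by unfold_locales (simp_all add: A.smult_mult_left A.smult_mult_right)
qed

lemma module_hom_opp:
  "module_hom K V (opp A) = module_hom K V A" "module_hom K (opp A) V = module_hom K A V"
  unfolding module_hom_def hom_def by simp_all

locale tensor_algebras = A: k_algebra K A + B: k_algebra K B
  for K :: "('k, 'x) ring_scheme" and A :: "('k, 'a, 'y) module_scheme"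
    and B :: "('k, 'b, 'z) module_scheme"
begin

sublocale tensor_modules K A B
  by unfold_locales

lemma bilinear_mult_aux:
  assumes "a \<in> carrier A" "b \<in> carrier B"
  shows "bilinear_map K A B T (\<lambda>a' b'. ptens (a \<otimes>\<^bsub>A\<^esub> a') (b \<otimes>\<^bsub>B\<^esub> b'))"
  by (intro bilinear_mapI lin_pure_left lin_pure_right A.lin_mult_right B.lin_mult_right lin_id
      A.m_closed B.m_closed assms)

lemma bilinear_mult_aux2:
  assumes "t \<in> carrier T"
  shows "bilinear_map K A B T (\<lambda>a b. tensor_sum T (\<lambda>a' b'. ptens (a \<otimes>\<^bsub>A\<^esub> a') (b \<otimes>\<^bsub>B\<^esub> b')) t)"
  by (intro bilinear_mapI lin_tensor_sum_param[OF module_T assms] lin_pure_left lin_pure_right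
      A.lin_mult_left B.lin_mult_left lin_id A.m_closed B.m_closed)
    (simp_all add: A.abelian_group_axioms B.abelian_group_axioms)

lemma bilinear_mult_T: "bilinear_map K T T T (\<lambda>s t. s \<otimes>\<^bsub>T\<^esub> t)"
  unfolding mult_tensor_algebra
  by (intro bilinear_mapI lin_tensor_sum[OF module_T bilinear_mult_aux2]
      lin_tensor_sum_param[OF module_T] lin_tensor_sum[OF module_T bilinear_mult_aux])
    (simp_all add: abelian_group_T smult_T_closed)

lemma mult_T_closed: "\<lbrakk>s \<in> carrier T; t \<in> carrier T\<rbrakk> \<Longrightarrow> s \<otimes>\<^bsub>T\<^esub> t \<in> carrier T"
  by (rule bilinear_map_closed[OF bilinear_mult_T])

lemma mult_T_l_distr: "\<lbrakk>s \<in> carrier T; s' \<in> carrier T; t \<in> carrier T\<rbrakk> \<Longrightarrow> (s \<oplus>\<^bsub>T\<^esub> s') \<otimes>\<^bsub>T\<^esub> t = s \<otimes>\<^bsub>T\<^esub> t \<oplus>\<^bsub>T\<^esub> s' \<otimes>\<^bsub>T\<^esub> t"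
  and mult_T_r_distr: "\<lbrakk>s \<in> carrier T; t \<in> carrier T; t' \<in> carrier T\<rbrakk> \<Longrightarrow> s \<otimes>\<^bsub>T\<^esub> (t \<oplus>\<^bsub>T\<^esub> t') = s \<otimes>\<^bsub>T\<^esub> t \<oplus>\<^bsub>T\<^esub> s \<otimes>\<^bsub>T\<^esub> t'"
  and mult_T_smult_left: "\<lbrakk>c \<in> carrier K; s \<in> carrier T; t \<in> carrier T\<rbrakk> \<Longrightarrow> (c \<odot>\<^bsub>T\<^esub> s) \<otimes>\<^bsub>T\<^esub> t = c \<odot>\<^bsub>T\<^esub> (s \<otimes>\<^bsub>T\<^esub> t)"
  and mult_T_smult_right: "\<lbrakk>c \<in> carrier K; s \<in> carrier T; t \<in> carrier T\<rbrakk> \<Longrightarrow> s \<otimes>\<^bsub>T\<^esub> (c \<odot>\<^bsub>T\<^esub> t) = c \<odot>\<^bsub>T\<^esub> (s \<otimes>\<^bsub>T\<^esub> t)"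
  using bilinear_mult_T module_hom_add[of "\<lambda>s. s \<otimes>\<^bsub>T\<^esub> t" K T T s s'] module_hom_add[of "\<lambda>t. s \<otimes>\<^bsub>T\<^esub> t" K T T t t']
    module_hom_smult[of "\<lambda>s. s \<otimes>\<^bsub>T\<^esub> t" K T T c s] module_hom_smult[of "\<lambda>t. s \<otimes>\<^bsub>T\<^esub> t" K T T c t]
  unfolding bilinear_map_def by blast+

lemma mult_pure:
  assumes "a \<in> carrier A" "b \<in> carrier B" "a' \<in> carrier A" "b' \<in> carrier B"
  shows "ptens a b \<otimes>\<^bsub>T\<^esub> ptens a' b' = ptens (a \<otimes>\<^bsub>A\<^esub> a') (b \<otimes>\<^bsub>B\<^esub> b')"
  using assms unfolding mult_tensor_algebra
  by (simp add: tensor_sum_pure[OF module_T bilinear_mult_aux2] pure_T tensor_sum_pure[OF module_T bilinear_mult_aux])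

lemma one_T: "\<one>\<^bsub>T\<^esub> = ptens \<one>\<^bsub>A\<^esub> \<one>\<^bsub>B\<^esub>"
  by (simp add: tensor_algebra_def)

lemma ring_T: "ring T"
proof (intro ringI abelian_group_T monoidI)
  show "(x \<otimes>\<^bsub>T\<^esub> y) \<otimes>\<^bsub>T\<^esub> z = x \<otimes>\<^bsub>T\<^esub> (y \<otimes>\<^bsub>T\<^esub> z)"
    if x: "x \<in> carrier T" and y: "y \<in> carrier T" and z: "z \<in> carrier T" for x y z
    using x
  proof (induct rule: T_induct)
    case p1: (pure a b)
    show ?case using y
    proof (induct rule: T_induct)
      case p2: (pure a' b')
      show ?case using z
      proof (induct rule: T_induct)
        case p3: (pure a'' b'')
        show ?case using p1 p2 p3 by (simp add: mult_pure A.m_assoc B.m_assoc)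
      qed (use p1 p2 in \<open>simp add: mult_T_r_distr mult_T_closed pure_T\<close>)
    qed (use p1 z in \<open>simp add: mult_T_r_distr mult_T_l_distr mult_T_closed pure_T\<close>)
  qed (use y z in \<open>simp add: mult_T_l_distr mult_T_closed\<close>)
  show "\<one>\<^bsub>T\<^esub> \<otimes>\<^bsub>T\<^esub> x = x" if x: "x \<in> carrier T" for x
    using x by (induct rule: T_induct) (simp_all add: one_T mult_pure mult_T_r_distr pure_T)
  show "x \<otimes>\<^bsub>T\<^esub> \<one>\<^bsub>T\<^esub> = x" if x: "x \<in> carrier T" for x
    using x by (induct rule: T_induct) (simp_all add: one_T mult_pure mult_T_l_distr pure_T)
qed (simp_all add: mult_T_closed mult_T_l_distr mult_T_r_distr one_T pure_T)

lemma k_algebra_T: "k_algebra K T"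
proof -
  interpret m: module K T by (rule module_T)
  interpret r: ring T by (rule ring_T)
  show ?thesis
    by unfold_locales (simp_all add: mult_T_smult_left mult_T_smult_right)
qed

end

section \<open>Sweedler calculus\<close>

text \<open>For \<open>\<delta> x = \<Sum> x\<^sub>0 \<otimes> x\<^sub>1\<close> this is \<open>\<Sum> \<phi> x\<^sub>0 x\<^sub>1\<close>, with the structure map \<open>\<delta>\<close> as an argument.
  Iterated sums replace Sweedler's higher indices.\<close>

definition cosum ::
  "('k, 'w, 'v) module_scheme \<Rightarrow> ('m \<Rightarrow> ('m \<times> 'h \<Rightarrow>\<^sub>0 int) set) \<Rightarrow> ('m \<Rightarrow> 'h \<Rightarrow> 'w) \<Rightarrow> 'm \<Rightarrow> 'w"
  where "cosum W \<delta> \<phi> x = tensor_sum W \<phi> (\<delta> x)"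

text \<open>With \<open>H\<close> as a comodule algebra over itself, every rule about \<open>\<rho>\<close> below is available for \<open>\<Delta>\<close>.\<close>

lemma (in hopf_algebra) comodule_self: "comodule_algebra K H \<Delta> \<epsilon> S H \<Delta>"
  by unfold_locales (use comult_hom coassoc counit_right in auto)

context comodule_algebra
begin

sublocale BH: tensor_algebras K B H
  by unfold_locales

sublocale BHH: tensor_modules K BH.T H
proof -
  interpret t: module K BH.T by (rule BH.module_T)
  show "tensor_modules K BH.T H" by unfold_locales
qed

abbreviation "BH \<equiv> tensor_algebra K B H"

lemma lin_rho: "\<rho> \<in> module_hom K B BH"
  using coaction_hom unfolding alg_hom_def by blast

lemma rho_closed: "b \<in> carrier B \<Longrightarrow> \<rho> b \<in> carrier BH"
  by (rule module_hom_closed[OF lin_rho])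

lemma cosum_closed:
  assumes "module K W" "b \<in> carrier B"
    and "\<And>x y. \<lbrakk>x \<in> carrier B; y \<in> carrier H\<rbrakk> \<Longrightarrow> \<phi> x y \<in> carrier W"
  shows "cosum W \<rho> \<phi> b \<in> carrier W"
  unfolding cosum_def by (intro BH.tensor_sum_closed rho_closed assms)

lemma cosum_cong:
  assumes "module K W" "b \<in> carrier B"
    and "\<And>x y. \<lbrakk>x \<in> carrier B; y \<in> carrier H\<rbrakk> \<Longrightarrow> \<phi> x y = \<psi> x y"
    and "\<And>x y. \<lbrakk>x \<in> carrier B; y \<in> carrier H\<rbrakk> \<Longrightarrow> \<psi> x y \<in> carrier W"
  shows "cosum W \<rho> \<phi> b = cosum W \<rho> \<psi> b"
  unfolding cosum_def by (intro BH.tensor_sum_cong rho_closed assms)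

lemma lin_cosum:
  assumes "module K W" "bilinear_map K B H W \<phi>" "f \<in> module_hom K V B"
  shows "(\<lambda>x. cosum W \<rho> \<phi> (f x)) \<in> module_hom K V W"
  unfolding cosum_def by (rule lin_comp[OF BH.lin_tensor_sum lin_comp[OF lin_rho]]) fact+

lemma lin_cosum_param:
  assumes "module K W" "module K V" "b \<in> carrier B"
    and "\<And>m n. \<lbrakk>m \<in> carrier B; n \<in> carrier H\<rbrakk> \<Longrightarrow> (\<lambda>x. \<phi> x m n) \<in> module_hom K V W"
  shows "(\<lambda>x. cosum W \<rho> (\<phi> x) b) \<in> module_hom K V W"
  unfolding cosum_def using assms module.abgroup[OF assms(2)] module.smult_closed[OF assms(2)]
  by (intro BH.lin_tensor_sum_param rho_closed) auto

lemma hom_cosum: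
  assumes "module K W" "module K W'" "f \<in> module_hom K W W'" "b \<in> carrier B"
    and "\<And>m n. \<lbrakk>m \<in> carrier B; n \<in> carrier H\<rbrakk> \<Longrightarrow> \<phi> m n \<in> carrier W"
  shows "f (cosum W \<rho> \<phi> b) = cosum W' \<rho> (\<lambda>m n. f (\<phi> m n)) b"
  unfolding cosum_def by (intro BH.hom_tensor_sum rho_closed assms)

lemma cosum_pure: "b \<in> carrier B \<Longrightarrow> cosum BH \<rho> (pure_tensor K B H) b = \<rho> b"
  unfolding cosum_def by (intro BH.tensor_sum_id rho_closed)

text \<open>This is the image of the coassociativity law under the linear map \<open>(B \<otimes> H) \<otimes> H \<rightarrow> W\<close> that belongs to
  the trilinear map \<open>\<phi>\<close>.\<close>

lemma cosum_coassoc: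
  assumes W: "module K W" and b: "b \<in> carrier B"
    and 1: "\<And>y z. \<lbrakk>y \<in> carrier H; z \<in> carrier H\<rbrakk> \<Longrightarrow> (\<lambda>x. \<phi> x y z) \<in> module_hom K B W"
    and 2: "\<And>x z. \<lbrakk>x \<in> carrier B; z \<in> carrier H\<rbrakk> \<Longrightarrow> (\<lambda>y. \<phi> x y z) \<in> module_hom K H W"
    and 3: "\<And>x y. \<lbrakk>x \<in> carrier B; y \<in> carrier H\<rbrakk> \<Longrightarrow> (\<lambda>z. \<phi> x y z) \<in> module_hom K H W"
  shows "cosum W \<rho> (\<lambda>b0 b1. cosum W \<rho> (\<lambda>x y. \<phi> x y b1) b0) b =
    cosum W \<rho> (\<lambda>b0 b1. cosum W \<Delta> (\<lambda>y z. \<phi> b0 y z) b1) b"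
proof -
  interpret HH: tensor_modules K H H by unfold_locales
  have D: "\<Delta> h \<in> carrier (tensor_algebra K H H)" if "h \<in> carrier H" for h
    using H.comult_hom that unfolding alg_hom_def by (auto intro: module_hom_closed)
  let ?inner = "\<lambda>t h. tensor_sum W (\<lambda>x y. \<phi> x y h) t"
  let ?L = "tensor_sum W ?inner"
  have bil: "bilinear_map K B H W (\<lambda>x y. \<phi> x y h)" if "h \<in> carrier H" for h
    using that 1 2 by (intro bilinear_mapI) auto
  have bil0: "bilinear_map K BH H W ?inner"
    by (intro bilinear_mapI BH.lin_tensor_sum bil BH.lin_tensor_sum_param 3 W)
      (simp_all add: H.abelian_group_axioms)
  note L = BHH.lin_tensor_sum[OF W bil0]
  note pL = BHH.tensor_sum_pure[OF W bil0]
  have "cosum W \<rho> (\<lambda>b0 b1. cosum W \<rho> (\<lambda>x y. \<phi> x y b1) b0) b =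
      tensor_sum W (\<lambda>b0 b1. ?L (pure_tensor K BH H (\<rho> b0) b1)) (\<rho> b)"
    unfolding cosum_def
    by (intro BH.tensor_sum_cong W rho_closed b)
      (simp_all add: pL rho_closed BH.tensor_sum_closed[OF W] bilinear_map_closed[OF bil])
  also have "\<dots> = ?L (tensor_sum BHH.T (\<lambda>b0 b1. pure_tensor K BH H (\<rho> b0) b1) (\<rho> b))"
    by (intro BH.hom_tensor_sum[symmetric] BHH.module_T W rho_closed b L BHH.pure_T)
  also have "\<dots> = ?L (tensor_sum BHH.T (\<lambda>b0 b1. tensor_sum BHH.T
      (\<lambda>y z. pure_tensor K BH H (pure_tensor K B H b0 y) z) (\<Delta> b1)) (\<rho> b))"
    using coaction_coassoc[OF b] by simp
  also have "\<dots> = tensor_sum W (\<lambda>b0 b1. ?L (tensor_sum BHH.T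
      (\<lambda>y z. pure_tensor K BH H (pure_tensor K B H b0 y) z) (\<Delta> b1))) (\<rho> b)"
    by (intro BH.hom_tensor_sum BHH.module_T W rho_closed b L HH.tensor_sum_closed D BHH.pure_T BH.pure_T)
  also have "\<dots> = cosum W \<rho> (\<lambda>b0 b1. cosum W \<Delta> (\<lambda>y z. \<phi> b0 y z) b1) b"
    unfolding cosum_def
  proof (intro BH.tensor_sum_cong W rho_closed b HH.tensor_sum_closed D)
    show "\<phi> x y z \<in> carrier W" if "x \<in> carrier B" "y \<in> carrier H" "z \<in> carrier H" for x y z
      using bilinear_map_closed[OF bil] that by simp
    fix b0 b1 assume b01: "b0 \<in> carrier B" "b1 \<in> carrier H"
    have "?L (tensor_sum BHH.T (\<lambda>y z. pure_tensor K BH H (pure_tensor K B H b0 y) z) (\<Delta> b1)) =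
        tensor_sum W (\<lambda>y z. ?L (pure_tensor K BH H (pure_tensor K B H b0 y) z)) (\<Delta> b1)"
      by (intro HH.hom_tensor_sum BHH.module_T W D b01 L BHH.pure_T BH.pure_T)
    also have "\<dots> = tensor_sum W (\<lambda>y z. \<phi> b0 y z) (\<Delta> b1)"
      by (intro HH.tensor_sum_cong W D b01)
        (simp_all add: b01 pL BH.pure_T BH.tensor_sum_pure[OF W bil] bilinear_map_closed[OF bil])
    finally show "?L (tensor_sum BHH.T (\<lambda>y z. pure_tensor K BH H (pure_tensor K B H b0 y) z) (\<Delta> b1)) =
      tensor_sum W (\<lambda>y z. \<phi> b0 y z) (\<Delta> b1)" .
  qed
  finally show ?thesis .
qed

lemma lin_counit: "\<epsilon> \<in> module_hom K H (scalar_algebra K)"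
  using H.counit_hom unfolding alg_hom_def by blast

lemma counit_closed: "h \<in> carrier H \<Longrightarrow> \<epsilon> h \<in> carrier K"
  using module_hom_closed[OF lin_counit] by (simp add: scalar_algebra_def)

lemma cosum_counit:
  assumes W: "module K W" and b: "b \<in> carrier B" and f: "f \<in> module_hom K B W"
  shows "cosum W \<rho> (\<lambda>b0 b1. \<epsilon> b1 \<odot>\<^bsub>W\<^esub> f b0) b = f b"
proof -
  interpret W: module K W by fact
  have "f b = f (cosum B \<rho> (\<lambda>b0 b1. \<epsilon> b1 \<odot>\<^bsub>B\<^esub> b0) b)"
    unfolding cosum_def using coaction_counit[OF b] by simp
  also have "\<dots> = cosum W \<rho> (\<lambda>b0 b1. f (\<epsilon> b1 \<odot>\<^bsub>B\<^esub> b0)) b"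
    by (intro hom_cosum B.k_module W f b) (simp add: counit_closed)
  also have "\<dots> = cosum W \<rho> (\<lambda>b0 b1. \<epsilon> b1 \<odot>\<^bsub>W\<^esub> f b0) b"
    by (intro cosum_cong W b) (simp_all add: counit_closed module_hom_smult[OF f] module_hom_closed[OF f])
  finally show ?thesis ..
qed

lemma rho_mult: "\<lbrakk>a \<in> carrier B; b \<in> carrier B\<rbrakk> \<Longrightarrow> \<rho> (a \<otimes>\<^bsub>B\<^esub> b) = \<rho> a \<otimes>\<^bsub>BH\<^esub> \<rho> b"
  using coaction_hom unfolding alg_hom_def by (meson IntD1 ring_hom_mult)

lemma rho_one: "\<rho> \<one>\<^bsub>B\<^esub> = pure_tensor K B H \<one>\<^bsub>B\<^esub> \<one>\<^bsub>H\<^esub>"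
  using coaction_hom unfolding alg_hom_def BH.one_T[symmetric] by (meson IntD1 ring_hom_one)

lemma cosum_one:
  assumes "module K W" "bilinear_map K B H W \<phi>"
  shows "cosum W \<rho> \<phi> \<one>\<^bsub>B\<^esub> = \<phi> \<one>\<^bsub>B\<^esub> \<one>\<^bsub>H\<^esub>"
  unfolding cosum_def rho_one by (rule BH.tensor_sum_pure) (simp_all add: assms)

lemma cosum_mult:
  assumes W: "module K W" and \<phi>: "bilinear_map K B H W \<phi>" and a: "a \<in> carrier B" and b: "b \<in> carrier B"
  shows "cosum W \<rho> \<phi> (a \<otimes>\<^bsub>B\<^esub> b) =
    cosum W \<rho> (\<lambda>a0 a1. cosum W \<rho> (\<lambda>b0 b1. \<phi> (a0 \<otimes>\<^bsub>B\<^esub> b0) (a1 \<otimes>\<^bsub>H\<^esub> b1)) b) a"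
proof -
  note L = BH.lin_tensor_sum[OF W \<phi>]
  have cl: "\<phi> x y \<in> carrier W" if "x \<in> carrier B" "y \<in> carrier H" for x y
    using bilinear_map_closed[OF \<phi>] that .
  have "cosum W \<rho> \<phi> (a \<otimes>\<^bsub>B\<^esub> b) = tensor_sum W \<phi> (cosum BH \<rho> (\<lambda>a0 a1. cosum BH \<rho>
      (\<lambda>b0 b1. pure_tensor K B H (a0 \<otimes>\<^bsub>B\<^esub> b0) (a1 \<otimes>\<^bsub>H\<^esub> b1)) b) a)"
    unfolding cosum_def by (simp add: rho_mult a b mult_tensor_algebra)
  also have "\<dots> = cosum W \<rho> (\<lambda>a0 a1. tensor_sum W \<phi> (cosum BH \<rho>
      (\<lambda>b0 b1. pure_tensor K B H (a0 \<otimes>\<^bsub>B\<^esub> b0) (a1 \<otimes>\<^bsub>H\<^esub> b1)) b)) a"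
    by (intro hom_cosum BH.module_T W L a b cosum_closed BH.pure_T B.m_closed H.m_closed)
  also have "\<dots> = cosum W \<rho> (\<lambda>a0 a1. cosum W \<rho> (\<lambda>b0 b1. \<phi> (a0 \<otimes>\<^bsub>B\<^esub> b0) (a1 \<otimes>\<^bsub>H\<^esub> b1)) b) a"
  proof (intro cosum_cong cosum_closed W a b cl B.m_closed H.m_closed)
    fix a0 a1 assume a01: "a0 \<in> carrier B" "a1 \<in> carrier H"
    have "tensor_sum W \<phi> (cosum BH \<rho> (\<lambda>b0 b1. pure_tensor K B H (a0 \<otimes>\<^bsub>B\<^esub> b0) (a1 \<otimes>\<^bsub>H\<^esub> b1)) b) =
      cosum W \<rho> (\<lambda>b0 b1. tensor_sum W \<phi> (pure_tensor K B H (a0 \<otimes>\<^bsub>B\<^esub> b0) (a1 \<otimes>\<^bsub>H\<^esub> b1))) b"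
      by (intro hom_cosum BH.module_T W L b BH.pure_T B.m_closed H.m_closed a01)
    also have "\<dots> = cosum W \<rho> (\<lambda>b0 b1. \<phi> (a0 \<otimes>\<^bsub>B\<^esub> b0) (a1 \<otimes>\<^bsub>H\<^esub> b1)) b"
      by (intro cosum_cong W b cl) (simp_all add: a01 BH.tensor_sum_pure[OF W \<phi>])
    finally show "tensor_sum W \<phi> (cosum BH \<rho> (\<lambda>b0 b1. pure_tensor K B H (a0 \<otimes>\<^bsub>B\<^esub> b0) (a1 \<otimes>\<^bsub>H\<^esub> b1)) b) =
      cosum W \<rho> (\<lambda>b0 b1. \<phi> (a0 \<otimes>\<^bsub>B\<^esub> b0) (a1 \<otimes>\<^bsub>H\<^esub> b1)) b" .
  qed
  finally show ?thesis .
qed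

end

lemma cosum_swap:
  assumes M: "comodule_algebra K H \<Delta> \<epsilon> S M \<delta>" and N: "comodule_algebra K H \<Delta> \<epsilon> S N \<eta>"
    and W: "module K W" and x: "x \<in> carrier M" and y: "y \<in> carrier N"
    and \<phi>: "\<And>a b c d. \<lbrakk>a \<in> carrier M; b \<in> carrier H; c \<in> carrier N; d \<in> carrier H\<rbrakk> \<Longrightarrow> \<phi> a b c d \<in> carrier W"
  shows "cosum W \<delta> (\<lambda>a b. cosum W \<eta> (\<lambda>c d. \<phi> a b c d) y) x = cosum W \<eta> (\<lambda>c d. cosum W \<delta> (\<lambda>a b. \<phi> a b c d) x) y"
proof -
  interpret M: comodule_algebra K H \<Delta> \<epsilon> S M \<delta> by fact
  interpret N: comodule_algebra K H \<Delta> \<epsilon> S N \<eta> by fact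
  show ?thesis
    unfolding cosum_def
    by (rule tensor_lift_swap[OF M.BH.tensor_pair_axioms _ N.BH.tensor_pair_axioms])
      (use M.rho_closed[OF x] N.rho_closed[OF y] \<phi> abelian_group.a_comm_group[OF module.abgroup[OF W]]
       in \<open>simp_all add: carrier_tensor_algebra\<close>)
qed

sublocale hopf_algebra \<subseteq> self: comodule_algebra K H \<Delta> \<epsilon> S H \<Delta>
  by (rule comodule_self)

text \<open>A Sweedler computation rewrites a term under nested sums. Its side conditions say that terms lie in
  a module or depend linearly on a variable. The rules \<open>lins\<close> reduce such conditions to subterms, so that
  resolution with these rules and the local assumptions proves them.\<close>

named_theorems lins

lemmas [lins] = lin_id bilinear_mapI

lemma lin_scalar' [lins]:
  assumes "module K W" "f \<in> module_hom K V (scalar_algebra K)" "m \<in> carrier W"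
  shows "(\<lambda>x. f x \<odot>\<^bsub>W\<^esub> m) \<in> module_hom K V W"
  by (rule module.lin_scalar[OF assms])

lemma lin_smult' [lins]:
  assumes "module K W" "c \<in> carrier K" "f \<in> module_hom K V W"
  shows "(\<lambda>x. c \<odot>\<^bsub>W\<^esub> f x) \<in> module_hom K V W"
  by (rule module.lin_smult[OF assms])

lemma smult_closed' [lins]:
  "\<lbrakk>module K W; c \<in> carrier K; x \<in> carrier W\<rbrakk> \<Longrightarrow> c \<odot>\<^bsub>W\<^esub> x \<in> carrier W"
  by (rule module.smult_closed)

context k_algebra
begin
lemmas [lins] = m_closed one_closed k_module lin_mult_left lin_mult_right
end

context tensor_modules
begin
lemmas [lins] = module_T pure_T lin_pure_left lin_pure_right
end

context comodule_algebra
begin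
lemmas [lins] = cosum_closed lin_cosum lin_cosum_param counit_closed lin_comp[OF lin_counit] rho_closed lin_comp[OF lin_rho]
end

sublocale comodule_algebra \<subseteq> BHalg: k_algebra K BH.T
  by (rule BH.k_algebra_T)

section \<open>The antipode\<close>

context hopf_algebra
begin

abbreviation "HH \<equiv> tensor_algebra K H H"

lemma antipode_closed: "h \<in> carrier H \<Longrightarrow> S h \<in> carrier H"
  by (rule module_hom_closed[OF antipode_linear])

lemmas [lins] = antipode_closed lin_comp[OF antipode_linear]

lemma counit_left_sum:
  assumes W: "module K W" and h: "h \<in> carrier H" and f: "f \<in> module_hom K H W"
  shows "cosum W \<Delta> (\<lambda>a b. \<epsilon> a \<odot>\<^bsub>W\<^esub> f b) h = f h"
proof -
  have "f h = f (cosum H \<Delta> (\<lambda>a b. \<epsilon> a \<odot>\<^bsub>H\<^esub> b) h)"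
    unfolding cosum_def using counit_left[OF h] by simp
  also have "\<dots> = cosum W \<Delta> (\<lambda>a b. f (\<epsilon> a \<odot>\<^bsub>H\<^esub> b)) h"
    by (rule self.hom_cosum[OF _ W f h]; (rule lins | assumption)+)
  also have "\<dots> = cosum W \<Delta> (\<lambda>a b. \<epsilon> a \<odot>\<^bsub>W\<^esub> f b) h"
    by (rule self.cosum_cong[OF W h]) (auto simp: module_hom_smult[OF f] self.counit_closed intro!: lins W module_hom_closed[OF f])
  finally show ?thesis ..
qed

lemma antipode_left_sum:
  assumes W: "module K W" and h: "h \<in> carrier H" and f: "f \<in> module_hom K H W"
  shows "cosum W \<Delta> (\<lambda>a b. f (S a \<otimes>\<^bsub>H\<^esub> b)) h = \<epsilon> h \<odot>\<^bsub>W\<^esub> f \<one>\<^bsub>H\<^esub>"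
proof -
  have "cosum W \<Delta> (\<lambda>a b. f (S a \<otimes>\<^bsub>H\<^esub> b)) h = f (cosum H \<Delta> (\<lambda>a b. S a \<otimes>\<^bsub>H\<^esub> b) h)"
    by (rule self.hom_cosum[OF _ W f h, symmetric]; (rule lins | assumption)+)
  also have "\<dots> = f (\<epsilon> h \<odot>\<^bsub>H\<^esub> \<one>\<^bsub>H\<^esub>)" unfolding cosum_def using antipode_left[OF h] by simp
  also have "\<dots> = \<epsilon> h \<odot>\<^bsub>W\<^esub> f \<one>\<^bsub>H\<^esub>" by (rule module_hom_smult[OF f]; (rule lins h)+)
  finally show ?thesis .
qed

lemma antipode_right_sum:
  assumes W: "module K W" and h: "h \<in> carrier H" and f: "f \<in> module_hom K H W"
  shows "cosum W \<Delta> (\<lambda>a b. f (a \<otimes>\<^bsub>H\<^esub> S b)) h = \<epsilon> h \<odot>\<^bsub>W\<^esub> f \<one>\<^bsub>H\<^esub>"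
proof -
  have "cosum W \<Delta> (\<lambda>a b. f (a \<otimes>\<^bsub>H\<^esub> S b)) h = f (cosum H \<Delta> (\<lambda>a b. a \<otimes>\<^bsub>H\<^esub> S b) h)"
    by (rule self.hom_cosum[OF _ W f h, symmetric]; (rule lins | assumption)+)
  also have "\<dots> = f (\<epsilon> h \<odot>\<^bsub>H\<^esub> \<one>\<^bsub>H\<^esub>)" unfolding cosum_def using antipode_right[OF h] by simp
  also have "\<dots> = \<epsilon> h \<odot>\<^bsub>W\<^esub> f \<one>\<^bsub>H\<^esub>" by (rule module_hom_smult[OF f]; (rule lins h)+)
  finally show ?thesis .
qed

lemma counit_one: "\<epsilon> \<one>\<^bsub>H\<^esub> = \<one>\<^bsub>K\<^esub>"
proof -
  have "\<epsilon> \<in> ring_hom H (scalar_algebra K)" using counit_hom unfolding alg_hom_def by blast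
  from ring_hom_one[OF this] show ?thesis by (simp add: scalar_algebra_def)
qed

lemma counit_mult: "\<lbrakk>x \<in> carrier H; y \<in> carrier H\<rbrakk> \<Longrightarrow> \<epsilon> (x \<otimes>\<^bsub>H\<^esub> y) = \<epsilon> x \<otimes>\<^bsub>K\<^esub> \<epsilon> y"
proof -
  have "\<epsilon> \<in> ring_hom H (scalar_algebra K)" using counit_hom unfolding alg_hom_def by blast
  from ring_hom_mult[OF this] show "\<lbrakk>x \<in> carrier H; y \<in> carrier H\<rbrakk> \<Longrightarrow> \<epsilon> (x \<otimes>\<^bsub>H\<^esub> y) = \<epsilon> x \<otimes>\<^bsub>K\<^esub> \<epsilon> y"
    by (simp add: scalar_algebra_def)
qed

lemma antipode_one: "S \<one>\<^bsub>H\<^esub> = \<one>\<^bsub>H\<^esub>"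
proof -
  have "cosum H \<Delta> (\<lambda>a b. S a \<otimes>\<^bsub>H\<^esub> b) \<one>\<^bsub>H\<^esub> = S \<one>\<^bsub>H\<^esub> \<otimes>\<^bsub>H\<^esub> \<one>\<^bsub>H\<^esub>"
    by (rule self.cosum_one; (rule lins | assumption)+)
  moreover have "cosum H \<Delta> (\<lambda>a b. S a \<otimes>\<^bsub>H\<^esub> b) \<one>\<^bsub>H\<^esub> = \<epsilon> \<one>\<^bsub>H\<^esub> \<odot>\<^bsub>H\<^esub> \<one>\<^bsub>H\<^esub>"
    using antipode_left_sum[OF _ _ lin_id] by (simp add: k_module)
  ultimately show ?thesis by (simp add: counit_one antipode_closed)
qed

text \<open>Both sides are inverse to the multiplication \<open>H \<otimes> H \<rightarrow> H\<close> for the convolution product, the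
  left side from the left and the right side from the right.\<close>

lemma antipode_mult:
  assumes x: "x \<in> carrier H" and y: "y \<in> carrier H"
  shows "S (x \<otimes>\<^bsub>H\<^esub> y) = S y \<otimes>\<^bsub>H\<^esub> S x"
proof -
  note M = k_module
  let ?\<phi> = "\<lambda>a b x' c d y'. S (a \<otimes>\<^bsub>H\<^esub> c) \<otimes>\<^bsub>H\<^esub> (b \<otimes>\<^bsub>H\<^esub> d \<otimes>\<^bsub>H\<^esub> (S y' \<otimes>\<^bsub>H\<^esub> S x'))"
  have inv: "cosum H \<Delta> (\<lambda>a b. cosum H \<Delta> (\<lambda>c d. S (a \<otimes>\<^bsub>H\<^esub> c) \<otimes>\<^bsub>H\<^esub> (b \<otimes>\<^bsub>H\<^esub> d \<otimes>\<^bsub>H\<^esub> z)) v) u = \<epsilon> v \<odot>\<^bsub>H\<^esub> (\<epsilon> u \<odot>\<^bsub>H\<^esub> z)"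
    if u: "u \<in> carrier H" and v: "v \<in> carrier H" and z: "z \<in> carrier H" for u v z
  proof -
    have "cosum H \<Delta> (\<lambda>a b. cosum H \<Delta> (\<lambda>c d. S (a \<otimes>\<^bsub>H\<^esub> c) \<otimes>\<^bsub>H\<^esub> (b \<otimes>\<^bsub>H\<^esub> d \<otimes>\<^bsub>H\<^esub> z)) v) u =
      cosum H \<Delta> (\<lambda>a b. S a \<otimes>\<^bsub>H\<^esub> (b \<otimes>\<^bsub>H\<^esub> z)) (u \<otimes>\<^bsub>H\<^esub> v)"
      by (rule self.cosum_mult[symmetric]; (rule lins u v z | assumption)+)
    also have "\<dots> = cosum H \<Delta> (\<lambda>a b. (\<lambda>w. w \<otimes>\<^bsub>H\<^esub> z) (S a \<otimes>\<^bsub>H\<^esub> b)) (u \<otimes>\<^bsub>H\<^esub> v)"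
      by (rule self.cosum_cong) (simp_all add: k_module u v z antipode_closed m_assoc)
    also have "\<dots> = \<epsilon> (u \<otimes>\<^bsub>H\<^esub> v) \<odot>\<^bsub>H\<^esub> (\<one>\<^bsub>H\<^esub> \<otimes>\<^bsub>H\<^esub> z)"
      by (rule antipode_left_sum; (rule lins u v z)+)
    also have "\<dots> = \<epsilon> v \<odot>\<^bsub>H\<^esub> (\<epsilon> u \<odot>\<^bsub>H\<^esub> z)"
      using u v z by (simp add: counit_mult smult_assoc1[symmetric] self.counit_closed m_comm[of "\<epsilon> u" "\<epsilon> v"])
    finally show ?thesis .
  qed
  have "S y \<otimes>\<^bsub>H\<^esub> S x = cosum H \<Delta> (\<lambda>x1 x2. \<epsilon> x1 \<odot>\<^bsub>H\<^esub> (S y \<otimes>\<^bsub>H\<^esub> S x2)) x"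
    by (rule counit_left_sum[symmetric]; (rule lins x y)+)
  also have "\<dots> = cosum H \<Delta> (\<lambda>x1 x2. cosum H \<Delta> (\<lambda>y1 y2. \<epsilon> y1 \<odot>\<^bsub>H\<^esub> (\<epsilon> x1 \<odot>\<^bsub>H\<^esub> (S y2 \<otimes>\<^bsub>H\<^esub> S x2))) y) x"
    by (rule self.cosum_cong, rule M, rule x, rule counit_left_sum[symmetric]; (rule lins x y | assumption)+)
  also have "\<dots> = cosum H \<Delta> (\<lambda>x1 x2. cosum H \<Delta> (\<lambda>y1 y2. cosum H \<Delta> (\<lambda>a b. cosum H \<Delta>
      (\<lambda>c d. ?\<phi> a b x2 c d y2) y1) x1) y) x"
    by (rule self.cosum_cong, rule M, rule x, rule self.cosum_cong, rule M, rule y, rule inv[symmetric]; (rule lins x y | assumption)+)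
  also have "\<dots> = cosum H \<Delta> (\<lambda>x1 x2. cosum H \<Delta> (\<lambda>a b. cosum H \<Delta> (\<lambda>y1 y2. cosum H \<Delta>
      (\<lambda>c d. ?\<phi> a b x2 c d y2) y1) y) x1) x"
    by (rule self.cosum_cong, rule M, rule x, rule cosum_swap[OF comodule_self comodule_self]; (rule lins x y | assumption)+)
  also have "\<dots> = cosum H \<Delta> (\<lambda>x1 x2. cosum H \<Delta> (\<lambda>b x'. cosum H \<Delta> (\<lambda>y1 y2. cosum H \<Delta>
      (\<lambda>c d. ?\<phi> x1 b x' c d y2) y1) y) x2) x"
    by (rule self.cosum_coassoc; (rule lins x y | assumption)+)
  also have "\<dots> = cosum H \<Delta> (\<lambda>x1 x2. cosum H \<Delta> (\<lambda>b x'. cosum H \<Delta> (\<lambda>y1 y2. cosum H \<Delta>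
      (\<lambda>d y'. ?\<phi> x1 b x' y1 d y') y2) y) x2) x"
    by (rule self.cosum_cong, rule M, rule x, rule self.cosum_cong, rule M, assumption, rule self.cosum_coassoc; (rule lins x y | assumption)+)
  also have "\<dots> = cosum H \<Delta> (\<lambda>x1 x2. cosum H \<Delta> (\<lambda>b x'. cosum H \<Delta> (\<lambda>y1 y2.
      \<epsilon> y2 \<odot>\<^bsub>H\<^esub> (S (x1 \<otimes>\<^bsub>H\<^esub> y1) \<otimes>\<^bsub>H\<^esub> (b \<otimes>\<^bsub>H\<^esub> S x'))) y) x2) x"
  proof (rule self.cosum_cong, rule M, rule x, rule self.cosum_cong, rule M, assumption, rule self.cosum_cong, rule M, rule y)
    fix x1 x2 b x' y1 y2
    assume c: "x1 \<in> carrier H" "x2 \<in> carrier H" "b \<in> carrier H" "x' \<in> carrier H" "y1 \<in> carrier H" "y2 \<in> carrier H"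
    have "cosum H \<Delta> (\<lambda>d y'. ?\<phi> x1 b x' y1 d y') y2 =
      cosum H \<Delta> (\<lambda>d y'. (\<lambda>w. S (x1 \<otimes>\<^bsub>H\<^esub> y1) \<otimes>\<^bsub>H\<^esub> (b \<otimes>\<^bsub>H\<^esub> (w \<otimes>\<^bsub>H\<^esub> S x'))) (d \<otimes>\<^bsub>H\<^esub> S y')) y2"
      by (rule self.cosum_cong) (simp_all add: c k_module antipode_closed m_assoc)
    also have "\<dots> = \<epsilon> y2 \<odot>\<^bsub>H\<^esub> (S (x1 \<otimes>\<^bsub>H\<^esub> y1) \<otimes>\<^bsub>H\<^esub> (b \<otimes>\<^bsub>H\<^esub> (\<one>\<^bsub>H\<^esub> \<otimes>\<^bsub>H\<^esub> S x')))"
      by (rule antipode_right_sum; (rule lins c)+)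
    finally show "cosum H \<Delta> (\<lambda>d y'. ?\<phi> x1 b x' y1 d y') y2 = \<epsilon> y2 \<odot>\<^bsub>H\<^esub> (S (x1 \<otimes>\<^bsub>H\<^esub> y1) \<otimes>\<^bsub>H\<^esub> (b \<otimes>\<^bsub>H\<^esub> S x'))"
      using c by (simp add: antipode_closed)
  qed ((rule lins x y | assumption)+)
  also have "\<dots> = cosum H \<Delta> (\<lambda>x1 x2. cosum H \<Delta> (\<lambda>b x'. S (x1 \<otimes>\<^bsub>H\<^esub> y) \<otimes>\<^bsub>H\<^esub> (b \<otimes>\<^bsub>H\<^esub> S x')) x2) x"
    by (rule self.cosum_cong, rule M, rule x, rule self.cosum_cong, rule M, assumption, rule self.cosum_counit; (rule lins x y | assumption)+)
  also have "\<dots> = cosum H \<Delta> (\<lambda>x1 x2. \<epsilon> x2 \<odot>\<^bsub>H\<^esub> (S (x1 \<otimes>\<^bsub>H\<^esub> y) \<otimes>\<^bsub>H\<^esub> \<one>\<^bsub>H\<^esub>)) x"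
    by (rule self.cosum_cong, rule M, rule x, rule antipode_right_sum; (rule lins x y | assumption)+)
  also have "\<dots> = S (x \<otimes>\<^bsub>H\<^esub> y) \<otimes>\<^bsub>H\<^esub> \<one>\<^bsub>H\<^esub>"
    by (rule self.cosum_counit; (rule lins x y | assumption)+)
  finally show ?thesis using x y by (simp add: antipode_closed)
qed

text \<open>The same argument, for the convolution inverse of \<open>\<Delta> : H \<rightarrow> H \<otimes> H\<close>.\<close>

lemma antipode_comult_pure:
  assumes h: "h \<in> carrier H"
  shows "\<Delta> (S h) = cosum HH \<Delta> (\<lambda>a b. pure_tensor K H H (S b) (S a)) h"
proof -
  let ?p = "pure_tensor K H H"
  note M = k_module and MM = self.BH.module_T
  define R where "R = (\<lambda>h. cosum HH \<Delta> (\<lambda>a b. ?p (S b) (S a)) h)"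
  have R: "R h \<in> carrier HH" if "h \<in> carrier H" for h
    unfolding R_def by (rule lins that | assumption)+
  have linR: "R \<in> module_hom K H HH"
    unfolding R_def by (rule lins | assumption)+
  note lR = R linR lin_comp[OF linR]
  have inv: "cosum HH \<Delta> (\<lambda>a b. \<Delta> a \<otimes>\<^bsub>HH\<^esub> R b) h = \<epsilon> h \<odot>\<^bsub>HH\<^esub> \<one>\<^bsub>HH\<^esub>" if h: "h \<in> carrier H" for h
  proof -
    have exp: "\<Delta> a \<otimes>\<^bsub>HH\<^esub> R b = cosum HH \<Delta> (\<lambda>p q. cosum HH \<Delta> (\<lambda>r s. ?p (p \<otimes>\<^bsub>H\<^esub> S s) (q \<otimes>\<^bsub>H\<^esub> S r)) b) a"
      if a: "a \<in> carrier H" and b: "b \<in> carrier H" for a b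
    proof -
      have "\<Delta> a \<otimes>\<^bsub>HH\<^esub> R b = cosum HH \<Delta> ?p a \<otimes>\<^bsub>HH\<^esub> R b" by (simp add: self.cosum_pure a)
      also have "\<dots> = cosum HH \<Delta> (\<lambda>p q. ?p p q \<otimes>\<^bsub>HH\<^esub> R b) a"
        by (rule self.hom_cosum[where f = "\<lambda>t. t \<otimes>\<^bsub>HH\<^esub> R b"]; (rule lins lR a b | assumption)+)
      also have "\<dots> = cosum HH \<Delta> (\<lambda>p q. cosum HH \<Delta> (\<lambda>r s. ?p p q \<otimes>\<^bsub>HH\<^esub> ?p (S s) (S r)) b) a"
        by (rule self.cosum_cong, rule MM, rule a, unfold R_def, rule self.hom_cosum; (rule lins a b | assumption)+)
      also have "\<dots> = cosum HH \<Delta> (\<lambda>p q. cosum HH \<Delta> (\<lambda>r s. ?p (p \<otimes>\<^bsub>H\<^esub> S s) (q \<otimes>\<^bsub>H\<^esub> S r)) b) a"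
        by (rule self.cosum_cong, rule MM, rule a, rule self.cosum_cong, rule MM, rule b, rule self.BH.mult_pure; (rule lins b | assumption)+)
      finally show ?thesis .
    qed
    have "cosum HH \<Delta> (\<lambda>a b. \<Delta> a \<otimes>\<^bsub>HH\<^esub> R b) h =
        cosum HH \<Delta> (\<lambda>a b. cosum HH \<Delta> (\<lambda>p q. cosum HH \<Delta> (\<lambda>r s. ?p (p \<otimes>\<^bsub>H\<^esub> S s) (q \<otimes>\<^bsub>H\<^esub> S r)) b) a) h"
      by (rule self.cosum_cong, rule MM, rule h, rule exp; (rule lins h | assumption)+)
    also have "\<dots> = cosum HH \<Delta> (\<lambda>p t. cosum HH \<Delta> (\<lambda>q b. cosum HH \<Delta> (\<lambda>r s. ?p (p \<otimes>\<^bsub>H\<^esub> S s) (q \<otimes>\<^bsub>H\<^esub> S r)) b) t) h"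
      by (rule self.cosum_coassoc; (rule lins h | assumption)+)
    also have "\<dots> = cosum HH \<Delta> (\<lambda>p t. cosum HH \<Delta> (\<lambda>u s. cosum HH \<Delta> (\<lambda>q r. ?p (p \<otimes>\<^bsub>H\<^esub> S s) (q \<otimes>\<^bsub>H\<^esub> S r)) u) t) h"
      by (rule self.cosum_cong, rule MM, rule h, rule self.cosum_coassoc[symmetric]; (rule lins h | assumption)+)
    also have "\<dots> = cosum HH \<Delta> (\<lambda>p t. cosum HH \<Delta> (\<lambda>u s. \<epsilon> u \<odot>\<^bsub>HH\<^esub> ?p (p \<otimes>\<^bsub>H\<^esub> S s) \<one>\<^bsub>H\<^esub>) t) h"
      by (rule self.cosum_cong, rule MM, rule h, rule self.cosum_cong, rule MM, assumption, rule antipode_right_sum; (rule lins h | assumption)+)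
    also have "\<dots> = cosum HH \<Delta> (\<lambda>p t. ?p (p \<otimes>\<^bsub>H\<^esub> S t) \<one>\<^bsub>H\<^esub>) h"
      by (rule self.cosum_cong, rule MM, rule h, rule counit_left_sum; (rule lins h | assumption)+)
    also have "\<dots> = \<epsilon> h \<odot>\<^bsub>HH\<^esub> ?p \<one>\<^bsub>H\<^esub> \<one>\<^bsub>H\<^esub>"
      by (rule antipode_right_sum; (rule lins h | assumption)+)
    finally show ?thesis by (simp only: self.BH.one_T)
  qed
  have "R h = cosum HH \<Delta> (\<lambda>a b. \<epsilon> a \<odot>\<^bsub>HH\<^esub> R b) h"
    by (rule counit_left_sum[symmetric]; (rule lins lR h)+)
  also have "\<dots> = cosum HH \<Delta> (\<lambda>a b. cosum HH \<Delta> (\<lambda>p q. \<Delta> (S p \<otimes>\<^bsub>H\<^esub> q) \<otimes>\<^bsub>HH\<^esub> R b) a) h"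
  proof (rule self.cosum_cong[OF MM h])
    fix a b assume a: "a \<in> carrier H" and b: "b \<in> carrier H"
    have "cosum HH \<Delta> (\<lambda>p q. \<Delta> (S p \<otimes>\<^bsub>H\<^esub> q) \<otimes>\<^bsub>HH\<^esub> R b) a = \<epsilon> a \<odot>\<^bsub>HH\<^esub> (\<Delta> \<one>\<^bsub>H\<^esub> \<otimes>\<^bsub>HH\<^esub> R b)"
      by (rule antipode_left_sum; (rule lins lR a b)+)
    then show "\<epsilon> a \<odot>\<^bsub>HH\<^esub> R b = cosum HH \<Delta> (\<lambda>p q. \<Delta> (S p \<otimes>\<^bsub>H\<^esub> q) \<otimes>\<^bsub>HH\<^esub> R b) a"
      using R[OF b] by (simp add: self.rho_one self.BH.one_T[symmetric])
  qed ((rule lins lR h | assumption)+)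
  also have "\<dots> = cosum HH \<Delta> (\<lambda>p t. cosum HH \<Delta> (\<lambda>q b. \<Delta> (S p \<otimes>\<^bsub>H\<^esub> q) \<otimes>\<^bsub>HH\<^esub> R b) t) h"
    by (rule self.cosum_coassoc; (rule lins lR h | assumption)+)
  also have "\<dots> = cosum HH \<Delta> (\<lambda>p t. \<epsilon> t \<odot>\<^bsub>HH\<^esub> \<Delta> (S p)) h"
  proof (rule self.cosum_cong[OF MM h])
    fix p t assume p: "p \<in> carrier H" and t: "t \<in> carrier H"
    have "cosum HH \<Delta> (\<lambda>q b. \<Delta> (S p \<otimes>\<^bsub>H\<^esub> q) \<otimes>\<^bsub>HH\<^esub> R b) t = cosum HH \<Delta> (\<lambda>q b. \<Delta> (S p) \<otimes>\<^bsub>HH\<^esub> (\<Delta> q \<otimes>\<^bsub>HH\<^esub> R b)) t"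
      by (rule self.cosum_cong[OF MM t])
        (simp_all add: self.rho_mult p antipode_closed R self.rho_closed self.BHalg.m_assoc)
    also have "\<dots> = \<Delta> (S p) \<otimes>\<^bsub>HH\<^esub> cosum HH \<Delta> (\<lambda>q b. \<Delta> q \<otimes>\<^bsub>HH\<^esub> R b) t"
      by (rule self.hom_cosum[symmetric]; (rule lins lR p t | assumption)+)
    also have "\<dots> = \<epsilon> t \<odot>\<^bsub>HH\<^esub> \<Delta> (S p)"
      using p t by (simp add: inv self.BHalg.smult_mult_right self.counit_closed antipode_closed self.rho_closed)
    finally show "cosum HH \<Delta> (\<lambda>q b. \<Delta> (S p \<otimes>\<^bsub>H\<^esub> q) \<otimes>\<^bsub>HH\<^esub> R b) t = \<epsilon> t \<odot>\<^bsub>HH\<^esub> \<Delta> (S p)" .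
  qed ((rule lins lR h | assumption)+)
  also have "\<dots> = \<Delta> (S h)"
    by (rule self.cosum_counit; (rule lins lR h | assumption)+)
  finally show ?thesis unfolding R_def by simp
qed

lemma antipode_comult:
  assumes W: "module K W" and \<phi>: "bilinear_map K H H W \<phi>" and h: "h \<in> carrier H"
  shows "cosum W \<Delta> \<phi> (S h) = cosum W \<Delta> (\<lambda>a b. \<phi> (S b) (S a)) h"
proof -
  have "cosum W \<Delta> \<phi> (S h) = tensor_sum W \<phi> (cosum HH \<Delta> (\<lambda>a b. pure_tensor K H H (S b) (S a)) h)"
    unfolding cosum_def antipode_comult_pure[OF h, unfolded cosum_def] ..
  also have "\<dots> = cosum W \<Delta> (\<lambda>a b. tensor_sum W \<phi> (pure_tensor K H H (S b) (S a))) h"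
    by (rule self.hom_cosum[OF _ W self.BH.lin_tensor_sum[OF W \<phi>]]; (rule lins h | assumption)+)
  also have "\<dots> = cosum W \<Delta> (\<lambda>a b. \<phi> (S b) (S a)) h"
    by (rule self.cosum_cong[OF W h])
      (simp_all add: self.BH.tensor_sum_pure[OF W \<phi>] antipode_closed bilinear_map_closed[OF \<phi>])
  finally show ?thesis .
qed

end

locale bijective_hopf_algebra = hopf_algebra K H \<Delta> \<epsilon> S
  for K :: "('k, 'x) ring_scheme" (structure) and H :: "('k, 'h, 'y) module_scheme" (structure)
    and \<Delta> \<epsilon> S +
  assumes bij: "bij_betw S (carrier H) (carrier H)"
begin

definition "Si = inv_into (carrier H) S"

lemma Si_closed: "h \<in> carrier H \<Longrightarrow> Si h \<in> carrier H"
  unfolding Si_def using bij by (metis bij_betw_imp_surj_on inv_into_into)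

lemma S_Si: "h \<in> carrier H \<Longrightarrow> S (Si h) = h"
  unfolding Si_def using bij by (metis bij_betw_inv_into_right)

lemma Si_S: "h \<in> carrier H \<Longrightarrow> Si (S h) = h"
  unfolding Si_def using bij by (metis bij_betw_inv_into_left)

lemma Si_eqI: "\<lbrakk>x \<in> carrier H; S x = y\<rbrakk> \<Longrightarrow> Si y = x"
  using Si_S by auto

lemma lin_Si: "Si \<in> module_hom K H H"
  by (intro module_homI Si_closed Si_eqI)
    (simp_all add: Si_closed S_Si module_hom_add[OF antipode_linear] module_hom_smult[OF antipode_linear])

lemmas [lins] = Si_closed lin_comp[OF lin_Si]

lemma Si_mult: "\<lbrakk>x \<in> carrier H; y \<in> carrier H\<rbrakk> \<Longrightarrow> Si (x \<otimes>\<^bsub>H\<^esub> y) = Si y \<otimes>\<^bsub>H\<^esub> Si x"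
  by (intro Si_eqI) (simp_all add: Si_closed S_Si antipode_mult)

lemma Si_one: "Si \<one>\<^bsub>H\<^esub> = \<one>\<^bsub>H\<^esub>"
  by (intro Si_eqI) (simp_all add: antipode_one)

text \<open>As \<open>S\<close> reverses products, the antipode laws turn into laws for \<open>S\<^sup>-\<^sup>1\<close> with the factors in the
  opposite order.\<close>

lemma Si_left_sum:
  assumes W: "module K W" and h: "h \<in> carrier H" and f: "f \<in> module_hom K H W"
  shows "cosum W \<Delta> (\<lambda>a b. f (Si b \<otimes>\<^bsub>H\<^esub> a)) h = \<epsilon> h \<odot>\<^bsub>W\<^esub> f \<one>\<^bsub>H\<^esub>"
proof -
  have "cosum W \<Delta> (\<lambda>a b. f (Si b \<otimes>\<^bsub>H\<^esub> a)) h = cosum W \<Delta> (\<lambda>a b. f (Si (S a \<otimes>\<^bsub>H\<^esub> b))) h"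
    by (rule self.cosum_cong[OF W h])
      (simp_all add: Si_mult Si_S antipode_closed Si_closed module_hom_closed[OF f])
  also have "\<dots> = \<epsilon> h \<odot>\<^bsub>W\<^esub> f (Si \<one>\<^bsub>H\<^esub>)"
    by (rule antipode_left_sum[OF W h lin_comp[OF f lin_Si]])
  finally show ?thesis by (simp add: Si_one)
qed

lemma Si_right_sum:
  assumes W: "module K W" and h: "h \<in> carrier H" and f: "f \<in> module_hom K H W"
  shows "cosum W \<Delta> (\<lambda>a b. f (b \<otimes>\<^bsub>H\<^esub> Si a)) h = \<epsilon> h \<odot>\<^bsub>W\<^esub> f \<one>\<^bsub>H\<^esub>"
proof -
  have "cosum W \<Delta> (\<lambda>a b. f (b \<otimes>\<^bsub>H\<^esub> Si a)) h = cosum W \<Delta> (\<lambda>a b. f (Si (a \<otimes>\<^bsub>H\<^esub> S b))) h"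
    by (rule self.cosum_cong[OF W h])
      (simp_all add: Si_mult Si_S antipode_closed Si_closed module_hom_closed[OF f])
  also have "\<dots> = \<epsilon> h \<odot>\<^bsub>W\<^esub> f (Si \<one>\<^bsub>H\<^esub>)"
    by (rule antipode_right_sum[OF W h lin_comp[OF f lin_Si]])
  finally show ?thesis by (simp add: Si_one)
qed

lemma Si_comult:
  assumes W: "module K W" and \<phi>: "bilinear_map K H H W \<phi>" and h: "h \<in> carrier H"
  shows "cosum W \<Delta> \<phi> (Si h) = cosum W \<Delta> (\<lambda>a b. \<phi> (Si b) (Si a)) h"
proof -
  have bil: "bilinear_map K H H W (\<lambda>a b. \<phi> (Si b) (Si a))"
    using \<phi> by (intro bilinear_mapI lin_comp[OF _ lin_Si]) (auto simp: bilinear_map_def Si_closed)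
  have "cosum W \<Delta> (\<lambda>a b. \<phi> (Si b) (Si a)) h = cosum W \<Delta> (\<lambda>a b. \<phi> (Si b) (Si a)) (S (Si h))"
    by (simp add: S_Si h)
  also have "\<dots> = cosum W \<Delta> (\<lambda>a b. \<phi> (Si (S a)) (Si (S b))) (Si h)"
    by (rule antipode_comult[OF W bil Si_closed[OF h]])
  also have "\<dots> = cosum W \<Delta> \<phi> (Si h)"
    by (rule self.cosum_cong[OF W Si_closed[OF h]]) (simp_all add: Si_S bilinear_map_closed[OF \<phi>])
  finally show ?thesis ..
qed

end

section \<open>The Galois map and coinvariants\<close>

locale bijective_comodule_algebra = comodule_algebra K H \<Delta> \<epsilon> S B \<rho> + H: bijective_hopf_algebra K H \<Delta> \<epsilon> S
  for K :: "('k, 'x) ring_scheme" (structure) and H :: "('k, 'h, 'y) module_scheme" (structure)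
    and \<Delta> \<epsilon> S and B :: "('k, 'b, 'z) module_scheme" (structure) and \<rho>
begin

abbreviation "Si \<equiv> H.Si"
abbreviation "ptBH \<equiv> pure_tensor K B H"

lemma comodule: "comodule_algebra K H \<Delta> \<epsilon> S B \<rho>" by unfold_locales

lemmas swap_BB = cosum_swap[OF comodule comodule]
lemmas swap_BH = cosum_swap[OF comodule H.comodule_self]
lemmas swap_HB = cosum_swap[OF H.comodule_self comodule]

text \<open>The Galois map on the pure tensor of \<open>x\<close> and \<open>y\<close>. As a map on \<open>B \<times> B\<close> it can be handled without the
  tensor product over \<open>A\<close>.\<close>

definition galois where "galois x y = cosum BH \<rho> (\<lambda>y0 y1. ptBH (x \<otimes>\<^bsub>B\<^esub> y0) y1) y"

lemma galois_closed: "\<lbrakk>x \<in> carrier B; y \<in> carrier B\<rbrakk> \<Longrightarrow> galois x y \<in> carrier BH"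
  unfolding galois_def by (rule lins | assumption)+

lemma bilinear_galois: "bilinear_map K B B BH galois"
  unfolding galois_def by (rule lins | assumption)+

text \<open>The Galois map sends \<open>x \<otimes> y\<close> to \<open>\<Sum> x y\<^sub>0 \<otimes> y\<^sub>1\<close>, whose first factor carries the coactions of both \<open>x\<close>
  and \<open>y\<close>. Multiplying by \<open>S y\<^sub>1\<close> isolates the coaction of \<open>x\<close> (\<open>galois_shift_galois\<close>). Thus functions
  of \<open>\<Sum> x\<^sub>0 y\<^sub>0 \<otimes> y\<^sub>1 \<otimes> x\<^sub>1\<close> are functions of the image under the Galois map.\<close>

definition galois_shift where
  "galois_shift W \<phi> = tensor_sum W (\<lambda>c k. cosum W \<rho> (\<lambda>c0 c1. cosum W \<Delta> (\<lambda>k1 k2. \<phi> c0 k2 (c1 \<otimes>\<^bsub>H\<^esub> S k1)) k) c)"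

definition trilinear where
  "trilinear W \<phi> \<longleftrightarrow>
    (\<forall>k \<in> carrier H. \<forall>l \<in> carrier H. (\<lambda>c. \<phi> c k l) \<in> module_hom K B W) \<and>
    (\<forall>c \<in> carrier B. \<forall>l \<in> carrier H. (\<lambda>k. \<phi> c k l) \<in> module_hom K H W) \<and>
    (\<forall>c \<in> carrier B. \<forall>k \<in> carrier H. (\<lambda>l. \<phi> c k l) \<in> module_hom K H W)"

lemma trilinearI:
  assumes "\<And>k l. \<lbrakk>k \<in> carrier H; l \<in> carrier H\<rbrakk> \<Longrightarrow> (\<lambda>c. \<phi> c k l) \<in> module_hom K B W"
    and "\<And>c l. \<lbrakk>c \<in> carrier B; l \<in> carrier H\<rbrakk> \<Longrightarrow> (\<lambda>k. \<phi> c k l) \<in> module_hom K H W"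
    and "\<And>c k. \<lbrakk>c \<in> carrier B; k \<in> carrier H\<rbrakk> \<Longrightarrow> (\<lambda>l. \<phi> c k l) \<in> module_hom K H W"
  shows "trilinear W \<phi>"
  using assms unfolding trilinear_def by blast

context
  fixes W :: "('k, 'w, 'v) module_scheme" and \<phi>
  assumes W: "module K W" and \<phi>: "trilinear W \<phi>"
begin

lemma tri1: "\<lbrakk>k \<in> carrier H; l \<in> carrier H\<rbrakk> \<Longrightarrow> (\<lambda>c. \<phi> c k l) \<in> module_hom K B W"
  and tri2: "\<lbrakk>c \<in> carrier B; l \<in> carrier H\<rbrakk> \<Longrightarrow> (\<lambda>k. \<phi> c k l) \<in> module_hom K H W"
  and tri3: "\<lbrakk>c \<in> carrier B; k \<in> carrier H\<rbrakk> \<Longrightarrow> (\<lambda>l. \<phi> c k l) \<in> module_hom K H W"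
  using \<phi> unfolding trilinear_def by blast+

lemmas tri = W module_hom_closed[OF tri1] lin_comp[OF tri1] lin_comp[OF tri2] lin_comp[OF tri3]

lemma galois_shift_bilinear:
  "bilinear_map K B H W (\<lambda>c k. cosum W \<rho> (\<lambda>c0 c1. cosum W \<Delta> (\<lambda>k1 k2. \<phi> c0 k2 (c1 \<otimes>\<^bsub>H\<^esub> S k1)) k) c)"
  by (rule lins tri | assumption)+

lemma lin_galois_shift: "galois_shift W \<phi> \<in> module_hom K BH W"
  unfolding galois_shift_def by (rule BH.lin_tensor_sum[OF W galois_shift_bilinear])

lemma galois_shift_pure:
  "\<lbrakk>c \<in> carrier B; k \<in> carrier H\<rbrakk> \<Longrightarrow> galois_shift W \<phi> (ptBH c k) =
    cosum W \<rho> (\<lambda>c0 c1. cosum W \<Delta> (\<lambda>k1 k2. \<phi> c0 k2 (c1 \<otimes>\<^bsub>H\<^esub> S k1)) k) c"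
  unfolding galois_shift_def by (rule BH.tensor_sum_pure[OF W galois_shift_bilinear])

lemma galois_shift_galois:
  assumes x: "x \<in> carrier B" and y: "y \<in> carrier B"
  shows "galois_shift W \<phi> (galois x y) = cosum W \<rho> (\<lambda>x0 x1. cosum W \<rho> (\<lambda>y0 y1. \<phi> (x0 \<otimes>\<^bsub>B\<^esub> y0) y1 x1) y) x"
proof -
  have "galois_shift W \<phi> (galois x y) = cosum W \<rho> (\<lambda>y0 y1. galois_shift W \<phi> (ptBH (x \<otimes>\<^bsub>B\<^esub> y0) y1)) y"
    unfolding galois_def by (rule hom_cosum[OF _ W lin_galois_shift]; (rule lins x y | assumption)+)
  also have "\<dots> = cosum W \<rho> (\<lambda>y0 y1. cosum W \<rho> (\<lambda>c0 c1. cosum W \<Delta> (\<lambda>k1 k2. \<phi> c0 k2 (c1 \<otimes>\<^bsub>H\<^esub> S k1)) y1) (x \<otimes>\<^bsub>B\<^esub> y0)) y"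
    by (rule cosum_cong, rule W, rule y, rule galois_shift_pure; (rule lins tri x y | assumption)+)
  also have "\<dots> = cosum W \<rho> (\<lambda>y0 y1. cosum W \<rho> (\<lambda>x0 x1. cosum W \<rho> (\<lambda>u v.
      cosum W \<Delta> (\<lambda>k1 k2. \<phi> (x0 \<otimes>\<^bsub>B\<^esub> u) k2 (x1 \<otimes>\<^bsub>H\<^esub> v \<otimes>\<^bsub>H\<^esub> S k1)) y1) y0) x) y"
    by (rule cosum_cong, rule W, rule y, rule cosum_mult; (rule lins tri x y | assumption)+)
  also have "\<dots> = cosum W \<rho> (\<lambda>x0 x1. cosum W \<rho> (\<lambda>y0 y1. cosum W \<rho> (\<lambda>u v.
      cosum W \<Delta> (\<lambda>k1 k2. \<phi> (x0 \<otimes>\<^bsub>B\<^esub> u) k2 (x1 \<otimes>\<^bsub>H\<^esub> v \<otimes>\<^bsub>H\<^esub> S k1)) y1) y0) y) x"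
    by (rule swap_BB; (rule lins tri x y | assumption)+)
  also have "\<dots> = cosum W \<rho> (\<lambda>x0 x1. cosum W \<rho> (\<lambda>y0 y1. cosum W \<Delta> (\<lambda>v z.
      cosum W \<Delta> (\<lambda>k1 k2. \<phi> (x0 \<otimes>\<^bsub>B\<^esub> y0) k2 (x1 \<otimes>\<^bsub>H\<^esub> v \<otimes>\<^bsub>H\<^esub> S k1)) z) y1) y) x"
    by (rule cosum_cong, rule W, rule x, rule cosum_coassoc; (rule lins tri x y | assumption)+)
  also have "\<dots> = cosum W \<rho> (\<lambda>x0 x1. cosum W \<rho> (\<lambda>y0 y1. cosum W \<Delta> (\<lambda>w k2.
      cosum W \<Delta> (\<lambda>v k1. \<phi> (x0 \<otimes>\<^bsub>B\<^esub> y0) k2 (x1 \<otimes>\<^bsub>H\<^esub> v \<otimes>\<^bsub>H\<^esub> S k1)) w) y1) y) x"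
    by (rule cosum_cong, rule W, rule x, rule cosum_cong, rule W, rule y, rule H.self.cosum_coassoc[symmetric]; (rule lins tri x y | assumption)+)
  also have "\<dots> = cosum W \<rho> (\<lambda>x0 x1. cosum W \<rho> (\<lambda>y0 y1. cosum W \<Delta> (\<lambda>w k2.
      \<epsilon> w \<odot>\<^bsub>W\<^esub> \<phi> (x0 \<otimes>\<^bsub>B\<^esub> y0) k2 x1) y1) y) x"
  proof (rule cosum_cong, rule W, rule x, rule cosum_cong, rule W, rule y, rule H.self.cosum_cong, rule W, assumption)
    fix x0 x1 y0 y1 w k2
    assume c: "x0 \<in> carrier B" "x1 \<in> carrier H" "y0 \<in> carrier B" "y1 \<in> carrier H" "w \<in> carrier H" "k2 \<in> carrier H"
    have "cosum W \<Delta> (\<lambda>v k1. \<phi> (x0 \<otimes>\<^bsub>B\<^esub> y0) k2 (x1 \<otimes>\<^bsub>H\<^esub> v \<otimes>\<^bsub>H\<^esub> S k1)) w =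
        cosum W \<Delta> (\<lambda>v k1. \<phi> (x0 \<otimes>\<^bsub>B\<^esub> y0) k2 (x1 \<otimes>\<^bsub>H\<^esub> (v \<otimes>\<^bsub>H\<^esub> S k1))) w"
      by (rule H.self.cosum_cong[OF W c(5)])
        (simp_all add: c H.antipode_closed H.m_assoc module_hom_closed[OF tri1])
    also have "\<dots> = \<epsilon> w \<odot>\<^bsub>W\<^esub> \<phi> (x0 \<otimes>\<^bsub>B\<^esub> y0) k2 (x1 \<otimes>\<^bsub>H\<^esub> \<one>\<^bsub>H\<^esub>)"
      by (rule H.antipode_right_sum; (rule lins tri c)+)
    finally show "cosum W \<Delta> (\<lambda>v k1. \<phi> (x0 \<otimes>\<^bsub>B\<^esub> y0) k2 (x1 \<otimes>\<^bsub>H\<^esub> v \<otimes>\<^bsub>H\<^esub> S k1)) w = \<epsilon> w \<odot>\<^bsub>W\<^esub> \<phi> (x0 \<otimes>\<^bsub>B\<^esub> y0) k2 x1"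
      using c by simp
  qed ((rule lins tri x y | assumption)+)
  also have "\<dots> = cosum W \<rho> (\<lambda>x0 x1. cosum W \<rho> (\<lambda>y0 y1. \<phi> (x0 \<otimes>\<^bsub>B\<^esub> y0) y1 x1) y) x"
    by (rule cosum_cong, rule W, rule x, rule cosum_cong, rule W, rule y, rule H.counit_left_sum; (rule lins tri x y | assumption)+)
  finally show ?thesis .
qed

end

definition kappa where "kappa b g = cosum BH \<rho> (\<lambda>b0 b1. ptBH b0 (Si g \<otimes>\<^bsub>H\<^esub> b1)) b"

lemma bilinear_kappa: "bilinear_map K B H BH kappa"
  unfolding kappa_def by (rule lins | assumption)+

text \<open>In terms of preimages under the Galois map, the coaction on the left tensor factor takes \<open>\<kappa> b g\<close> to
  \<open>\<Sum> \<kappa> b g\<^sub>1 \<otimes> g\<^sub>2\<close>: the coaction of \<open>b\<close> cancels and only that of \<open>g\<close> remains.\<close>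

lemma galois_shift_kappa:
  assumes W: "module K W" and \<phi>: "trilinear W \<phi>" and b: "b \<in> carrier B" and g: "g \<in> carrier H"
  shows "galois_shift W \<phi> (kappa b g) =
    cosum W \<Delta> (\<lambda>g1 g2. cosum W \<rho> (\<lambda>b0 b1. \<phi> b0 (Si g1 \<otimes>\<^bsub>H\<^esub> b1) g2) b) g"
proof -
  note tri = tri[OF W \<phi>] and tri1 = tri1[OF W \<phi>]
  have "galois_shift W \<phi> (kappa b g) = cosum W \<rho> (\<lambda>b0 b1. galois_shift W \<phi> (ptBH b0 (Si g \<otimes>\<^bsub>H\<^esub> b1))) b"
    unfolding kappa_def by (rule hom_cosum[OF _ W lin_galois_shift[OF W \<phi>]]; (rule lins b g | assumption)+)
  also have "\<dots> = cosum W \<rho> (\<lambda>b0 b1. cosum W \<rho> (\<lambda>c0 c1. cosum W \<Delta> (\<lambda>k1 k2. \<phi> c0 k2 (c1 \<otimes>\<^bsub>H\<^esub> S k1)) (Si g \<otimes>\<^bsub>H\<^esub> b1)) b0) b"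
    by (rule cosum_cong, rule W, rule b, rule galois_shift_pure[OF W \<phi>]; (rule lins tri b g | assumption)+)
  also have "\<dots> = cosum W \<rho> (\<lambda>b0 b1. cosum W \<rho> (\<lambda>c0 c1. cosum W \<Delta> (\<lambda>s t. cosum W \<Delta> (\<lambda>u v.
      \<phi> c0 (t \<otimes>\<^bsub>H\<^esub> v) (c1 \<otimes>\<^bsub>H\<^esub> S (s \<otimes>\<^bsub>H\<^esub> u))) b1) (Si g)) b0) b"
    by (rule cosum_cong, rule W, rule b, rule cosum_cong, rule W, assumption, rule H.self.cosum_mult; (rule lins tri b g | assumption)+)
  also have "\<dots> = cosum W \<rho> (\<lambda>b0 b1. cosum W \<rho> (\<lambda>c0 c1. cosum W \<Delta> (\<lambda>g1 g2. cosum W \<Delta> (\<lambda>u v.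
      \<phi> c0 (Si g1 \<otimes>\<^bsub>H\<^esub> v) (c1 \<otimes>\<^bsub>H\<^esub> S (Si g2 \<otimes>\<^bsub>H\<^esub> u))) b1) g) b0) b"
    by (rule cosum_cong, rule W, rule b, rule cosum_cong, rule W, assumption, rule H.Si_comult; (rule lins tri b g | assumption)+)
  also have "\<dots> = cosum W \<rho> (\<lambda>b0 b1. cosum W \<rho> (\<lambda>c0 c1. cosum W \<Delta> (\<lambda>g1 g2. cosum W \<Delta> (\<lambda>u v.
      \<phi> c0 (Si g1 \<otimes>\<^bsub>H\<^esub> v) (c1 \<otimes>\<^bsub>H\<^esub> S u \<otimes>\<^bsub>H\<^esub> g2)) b1) g) b0) b"
    by (rule cosum_cong, rule W, rule b, rule cosum_cong, rule W, assumption, rule H.self.cosum_cong, rule W, rule g,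
        rule H.self.cosum_cong, rule W, assumption,
        simp add: H.antipode_mult H.Si_closed H.S_Si H.m_assoc H.antipode_closed; (rule lins tri b g | assumption)+)
  also have "\<dots> = cosum W \<rho> (\<lambda>b0 b1. cosum W \<Delta> (\<lambda>g1 g2. cosum W \<rho> (\<lambda>c0 c1. cosum W \<Delta> (\<lambda>u v.
      \<phi> c0 (Si g1 \<otimes>\<^bsub>H\<^esub> v) (c1 \<otimes>\<^bsub>H\<^esub> S u \<otimes>\<^bsub>H\<^esub> g2)) b1) b0) g) b"
    by (rule cosum_cong, rule W, rule b, rule swap_BH; (rule lins tri b g | assumption)+)
  also have "\<dots> = cosum W \<Delta> (\<lambda>g1 g2. cosum W \<rho> (\<lambda>b0 b1. cosum W \<rho> (\<lambda>c0 c1. cosum W \<Delta> (\<lambda>u v.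
      \<phi> c0 (Si g1 \<otimes>\<^bsub>H\<^esub> v) (c1 \<otimes>\<^bsub>H\<^esub> S u \<otimes>\<^bsub>H\<^esub> g2)) b1) b0) b) g"
    by (rule swap_BH; (rule lins tri b g | assumption)+)
  also have "\<dots> = cosum W \<Delta> (\<lambda>g1 g2. cosum W \<rho> (\<lambda>b0 b1. cosum W \<Delta> (\<lambda>c1 z. cosum W \<Delta> (\<lambda>u v.
      \<phi> b0 (Si g1 \<otimes>\<^bsub>H\<^esub> v) (c1 \<otimes>\<^bsub>H\<^esub> S u \<otimes>\<^bsub>H\<^esub> g2)) z) b1) b) g"
    by (rule H.self.cosum_cong, rule W, rule g, rule cosum_coassoc; (rule lins tri b g | assumption)+)
  also have "\<dots> = cosum W \<Delta> (\<lambda>g1 g2. cosum W \<rho> (\<lambda>b0 b1. cosum W \<Delta> (\<lambda>w v. cosum W \<Delta> (\<lambda>c1 u.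
      \<phi> b0 (Si g1 \<otimes>\<^bsub>H\<^esub> v) (c1 \<otimes>\<^bsub>H\<^esub> S u \<otimes>\<^bsub>H\<^esub> g2)) w) b1) b) g"
    by (rule H.self.cosum_cong, rule W, rule g, rule cosum_cong, rule W, rule b, rule H.self.cosum_coassoc[symmetric]; (rule lins tri b g | assumption)+)
  also have "\<dots> = cosum W \<Delta> (\<lambda>g1 g2. cosum W \<rho> (\<lambda>b0 b1. cosum W \<Delta> (\<lambda>w v.
      \<epsilon> w \<odot>\<^bsub>W\<^esub> \<phi> b0 (Si g1 \<otimes>\<^bsub>H\<^esub> v) (\<one>\<^bsub>H\<^esub> \<otimes>\<^bsub>H\<^esub> g2)) b1) b) g"
    by (rule H.self.cosum_cong, rule W, rule g, rule cosum_cong, rule W, rule b, rule H.self.cosum_cong, rule W, assumption,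
        rule H.antipode_right_sum; (rule lins tri b g | assumption)+)
  also have "\<dots> = cosum W \<Delta> (\<lambda>g1 g2. cosum W \<rho> (\<lambda>b0 b1. \<phi> b0 (Si g1 \<otimes>\<^bsub>H\<^esub> b1) (\<one>\<^bsub>H\<^esub> \<otimes>\<^bsub>H\<^esub> g2)) b) g"
    by (rule H.self.cosum_cong, rule W, rule g, rule cosum_cong, rule W, rule b, rule H.counit_left_sum; (rule lins tri b g | assumption)+)
  also have "\<dots> = cosum W \<Delta> (\<lambda>g1 g2. cosum W \<rho> (\<lambda>b0 b1. \<phi> b0 (Si g1 \<otimes>\<^bsub>H\<^esub> b1) g2) b) g"
    by (rule H.self.cosum_cong, rule W, rule g, rule cosum_cong, rule W, rule b, simp; (rule lins tri b g | assumption)+)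
  finally show ?thesis .
qed

abbreviation "A \<equiv> coinvariants K H B \<rho>"

lemma carrier_A: "carrier A = {b \<in> carrier B. \<rho> b = ptBH b \<one>\<^bsub>H\<^esub>}"
  by (simp add: coinvariants_def)

lemma A_simps [simp]:
  "x \<otimes>\<^bsub>A\<^esub> y = x \<otimes>\<^bsub>B\<^esub> y" "\<one>\<^bsub>A\<^esub> = \<one>\<^bsub>B\<^esub>" "\<zero>\<^bsub>A\<^esub> = \<zero>\<^bsub>B\<^esub>" "x \<oplus>\<^bsub>A\<^esub> y = x \<oplus>\<^bsub>B\<^esub> y" "c \<odot>\<^bsub>A\<^esub> x = c \<odot>\<^bsub>B\<^esub> x"
  by (simp_all add: coinvariants_def)

lemma A_B: "a \<in> carrier A \<Longrightarrow> a \<in> carrier B"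
  by (simp add: carrier_A)

lemma cosum_A:
  assumes "module K W" "bilinear_map K B H W \<phi>" "a \<in> carrier A"
  shows "cosum W \<rho> \<phi> a = \<phi> a \<one>\<^bsub>H\<^esub>"
  using assms unfolding cosum_def by (simp add: carrier_A BH.tensor_sum_pure)

lemma cosum_A_left:
  assumes W: "module K W" and \<phi>: "bilinear_map K B H W \<phi>" and a: "a \<in> carrier A" and b: "b \<in> carrier B"
  shows "cosum W \<rho> \<phi> (a \<otimes>\<^bsub>B\<^esub> b) = cosum W \<rho> (\<lambda>b0 b1. \<phi> (a \<otimes>\<^bsub>B\<^esub> b0) b1) b"
proof -
  have \<phi>1: "\<And>c. c \<in> carrier B \<Longrightarrow> (\<lambda>x. \<phi> c x) \<in> module_hom K H W"
    and \<phi>2: "\<And>h. h \<in> carrier H \<Longrightarrow> (\<lambda>x. \<phi> x h) \<in> module_hom K B W"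
    using \<phi> unfolding bilinear_map_def by auto
  have "cosum W \<rho> \<phi> (a \<otimes>\<^bsub>B\<^esub> b) = cosum W \<rho> (\<lambda>a0 a1. cosum W \<rho> (\<lambda>b0 b1. \<phi> (a0 \<otimes>\<^bsub>B\<^esub> b0) (a1 \<otimes>\<^bsub>H\<^esub> b1)) b) a"
    by (rule cosum_mult[OF W \<phi> A_B[OF a] b])
  also have "\<dots> = cosum W \<rho> (\<lambda>b0 b1. \<phi> (a \<otimes>\<^bsub>B\<^esub> b0) (\<one>\<^bsub>H\<^esub> \<otimes>\<^bsub>H\<^esub> b1)) b"
    by (rule cosum_A; (rule lins W a b A_B[OF a] module_hom_closed[OF \<phi>1] lin_comp[OF \<phi>1] lin_comp[OF \<phi>2] | assumption)+)
  also have "\<dots> = cosum W \<rho> (\<lambda>b0 b1. \<phi> (a \<otimes>\<^bsub>B\<^esub> b0) b1) b"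
    by (rule cosum_cong[OF W b]) (simp_all add: A_B a bilinear_map_closed[OF \<phi>])
  finally show ?thesis .
qed

lemma cosum_A_right:
  assumes W: "module K W" and \<phi>: "bilinear_map K B H W \<phi>" and a: "a \<in> carrier A" and b: "b \<in> carrier B"
  shows "cosum W \<rho> \<phi> (b \<otimes>\<^bsub>B\<^esub> a) = cosum W \<rho> (\<lambda>b0 b1. \<phi> (b0 \<otimes>\<^bsub>B\<^esub> a) b1) b"
proof -
  have \<phi>1: "\<And>c. c \<in> carrier B \<Longrightarrow> (\<lambda>x. \<phi> c x) \<in> module_hom K H W"
    and \<phi>2: "\<And>h. h \<in> carrier H \<Longrightarrow> (\<lambda>x. \<phi> x h) \<in> module_hom K B W"
    using \<phi> unfolding bilinear_map_def by auto
  have "cosum W \<rho> \<phi> (b \<otimes>\<^bsub>B\<^esub> a) = cosum W \<rho> (\<lambda>b0 b1. cosum W \<rho> (\<lambda>a0 a1. \<phi> (b0 \<otimes>\<^bsub>B\<^esub> a0) (b1 \<otimes>\<^bsub>H\<^esub> a1)) a) b"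
    by (rule cosum_mult[OF W \<phi> b A_B[OF a]])
  also have "\<dots> = cosum W \<rho> (\<lambda>b0 b1. \<phi> (b0 \<otimes>\<^bsub>B\<^esub> a) (b1 \<otimes>\<^bsub>H\<^esub> \<one>\<^bsub>H\<^esub>)) b"
    by (rule cosum_cong, rule W, rule b, rule cosum_A; (rule lins W a b A_B[OF a] module_hom_closed[OF \<phi>1] lin_comp[OF \<phi>1] lin_comp[OF \<phi>2] | assumption)+)
  also have "\<dots> = cosum W \<rho> (\<lambda>b0 b1. \<phi> (b0 \<otimes>\<^bsub>B\<^esub> a) b1) b"
    by (rule cosum_cong[OF W b]) (simp_all add: A_B a bilinear_map_closed[OF \<phi>])
  finally show ?thesis .
qed

lemma k_algebra_A: "k_algebra K A"
proof -
  interpret BHr: ring BH by (rule BH.ring_T)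
  have \<rho>add: "\<rho> (x \<oplus>\<^bsub>B\<^esub> y) = \<rho> x \<oplus>\<^bsub>BH\<^esub> \<rho> y" if "x \<in> carrier B" "y \<in> carrier B" for x y
    by (rule module_hom_add[OF lin_rho that])
  have add: "x \<oplus>\<^bsub>B\<^esub> y \<in> carrier A" if "x \<in> carrier A" "y \<in> carrier A" for x y
    using that by (simp add: carrier_A \<rho>add BH.pure_add_left)
  have smult: "c \<odot>\<^bsub>B\<^esub> x \<in> carrier A" if "c \<in> carrier K" "x \<in> carrier A" for c x
    using that by (simp add: carrier_A module_hom_smult[OF lin_rho] BH.smult_pure)
  have mult: "x \<otimes>\<^bsub>B\<^esub> y \<in> carrier A" if "x \<in> carrier A" "y \<in> carrier A" for x y
    using that by (simp add: carrier_A rho_mult BH.mult_pure)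
  have one: "\<one>\<^bsub>B\<^esub> \<in> carrier A" by (simp add: carrier_A rho_one)
  have zero: "\<zero>\<^bsub>B\<^esub> \<in> carrier A" using smult[OF _ one, of "\<zero>\<^bsub>K\<^esub>"] by simp
  have neg: "\<ominus>\<^bsub>B\<^esub> x \<in> carrier A" if "x \<in> carrier A" for x
    using smult[of "\<ominus>\<^bsub>K\<^esub> \<one>\<^bsub>K\<^esub>" x] that A_B[OF that] by (simp add: B.smult_l_minus)
  have "\<exists>y\<in>carrier A. y \<oplus>\<^bsub>B\<^esub> x = \<zero>\<^bsub>B\<^esub>" if "x \<in> carrier A" for x
    using neg[OF that] A_B[OF that] B.l_neg by (intro bexI[of _ "\<ominus>\<^bsub>B\<^esub> x"]) auto
  then have ab: "abelian_group A"
    by (intro abelian_groupI) (simp_all add: add zero A_B B.a_ac)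
  interpret A: abelian_group A by (rule ab)
  interpret r: ring A
    by (intro ringI ab monoidI) (simp_all add: mult one A_B B.m_assoc B.l_distr B.r_distr)
  interpret m: module K A
    by (intro moduleI ab) (simp_all add: smult A_B B.smult_l_distr B.smult_r_distr B.smult_assoc1 H.is_cring)
  show ?thesis
    by unfold_locales (simp_all add: A_B B.smult_mult_left B.smult_mult_right)
qed

end

section \<open>The diagonal coaction and its coinvariants\<close>

lemma bilinear_map_opp: "bilinear_map K M (opp N) W \<phi> = bilinear_map K M N W \<phi>"
  unfolding bilinear_map_def module_hom_opp opp_simps ..

context bijective_comodule_algebra
begin

sublocale Bop: k_algebra K "opp B"
  by (rule k_algebra_opp) unfold_locales

sublocale Be: tensor_algebras K B "opp B"
  by unfold_locales

sublocale Bek: k_algebra K Be.T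
  by (rule Be.k_algebra_T)

sublocale BeH: tensor_algebras K Be.T H
  by unfold_locales

abbreviation "Be \<equiv> enveloping_algebra K B"
abbreviation "ptBe \<equiv> pure_tensor K B (opp B)"
abbreviation "BeH \<equiv> tensor_algebra K Be H"
abbreviation "ptBeH \<equiv> pure_tensor K Be H"
abbreviation "\<Gamma> \<equiv> ehresmann_schauenburg K H B \<rho>"
abbreviation "diag \<equiv> diagonal_coaction K H B \<rho>"

lemma opp_carrierI [lins]: "x \<in> carrier B \<Longrightarrow> x \<in> carrier (opp B)"
  by simp

lemma opp_targetI [lins]: "f \<in> module_hom K V B \<Longrightarrow> f \<in> module_hom K V (opp B)"
  by (simp add: module_hom_opp)

lemmas Be_lin_sum = Be.lin_tensor_sum[unfolded bilinear_map_opp]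
lemmas Be_sum_pure = Be.tensor_sum_pure[unfolded bilinear_map_opp opp_simps]

definition diag_pure where
  "diag_pure b b' = cosum BeH \<rho> (\<lambda>b0 b1. cosum BeH \<rho> (\<lambda>c0 c1. ptBeH (ptBe b0 c0) (b1 \<otimes>\<^bsub>H\<^esub> c1)) b') b"

lemma diag_def: "diag = tensor_sum BeH diag_pure"
  unfolding diagonal_coaction_def diag_pure_def cosum_def fun_eq_iff by simp

lemma bilinear_diag_pure: "bilinear_map K B B BeH diag_pure"
  unfolding diag_pure_def by (rule lins | assumption)+

lemma lin_diag: "diag \<in> module_hom K Be BeH"
  unfolding diag_def by (rule Be_lin_sum[OF BeH.module_T bilinear_diag_pure])

lemma diag_ptBe: "\<lbrakk>b \<in> carrier B; b' \<in> carrier B\<rbrakk> \<Longrightarrow> diag (ptBe b b') = diag_pure b b'"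
  unfolding diag_def by (rule Be_sum_pure[OF BeH.module_T bilinear_diag_pure])

lemma Gamma_iff: "t \<in> \<Gamma> \<longleftrightarrow> t \<in> carrier Be \<and> diag t = ptBeH t \<one>\<^bsub>H\<^esub>"
  unfolding ehresmann_schauenburg_def by simp

lemma sum_diag_pure:
  assumes W: "module K W" and \<phi>: "bilinear_map K Be H W \<phi>" and b: "b \<in> carrier B" and b': "b' \<in> carrier B"
  shows "tensor_sum W \<phi> (diag_pure b b') =
    cosum W \<rho> (\<lambda>b0 b1. cosum W \<rho> (\<lambda>c0 c1. \<phi> (ptBe b0 c0) (b1 \<otimes>\<^bsub>H\<^esub> c1)) b') b"
proof -
  note L = BeH.lin_tensor_sum[OF W \<phi>]
  have "tensor_sum W \<phi> (diag_pure b b') = cosum W \<rho> (\<lambda>b0 b1. tensor_sum W \<phi> (cosum BeH \<rho> (\<lambda>c0 c1. ptBeH (ptBe b0 c0) (b1 \<otimes>\<^bsub>H\<^esub> c1)) b')) b"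
    unfolding diag_pure_def by (rule hom_cosum[OF _ W L]; (rule lins b b' | assumption)+)
  also have "\<dots> = cosum W \<rho> (\<lambda>b0 b1. cosum W \<rho> (\<lambda>c0 c1. tensor_sum W \<phi> (ptBeH (ptBe b0 c0) (b1 \<otimes>\<^bsub>H\<^esub> c1))) b') b"
    by (rule cosum_cong, rule W, rule b, rule hom_cosum[OF _ W L]; (rule lins W b b' module_hom_closed[OF L] | assumption)+)
  also have "\<dots> = cosum W \<rho> (\<lambda>b0 b1. cosum W \<rho> (\<lambda>c0 c1. \<phi> (ptBe b0 c0) (b1 \<otimes>\<^bsub>H\<^esub> c1)) b') b"
    by (rule cosum_cong, rule W, rule b, rule cosum_cong, rule W, rule b', rule BeH.tensor_sum_pure[OF W \<phi>];
        (rule lins W b b' bilinear_map_closed[OF \<phi>] | assumption)+)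
  finally show ?thesis .
qed

definition mu where "mu = tensor_sum B (\<lambda>b b'. b \<otimes>\<^bsub>B\<^esub> b')"

lemma lin_mu: "mu \<in> module_hom K Be B"
  unfolding mu_def by (rule Be_lin_sum[OF B.k_module]; (rule lins | assumption)+)

lemma mu_ptBe: "\<lbrakk>b \<in> carrier B; b' \<in> carrier B\<rbrakk> \<Longrightarrow> mu (ptBe b b') = b \<otimes>\<^bsub>B\<^esub> b'"
  unfolding mu_def by (rule Be_sum_pure[OF B.k_module]; (rule lins | assumption)+)

text \<open>The multiplication \<open>B\<^bsup>e\<^esup> \<rightarrow> B\<close> is colinear for the diagonal coaction, so it maps coinvariants to
  coinvariants.\<close>

lemma mu_Gamma:
  assumes t: "t \<in> \<Gamma>" shows "mu t \<in> carrier A"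
proof -
  have tc: "t \<in> carrier Be" and td: "diag t = ptBeH t \<one>\<^bsub>H\<^esub>" using t by (simp_all add: Gamma_iff)
  note lm = module_hom_closed[OF lin_mu] lin_comp[OF lin_mu]
  let ?\<phi> = "\<lambda>t h. ptBH (mu t) h"
  have bil: "bilinear_map K Be H BH ?\<phi>" by (rule lins lm | assumption)+
  note L = BeH.lin_tensor_sum[OF BH.module_T bil]
  have "\<rho> (mu t) = tensor_sum BH ?\<phi> (diag t)"
  proof (rule Be.hom_eqI[where f = "\<lambda>t. \<rho> (mu t)" and g = "\<lambda>t. tensor_sum BH ?\<phi> (diag t)"])
    show "(\<lambda>t. \<rho> (mu t)) \<in> module_hom K Be BH" by (rule lins lm)+
    show "(\<lambda>t. tensor_sum BH ?\<phi> (diag t)) \<in> module_hom K Be BH" by (rule lin_comp[OF L lin_diag])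
    fix b b' assume b: "b \<in> carrier B" and "b' \<in> carrier (opp B)"
    then have b': "b' \<in> carrier B" by simp
    have "\<rho> (mu (ptBe b b')) = cosum BH \<rho> ptBH (b \<otimes>\<^bsub>B\<^esub> b')"
      using b b' by (simp add: mu_ptBe cosum_pure)
    also have "\<dots> = cosum BH \<rho> (\<lambda>b0 b1. cosum BH \<rho> (\<lambda>c0 c1. ptBH (b0 \<otimes>\<^bsub>B\<^esub> c0) (b1 \<otimes>\<^bsub>H\<^esub> c1)) b') b"
      by (rule cosum_mult; (rule lins b b' | assumption)+)
    also have "\<dots> = cosum BH \<rho> (\<lambda>b0 b1. cosum BH \<rho> (\<lambda>c0 c1. ?\<phi> (ptBe b0 c0) (b1 \<otimes>\<^bsub>H\<^esub> c1)) b') b"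
      by (rule cosum_cong, rule BH.module_T, rule b, rule cosum_cong, rule BH.module_T, rule b', subst mu_ptBe;
        (assumption | rule refl lins lm b b')+)
    also have "\<dots> = tensor_sum BH ?\<phi> (diag (ptBe b b'))"
      unfolding diag_ptBe[OF b b'] by (rule sum_diag_pure[OF BH.module_T bil b b', symmetric])
    finally show "\<rho> (mu (ptBe b b')) = tensor_sum BH ?\<phi> (diag (ptBe b b'))" .
  qed (rule tc)
  also have "\<dots> = ptBH (mu t) \<one>\<^bsub>H\<^esub>"
    unfolding td by (rule BeH.tensor_sum_pure[OF BH.module_T bil tc]) simp
  finally show ?thesis using lm(1)[OF tc] by (simp add: carrier_A)
qed

lemma diag_pure_A:
  assumes a: "a \<in> carrier A" and a': "a' \<in> carrier A" and b: "b \<in> carrier B" and b': "b' \<in> carrier B"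
  shows "diag_pure (a \<otimes>\<^bsub>B\<^esub> b) (b' \<otimes>\<^bsub>B\<^esub> a') =
    tensor_sum BeH (\<lambda>t h. ptBeH (ptBe a a' \<otimes>\<^bsub>Be\<^esub> t) h) (diag_pure b b')"
proof -
  note aa = a a' A_B[OF a] A_B[OF a']
  have "diag_pure (a \<otimes>\<^bsub>B\<^esub> b) (b' \<otimes>\<^bsub>B\<^esub> a') =
    cosum BeH \<rho> (\<lambda>b0 b1. cosum BeH \<rho> (\<lambda>c0 c1. ptBeH (ptBe (a \<otimes>\<^bsub>B\<^esub> b0) c0) (b1 \<otimes>\<^bsub>H\<^esub> c1)) (b' \<otimes>\<^bsub>B\<^esub> a')) b"
    unfolding diag_pure_def by (rule cosum_A_left; (rule lins b b' aa | assumption)+)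
  also have "\<dots> = cosum BeH \<rho> (\<lambda>b0 b1. cosum BeH \<rho> (\<lambda>c0 c1. ptBeH (ptBe (a \<otimes>\<^bsub>B\<^esub> b0) (c0 \<otimes>\<^bsub>B\<^esub> a')) (b1 \<otimes>\<^bsub>H\<^esub> c1)) b') b"
    by (rule cosum_cong, rule BeH.module_T, rule b, rule cosum_A_right; (rule lins b b' aa | assumption)+)
  also have "\<dots> = cosum BeH \<rho> (\<lambda>b0 b1. cosum BeH \<rho> (\<lambda>c0 c1. ptBeH (ptBe a a' \<otimes>\<^bsub>Be\<^esub> ptBe b0 c0) (b1 \<otimes>\<^bsub>H\<^esub> c1)) b') b"
    by (rule cosum_cong, rule BeH.module_T, rule b, rule cosum_cong, rule BeH.module_T, rule b', subst Be.mult_pure, unfold opp_simps;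
        (assumption | rule aa refl lins b b')+)
  also have "\<dots> = tensor_sum BeH (\<lambda>t h. ptBeH (ptBe a a' \<otimes>\<^bsub>Be\<^esub> t) h) (diag_pure b b')"
    by (rule sum_diag_pure[symmetric]; (rule lins b b' aa | assumption)+)
  finally show ?thesis .
qed

text \<open>Multiplication by \<open>a \<otimes> a'\<close> commutes with the diagonal coaction when \<open>a\<close> and \<open>a'\<close> are coinvariant.\<close>

lemma Gamma_mult_A:
  assumes a: "a \<in> carrier A" and a': "a' \<in> carrier A" and t: "t \<in> \<Gamma>"
  shows "ptBe a a' \<otimes>\<^bsub>Be\<^esub> t \<in> \<Gamma>"
proof -
  note aa = a a' A_B[OF a] A_B[OF a']
  have tc: "t \<in> carrier Be" and td: "diag t = ptBeH t \<one>\<^bsub>H\<^esub>" using t by (simp_all add: Gamma_iff)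
  let ?\<phi> = "\<lambda>t h. ptBeH (ptBe a a' \<otimes>\<^bsub>Be\<^esub> t) h"
  have bil: "bilinear_map K Be H BeH ?\<phi>" by (rule lins aa | assumption)+
  have lin: "(\<lambda>t. ptBe a a' \<otimes>\<^bsub>Be\<^esub> t) \<in> module_hom K Be Be" by (rule lins aa | assumption)+
  have "diag (ptBe a a' \<otimes>\<^bsub>Be\<^esub> t) = tensor_sum BeH ?\<phi> (diag t)"
  proof (rule Be.hom_eqI[OF lin_comp[OF lin_diag lin] lin_comp[OF BeH.lin_tensor_sum[OF BeH.module_T bil] lin_diag] tc])
    fix b b' assume b: "b \<in> carrier B" and "b' \<in> carrier (opp B)"
    then have b': "b' \<in> carrier B" by simp
    show "diag (ptBe a a' \<otimes>\<^bsub>Be\<^esub> ptBe b b') = tensor_sum BeH ?\<phi> (diag (ptBe b b'))"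
      using aa b b' by (simp add: Be.mult_pure diag_ptBe diag_pure_A)
  qed
  also have "\<dots> = ?\<phi> t \<one>\<^bsub>H\<^esub>"
    unfolding td by (rule BeH.tensor_sum_pure[OF BeH.module_T bil tc]) simp
  finally show ?thesis using module_hom_closed[OF lin tc] by (simp add: Gamma_iff)
qed

end

section \<open>The projection onto the Ehresmann-Schauenburg bialgebroid\<close>

locale total_integral = bijective_comodule_algebra K H \<Delta> \<epsilon> S B \<rho>
  for K :: "('k, 'x) ring_scheme" (structure) and H :: "('k, 'h, 'y) module_scheme" (structure)
    and \<Delta> \<epsilon> S and B :: "('k, 'b, 'z) module_scheme" (structure) and \<rho> +
  fixes j :: "'h \<Rightarrow> 'b"
  assumes lin_j: "j \<in> module_hom K H B"
    and j_colinear: "h \<in> carrier H \<Longrightarrow> \<rho> (j h) = cosum BH \<Delta> (\<lambda>a b. ptBH (j a) b) h"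
    and j_one: "j \<one>\<^bsub>H\<^esub> = \<one>\<^bsub>B\<^esub>"
begin

lemma j_closed [lins]: "h \<in> carrier H \<Longrightarrow> j h \<in> carrier B"
  by (rule module_hom_closed[OF lin_j])

lemmas [lins] = lin_comp[OF lin_j]

lemma cosum_j:
  assumes W: "module K W" and \<phi>: "bilinear_map K B H W \<phi>" and h: "h \<in> carrier H"
  shows "cosum W \<rho> \<phi> (j h) = cosum W \<Delta> (\<lambda>a b. \<phi> (j a) b) h"
proof -
  note L = BH.lin_tensor_sum[OF W \<phi>]
  have "cosum W \<rho> \<phi> (j h) = tensor_sum W \<phi> (cosum BH \<Delta> (\<lambda>a b. ptBH (j a) b) h)"
    unfolding cosum_def using j_colinear[OF h, unfolded cosum_def] by simp
  also have "\<dots> = cosum W \<Delta> (\<lambda>a b. tensor_sum W \<phi> (ptBH (j a) b)) h"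
    by (rule H.self.hom_cosum[OF _ W L h]; (rule lins | assumption)+)
  also have "\<dots> = cosum W \<Delta> (\<lambda>a b. \<phi> (j a) b) h"
    by (rule H.self.cosum_cong[OF W h]) (simp_all add: j_closed BH.tensor_sum_pure[OF W \<phi>] bilinear_map_closed[OF \<phi>])
  finally show ?thesis .
qed

text \<open>The map \<open>q b\<close> is a colinear map \<open>H \<rightarrow> B\<close> (\<open>cosum_q\<close>) that depends on \<open>b\<close> left \<open>A\<close>-linearly (\<open>q_A\<close>). Every
  \<open>b\<close> is recovered from the maps \<open>q b\<^sub>0\<close> (\<open>q_self\<close>).\<close>

definition q where "q b g = cosum B \<rho> (\<lambda>b0 b1. b0 \<otimes>\<^bsub>B\<^esub> j (S b1 \<otimes>\<^bsub>H\<^esub> g)) b"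

lemma q_closed [lins]: "\<lbrakk>b \<in> carrier B; g \<in> carrier H\<rbrakk> \<Longrightarrow> q b g \<in> carrier B"
  unfolding q_def by (rule lins | assumption)+

lemma lin_q_left [lins]: "\<lbrakk>f \<in> module_hom K V B; g \<in> carrier H\<rbrakk> \<Longrightarrow> (\<lambda>x. q (f x) g) \<in> module_hom K V B"
  unfolding q_def by (rule lins | assumption)+

lemma lin_q_right0: "b \<in> carrier B \<Longrightarrow> (\<lambda>g. q b g) \<in> module_hom K H B"
  unfolding q_def by (rule lins | assumption)+

lemma lin_q_right [lins]: "\<lbrakk>f \<in> module_hom K V H; b \<in> carrier B\<rbrakk> \<Longrightarrow> (\<lambda>x. q b (f x)) \<in> module_hom K V B"
  by (rule lin_comp[OF lin_q_right0])

lemma q_A: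
  assumes a: "a \<in> carrier A" and b: "b \<in> carrier B" and g: "g \<in> carrier H"
  shows "q (a \<otimes>\<^bsub>B\<^esub> b) g = a \<otimes>\<^bsub>B\<^esub> q b g"
proof -
  note aa = a A_B[OF a]
  have "q (a \<otimes>\<^bsub>B\<^esub> b) g = cosum B \<rho> (\<lambda>b0 b1. (a \<otimes>\<^bsub>B\<^esub> b0) \<otimes>\<^bsub>B\<^esub> j (S b1 \<otimes>\<^bsub>H\<^esub> g)) b"
    unfolding q_def by (rule cosum_A_left; (rule lins aa b g | assumption)+)
  also have "\<dots> = cosum B \<rho> (\<lambda>b0 b1. a \<otimes>\<^bsub>B\<^esub> (b0 \<otimes>\<^bsub>B\<^esub> j (S b1 \<otimes>\<^bsub>H\<^esub> g))) b"
    by (rule cosum_cong[OF B.k_module b]) (simp_all add: aa g j_closed H.antipode_closed B.m_assoc)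
  also have "\<dots> = a \<otimes>\<^bsub>B\<^esub> q b g"
    unfolding q_def by (rule hom_cosum[symmetric]; (rule lins aa b g | assumption)+)
  finally show ?thesis .
qed

text \<open>\<open>\<Sum> b\<^sub>0 j (S b\<^sub>1 b\<^sub>2) = b j 1\<close>.\<close>

lemma q_self:
  assumes b: "b \<in> carrier B"
  shows "cosum B \<rho> (\<lambda>b0 b1. q b0 b1) b = b"
proof -
  have "cosum B \<rho> (\<lambda>b0 b1. q b0 b1) b = cosum B \<rho> (\<lambda>b0 b1. cosum B \<Delta> (\<lambda>y z. b0 \<otimes>\<^bsub>B\<^esub> j (S y \<otimes>\<^bsub>H\<^esub> z)) b1) b"
    unfolding q_def by (rule cosum_coassoc; (rule lins b | assumption)+)
  also have "\<dots> = cosum B \<rho> (\<lambda>b0 b1. \<epsilon> b1 \<odot>\<^bsub>B\<^esub> (b0 \<otimes>\<^bsub>B\<^esub> j \<one>\<^bsub>H\<^esub>)) b"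
    by (rule cosum_cong, rule B.k_module, rule b, rule H.antipode_left_sum; (rule lins b | assumption)+)
  also have "\<dots> = b \<otimes>\<^bsub>B\<^esub> j \<one>\<^bsub>H\<^esub>"
    by (rule cosum_counit; (rule lins b | assumption)+)
  finally show ?thesis using b by (simp add: j_one)
qed

text \<open>\<open>\<rho> (q b g) = \<Sum> b\<^sub>0 j (S b\<^sub>3 g\<^sub>1) \<otimes> b\<^sub>1 S b\<^sub>2 g\<^sub>2\<close>, and \<open>b\<^sub>1 S b\<^sub>2\<close> cancels.\<close>

lemma cosum_q:
  assumes W: "module K W" and \<phi>: "bilinear_map K B H W \<phi>" and b: "b \<in> carrier B" and g: "g \<in> carrier H"
  shows "cosum W \<rho> \<phi> (q b g) = cosum W \<Delta> (\<lambda>g1 g2. \<phi> (q b g1) g2) g"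
proof -
  have \<phi>1: "\<And>c. c \<in> carrier B \<Longrightarrow> (\<lambda>x. \<phi> c x) \<in> module_hom K H W"
    and \<phi>2: "\<And>h. h \<in> carrier H \<Longrightarrow> (\<lambda>x. \<phi> x h) \<in> module_hom K B W"
    using \<phi> unfolding bilinear_map_def by auto
  note bi = W module_hom_closed[OF \<phi>1] lin_comp[OF \<phi>1] lin_comp[OF \<phi>2] b g
  have "cosum W \<rho> \<phi> (q b g) = cosum W \<rho> (\<lambda>b0 b1. cosum W \<rho> \<phi> (b0 \<otimes>\<^bsub>B\<^esub> j (S b1 \<otimes>\<^bsub>H\<^esub> g))) b"
    unfolding q_def by (rule hom_cosum[where f = "\<lambda>x. cosum W \<rho> \<phi> x"]; (rule lins bi \<phi> | assumption)+)
  also have "\<dots> = cosum W \<rho> (\<lambda>b0 b1. cosum W \<rho> (\<lambda>x y. cosum W \<rho> (\<lambda>u v. \<phi> (x \<otimes>\<^bsub>B\<^esub> u) (y \<otimes>\<^bsub>H\<^esub> v)) (j (S b1 \<otimes>\<^bsub>H\<^esub> g))) b0) b"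
    by (rule cosum_cong, rule W, rule b, rule cosum_mult; (rule lins bi \<phi> | assumption)+)
  also have "\<dots> = cosum W \<rho> (\<lambda>b0 b1. cosum W \<rho> (\<lambda>x y. cosum W \<Delta> (\<lambda>u v. \<phi> (x \<otimes>\<^bsub>B\<^esub> j u) (y \<otimes>\<^bsub>H\<^esub> v)) (S b1 \<otimes>\<^bsub>H\<^esub> g)) b0) b"
    by (rule cosum_cong, rule W, rule b, rule cosum_cong, rule W, assumption, rule cosum_j; (rule lins bi | assumption)+)
  also have "\<dots> = cosum W \<rho> (\<lambda>b0 b1. cosum W \<rho> (\<lambda>x y. cosum W \<Delta> (\<lambda>s t. cosum W \<Delta> (\<lambda>g1 g2.
      \<phi> (x \<otimes>\<^bsub>B\<^esub> j (s \<otimes>\<^bsub>H\<^esub> g1)) (y \<otimes>\<^bsub>H\<^esub> (t \<otimes>\<^bsub>H\<^esub> g2))) g) (S b1)) b0) b"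
    by (rule cosum_cong, rule W, rule b, rule cosum_cong, rule W, assumption, rule H.self.cosum_mult; (rule lins bi | assumption)+)
  also have "\<dots> = cosum W \<rho> (\<lambda>b0 b1. cosum W \<rho> (\<lambda>x y. cosum W \<Delta> (\<lambda>p r. cosum W \<Delta> (\<lambda>g1 g2.
      \<phi> (x \<otimes>\<^bsub>B\<^esub> j (S r \<otimes>\<^bsub>H\<^esub> g1)) (y \<otimes>\<^bsub>H\<^esub> (S p \<otimes>\<^bsub>H\<^esub> g2))) g) b1) b0) b"
    by (rule cosum_cong, rule W, rule b, rule cosum_cong, rule W, assumption, rule H.antipode_comult; (rule lins bi | assumption)+)
  also have "\<dots> = cosum W \<rho> (\<lambda>b0 b1. cosum W \<Delta> (\<lambda>y z. cosum W \<Delta> (\<lambda>p r. cosum W \<Delta> (\<lambda>g1 g2.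
      \<phi> (b0 \<otimes>\<^bsub>B\<^esub> j (S r \<otimes>\<^bsub>H\<^esub> g1)) (y \<otimes>\<^bsub>H\<^esub> (S p \<otimes>\<^bsub>H\<^esub> g2))) g) z) b1) b"
    by (rule cosum_coassoc; (rule lins bi | assumption)+)
  also have "\<dots> = cosum W \<rho> (\<lambda>b0 b1. cosum W \<Delta> (\<lambda>w r. cosum W \<Delta> (\<lambda>y p. cosum W \<Delta> (\<lambda>g1 g2.
      \<phi> (b0 \<otimes>\<^bsub>B\<^esub> j (S r \<otimes>\<^bsub>H\<^esub> g1)) (y \<otimes>\<^bsub>H\<^esub> (S p \<otimes>\<^bsub>H\<^esub> g2))) g) w) b1) b"
    by (rule cosum_cong, rule W, rule b, rule H.self.cosum_coassoc[symmetric]; (rule lins bi | assumption)+)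
  also have "\<dots> = cosum W \<rho> (\<lambda>b0 b1. cosum W \<Delta> (\<lambda>w r. cosum W \<Delta> (\<lambda>y p. cosum W \<Delta> (\<lambda>g1 g2.
      \<phi> (b0 \<otimes>\<^bsub>B\<^esub> j (S r \<otimes>\<^bsub>H\<^esub> g1)) ((y \<otimes>\<^bsub>H\<^esub> S p) \<otimes>\<^bsub>H\<^esub> g2)) g) w) b1) b"
    by (rule cosum_cong, rule W, rule b, rule H.self.cosum_cong, rule W, assumption, rule H.self.cosum_cong, rule W, assumption,
        rule H.self.cosum_cong, rule W, rule g, subst H.m_assoc; (assumption | rule refl lins bi)+)
  also have "\<dots> = cosum W \<rho> (\<lambda>b0 b1. cosum W \<Delta> (\<lambda>w r. \<epsilon> w \<odot>\<^bsub>W\<^esub> cosum W \<Delta> (\<lambda>g1 g2.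
      \<phi> (b0 \<otimes>\<^bsub>B\<^esub> j (S r \<otimes>\<^bsub>H\<^esub> g1)) (\<one>\<^bsub>H\<^esub> \<otimes>\<^bsub>H\<^esub> g2)) g) b1) b"
    by (rule cosum_cong, rule W, rule b, rule H.self.cosum_cong, rule W, assumption,
        rule H.antipode_right_sum[where f = "\<lambda>z. cosum W \<Delta> (\<lambda>g1 g2. \<phi> (_ \<otimes>\<^bsub>B\<^esub> j (S _ \<otimes>\<^bsub>H\<^esub> g1)) (z \<otimes>\<^bsub>H\<^esub> g2)) g"]; (rule lins bi | assumption)+)
  also have "\<dots> = cosum W \<rho> (\<lambda>b0 b1. cosum W \<Delta> (\<lambda>g1 g2.
      \<phi> (b0 \<otimes>\<^bsub>B\<^esub> j (S b1 \<otimes>\<^bsub>H\<^esub> g1)) (\<one>\<^bsub>H\<^esub> \<otimes>\<^bsub>H\<^esub> g2)) g) b"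
    by (rule cosum_cong, rule W, rule b, rule H.counit_left_sum; (rule lins bi | assumption)+)
  also have "\<dots> = cosum W \<Delta> (\<lambda>g1 g2. cosum W \<rho> (\<lambda>b0 b1.
      \<phi> (b0 \<otimes>\<^bsub>B\<^esub> j (S b1 \<otimes>\<^bsub>H\<^esub> g1)) (\<one>\<^bsub>H\<^esub> \<otimes>\<^bsub>H\<^esub> g2)) b) g"
    by (rule swap_BH; (rule lins bi | assumption)+)
  also have "\<dots> = cosum W \<Delta> (\<lambda>g1 g2. \<phi> (q b g1) (\<one>\<^bsub>H\<^esub> \<otimes>\<^bsub>H\<^esub> g2)) g"
    unfolding q_def
    by (rule H.self.cosum_cong, rule W, rule g, rule hom_cosum[where f = "\<lambda>x. \<phi> x _", symmetric]; (rule lins bi | assumption)+)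
  also have "\<dots> = cosum W \<Delta> (\<lambda>g1 g2. \<phi> (q b g1) g2) g"
    by (rule H.self.cosum_cong, rule W, rule g, simp; (rule lins bi | assumption)+)
  finally show ?thesis .
qed

text \<open>\<open>P\<close> is the projection of \<open>B\<^bsup>e\<^esup>\<close> onto \<open>\<Gamma>\<close>, and \<open>P0\<close> is its restriction to pure tensors. The coaction of
  \<open>q b (S\<^sup>-\<^sup>1 b'\<^sub>1)\<close> produces a factor \<open>S\<^sup>-\<^sup>1 b'\<^sub>1\<close>, which cancels against the coaction of \<open>b'\<^sub>0\<close> (\<open>diag_P0\<close>).\<close>

definition P0 where "P0 b b' = cosum Be \<rho> (\<lambda>c0 c1. ptBe (q b (Si c1)) c0) b'"

lemma P0_closed: "\<lbrakk>b \<in> carrier B; b' \<in> carrier B\<rbrakk> \<Longrightarrow> P0 b b' \<in> carrier Be"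
  unfolding P0_def by (rule lins | assumption)+

lemma bilinear_P0: "bilinear_map K B B Be P0"
  unfolding P0_def by (rule lins | assumption)+

definition P where "P = tensor_sum Be P0"

lemma lin_P: "P \<in> module_hom K Be Be"
  unfolding P_def by (rule Be_lin_sum[OF Be.module_T bilinear_P0])

lemma P_closed: "t \<in> carrier Be \<Longrightarrow> P t \<in> carrier Be"
  by (rule module_hom_closed[OF lin_P])

lemma P_ptBe: "\<lbrakk>b \<in> carrier B; b' \<in> carrier B\<rbrakk> \<Longrightarrow> P (ptBe b b') = P0 b b'"
  unfolding P_def by (rule Be_sum_pure[OF Be.module_T bilinear_P0])

lemma diag_P0:
  assumes b: "b \<in> carrier B" and b': "b' \<in> carrier B"
  shows "diag (P0 b b') = ptBeH (P0 b b') \<one>\<^bsub>H\<^esub>"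
proof -
  note W = BeH.module_T
  have "diag (P0 b b') = cosum BeH \<rho> (\<lambda>c0 c1. diag (ptBe (q b (Si c1)) c0)) b'"
    unfolding P0_def by (rule hom_cosum[OF _ W lin_diag]; (rule lins b b' | assumption)+)
  also have "\<dots> = cosum BeH \<rho> (\<lambda>c0 c1. cosum BeH \<rho> (\<lambda>u v. cosum BeH \<rho> (\<lambda>x y. ptBeH (ptBe u x) (v \<otimes>\<^bsub>H\<^esub> y)) c0) (q b (Si c1))) b'"
    by (rule cosum_cong, rule W, rule b', subst diag_ptBe, unfold diag_pure_def; (assumption | rule refl lins b b')+)
  also have "\<dots> = cosum BeH \<rho> (\<lambda>c0 c1. cosum BeH \<Delta> (\<lambda>g1 g2. cosum BeH \<rho> (\<lambda>x y. ptBeH (ptBe (q b g1) x) (g2 \<otimes>\<^bsub>H\<^esub> y)) c0) (Si c1)) b'"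
    by (rule cosum_cong, rule W, rule b', rule cosum_q; (rule lins b b' | assumption)+)
  also have "\<dots> = cosum BeH \<rho> (\<lambda>c0 c1. cosum BeH \<Delta> (\<lambda>p r. cosum BeH \<rho> (\<lambda>x y. ptBeH (ptBe (q b (Si r)) x) (Si p \<otimes>\<^bsub>H\<^esub> y)) c0) c1) b'"
    by (rule cosum_cong, rule W, rule b', rule H.Si_comult; (rule lins b b' | assumption)+)
  also have "\<dots> = cosum BeH \<rho> (\<lambda>c0 c1. cosum BeH \<rho> (\<lambda>x y. cosum BeH \<Delta> (\<lambda>p r. ptBeH (ptBe (q b (Si r)) x) (Si p \<otimes>\<^bsub>H\<^esub> y)) c1) c0) b'"
    by (rule cosum_cong, rule W, rule b', rule swap_HB; (rule lins b b' | assumption)+)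
  also have "\<dots> = cosum BeH \<rho> (\<lambda>c0 c1. cosum BeH \<Delta> (\<lambda>y z. cosum BeH \<Delta> (\<lambda>p r. ptBeH (ptBe (q b (Si r)) c0) (Si p \<otimes>\<^bsub>H\<^esub> y)) z) c1) b'"
    by (rule cosum_coassoc; (rule lins b b' | assumption)+)
  also have "\<dots> = cosum BeH \<rho> (\<lambda>c0 c1. cosum BeH \<Delta> (\<lambda>w r. cosum BeH \<Delta> (\<lambda>y p. ptBeH (ptBe (q b (Si r)) c0) (Si p \<otimes>\<^bsub>H\<^esub> y)) w) c1) b'"
    by (rule cosum_cong, rule W, rule b', rule H.self.cosum_coassoc[symmetric]; (rule lins b b' | assumption)+)
  also have "\<dots> = cosum BeH \<rho> (\<lambda>c0 c1. cosum BeH \<Delta> (\<lambda>w r. \<epsilon> w \<odot>\<^bsub>BeH\<^esub> ptBeH (ptBe (q b (Si r)) c0) \<one>\<^bsub>H\<^esub>) c1) b'"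
    by (rule cosum_cong, rule W, rule b', rule H.self.cosum_cong, rule W, assumption, rule H.Si_left_sum; (rule lins b b' | assumption)+)
  also have "\<dots> = cosum BeH \<rho> (\<lambda>c0 c1. ptBeH (ptBe (q b (Si c1)) c0) \<one>\<^bsub>H\<^esub>) b'"
    by (rule cosum_cong, rule W, rule b', rule H.counit_left_sum; (rule lins b b' | assumption)+)
  also have "\<dots> = ptBeH (P0 b b') \<one>\<^bsub>H\<^esub>"
    unfolding P0_def by (rule hom_cosum[where f = "\<lambda>t. ptBeH t \<one>\<^bsub>H\<^esub>", symmetric]; (rule lins b b' | assumption)+)
  finally show ?thesis .
qed

lemma P0_Gamma: "\<lbrakk>b \<in> carrier B; b' \<in> carrier B\<rbrakk> \<Longrightarrow> P0 b b' \<in> \<Gamma>"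
  by (simp add: Gamma_iff P0_closed diag_P0)

lemma P_Gamma:
  assumes t: "t \<in> carrier Be" shows "P t \<in> \<Gamma>"
proof -
  have "diag (P t) = ptBeH (P t) \<one>\<^bsub>H\<^esub>"
  proof (rule Be.hom_eqI[OF lin_comp[OF lin_diag lin_P] BeH.lin_pure_left[OF lin_P H.one_closed] t])
    fix b b' assume "b \<in> carrier B" "b' \<in> carrier (opp B)"
    then show "diag (P (ptBe b b')) = ptBeH (P (ptBe b b')) \<one>\<^bsub>H\<^esub>"
      by (simp add: P_ptBe diag_P0)
  qed
  then show ?thesis by (simp add: Gamma_iff P_closed t)
qed

text \<open>On \<open>B\<^bsup>e\<^esup>\<close> the map \<open>P\<close> is the composite of the diagonal coaction with the map \<open>\<chi>\<close> that sends
  \<open>(b \<otimes> b') \<otimes> g\<close> to \<open>\<Sum> q b\<^sub>0 (S\<^sup>-\<^sup>1 (S b\<^sub>1 g)) \<otimes> b'\<close>. An element \<open>t\<close> of \<open>\<Gamma>\<close> has the diagonal coaction \<open>t \<otimes> 1\<close>,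
  and \<open>\<chi> (t \<otimes> 1) = t\<close> because \<open>\<Sum> q b\<^sub>0 b\<^sub>1 = b\<close>.\<close>

lemma P_Gamma_id:
  assumes t: "t \<in> \<Gamma>" shows "P t = t"
proof -
  note W = Be.module_T
  have tc: "t \<in> carrier Be" and td: "diag t = ptBeH t \<one>\<^bsub>H\<^esub>" using t by (simp_all add: Gamma_iff)
  define f where "f = (\<lambda>g b b'. cosum Be \<rho> (\<lambda>b0 b1. ptBe (q b0 (Si (S b1 \<otimes>\<^bsub>H\<^esub> g))) b') b)"
  define \<chi> where "\<chi> = (\<lambda>t g. tensor_sum Be (f g) t)"
  have bilf: "bilinear_map K B B Be (f g)" if "g \<in> carrier H" for g
    unfolding f_def by (rule lins that | assumption)+
  have \<chi>1: "(\<lambda>t. \<chi> t g) \<in> module_hom K Be Be" if "g \<in> carrier H" for g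
    unfolding \<chi>_def by (rule Be_lin_sum[OF W bilf[OF that]])
  have \<chi>2: "(\<lambda>g. \<chi> t g) \<in> module_hom K H Be" if "t \<in> carrier Be" for t
    unfolding \<chi>_def
  proof (rule Be.lin_tensor_sum_param[OF W that])
    show "(\<lambda>g. f g b b') \<in> module_hom K H Be" if b: "b \<in> carrier B" and b': "b' \<in> carrier (opp B)" for b b'
      unfolding f_def by (rule lins b b' | assumption)+
  qed (simp_all add: H.abelian_group_axioms)
  have \<chi>p: "\<chi> (ptBe b b') g = f g b b'" if "b \<in> carrier B" "b' \<in> carrier B" "g \<in> carrier H" for b b' g
    unfolding \<chi>_def by (rule Be_sum_pure[OF W bilf]) (use that in simp_all)
  have bil: "bilinear_map K Be H Be \<chi>" by (rule bilinear_mapI[OF \<chi>2 \<chi>1])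
  note L = BeH.lin_tensor_sum[OF W bil]
  have "P t = tensor_sum Be \<chi> (diag t)"
  proof (rule Be.hom_eqI[OF lin_P lin_comp[OF L lin_diag] tc])
    fix b b' assume b: "b \<in> carrier B" and "b' \<in> carrier (opp B)"
    then have b': "b' \<in> carrier B" by simp
    have "tensor_sum Be \<chi> (diag (ptBe b b')) =
        cosum Be \<rho> (\<lambda>b0 b1. cosum Be \<rho> (\<lambda>c0 c1. \<chi> (ptBe b0 c0) (b1 \<otimes>\<^bsub>H\<^esub> c1)) b') b"
      unfolding diag_ptBe[OF b b'] by (rule sum_diag_pure[OF W bil b b'])
    also have "\<dots> = cosum Be \<rho> (\<lambda>b0 b1. cosum Be \<rho> (\<lambda>c0 c1. cosum Be \<rho>
        (\<lambda>u v. ptBe (q u (Si (S v \<otimes>\<^bsub>H\<^esub> (b1 \<otimes>\<^bsub>H\<^esub> c1)))) c0) b0) b') b"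
      by (rule cosum_cong, rule W, rule b, rule cosum_cong, rule W, rule b', subst \<chi>p, unfold f_def; (assumption | rule refl lins b b')+)
    also have "\<dots> = cosum Be \<rho> (\<lambda>c0 c1. cosum Be \<rho> (\<lambda>b0 b1. cosum Be \<rho>
        (\<lambda>u v. ptBe (q u (Si (S v \<otimes>\<^bsub>H\<^esub> (b1 \<otimes>\<^bsub>H\<^esub> c1)))) c0) b0) b) b'"
      by (rule swap_BB; (rule lins b b' | assumption)+)
    also have "\<dots> = cosum Be \<rho> (\<lambda>c0 c1. cosum Be \<rho> (\<lambda>b0 b1. cosum Be \<Delta>
        (\<lambda>v z. ptBe (q b0 (Si (S v \<otimes>\<^bsub>H\<^esub> (z \<otimes>\<^bsub>H\<^esub> c1)))) c0) b1) b) b'"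
      by (rule cosum_cong, rule W, rule b', rule cosum_coassoc; (rule lins b b' | assumption)+)
    also have "\<dots> = cosum Be \<rho> (\<lambda>c0 c1. cosum Be \<rho> (\<lambda>b0 b1. cosum Be \<Delta>
        (\<lambda>v z. ptBe (q b0 (Si ((S v \<otimes>\<^bsub>H\<^esub> z) \<otimes>\<^bsub>H\<^esub> c1))) c0) b1) b) b'"
      by (rule cosum_cong, rule W, rule b', rule cosum_cong, rule W, rule b, rule H.self.cosum_cong, rule W, assumption,
          subst H.m_assoc; (assumption | rule refl lins b b')+)
    also have "\<dots> = cosum Be \<rho> (\<lambda>c0 c1. cosum Be \<rho> (\<lambda>b0 b1. \<epsilon> b1 \<odot>\<^bsub>Be\<^esub> ptBe (q b0 (Si (\<one>\<^bsub>H\<^esub> \<otimes>\<^bsub>H\<^esub> c1))) c0) b) b'"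
      by (rule cosum_cong, rule W, rule b', rule cosum_cong, rule W, rule b,
        rule H.antipode_left_sum[where f = "\<lambda>w. ptBe (q _ (Si (w \<otimes>\<^bsub>H\<^esub> _))) _"]; (rule lins b b' | assumption)+)
    also have "\<dots> = cosum Be \<rho> (\<lambda>c0 c1. ptBe (q b (Si (\<one>\<^bsub>H\<^esub> \<otimes>\<^bsub>H\<^esub> c1))) c0) b'"
      by (rule cosum_cong, rule W, rule b', rule cosum_counit; (rule lins b b' | assumption)+)
    also have "\<dots> = P0 b b'"
      unfolding P0_def by (rule cosum_cong, rule W, rule b', simp; (rule lins b b' | assumption)+)
    finally show "P (ptBe b b') = tensor_sum Be \<chi> (diag (ptBe b b'))" using b b' by (simp add: P_ptBe)
  qed
  also have "\<dots> = \<chi> t \<one>\<^bsub>H\<^esub>" unfolding td by (rule BeH.tensor_sum_pure[OF W bil tc H.one_closed])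
  also have "\<dots> = t"
  proof (rule Be.hom_eqI[OF \<chi>1[OF H.one_closed] lin_id tc])
    fix b b' assume b: "b \<in> carrier B" and "b' \<in> carrier (opp B)"
    then have b': "b' \<in> carrier B" by simp
    have "\<chi> (ptBe b b') \<one>\<^bsub>H\<^esub> = cosum Be \<rho> (\<lambda>b0 b1. ptBe (q b0 b1) b') b"
      unfolding \<chi>p[OF b b' H.one_closed] f_def
      by (rule cosum_cong, rule W, rule b, simp add: H.Si_S H.antipode_closed; (rule lins b b' | assumption)+)
    also have "\<dots> = ptBe (cosum B \<rho> (\<lambda>b0 b1. q b0 b1) b) b'"
      by (rule hom_cosum[where f = "\<lambda>t. ptBe t b'", symmetric]; (rule lins b b' | assumption)+)
    finally show "\<chi> (ptBe b b') \<one>\<^bsub>H\<^esub> = ptBe b b'" by (simp add: q_self b)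
  qed
  finally show ?thesis .
qed

lemma P_A:
  assumes a: "a \<in> carrier A" and a': "a' \<in> carrier A" and t: "t \<in> carrier Be"
  shows "P (ptBe a a' \<otimes>\<^bsub>Be\<^esub> t) = ptBe a a' \<otimes>\<^bsub>Be\<^esub> P t"
proof -
  note aa = a a' A_B[OF a] A_B[OF a'] and W = Be.module_T
  have lin: "(\<lambda>t. ptBe a a' \<otimes>\<^bsub>Be\<^esub> t) \<in> module_hom K Be Be" by (rule lins aa | assumption)+
  show ?thesis
  proof (rule Be.hom_eqI[OF lin_comp[OF lin_P lin] lin_comp[OF lin lin_P] t])
    fix b b' assume b: "b \<in> carrier B" and "b' \<in> carrier (opp B)"
    then have b': "b' \<in> carrier B" by simp
    have "P (ptBe a a' \<otimes>\<^bsub>Be\<^esub> ptBe b b') = P0 (a \<otimes>\<^bsub>B\<^esub> b) (b' \<otimes>\<^bsub>B\<^esub> a')"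
      using aa b b' by (simp add: Be.mult_pure P_ptBe)
    also have "\<dots> = cosum Be \<rho> (\<lambda>c0 c1. ptBe (q (a \<otimes>\<^bsub>B\<^esub> b) (Si c1)) (c0 \<otimes>\<^bsub>B\<^esub> a')) b'"
      unfolding P0_def by (rule cosum_A_right; (rule lins aa b b' | assumption)+)
    also have "\<dots> = cosum Be \<rho> (\<lambda>c0 c1. ptBe a a' \<otimes>\<^bsub>Be\<^esub> ptBe (q b (Si c1)) c0) b'"
      by (rule cosum_cong, rule W, rule b', subst Be.mult_pure, unfold opp_simps, (assumption | rule refl lins aa b b')+,
        subst q_A; (assumption | rule refl lins aa b b')+)
    also have "\<dots> = ptBe a a' \<otimes>\<^bsub>Be\<^esub> P0 b b'"
      unfolding P0_def by (rule hom_cosum[symmetric]; (rule lins aa b b' | assumption)+)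
    finally show "P (ptBe a a' \<otimes>\<^bsub>Be\<^esub> ptBe b b') = ptBe a a' \<otimes>\<^bsub>Be\<^esub> P (ptBe b b')"
      using b b' by (simp add: P_ptBe)
  qed
qed

text \<open>This is the projection followed by the multiplication of \<open>B\<close> (\<open>F_mu\<close>). Its values lie in \<open>A\<close> because
  the multiplication maps \<open>\<Gamma>\<close> to \<open>A\<close>.\<close>

definition F where "F b x = cosum B \<rho> (\<lambda>x0 x1. q b (Si x1) \<otimes>\<^bsub>B\<^esub> x0) x"

lemma F_mu: "\<lbrakk>b \<in> carrier B; x \<in> carrier B\<rbrakk> \<Longrightarrow> F b x = mu (P0 b x)"
proof -
  assume b: "b \<in> carrier B" and x: "x \<in> carrier B"
  have "mu (P0 b x) = cosum B \<rho> (\<lambda>x0 x1. mu (ptBe (q b (Si x1)) x0)) x"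
    unfolding P0_def by (rule hom_cosum[OF _ _ lin_mu]; (rule lins b x | assumption)+)
  also have "\<dots> = F b x"
    unfolding F_def by (rule cosum_cong, rule B.k_module, rule x, rule mu_ptBe; (rule lins b x | assumption)+)
  finally show ?thesis ..
qed

lemma F_A: "\<lbrakk>b \<in> carrier B; x \<in> carrier B\<rbrakk> \<Longrightarrow> F b x \<in> carrier A"
  by (simp add: F_mu mu_Gamma P0_Gamma)

lemma F_closed [lins]: "\<lbrakk>b \<in> carrier B; x \<in> carrier B\<rbrakk> \<Longrightarrow> F b x \<in> carrier B"
  by (rule A_B[OF F_A])

lemma bilinear_F: "bilinear_map K B B B F"
  unfolding F_def by (rule lins | assumption)+

lemma F_A_left:
  assumes a: "a \<in> carrier A" and b: "b \<in> carrier B" and x: "x \<in> carrier B"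
  shows "F (a \<otimes>\<^bsub>B\<^esub> b) x = a \<otimes>\<^bsub>B\<^esub> F b x"
proof -
  note aa = a A_B[OF a]
  have "F (a \<otimes>\<^bsub>B\<^esub> b) x = cosum B \<rho> (\<lambda>x0 x1. a \<otimes>\<^bsub>B\<^esub> (q b (Si x1) \<otimes>\<^bsub>B\<^esub> x0)) x"
    unfolding F_def
    by (rule cosum_cong[OF B.k_module x]) (simp_all add: aa b q_A q_closed H.Si_closed B.m_assoc)
  also have "\<dots> = a \<otimes>\<^bsub>B\<^esub> F b x"
    unfolding F_def by (rule hom_cosum[symmetric]; (rule lins aa b x | assumption)+)
  finally show ?thesis .
qed

lemma F_A_right:
  assumes a: "a \<in> carrier A" and b: "b \<in> carrier B" and x: "x \<in> carrier B"
  shows "F b (x \<otimes>\<^bsub>B\<^esub> a) = F b x \<otimes>\<^bsub>B\<^esub> a"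
proof -
  note aa = a A_B[OF a]
  have "F b (x \<otimes>\<^bsub>B\<^esub> a) = cosum B \<rho> (\<lambda>x0 x1. q b (Si x1) \<otimes>\<^bsub>B\<^esub> (x0 \<otimes>\<^bsub>B\<^esub> a)) x"
    unfolding F_def by (rule cosum_A_right; (rule lins aa b x | assumption)+)
  also have "\<dots> = cosum B \<rho> (\<lambda>x0 x1. (q b (Si x1) \<otimes>\<^bsub>B\<^esub> x0) \<otimes>\<^bsub>B\<^esub> a) x"
    by (rule cosum_cong[OF B.k_module x]) (simp_all add: aa b q_closed H.Si_closed B.m_assoc)
  also have "\<dots> = F b x \<otimes>\<^bsub>B\<^esub> a"
    unfolding F_def by (rule hom_cosum[symmetric]; (rule lins aa b x | assumption)+)
  finally show ?thesis .
qed

text \<open>There is a linear map on \<open>B \<otimes> H\<close> that sends \<open>\<Sum> u v\<^sub>0 \<otimes> v\<^sub>1\<close> to \<open>F c u v\<close>: by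
  definition \<open>F c u = \<Sum> q c (S\<^sup>-\<^sup>1 u\<^sub>1) u\<^sub>0\<close>, and \<open>galois_shift\<close> provides the coaction of \<open>u\<close>. The claim compares its values on both sides of the
  last hypothesis.\<close>

lemma F_galois_left:
  fixes n :: nat
  assumes c: "c \<in> carrier B" and h: "h \<in> carrier H"
    and x: "x \<in> {..<n} \<rightarrow> carrier B" and y: "y \<in> {..<n} \<rightarrow> carrier B"
    and eq: "finsum BH (\<lambda>i. galois (x i) (y i)) {..<n} = ptBH \<one>\<^bsub>B\<^esub> h"
  shows "finsum B (\<lambda>i. F c (x i) \<otimes>\<^bsub>B\<^esub> y i) {..<n} = q c h"
proof -
  note W = B.k_module
  define \<phi> where "\<phi> = (\<lambda>c' k l. \<epsilon> k \<odot>\<^bsub>B\<^esub> (q c (Si l) \<otimes>\<^bsub>B\<^esub> c'))"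
  have tri: "trilinear B \<phi>"
    unfolding \<phi>_def by (rule trilinearI; (rule lins c | assumption)+)
  have summand: "galois_shift B \<phi> (galois u v) = F c u \<otimes>\<^bsub>B\<^esub> v" if u: "u \<in> carrier B" and v: "v \<in> carrier B" for u v
  proof -
    have "galois_shift B \<phi> (galois u v) = cosum B \<rho> (\<lambda>u0 u1. cosum B \<rho> (\<lambda>v0 v1. \<epsilon> v1 \<odot>\<^bsub>B\<^esub> (q c (Si u1) \<otimes>\<^bsub>B\<^esub> (u0 \<otimes>\<^bsub>B\<^esub> v0))) v) u"
      using galois_shift_galois[OF W tri u v] unfolding \<phi>_def .
    also have "\<dots> = cosum B \<rho> (\<lambda>u0 u1. q c (Si u1) \<otimes>\<^bsub>B\<^esub> (u0 \<otimes>\<^bsub>B\<^esub> v)) u"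
      by (rule cosum_cong, rule W, rule u, rule cosum_counit; (rule lins c u v | assumption)+)
    also have "\<dots> = cosum B \<rho> (\<lambda>u0 u1. (q c (Si u1) \<otimes>\<^bsub>B\<^esub> u0) \<otimes>\<^bsub>B\<^esub> v) u"
      by (rule cosum_cong[OF W u]) (simp_all add: c u v q_closed H.Si_closed B.m_assoc)
    also have "\<dots> = F c u \<otimes>\<^bsub>B\<^esub> v"
      unfolding F_def by (rule hom_cosum[where f = "\<lambda>z. z \<otimes>\<^bsub>B\<^esub> v", symmetric]; (rule lins c u v | assumption)+)
    finally show ?thesis .
  qed
  have "finsum B (\<lambda>i. F c (x i) \<otimes>\<^bsub>B\<^esub> y i) {..<n} = finsum B (\<lambda>i. galois_shift B \<phi> (galois (x i) (y i))) {..<n}"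
    by (rule B.finsum_cong') (use x y in \<open>auto simp: summand Pi_iff intro!: B.m_closed F_closed c\<close>)
  also have "\<dots> = galois_shift B \<phi> (finsum BH (\<lambda>i. galois (x i) (y i)) {..<n})"
    by (rule module_hom_finsum[symmetric, OF BH.abelian_group_T B.abelian_group_axioms lin_galois_shift[OF W tri]])
      (use x y in \<open>auto simp: Pi_iff intro!: galois_closed\<close>)
  also have "\<dots> = galois_shift B \<phi> (ptBH \<one>\<^bsub>B\<^esub> h)" unfolding eq ..
  also have "\<dots> = cosum B \<rho> (\<lambda>c0 c1. cosum B \<Delta> (\<lambda>k1 k2. \<epsilon> k2 \<odot>\<^bsub>B\<^esub> (q c (Si (c1 \<otimes>\<^bsub>H\<^esub> S k1)) \<otimes>\<^bsub>B\<^esub> c0)) h) \<one>\<^bsub>B\<^esub>"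
    using galois_shift_pure[OF W tri B.one_closed h] unfolding \<phi>_def .
  also have "\<dots> = cosum B \<Delta> (\<lambda>k1 k2. \<epsilon> k2 \<odot>\<^bsub>B\<^esub> (q c (Si (\<one>\<^bsub>H\<^esub> \<otimes>\<^bsub>H\<^esub> S k1)) \<otimes>\<^bsub>B\<^esub> \<one>\<^bsub>B\<^esub>)) h"
    by (rule cosum_one; (rule lins c h | assumption)+)
  also have "\<dots> = q c (Si (\<one>\<^bsub>H\<^esub> \<otimes>\<^bsub>H\<^esub> S h)) \<otimes>\<^bsub>B\<^esub> \<one>\<^bsub>B\<^esub>"
    by (rule H.self.cosum_counit; (rule lins c h | assumption)+)
  finally show ?thesis using c h by (simp add: H.antipode_closed H.Si_S q_closed)
qed

text \<open>Here the linear map is \<open>p \<otimes> k \<mapsto> \<Sum> p j (S k S\<^sup>-\<^sup>1 c\<^sub>1) c\<^sub>0\<close>, which sends \<open>\<Sum> u v\<^sub>0 \<otimes> v\<^sub>1\<close> to \<open>u F v c\<close>.\<close>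

lemma F_galois_right:
  fixes n :: nat
  assumes c: "c \<in> carrier B" and h: "h \<in> carrier H"
    and x: "x \<in> {..<n} \<rightarrow> carrier B" and y: "y \<in> {..<n} \<rightarrow> carrier B"
    and eq: "finsum BH (\<lambda>i. galois (x i) (y i)) {..<n} = ptBH \<one>\<^bsub>B\<^esub> h"
  shows "finsum B (\<lambda>i. x i \<otimes>\<^bsub>B\<^esub> F (y i) c) {..<n} = cosum B \<rho> (\<lambda>c0 c1. j (S h \<otimes>\<^bsub>H\<^esub> Si c1) \<otimes>\<^bsub>B\<^esub> c0) c"
proof -
  note W = B.k_module
  define \<phi> where "\<phi> = (\<lambda>p k. cosum B \<rho> (\<lambda>c0 c1. p \<otimes>\<^bsub>B\<^esub> (j (S k \<otimes>\<^bsub>H\<^esub> Si c1) \<otimes>\<^bsub>B\<^esub> c0)) c)"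
  have bil: "bilinear_map K B H B \<phi>"
    unfolding \<phi>_def by (rule lins c | assumption)+
  note L = BH.lin_tensor_sum[OF W bil] and Lp = BH.tensor_sum_pure[OF W bil]
  have summand: "tensor_sum B \<phi> (galois u v) = u \<otimes>\<^bsub>B\<^esub> F v c" if u: "u \<in> carrier B" and v: "v \<in> carrier B" for u v
  proof -
    have "tensor_sum B \<phi> (galois u v) = cosum B \<rho> (\<lambda>v0 v1. tensor_sum B \<phi> (ptBH (u \<otimes>\<^bsub>B\<^esub> v0) v1)) v"
      unfolding galois_def by (rule hom_cosum[OF _ W L]; (rule lins u v | assumption)+)
    also have "\<dots> = cosum B \<rho> (\<lambda>v0 v1. cosum B \<rho> (\<lambda>c0 c1. (u \<otimes>\<^bsub>B\<^esub> v0) \<otimes>\<^bsub>B\<^esub> (j (S v1 \<otimes>\<^bsub>H\<^esub> Si c1) \<otimes>\<^bsub>B\<^esub> c0)) c) v"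
      by (rule cosum_cong, rule W, rule v, subst Lp, unfold \<phi>_def; (assumption | rule refl lins c u v)+)
    also have "\<dots> = cosum B \<rho> (\<lambda>c0 c1. cosum B \<rho> (\<lambda>v0 v1. (u \<otimes>\<^bsub>B\<^esub> v0) \<otimes>\<^bsub>B\<^esub> (j (S v1 \<otimes>\<^bsub>H\<^esub> Si c1) \<otimes>\<^bsub>B\<^esub> c0)) v) c"
      by (rule swap_BB; (rule lins u v c | assumption)+)
    also have "\<dots> = cosum B \<rho> (\<lambda>c0 c1. u \<otimes>\<^bsub>B\<^esub> (q v (Si c1) \<otimes>\<^bsub>B\<^esub> c0)) c"
    proof (rule cosum_cong[OF W c])
      fix c0 c1 assume cc: "c0 \<in> carrier B" "c1 \<in> carrier H"
      have "cosum B \<rho> (\<lambda>v0 v1. (u \<otimes>\<^bsub>B\<^esub> v0) \<otimes>\<^bsub>B\<^esub> (j (S v1 \<otimes>\<^bsub>H\<^esub> Si c1) \<otimes>\<^bsub>B\<^esub> c0)) v =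
        cosum B \<rho> (\<lambda>v0 v1. u \<otimes>\<^bsub>B\<^esub> ((v0 \<otimes>\<^bsub>B\<^esub> j (S v1 \<otimes>\<^bsub>H\<^esub> Si c1)) \<otimes>\<^bsub>B\<^esub> c0)) v"
        by (rule cosum_cong[OF W v]) (simp_all add: u v cc H.Si_closed H.antipode_closed j_closed B.m_assoc)
      also have "\<dots> = u \<otimes>\<^bsub>B\<^esub> (q v (Si c1) \<otimes>\<^bsub>B\<^esub> c0)"
        unfolding q_def by (rule hom_cosum[where f = "\<lambda>z. u \<otimes>\<^bsub>B\<^esub> (z \<otimes>\<^bsub>B\<^esub> c0)", symmetric]; (rule lins u v cc | assumption)+)
      finally show "cosum B \<rho> (\<lambda>v0 v1. (u \<otimes>\<^bsub>B\<^esub> v0) \<otimes>\<^bsub>B\<^esub> (j (S v1 \<otimes>\<^bsub>H\<^esub> Si c1) \<otimes>\<^bsub>B\<^esub> c0)) v = u \<otimes>\<^bsub>B\<^esub> (q v (Si c1) \<otimes>\<^bsub>B\<^esub> c0)" .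
    qed ((rule lins u v | assumption)+)
    also have "\<dots> = u \<otimes>\<^bsub>B\<^esub> F v c"
      unfolding F_def by (rule hom_cosum[symmetric]; (rule lins u v c | assumption)+)
    finally show ?thesis .
  qed
  have "finsum B (\<lambda>i. x i \<otimes>\<^bsub>B\<^esub> F (y i) c) {..<n} = finsum B (\<lambda>i. tensor_sum B \<phi> (galois (x i) (y i))) {..<n}"
    by (rule B.finsum_cong') (use x y in \<open>auto simp: summand Pi_iff intro!: B.m_closed F_closed c\<close>)
  also have "\<dots> = tensor_sum B \<phi> (finsum BH (\<lambda>i. galois (x i) (y i)) {..<n})"
    by (rule module_hom_finsum[symmetric, OF BH.abelian_group_T B.abelian_group_axioms L])
      (use x y in \<open>auto simp: Pi_iff intro!: galois_closed\<close>)
  also have "\<dots> = \<phi> \<one>\<^bsub>B\<^esub> h" unfolding eq by (rule Lp[OF B.one_closed h])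
  also have "\<dots> = cosum B \<rho> (\<lambda>c0 c1. j (S h \<otimes>\<^bsub>H\<^esub> Si c1) \<otimes>\<^bsub>B\<^esub> c0) c"
    unfolding \<phi>_def by (rule cosum_cong[OF W c]) (simp_all add: c h H.Si_closed H.antipode_closed j_closed)
  finally show ?thesis .
qed

end

section \<open>Bases of vector spaces relative to a subspace\<close>

locale vector_subspace = K: field K + V: module K V
  for K :: "('k, 'x) ring_scheme" and V :: "('k, 'v, 'y) module_scheme" +
  fixes D :: "'v set"
  assumes D_V: "D \<subseteq> carrier V" and D_zero: "\<zero>\<^bsub>V\<^esub> \<in> D"
    and D_add: "\<lbrakk>x \<in> D; y \<in> D\<rbrakk> \<Longrightarrow> x \<oplus>\<^bsub>V\<^esub> y \<in> D"
    and D_smult: "\<lbrakk>c \<in> carrier K; x \<in> D\<rbrakk> \<Longrightarrow> c \<odot>\<^bsub>V\<^esub> x \<in> D"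
begin

definition supp :: "('v \<Rightarrow> 'k) \<Rightarrow> 'v set" where "supp c = {e. c e \<noteq> \<zero>\<^bsub>K\<^esub>}"

definition coefs :: "'v set \<Rightarrow> ('v \<Rightarrow> 'k) set"
  where "coefs X = {c. (\<forall>e. c e \<in> carrier K) \<and> finite (supp c) \<and> supp c \<subseteq> X}"

definition lc :: "('v \<Rightarrow> 'k) \<Rightarrow> 'v" where "lc c = finsum V (\<lambda>e. c e \<odot>\<^bsub>V\<^esub> e) (supp c)"

definition indep :: "'v set \<Rightarrow> bool"
  where "indep X \<longleftrightarrow> (\<forall>c \<in> coefs X. lc c \<in> D \<longrightarrow> supp c = {})"

lemma lc_superset:
  assumes c: "c \<in> coefs X" and X: "X \<subseteq> carrier V" and S: "finite S" "supp c \<subseteq> S" "S \<subseteq> X"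
  shows "lc c = finsum V (\<lambda>e. c e \<odot>\<^bsub>V\<^esub> e) S"
  unfolding lc_def
  by (rule V.add.finprod_mono_neutral_cong_left)
    (use c X S in \<open>auto simp: coefs_def supp_def subset_iff\<close>)

lemma lc_closed: "\<lbrakk>c \<in> coefs X; X \<subseteq> carrier V\<rbrakk> \<Longrightarrow> lc c \<in> carrier V"
  unfolding lc_def by (rule V.M.finsum_closed) (auto simp: coefs_def)

lemma coefs_add: "\<lbrakk>c \<in> coefs X; d \<in> coefs X\<rbrakk> \<Longrightarrow> (\<lambda>e. c e \<oplus>\<^bsub>K\<^esub> d e) \<in> coefs X"
proof -
  assume c: "c \<in> coefs X" and d: "d \<in> coefs X"
  then have "supp (\<lambda>e. c e \<oplus>\<^bsub>K\<^esub> d e) \<subseteq> supp c \<union> supp d" "finite (supp c \<union> supp d)" "supp c \<union> supp d \<subseteq> X"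
    by (auto simp: coefs_def supp_def)
  then show ?thesis using c d finite_subset unfolding coefs_def by (simp; blast)
qed

lemma coefs_smult: "\<lbrakk>k \<in> carrier K; c \<in> coefs X\<rbrakk> \<Longrightarrow> (\<lambda>e. k \<otimes>\<^bsub>K\<^esub> c e) \<in> coefs X"
proof -
  assume k: "k \<in> carrier K" and c: "c \<in> coefs X"
  then have "supp (\<lambda>e. k \<otimes>\<^bsub>K\<^esub> c e) \<subseteq> supp c" by (auto simp: coefs_def supp_def)
  then show ?thesis using k c finite_subset unfolding coefs_def by (simp; blast)
qed

lemma lc_add:
  assumes X: "X \<subseteq> carrier V" and c: "c \<in> coefs X" and d: "d \<in> coefs X"
  shows "lc (\<lambda>e. c e \<oplus>\<^bsub>K\<^esub> d e) = lc c \<oplus>\<^bsub>V\<^esub> lc d"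
proof -
  let ?S = "supp c \<union> supp d"
  have S: "finite ?S" "?S \<subseteq> X" "supp (\<lambda>e. c e \<oplus>\<^bsub>K\<^esub> d e) \<subseteq> ?S"
    using c d by (auto simp: coefs_def supp_def)
  have cl: "c e \<in> carrier K" "d e \<in> carrier K" for e using c d by (auto simp: coefs_def)
  have "lc (\<lambda>e. c e \<oplus>\<^bsub>K\<^esub> d e) = finsum V (\<lambda>e. (c e \<oplus>\<^bsub>K\<^esub> d e) \<odot>\<^bsub>V\<^esub> e) ?S"
    by (rule lc_superset[OF coefs_add[OF c d] X S(1,3,2)])
  also have "\<dots> = finsum V (\<lambda>e. c e \<odot>\<^bsub>V\<^esub> e \<oplus>\<^bsub>V\<^esub> d e \<odot>\<^bsub>V\<^esub> e) ?S"
    by (rule V.M.finsum_cong') (use S(2) X cl in \<open>auto simp: V.smult_l_distr subset_iff\<close>)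
  also have "\<dots> = finsum V (\<lambda>e. c e \<odot>\<^bsub>V\<^esub> e) ?S \<oplus>\<^bsub>V\<^esub> finsum V (\<lambda>e. d e \<odot>\<^bsub>V\<^esub> e) ?S"
    by (rule V.M.finsum_addf) (use S(2) X cl in auto)
  finally show ?thesis
    using lc_superset[OF c X S(1) _ S(2)] lc_superset[OF d X S(1) _ S(2)] by simp
qed

lemma lc_smult:
  assumes X: "X \<subseteq> carrier V" and k: "k \<in> carrier K" and c: "c \<in> coefs X"
  shows "lc (\<lambda>e. k \<otimes>\<^bsub>K\<^esub> c e) = k \<odot>\<^bsub>V\<^esub> lc c"
proof -
  have S: "finite (supp c)" "supp c \<subseteq> X" "supp (\<lambda>e. k \<otimes>\<^bsub>K\<^esub> c e) \<subseteq> supp c"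
    using c k by (auto simp: coefs_def supp_def)
  have cl: "c e \<in> carrier K" for e using c by (auto simp: coefs_def)
  have "lc (\<lambda>e. k \<otimes>\<^bsub>K\<^esub> c e) = finsum V (\<lambda>e. (k \<otimes>\<^bsub>K\<^esub> c e) \<odot>\<^bsub>V\<^esub> e) (supp c)"
    by (rule lc_superset[OF coefs_smult[OF k c] X S(1,3,2)])
  also have "\<dots> = finsum V (\<lambda>e. k \<odot>\<^bsub>V\<^esub> (c e \<odot>\<^bsub>V\<^esub> e)) (supp c)"
    by (rule V.M.finsum_cong') (use S(2) X cl k in \<open>auto simp: V.smult_assoc1 subset_iff\<close>)
  also have "\<dots> = k \<odot>\<^bsub>V\<^esub> lc c"
    unfolding lc_def
    by (rule module_hom_finsum[symmetric, OF V.abgroup V.abgroup V.lin_smult[OF k lin_id]])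
      (use S(2) X cl in auto)
  finally show ?thesis .
qed

lemma coefs_single:
  assumes "x \<in> X" "k \<in> carrier K"
  shows "(\<lambda>e. if e = x then k else \<zero>\<^bsub>K\<^esub>) \<in> coefs X"
  using assms finite_subset[of "supp (\<lambda>e. if e = x then k else \<zero>\<^bsub>K\<^esub>)" "{x}"]
  by (auto simp: coefs_def supp_def)

lemma lc_single:
  assumes "X \<subseteq> carrier V" "x \<in> X" "k \<in> carrier K"
  shows "lc (\<lambda>e. if e = x then k else \<zero>\<^bsub>K\<^esub>) = k \<odot>\<^bsub>V\<^esub> x"
  using assms
  by (subst lc_superset[OF coefs_single[OF assms(2,3)] assms(1), of "{x}"]) (auto simp: supp_def)

lemma D_uminus: "x \<in> D \<Longrightarrow> \<ominus>\<^bsub>V\<^esub> x \<in> D"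
  using D_smult[of "\<ominus>\<^bsub>K\<^esub> \<one>\<^bsub>K\<^esub>" x] D_V by (auto simp: V.smult_l_minus)

lemma D_diff: "\<lbrakk>x \<in> D; y \<in> D\<rbrakk> \<Longrightarrow> x \<ominus>\<^bsub>V\<^esub> y \<in> D"
  unfolding a_minus_def by (intro D_add D_uminus)

lemma maximal_indep: "\<exists>X. X \<subseteq> carrier V \<and> indep X \<and> (\<forall>Y. Y \<subseteq> carrier V \<and> indep Y \<and> X \<subseteq> Y \<longrightarrow> Y = X)"
proof -
  let ?Z = "{X. X \<subseteq> carrier V \<and> indep X}"
  have "\<exists>M\<in>?Z. \<forall>X\<in>?Z. M \<subseteq> X \<longrightarrow> X = M"
  proof (rule subset_Zorn_nonempty)
    have "{} \<in> ?Z" by (auto simp: indep_def coefs_def)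
    then show "?Z \<noteq> {}" by blast
    fix C assume C: "C \<noteq> {}" "subset.chain ?Z C"
    have sub: "X \<subseteq> carrier V" "indep X" if "X \<in> C" for X
      using C(2) that by (auto simp: subset.chain_def)
    have "indep (\<Union>C)" unfolding indep_def
    proof (intro ballI impI)
      fix c assume c: "c \<in> coefs (\<Union>C)" "lc c \<in> D"
      then have "finite (supp c)" "supp c \<subseteq> \<Union>C" by (auto simp: coefs_def)
      then obtain X where X: "X \<in> C" "supp c \<subseteq> X"
        using finite_subset_Union_chain[OF _ _ C] by blast
      then have "c \<in> coefs X" using c by (auto simp: coefs_def)
      then show "supp c = {}" using sub[OF X(1)] c by (auto simp: indep_def)
    qed
    then show "\<Union>C \<in> ?Z" using sub by blast
  qed
  then obtain M where "M \<in> ?Z" "\<forall>X\<in>?Z. M \<subseteq> X \<longrightarrow> X = M" by (rule bexE)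
  then show ?thesis by (intro exI[of _ M]) simp
qed

text \<open>A maximal set \<open>X\<close> that is independent modulo \<open>D\<close> is a basis of \<open>V/D\<close>, and \<open>\<psi>\<close> gives the coordinates.
  Removing the component along \<open>X\<close> is a linear projection onto \<open>D\<close>, which serves to extend linear maps
  from \<open>D\<close> to \<open>V\<close>.\<close>

theorem relative_basis:
  "\<exists>X \<psi>. X \<subseteq> carrier V \<and> (\<forall>e. \<psi> e \<in> module_hom K V (scalar_algebra K)) \<and>
    (\<forall>e. \<forall>d \<in> D. \<psi> e d = \<zero>\<^bsub>K\<^esub>) \<and>
    (\<lambda>v. v \<ominus>\<^bsub>V\<^esub> finsum V (\<lambda>e. \<psi> e v \<odot>\<^bsub>V\<^esub> e) {e. \<psi> e v \<noteq> \<zero>\<^bsub>K\<^esub>}) \<in> module_hom K V V \<and>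
    (\<forall>v \<in> carrier V. finite {e. \<psi> e v \<noteq> \<zero>\<^bsub>K\<^esub>} \<and> {e. \<psi> e v \<noteq> \<zero>\<^bsub>K\<^esub>} \<subseteq> X \<and>
      v \<ominus>\<^bsub>V\<^esub> finsum V (\<lambda>e. \<psi> e v \<odot>\<^bsub>V\<^esub> e) {e. \<psi> e v \<noteq> \<zero>\<^bsub>K\<^esub>} \<in> D)"
proof -
  obtain X where X: "X \<subseteq> carrier V" and ind: "indep X"
    and max: "\<And>Y. \<lbrakk>Y \<subseteq> carrier V; indep Y; X \<subseteq> Y\<rbrakk> \<Longrightarrow> Y = X"
    using maximal_indep by blast
  have ex: "\<exists>c \<in> coefs X. v \<ominus>\<^bsub>V\<^esub> lc c \<in> D" if v: "v \<in> carrier V" for v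
  proof (cases "v \<in> X")
    case True
    then show ?thesis using v X D_zero
      by (intro bexI[OF _ coefs_single[OF True K.one_closed]])
        (simp add: lc_single V.r_neg a_minus_def)
  next
    case False
    let ?Y = "insert v X"
    have Y: "?Y \<subseteq> carrier V" using X v by blast
    have "\<not> indep ?Y" using max[OF Y] False by blast
    then obtain c where c: "c \<in> coefs ?Y" "lc c \<in> D" "supp c \<noteq> {}" by (auto simp: indep_def)
    have cK: "c e \<in> carrier K" for e using c by (auto simp: coefs_def)
    have "c v \<noteq> \<zero>\<^bsub>K\<^esub>"
    proof
      assume "c v = \<zero>\<^bsub>K\<^esub>"
      then have "c \<in> coefs X" using c by (auto simp: coefs_def supp_def)
      then show False using ind c by (auto simp: indep_def)
    qed
    then have u: "c v \<in> Units K" using K.field_Units cK by blast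
    define k where "k = inv\<^bsub>K\<^esub> c v"
    have k: "k \<in> carrier K" "k \<otimes>\<^bsub>K\<^esub> c v = \<one>\<^bsub>K\<^esub>" unfolding k_def using u by simp_all
    define c' where "c' = (\<lambda>e. if e = v then \<zero>\<^bsub>K\<^esub> else c e)"
    have sub: "supp c' \<subseteq> supp c - {v}" by (auto simp: c'_def supp_def)
    have fin: "finite (supp c')" using finite_subset[OF sub] c(1) by (simp add: coefs_def)
    have c'K: "\<forall>e. c' e \<in> carrier K" using cK by (simp add: c'_def)
    have c'X: "c' \<in> coefs X" and c'Y: "c' \<in> coefs ?Y"
      using c(1) sub fin c'K unfolding coefs_def by blast+
    have "c = (\<lambda>e. (if e = v then c v else \<zero>\<^bsub>K\<^esub>) \<oplus>\<^bsub>K\<^esub> c' e)" using cK by (auto simp: c'_def)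
    then have "lc c = c v \<odot>\<^bsub>V\<^esub> v \<oplus>\<^bsub>V\<^esub> lc c'"
      using lc_add[OF Y coefs_single c'Y, of v "c v"] lc_single[OF Y, of v "c v"] cK by simp
    then have "k \<odot>\<^bsub>V\<^esub> lc c = v \<oplus>\<^bsub>V\<^esub> k \<odot>\<^bsub>V\<^esub> lc c'"
      using k v cK lc_closed[OF c'X X] by (simp add: V.smult_r_distr V.smult_assoc1[symmetric])
    moreover have "k \<odot>\<^bsub>V\<^esub> lc c \<in> D" using k c by (intro D_smult)
    moreover have "lc (\<lambda>e. (\<ominus>\<^bsub>K\<^esub> k) \<otimes>\<^bsub>K\<^esub> c' e) = \<ominus>\<^bsub>V\<^esub> (k \<odot>\<^bsub>V\<^esub> lc c')"
      using k lc_smult[OF X _ c'X, of "\<ominus>\<^bsub>K\<^esub> k"] lc_closed[OF c'X X] by (simp add: V.smult_l_minus)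
    ultimately show ?thesis
      using k v lc_closed[OF c'X X] by (intro bexI[OF _ coefs_smult[OF _ c'X, of "\<ominus>\<^bsub>K\<^esub> k"]]) (simp_all add: a_minus_def)
  qed
  have uniq: "c = d" if c: "c \<in> coefs X" and d: "d \<in> coefs X" and v: "v \<in> carrier V"
    and cD: "v \<ominus>\<^bsub>V\<^esub> lc c \<in> D" and dD: "v \<ominus>\<^bsub>V\<^esub> lc d \<in> D" for c d v
  proof -
    have m: "\<ominus>\<^bsub>K\<^esub> \<one>\<^bsub>K\<^esub> \<in> carrier K" by simp
    let ?e = "\<lambda>e. c e \<oplus>\<^bsub>K\<^esub> (\<ominus>\<^bsub>K\<^esub> \<one>\<^bsub>K\<^esub>) \<otimes>\<^bsub>K\<^esub> d e"
    have cl: "lc c \<in> carrier V" "lc d \<in> carrier V" using lc_closed[OF _ X] c d by blast+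
    have K: "c e \<in> carrier K" "d e \<in> carrier K" for e using c d by (auto simp: coefs_def)
    have e: "?e \<in> coefs X" by (intro coefs_add coefs_smult c d m)
    have "lc ?e = lc c \<oplus>\<^bsub>V\<^esub> \<ominus>\<^bsub>V\<^esub> lc d"
      using lc_add[OF X c coefs_smult[OF m d]] lc_smult[OF X m d] cl by (simp add: V.smult_l_minus)
    also have "\<dots> = (v \<ominus>\<^bsub>V\<^esub> lc d) \<ominus>\<^bsub>V\<^esub> (v \<ominus>\<^bsub>V\<^esub> lc c)"
      using cl v by (simp add: a_minus_def V.minus_add V.a_ac V.minus_minus V.r_neg2)
    finally have "lc ?e \<in> D" using D_diff[OF dD cD] by simp
    then have "supp ?e = {}" using ind e by (auto simp: indep_def)
    then have "?e x = \<zero>\<^bsub>K\<^esub>" for x unfolding supp_def by blast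
    then have "c x = d x" for x
      using K K.minus_equality[of "c x" "\<ominus>\<^bsub>K\<^esub> d x"] by (simp add: K.l_minus)
    then show ?thesis by blast
  qed
  define \<gamma> where "\<gamma> v = (SOME c. c \<in> coefs X \<and> v \<ominus>\<^bsub>V\<^esub> lc c \<in> D)" for v
  have \<gamma>: "\<gamma> v \<in> coefs X" "v \<ominus>\<^bsub>V\<^esub> lc (\<gamma> v) \<in> D" if "v \<in> carrier V" for v
    using someI_ex[of "\<lambda>c. c \<in> coefs X \<and> v \<ominus>\<^bsub>V\<^esub> lc c \<in> D"] ex[OF that] unfolding \<gamma>_def by blast+
  have cl: "lc (\<gamma> v) \<in> carrier V" if "v \<in> carrier V" for v using lc_closed[OF \<gamma>(1)[OF that] X] .
  have \<gamma>K: "\<gamma> v e \<in> carrier K" if "v \<in> carrier V" for v e using \<gamma>(1)[OF that] by (auto simp: coefs_def)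
  have add: "\<gamma> (v \<oplus>\<^bsub>V\<^esub> w) = (\<lambda>e. \<gamma> v e \<oplus>\<^bsub>K\<^esub> \<gamma> w e)" if v: "v \<in> carrier V" and w: "w \<in> carrier V" for v w
  proof (rule uniq[OF \<gamma>(1) _ _ \<gamma>(2)])
    have "(v \<oplus>\<^bsub>V\<^esub> w) \<ominus>\<^bsub>V\<^esub> lc (\<lambda>e. \<gamma> v e \<oplus>\<^bsub>K\<^esub> \<gamma> w e) = (v \<ominus>\<^bsub>V\<^esub> lc (\<gamma> v)) \<oplus>\<^bsub>V\<^esub> (w \<ominus>\<^bsub>V\<^esub> lc (\<gamma> w))"
      using v w cl by (simp add: lc_add[OF X \<gamma>(1)[OF v] \<gamma>(1)[OF w]] a_minus_def V.minus_add V.a_ac)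
    then show "(v \<oplus>\<^bsub>V\<^esub> w) \<ominus>\<^bsub>V\<^esub> lc (\<lambda>e. \<gamma> v e \<oplus>\<^bsub>K\<^esub> \<gamma> w e) \<in> D"
      using D_add[OF \<gamma>(2)[OF v] \<gamma>(2)[OF w]] by simp
  qed (use v w \<gamma>(1) coefs_add in auto)
  have smult: "\<gamma> (k \<odot>\<^bsub>V\<^esub> v) = (\<lambda>e. k \<otimes>\<^bsub>K\<^esub> \<gamma> v e)" if k: "k \<in> carrier K" and v: "v \<in> carrier V" for k v
  proof (rule uniq[OF \<gamma>(1) _ _ \<gamma>(2)])
    have "(k \<odot>\<^bsub>V\<^esub> v) \<ominus>\<^bsub>V\<^esub> lc (\<lambda>e. k \<otimes>\<^bsub>K\<^esub> \<gamma> v e) = k \<odot>\<^bsub>V\<^esub> (v \<ominus>\<^bsub>V\<^esub> lc (\<gamma> v))"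
      using k v cl by (simp add: lc_smult[OF X k \<gamma>(1)[OF v]] a_minus_def V.smult_r_distr V.smult_r_minus)
    then show "(k \<odot>\<^bsub>V\<^esub> v) \<ominus>\<^bsub>V\<^esub> lc (\<lambda>e. k \<otimes>\<^bsub>K\<^esub> \<gamma> v e) \<in> D"
      using D_smult[OF k \<gamma>(2)[OF v]] by simp
  qed (use k v \<gamma>(1) coefs_smult in auto)
  have zero: "\<gamma> d = (\<lambda>e. \<zero>\<^bsub>K\<^esub>)" if d: "d \<in> D" for d
  proof (rule uniq[OF \<gamma>(1) _ _ \<gamma>(2)])
    have "supp (\<lambda>e. \<zero>\<^bsub>K\<^esub>) = {}" by (simp add: supp_def)
    then show "d \<ominus>\<^bsub>V\<^esub> lc (\<lambda>e. \<zero>\<^bsub>K\<^esub>) \<in> D" "(\<lambda>e. \<zero>\<^bsub>K\<^esub>) \<in> coefs X"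
      using d D_diff[OF d D_zero] by (auto simp: lc_def coefs_def)
  qed (use d D_V in auto)
  show ?thesis
  proof (intro exI[of _ X] exI[of _ "\<lambda>e v. \<gamma> v e"] conjI allI ballI)
    show "(\<lambda>v. \<gamma> v e) \<in> module_hom K V (scalar_algebra K)" for e
      by (rule module_homI) (simp_all add: \<gamma>K add smult scalar_algebra_def)
    show "\<gamma> d e = \<zero>\<^bsub>K\<^esub>" if "d \<in> D" for e d by (simp add: zero[OF that])
    have "(\<lambda>v. v \<ominus>\<^bsub>V\<^esub> lc (\<gamma> v)) \<in> module_hom K V V"
      by (rule module_homI)
        (use cl in \<open>simp_all add: add smult lc_add[OF X \<gamma>(1) \<gamma>(1)] lc_smult[OF X _ \<gamma>(1)]
          a_minus_def V.minus_add V.a_ac V.smult_r_distr V.smult_r_minus\<close>)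
    then show "(\<lambda>v. v \<ominus>\<^bsub>V\<^esub> finsum V (\<lambda>e. \<gamma> v e \<odot>\<^bsub>V\<^esub> e) {e. \<gamma> v e \<noteq> \<zero>\<^bsub>K\<^esub>}) \<in> module_hom K V V"
      by (simp add: lc_def supp_def)
    fix v assume v: "v \<in> carrier V"
    show "finite {e. \<gamma> v e \<noteq> \<zero>\<^bsub>K\<^esub>}" "{e. \<gamma> v e \<noteq> \<zero>\<^bsub>K\<^esub>} \<subseteq> X"
      using \<gamma>(1)[OF v] by (auto simp: coefs_def supp_def)
    show "v \<ominus>\<^bsub>V\<^esub> finsum V (\<lambda>e. \<gamma> v e \<odot>\<^bsub>V\<^esub> e) {e. \<gamma> v e \<noteq> \<zero>\<^bsub>K\<^esub>} \<in> D"
      using \<gamma>(2)[OF v] by (simp add: lc_def supp_def)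
  qed (rule X)
qed

end

section \<open>Descent of linear systems along faithfully flat modules\<close>

context left_module
begin

lemma smult_zero: "r \<in> carrier R \<Longrightarrow> r \<odot>\<^bsub>M\<^esub> \<zero>\<^bsub>M\<^esub> = \<zero>\<^bsub>M\<^esub>"
  using smult_r_distr[of r "\<zero>\<^bsub>M\<^esub>" "\<zero>\<^bsub>M\<^esub>"] smult_closed[of r "\<zero>\<^bsub>M\<^esub>"] by simp

lemma zero_smult: "m \<in> carrier M \<Longrightarrow> \<zero>\<^bsub>R\<^esub> \<odot>\<^bsub>M\<^esub> m = \<zero>\<^bsub>M\<^esub>"
  using smult_l_distr[of "\<zero>\<^bsub>R\<^esub>" "\<zero>\<^bsub>R\<^esub>" m] smult_closed[of "\<zero>\<^bsub>R\<^esub>" m] by simp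

lemma uminus_one_smult: "m \<in> carrier M \<Longrightarrow> (\<ominus>\<^bsub>R\<^esub> \<one>\<^bsub>R\<^esub>) \<odot>\<^bsub>M\<^esub> m = \<ominus>\<^bsub>M\<^esub> m"
  using smult_l_distr[of "\<ominus>\<^bsub>R\<^esub> \<one>\<^bsub>R\<^esub>" "\<one>\<^bsub>R\<^esub>" m] smult_closed[of "\<ominus>\<^bsub>R\<^esub> \<one>\<^bsub>R\<^esub>" m]
  by (simp add: zero_smult smult_one R.l_neg M.minus_equality)

lemma smult_hom: "r \<in> carrier R \<Longrightarrow> (\<lambda>m. r \<odot>\<^bsub>M\<^esub> m) \<in> hom (add_monoid M) (add_monoid M)"
  by (auto simp: hom_def smult_closed smult_r_distr)

lemma smult_finsum:
  "\<lbrakk>r \<in> carrier R; x \<in> I \<rightarrow> carrier M\<rbrakk> \<Longrightarrow> r \<odot>\<^bsub>M\<^esub> finsum M x I = finsum M (\<lambda>i. r \<odot>\<^bsub>M\<^esub> x i) I"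
  by (rule add_hom_finsum[OF M.abelian_group_axioms M.abelian_group_axioms smult_hom])

end

definition is_submodule :: "('r, 'x) ring_scheme \<Rightarrow> ('r, 'm, 'y) module_scheme \<Rightarrow> 'm set \<Rightarrow> bool"
  where "is_submodule R M W \<longleftrightarrow> W \<subseteq> carrier M \<and> \<zero>\<^bsub>M\<^esub> \<in> W \<and> (\<forall>x \<in> W. \<forall>y \<in> W. x \<oplus>\<^bsub>M\<^esub> y \<in> W) \<and>
    (\<forall>r \<in> carrier R. \<forall>x \<in> W. r \<odot>\<^bsub>M\<^esub> x \<in> W)"

lemma submodule_uminus:
  assumes "left_module R M" "is_submodule R M W" "x \<in> W" shows "\<ominus>\<^bsub>M\<^esub> x \<in> W"
proof -
  interpret left_module R M by fact
  show ?thesis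
    using assms(2,3) uminus_one_smult[of x] unfolding is_submodule_def by (metis R.add.inv_closed R.one_closed subsetD)
qed

lemma left_module_submodule:
  assumes M: "left_module R M" and W: "is_submodule R M W"
  shows "left_module R (M\<lparr>carrier := W\<rparr>)"
proof -
  interpret left_module R M by fact
  have W': "W \<subseteq> carrier M" "\<zero>\<^bsub>M\<^esub> \<in> W" "\<And>x y. \<lbrakk>x \<in> W; y \<in> W\<rbrakk> \<Longrightarrow> x \<oplus>\<^bsub>M\<^esub> y \<in> W"
    "\<And>r x. \<lbrakk>r \<in> carrier R; x \<in> W\<rbrakk> \<Longrightarrow> r \<odot>\<^bsub>M\<^esub> x \<in> W"
    using W unfolding is_submodule_def by auto
  have c: "x \<in> carrier M" if "x \<in> W" for x using W' that by blast
  have "\<exists>y\<in>W. y \<oplus>\<^bsub>M\<^esub> x = \<zero>\<^bsub>M\<^esub>" if "x \<in> W" for x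
    using submodule_uminus[OF M W that] c[OF that] M.l_neg by blast
  then have "abelian_group (M\<lparr>carrier := W\<rparr>)"
    by (intro abelian_groupI) (simp_all add: W' c M.a_ac)
  then show ?thesis
    unfolding left_module_def left_module_axioms_def
    by (simp add: R.ring_axioms W' c smult_l_distr smult_r_distr smult_assoc smult_one)
qed

definition coset_of where "coset_of M W x = {y \<in> carrier M. y \<ominus>\<^bsub>M\<^esub> x \<in> W}"

text \<open>The elements are cosets, as sets. A quotient of the module \<open>power_module k M\<close> below thus has its
  elements in \<open>(nat \<Rightarrow> 'm) set\<close>, which is the type of the test modules in \<open>faithfully_flat_descent\<close>.\<close>

definition quotient_module :: "('r, 'm, 'y) module_scheme \<Rightarrow> 'm set \<Rightarrow> ('r, 'm set) module"
  where "quotient_module M W =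
    \<lparr>carrier = coset_of M W ` carrier M, monoid.mult = (\<lambda>X Y. X), one = W, ring.zero = coset_of M W \<zero>\<^bsub>M\<^esub>,
     add = (\<lambda>X Y. coset_of M W ((SOME x. x \<in> X) \<oplus>\<^bsub>M\<^esub> (SOME y. y \<in> Y))),
     smult = (\<lambda>r X. coset_of M W (r \<odot>\<^bsub>M\<^esub> (SOME x. x \<in> X)))\<rparr>"

context
  fixes R :: "('r, 'x) ring_scheme" and M :: "('r, 'm, 'y) module_scheme" and W :: "'m set"
  assumes M: "left_module R M" and W: "is_submodule R M W"
begin

interpretation left_module R M by (rule M)

lemma W_rules: "W \<subseteq> carrier M" "\<zero>\<^bsub>M\<^esub> \<in> W" "\<And>x y. \<lbrakk>x \<in> W; y \<in> W\<rbrakk> \<Longrightarrow> x \<oplus>\<^bsub>M\<^esub> y \<in> W"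
  "\<And>r x. \<lbrakk>r \<in> carrier R; x \<in> W\<rbrakk> \<Longrightarrow> r \<odot>\<^bsub>M\<^esub> x \<in> W" "\<And>x. x \<in> W \<Longrightarrow> \<ominus>\<^bsub>M\<^esub> x \<in> W"
  using W submodule_uminus[OF M W] unfolding is_submodule_def by auto

lemma coset_of_eq:
  assumes x: "x \<in> carrier M" and y: "y \<in> carrier M"
  shows "coset_of M W x = coset_of M W y \<longleftrightarrow> x \<ominus>\<^bsub>M\<^esub> y \<in> W"
proof
  assume "coset_of M W x = coset_of M W y"
  moreover have "x \<in> coset_of M W x" using x W_rules by (simp add: coset_of_def a_minus_def M.r_neg)
  ultimately show "x \<ominus>\<^bsub>M\<^esub> y \<in> W" by (simp add: coset_of_def)
next
  assume xy: "x \<ominus>\<^bsub>M\<^esub> y \<in> W"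
  have yx: "y \<ominus>\<^bsub>M\<^esub> x \<in> W"
    using W_rules(5)[OF xy] x y by (simp add: a_minus_def M.minus_add M.a_comm)
  have tr: "z \<ominus>\<^bsub>M\<^esub> w \<in> W" if "z \<ominus>\<^bsub>M\<^esub> v \<in> W" "v \<ominus>\<^bsub>M\<^esub> w \<in> W" "z \<in> carrier M" "v \<in> carrier M" "w \<in> carrier M" for z v w
    using W_rules(3)[OF that(1,2)] that(3-5) by (simp add: a_minus_def M.a_assoc M.r_neg1)
  show "coset_of M W x = coset_of M W y"
    unfolding coset_of_def using tr[OF _ xy _ x y] tr[OF _ yx _ y x] by blast
qed

lemma coset_of_rep:
  assumes x: "x \<in> carrier M"
  shows "(SOME z. z \<in> coset_of M W x) \<in> carrier M" "(SOME z. z \<in> coset_of M W x) \<ominus>\<^bsub>M\<^esub> x \<in> W"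
proof -
  have "x \<in> coset_of M W x" using x W_rules by (simp add: coset_of_def a_minus_def M.r_neg)
  then have "(SOME z. z \<in> coset_of M W x) \<in> coset_of M W x" by (rule someI)
  then show "(SOME z. z \<in> coset_of M W x) \<in> carrier M" "(SOME z. z \<in> coset_of M W x) \<ominus>\<^bsub>M\<^esub> x \<in> W"
    by (simp_all add: coset_of_def)
qed

lemma quotient_add:
  assumes x: "x \<in> carrier M" and y: "y \<in> carrier M"
  shows "coset_of M W x \<oplus>\<^bsub>quotient_module M W\<^esub> coset_of M W y = coset_of M W (x \<oplus>\<^bsub>M\<^esub> y)"
proof -
  define u v where "u = (SOME z. z \<in> coset_of M W x)" and "v = (SOME z. z \<in> coset_of M W y)"
  have uv: "u \<in> carrier M" "u \<ominus>\<^bsub>M\<^esub> x \<in> W" "v \<in> carrier M" "v \<ominus>\<^bsub>M\<^esub> y \<in> W"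
    unfolding u_def v_def using coset_of_rep x y by blast+
  have "(u \<oplus>\<^bsub>M\<^esub> v) \<ominus>\<^bsub>M\<^esub> (x \<oplus>\<^bsub>M\<^esub> y) = (u \<ominus>\<^bsub>M\<^esub> x) \<oplus>\<^bsub>M\<^esub> (v \<ominus>\<^bsub>M\<^esub> y)"
    using uv x y by (simp add: a_minus_def M.minus_add M.a_ac)
  then show ?thesis
    using W_rules(3)[OF uv(2,4)] uv x y coset_of_eq
    by (simp add: quotient_module_def u_def[symmetric] v_def[symmetric])
qed

lemma quotient_smult:
  assumes r: "r \<in> carrier R" and x: "x \<in> carrier M"
  shows "r \<odot>\<^bsub>quotient_module M W\<^esub> coset_of M W x = coset_of M W (r \<odot>\<^bsub>M\<^esub> x)"
proof -
  define u where "u = (SOME z. z \<in> coset_of M W x)"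
  have u: "u \<in> carrier M" "u \<ominus>\<^bsub>M\<^esub> x \<in> W" unfolding u_def using coset_of_rep x by blast+
  have "\<ominus>\<^bsub>M\<^esub> (r \<odot>\<^bsub>M\<^esub> x) = r \<odot>\<^bsub>M\<^esub> (\<ominus>\<^bsub>M\<^esub> x)"
    using r x smult_r_distr[of r "\<ominus>\<^bsub>M\<^esub> x" x] by (intro M.minus_equality) (simp_all add: smult_closed M.l_neg smult_zero)
  then have "r \<odot>\<^bsub>M\<^esub> u \<ominus>\<^bsub>M\<^esub> r \<odot>\<^bsub>M\<^esub> x = r \<odot>\<^bsub>M\<^esub> (u \<ominus>\<^bsub>M\<^esub> x)"
    using r u x by (simp add: a_minus_def smult_r_distr)
  then show ?thesis
    using W_rules(4)[OF r u(2)] r u x coset_of_eq[of "r \<odot>\<^bsub>M\<^esub> u" "r \<odot>\<^bsub>M\<^esub> x"]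
    by (simp add: quotient_module_def u_def[symmetric] smult_closed)
qed

lemma left_module_quotient: "left_module R (quotient_module M W)"
proof -
  let ?Q = "quotient_module M W" and ?c = "coset_of M W"
  have car: "carrier ?Q = ?c ` carrier M" and zero: "\<zero>\<^bsub>?Q\<^esub> = ?c \<zero>\<^bsub>M\<^esub>" by (simp_all add: quotient_module_def)
  have "\<exists>Y\<in>carrier ?Q. Y \<oplus>\<^bsub>?Q\<^esub> X = \<zero>\<^bsub>?Q\<^esub>" if XQ: "X \<in> carrier ?Q" for X
  proof -
    obtain x where x: "x \<in> carrier M" and X: "X = ?c x"
      using XQ unfolding car by blast
    show ?thesis
    proof (rule bexI)
      show "?c (\<ominus>\<^bsub>M\<^esub> x) \<oplus>\<^bsub>?Q\<^esub> X = \<zero>\<^bsub>?Q\<^esub>"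
        unfolding X zero by (subst quotient_add) (simp_all add: x M.l_neg)
      show "?c (\<ominus>\<^bsub>M\<^esub> x) \<in> carrier ?Q" unfolding car by (rule imageI) (simp add: x)
    qed
  qed
  moreover have "P X" if "\<And>x. x \<in> carrier M \<Longrightarrow> P (?c x)" "X \<in> carrier ?Q" for P X
    using that(2) unfolding car by (rule imageE) (simp add: that(1))
  note ind = this
  ultimately have "abelian_group ?Q"
  proof (intro abelian_groupI)
    fix X Y assume X: "X \<in> carrier ?Q" and Y: "Y \<in> carrier ?Q"
    from X show "X \<oplus>\<^bsub>?Q\<^esub> Y \<in> carrier ?Q"
      by (rule ind[rotated], rule_tac ind[OF _ Y]) (simp add: quotient_add car)
    from X show "X \<oplus>\<^bsub>?Q\<^esub> Y = Y \<oplus>\<^bsub>?Q\<^esub> X"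
      by (rule ind[rotated], rule_tac ind[OF _ Y]) (simp add: quotient_add M.a_comm)
    from X show "\<zero>\<^bsub>?Q\<^esub> \<oplus>\<^bsub>?Q\<^esub> X = X"
      by (rule ind[rotated]) (simp add: quotient_add zero)
    fix Z assume Z: "Z \<in> carrier ?Q"
    from X show "X \<oplus>\<^bsub>?Q\<^esub> Y \<oplus>\<^bsub>?Q\<^esub> Z = X \<oplus>\<^bsub>?Q\<^esub> (Y \<oplus>\<^bsub>?Q\<^esub> Z)"
      by (rule ind[rotated], rule_tac ind[OF _ Y], rule_tac ind[OF _ Z]) (simp add: quotient_add M.a_assoc)
  qed (auto simp: car zero)
  moreover have "left_module_axioms R ?Q"
  proof
    fix r s X Y assume r: "r \<in> carrier R" and X: "X \<in> carrier ?Q"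
    from X show "r \<odot>\<^bsub>?Q\<^esub> X \<in> carrier ?Q"
      by (rule ind[rotated]) (simp add: quotient_smult r smult_closed car)
    show "(r \<oplus>\<^bsub>R\<^esub> s) \<odot>\<^bsub>?Q\<^esub> X = r \<odot>\<^bsub>?Q\<^esub> X \<oplus>\<^bsub>?Q\<^esub> s \<odot>\<^bsub>?Q\<^esub> X" if s: "s \<in> carrier R"
      using X by (rule ind[rotated]) (simp add: quotient_smult quotient_add r s smult_closed smult_l_distr)
    show "r \<odot>\<^bsub>?Q\<^esub> (X \<oplus>\<^bsub>?Q\<^esub> Y) = r \<odot>\<^bsub>?Q\<^esub> X \<oplus>\<^bsub>?Q\<^esub> r \<odot>\<^bsub>?Q\<^esub> Y" if Y: "Y \<in> carrier ?Q"
      using X by (rule ind[rotated], rule_tac ind[OF _ Y]) (simp add: quotient_smult quotient_add r smult_closed smult_r_distr)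
    show "(r \<otimes>\<^bsub>R\<^esub> s) \<odot>\<^bsub>?Q\<^esub> X = r \<odot>\<^bsub>?Q\<^esub> (s \<odot>\<^bsub>?Q\<^esub> X)" if s: "s \<in> carrier R"
      using X by (rule ind[rotated]) (simp add: quotient_smult r s smult_closed smult_assoc)
  next
    fix X assume X: "X \<in> carrier ?Q"
    show "\<one>\<^bsub>R\<^esub> \<odot>\<^bsub>?Q\<^esub> X = X"
      using X by (rule ind[rotated]) (simp add: quotient_smult smult_one)
  qed
  ultimately show ?thesis
    unfolding left_module_def by (simp add: R.ring_axioms)
qed

lemma quotient_eq_zero: "x \<in> carrier M \<Longrightarrow> coset_of M W x = \<zero>\<^bsub>quotient_module M W\<^esub> \<longleftrightarrow> x \<in> W"
  using coset_of_eq[of x "\<zero>\<^bsub>M\<^esub>"] M.minus_equality[of "\<zero>\<^bsub>M\<^esub>" "\<zero>\<^bsub>M\<^esub>"]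
  by (simp add: quotient_module_def a_minus_def)

end

text \<open>\<open>M\<^sup>k\<close>, with vectors as functions that vanish from \<open>k\<close> on, so that equal vectors are equal functions.\<close>

definition power_module :: "nat \<Rightarrow> ('r, 'm, 'y) module_scheme \<Rightarrow> ('r, nat \<Rightarrow> 'm) module"
  where "power_module k M =
    \<lparr>carrier = {f. (\<forall>i<k. f i \<in> carrier M) \<and> (\<forall>i\<ge>k. f i = \<zero>\<^bsub>M\<^esub>)}, monoid.mult = (\<lambda>f g. f),
     one = (\<lambda>_. \<zero>\<^bsub>M\<^esub>), ring.zero = (\<lambda>_. \<zero>\<^bsub>M\<^esub>), add = (\<lambda>f g i. f i \<oplus>\<^bsub>M\<^esub> g i),
     smult = (\<lambda>r f i. r \<odot>\<^bsub>M\<^esub> f i)\<rparr>"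

lemma left_module_power:
  assumes "left_module R M" shows "left_module R (power_module k M)"
proof -
  interpret left_module R M by fact
  let ?P = "power_module k M"
  have c: "f i \<in> carrier M" if "f \<in> carrier ?P" for f i
    using that by (cases "i < k") (auto simp: power_module_def)
  have "\<exists>g\<in>carrier ?P. g \<oplus>\<^bsub>?P\<^esub> f = \<zero>\<^bsub>?P\<^esub>" if "f \<in> carrier ?P" for f
    using c[OF that] that
    by (intro bexI[of _ "\<lambda>i. \<ominus>\<^bsub>M\<^esub> f i"]) (auto simp: power_module_def M.l_neg)
  then have "abelian_group ?P"
  proof (intro abelian_groupI)
    fix f g h assume "f \<in> carrier ?P" "g \<in> carrier ?P" "h \<in> carrier ?P"
    then show "f \<oplus>\<^bsub>?P\<^esub> g \<oplus>\<^bsub>?P\<^esub> h = f \<oplus>\<^bsub>?P\<^esub> (g \<oplus>\<^bsub>?P\<^esub> h)"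
      using c[of f] c[of g] c[of h] by (simp add: power_module_def M.a_assoc)
  next
    fix f g assume "f \<in> carrier ?P" "g \<in> carrier ?P"
    then show "f \<oplus>\<^bsub>?P\<^esub> g = g \<oplus>\<^bsub>?P\<^esub> f"
      using c[of f] c[of g] by (simp add: power_module_def M.a_comm)
  next
    fix f assume "f \<in> carrier ?P"
    then show "\<zero>\<^bsub>?P\<^esub> \<oplus>\<^bsub>?P\<^esub> f = f" using c[of f] by (simp add: power_module_def)
  qed (auto simp: power_module_def)
  moreover have "left_module_axioms R ?P"
  proof
    fix r s f g assume r: "r \<in> carrier R" and f: "f \<in> carrier ?P"
    show "r \<odot>\<^bsub>?P\<^esub> f \<in> carrier ?P" using r f by (auto simp: power_module_def smult_closed smult_zero)
    show "(r \<oplus>\<^bsub>R\<^esub> s) \<odot>\<^bsub>?P\<^esub> f = r \<odot>\<^bsub>?P\<^esub> f \<oplus>\<^bsub>?P\<^esub> s \<odot>\<^bsub>?P\<^esub> f" if "s \<in> carrier R"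
      using r that c[OF f] by (simp add: power_module_def smult_l_distr)
    show "r \<odot>\<^bsub>?P\<^esub> (f \<oplus>\<^bsub>?P\<^esub> g) = r \<odot>\<^bsub>?P\<^esub> f \<oplus>\<^bsub>?P\<^esub> r \<odot>\<^bsub>?P\<^esub> g" if "g \<in> carrier ?P"
      using r c[OF f] c[OF that] by (simp add: power_module_def smult_r_distr)
    show "(r \<otimes>\<^bsub>R\<^esub> s) \<odot>\<^bsub>?P\<^esub> f = r \<odot>\<^bsub>?P\<^esub> (s \<odot>\<^bsub>?P\<^esub> f)" if "s \<in> carrier R"
      using r that c[OF f] by (simp add: power_module_def smult_assoc)
  next
    fix f assume f: "f \<in> carrier ?P"
    show "\<one>\<^bsub>R\<^esub> \<odot>\<^bsub>?P\<^esub> f = f" using c[OF f] by (simp add: power_module_def smult_one)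
  qed
  ultimately show ?thesis unfolding left_module_def by (simp add: R.ring_axioms)
qed

lemma balanced_mapI:
  assumes "\<And>m n. \<lbrakk>m \<in> carrier M; n \<in> carrier N\<rbrakk> \<Longrightarrow> \<phi> m n \<in> carrier G"
    and "\<And>m m' n. \<lbrakk>m \<in> carrier M; m' \<in> carrier M; n \<in> carrier N\<rbrakk> \<Longrightarrow> \<phi> (m \<oplus>\<^bsub>M\<^esub> m') n = \<phi> m n \<otimes>\<^bsub>G\<^esub> \<phi> m' n"
    and "\<And>m n n'. \<lbrakk>m \<in> carrier M; n \<in> carrier N; n' \<in> carrier N\<rbrakk> \<Longrightarrow> \<phi> m (n \<oplus>\<^bsub>N\<^esub> n') = \<phi> m n \<otimes>\<^bsub>G\<^esub> \<phi> m n'"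
    and "\<And>r m n. \<lbrakk>r \<in> carrier R; m \<in> carrier M; n \<in> carrier N\<rbrakk> \<Longrightarrow> \<phi> (r \<odot>\<^bsub>M\<^esub> m) n = \<phi> m (r \<odot>\<^bsub>N\<^esub> n)"
  shows "balanced_map R M N G \<phi>"
  unfolding balanced_map_def by (intro conjI ballI assms)

lemma balanced_mapD:
  assumes "balanced_map R M N G \<phi>"
  shows "\<lbrakk>m \<in> carrier M; n \<in> carrier N\<rbrakk> \<Longrightarrow> \<phi> m n \<in> carrier G"
    and "\<lbrakk>m \<in> carrier M; m' \<in> carrier M; n \<in> carrier N\<rbrakk> \<Longrightarrow> \<phi> (m \<oplus>\<^bsub>M\<^esub> m') n = \<phi> m n \<otimes>\<^bsub>G\<^esub> \<phi> m' n"
    and "\<lbrakk>m \<in> carrier M; n \<in> carrier N; n' \<in> carrier N\<rbrakk> \<Longrightarrow> \<phi> m (n \<oplus>\<^bsub>N\<^esub> n') = \<phi> m n \<otimes>\<^bsub>G\<^esub> \<phi> m n'"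
    and "\<lbrakk>r \<in> carrier R; m \<in> carrier M; n \<in> carrier N\<rbrakk> \<Longrightarrow> \<phi> (r \<odot>\<^bsub>M\<^esub> m) n = \<phi> m (r \<odot>\<^bsub>N\<^esub> n)"
  using assms unfolding balanced_map_def by blast+

lemma (in tensor_pair) pure_zero_left:
  assumes n: "n \<in> carrier N" shows "ptens \<zero>\<^bsub>M\<^esub> n = \<one>\<^bsub>TG\<^esub>"
proof -
  interpret T: comm_group TG by (rule comm_group_TG)
  have "ptens (\<zero>\<^bsub>M\<^esub> \<oplus>\<^bsub>M\<^esub> \<zero>\<^bsub>M\<^esub>) n = ptens \<zero>\<^bsub>M\<^esub> n \<otimes>\<^bsub>TG\<^esub> ptens \<zero>\<^bsub>M\<^esub> n"
    by (rule balanced_mapD(2)[OF pure_balanced]) (simp_all add: n)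
  then show ?thesis using pure_closed[OF M.zero_closed n] by simp
qed

lemma tensor_pair_right_left:
  assumes "right_module R M" "left_module R N" shows "tensor_pair R M N"
proof -
  interpret M: left_module "opp R" M by fact
  interpret N: left_module R N by fact
  show ?thesis
    by unfold_locales (use M.smult_closed N.smult_closed in auto)
qed

text \<open>If \<open>q \<otimes> n = 0\<close> for all \<open>n\<close>, then flatness makes \<open>qR \<otimes> N\<close> vanish, so that the sequence
  \<open>0 \<rightarrow> qR \<rightarrow> 0\<close> becomes exact after tensoring and hence was exact before.\<close>

lemma faithfully_flat_detect:
  fixes Q :: "('r, 'm) module" and R :: "('r, 'x) ring_scheme" and N :: "('r, 'n, 'y) module_scheme"
  assumes ff: "faithfully_flat TYPE('m) R N" and Q: "right_module R Q" and q: "q \<in> carrier Q"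
    and zero: "\<And>n. n \<in> carrier N \<Longrightarrow> pure_tensor R Q N q n = \<one>\<^bsub>tensor_group R Q N\<^esub>"
  shows "q = \<zero>\<^bsub>Q\<^esub>"
proof -
  have N: "left_module R N" using ff unfolding faithfully_flat_def by blast
  interpret Q: left_module "opp R" Q by fact
  interpret N: left_module R N by fact
  let ?C = "{r \<odot>\<^bsub>Q\<^esub> q | r. r \<in> carrier R}"
  have "is_submodule (opp R) Q ?C"
    unfolding is_submodule_def
  proof (intro conjI ballI subsetI)
    show "\<zero>\<^bsub>Q\<^esub> \<in> ?C" using Q.zero_smult[OF q] N.R.zero_closed by force
    fix x assume "x \<in> ?C"
    then obtain r where r: "r \<in> carrier R" "x = r \<odot>\<^bsub>Q\<^esub> q" by blast
    show "x \<in> carrier Q" using r q Q.smult_closed by simp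
    show "s \<odot>\<^bsub>Q\<^esub> x \<in> ?C" if "s \<in> carrier (opp R)" for s
      using that r q Q.smult_assoc[of s r q] by (intro CollectI exI[of _ "r \<otimes>\<^bsub>R\<^esub> s"]) simp
    fix y assume "y \<in> ?C"
    then obtain s where s: "s \<in> carrier R" "y = s \<odot>\<^bsub>Q\<^esub> q" by blast
    show "x \<oplus>\<^bsub>Q\<^esub> y \<in> ?C" using r s q Q.smult_l_distr[of r s q] by (intro CollectI exI[of _ "r \<oplus>\<^bsub>R\<^esub> s"]) simp
  qed
  note C = left_module_submodule[OF Q this]
  have "is_submodule (opp R) Q {\<zero>\<^bsub>Q\<^esub>}"
    unfolding is_submodule_def by (simp add: Q.smult_zero[simplified])
  note Z = left_module_submodule[OF Q this]
  define Cm Zm where "Cm = Q\<lparr>carrier := ?C\<rparr>" and "Zm = Q\<lparr>carrier := {\<zero>\<^bsub>Q\<^esub>}\<rparr>"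
  have Cm: "right_module R Cm" and Zm: "right_module R Zm" using C Z unfolding Cm_def Zm_def .
  have cC: "carrier Cm = ?C" by (simp add: Cm_def)
  have cs [simp]: "carrier Zm = {\<zero>\<^bsub>Q\<^esub>}" "\<zero>\<^bsub>Cm\<^esub> = \<zero>\<^bsub>Q\<^esub>" "\<zero>\<^bsub>Zm\<^esub> = \<zero>\<^bsub>Q\<^esub>"
    "x \<oplus>\<^bsub>Cm\<^esub> y = x \<oplus>\<^bsub>Q\<^esub> y" "x \<oplus>\<^bsub>Zm\<^esub> y = x \<oplus>\<^bsub>Q\<^esub> y" "r \<odot>\<^bsub>Cm\<^esub> x = r \<odot>\<^bsub>Q\<^esub> x" "r \<odot>\<^bsub>Zm\<^esub> x = r \<odot>\<^bsub>Q\<^esub> x" for r x y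
    by (simp_all add: Cm_def Zm_def)
  interpret TQ: tensor_pair R Q N by (rule tensor_pair_right_left[OF Q N])
  interpret TC: tensor_pair R Cm N by (rule tensor_pair_right_left[OF Cm N])
  interpret TZ: tensor_pair R Zm N by (rule tensor_pair_right_left[OF Zm N])
  interpret GQ: comm_group "tensor_group R Q N" by (rule TQ.comm_group_TG)
  interpret GC: comm_group "tensor_group R Cm N" by (rule TC.comm_group_TG)
  interpret GZ: comm_group "tensor_group R Zm N" by (rule TZ.comm_group_TG)
  have CQ: "x \<in> carrier Q" if "x \<in> carrier Cm" for x using that q Q.smult_closed unfolding cC by auto
  have ZC: "\<zero>\<^bsub>Q\<^esub> \<in> carrier Cm" using Q.zero_smult[OF q] N.R.zero_closed unfolding cC by force
  have rz: "r \<odot>\<^bsub>Q\<^esub> \<zero>\<^bsub>Q\<^esub> = \<zero>\<^bsub>Q\<^esub>" if "r \<in> carrier R" for r using Q.smult_zero that by simp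
  define f where "f = tensor_lift (tensor_group R Cm N) (\<lambda>m n. pure_tensor R Cm N m n)"
  define g where "g = tensor_lift (tensor_group R Q N) (\<lambda>m n. pure_tensor R Q N m n)"
  define g' where "g' = tensor_lift (tensor_group R Zm N) (\<lambda>(m :: 'm) n. pure_tensor R Zm N \<zero>\<^bsub>Q\<^esub> n)"
  have pC: "balanced_map R Cm N (tensor_group R Cm N) (pure_tensor R Cm N)" by (rule TC.pure_balanced)
  have bf: "balanced_map R Zm N (tensor_group R Cm N) (pure_tensor R Cm N)"
    by (rule balanced_mapI) (use balanced_mapD[OF pC] ZC TC.pure_zero_left N.smult_closed rz in auto)
  have bg: "balanced_map R Cm N (tensor_group R Q N) (pure_tensor R Q N)"
    by (rule balanced_mapI) (use balanced_mapD[OF TQ.pure_balanced] CQ in auto)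
  have zn: "pure_tensor R Zm N \<zero>\<^bsub>Q\<^esub> n = \<one>\<^bsub>tensor_group R Zm N\<^esub>" if "n \<in> carrier N" for n
    using TZ.pure_zero_left[OF that] by simp
  have bg': "balanced_map R Cm N (tensor_group R Zm N) (\<lambda>(m :: 'm) n. pure_tensor R Zm N \<zero>\<^bsub>Q\<^esub> n)"
    by (rule balanced_mapI) (simp_all add: zn N.smult_closed)
  note fh = TZ.tensor_lift_hom[OF TC.comm_group_TG bf, folded f_def]
  note gh = TC.tensor_lift_hom[OF TQ.comm_group_TG bg, folded g_def]
  note g'h = TC.tensor_lift_hom[OF TZ.comm_group_TG bg', folded g'_def]
  have Zone: "t = \<one>\<^bsub>tensor_group R Zm N\<^esub>" if "t \<in> carrier (tensor_group R Zm N)" for t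
    using that by (induct rule: TZ.tensor_induct) (simp_all add: zn)
  have f1: "f ` carrier (tensor_group R Zm N) = {\<one>\<^bsub>tensor_group R Cm N\<^esub>}"
  proof -
    have "carrier (tensor_group R Zm N) = {\<one>\<^bsub>tensor_group R Zm N\<^esub>}"
      using Zone GZ.one_closed by blast
    then show ?thesis using hom_one[OF fh GZ.group_axioms GC.group_axioms] by simp
  qed
  have exact1: "exact_at (add_monoid Zm) (\<lambda>x. x) (add_monoid Cm) (\<lambda>x. x) (add_monoid Q)"
    unfolding exact_at_def kernel_def using ZC by auto
  have smC: "r \<odot>\<^bsub>Q\<^esub> x \<in> carrier Cm" if "r \<in> carrier R" "x \<in> carrier Cm" for r x
    using TC.smult_M[OF that] by simp
  have homf: "(\<lambda>x. x) \<in> module_hom R Zm Cm" and homg: "(\<lambda>x. x) \<in> module_hom R Cm Q"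
    and homg': "(\<lambda>x. \<zero>\<^bsub>Q\<^esub>) \<in> module_hom R Cm Zm"
    using ZC CQ by (auto intro!: module_homI simp: rz)
  have "exact_at (tensor_group R Zm N) f (tensor_group R Cm N) g (tensor_group R Q N)"
    using ff exact1 Cm Zm Q homf homg unfolding faithfully_flat_def f_def g_def by blast
  then have ker: "kernel (tensor_group R Cm N) (tensor_group R Q N) g = {\<one>\<^bsub>tensor_group R Cm N\<^esub>}"
    unfolding exact_at_def f1 by simp
  have "q \<in> ?C" using Q.smult_one[OF q] N.R.one_closed by force
  then have qC: "q \<in> carrier Cm" unfolding cC .
  have q1: "pure_tensor R Cm N q n = \<one>\<^bsub>tensor_group R Cm N\<^esub>" if n: "n \<in> carrier N" for n
  proof -
    have "pure_tensor R Cm N q n \<in> kernel (tensor_group R Cm N) (tensor_group R Q N) g"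
      unfolding kernel_def g_def
      using TC.pure_closed[of q n] TC.tensor_lift_pure[OF TQ.comm_group_TG bg, of q n] zero[OF n] qC n by simp
    then show ?thesis unfolding ker by simp
  qed
  have Cone: "t = \<one>\<^bsub>tensor_group R Cm N\<^esub>" if "t \<in> carrier (tensor_group R Cm N)" for t
    using that
  proof (induct rule: TC.tensor_induct)
    case (pure m n)
    then obtain r where r: "r \<in> carrier R" "m = r \<odot>\<^bsub>Q\<^esub> q" unfolding cC by blast
    have "pure_tensor R Cm N (r \<odot>\<^bsub>Q\<^esub> q) n = pure_tensor R Cm N q (r \<odot>\<^bsub>N\<^esub> n)"
      using balanced_mapD(4)[OF pC r(1) qC pure(2)] by simp
    then show ?case using q1[OF N.smult_closed] r pure by simp
  qed simp
  have "exact_at (tensor_group R Zm N) f (tensor_group R Cm N) g' (tensor_group R Zm N)"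
    unfolding exact_at_def f1 kernel_def
    using Cone Zone hom_in_carrier[OF g'h] GC.one_closed by blast
  then have "exact_at (add_monoid Zm) (\<lambda>x. x) (add_monoid Cm) (\<lambda>x. \<zero>\<^bsub>Q\<^esub>) (add_monoid Zm)"
    using ff Cm Zm homf homg' unfolding faithfully_flat_def f_def g'_def by blast
  then show ?thesis
    unfolding exact_at_def kernel_def using qC by auto
qed

text \<open>A system of \<open>k\<close> linear equations \<open>z\<^sub>i = \<Sum>\<^sub>p y\<^sub>p\<^sub>i a\<^sub>p\<close> is solvable in \<open>R\<close> if it is solvable after tensoring
  with every element of \<open>N\<close>. Let \<open>W\<close> be the submodule of \<open>M\<^sup>k\<close> that the columns \<open>y\<^sub>p\<close> generate. By hypothesis
  the class of \<open>z\<close> in \<open>M\<^sup>k/W\<close> vanishes when tensored with any \<open>n\<close>, hence it is zero by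
  \<open>faithfully_flat_detect\<close>.\<close>

theorem faithfully_flat_descent:
  fixes M :: "('r, 'm, 'y) module_scheme" and R :: "('r, 'x) ring_scheme" and N :: "('r, 'n, 'z) module_scheme"
    and k :: nat
  assumes ff: "faithfully_flat TYPE((nat \<Rightarrow> 'm) set) R N" and M: "right_module R M"
    and P: "finite P" and z: "\<And>i. i < k \<Longrightarrow> z i \<in> carrier M"
    and y: "\<And>p i. \<lbrakk>p \<in> P; i < k\<rbrakk> \<Longrightarrow> y p i \<in> carrier M"
    and sys: "\<And>n. n \<in> carrier N \<Longrightarrow> \<exists>b. b \<in> P \<rightarrow> carrier N \<and> (\<forall>i<k. pure_tensor R M N (z i) n =
      finprod (tensor_group R M N) (\<lambda>p. pure_tensor R M N (y p i) (b p)) P)"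
  shows "\<exists>a. a \<in> P \<rightarrow> carrier R \<and> (\<forall>i<k. z i = finsum M (\<lambda>p. a p \<odot>\<^bsub>M\<^esub> y p i) P)"
proof -
  have N: "left_module R N" using ff unfolding faithfully_flat_def by blast
  interpret M: left_module "opp R" M by fact
  interpret N: left_module R N by fact
  let ?V = "power_module k M"
  have V: "left_module (opp R) ?V" by (rule left_module_power[OF M])
  interpret V: left_module "opp R" ?V by (rule V)
  define vec where "vec x = (\<lambda>i. if i < k then x i else \<zero>\<^bsub>M\<^esub>)" for x :: "nat \<Rightarrow> 'm"
  define comb where "comb a i = finsum M (\<lambda>p. a p \<odot>\<^bsub>M\<^esub> y p i) P" for a i
  have ay: "(\<lambda>p. a p \<odot>\<^bsub>M\<^esub> y p i) \<in> P \<rightarrow> carrier M" if "a \<in> P \<rightarrow> carrier R" "i < k" for a i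
    using that y M.smult_closed by (auto simp: Pi_iff)
  have comb_closed: "comb a i \<in> carrier M" if "a \<in> P \<rightarrow> carrier R" "i < k" for a i
    unfolding comb_def by (rule M.M.finsum_closed[OF ay[OF that]])
  have vec_closed: "vec x \<in> carrier ?V" if "\<And>i. i < k \<Longrightarrow> x i \<in> carrier M" for x
    using that by (simp add: power_module_def vec_def)
  (* The vectors of right-hand sides of the system, for all values of the unknowns. *)
  define W0 where "W0 = {vec (comb a) | a. a \<in> P \<rightarrow> carrier R}"
  have W: "is_submodule (opp R) ?V W0"
    unfolding is_submodule_def W0_def
  proof (intro conjI ballI subsetI)
    have "vec (comb (\<lambda>p. \<zero>\<^bsub>R\<^esub>)) = \<zero>\<^bsub>?V\<^esub>"
    proof
      fix i
      show "vec (comb (\<lambda>p. \<zero>\<^bsub>R\<^esub>)) i = \<zero>\<^bsub>?V\<^esub> i"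
        using y M.zero_smult by (auto simp: vec_def comb_def power_module_def intro!: M.M.add.finprod_one_eqI)
    qed
    then show "\<zero>\<^bsub>?V\<^esub> \<in> {vec (comb a) | a. a \<in> P \<rightarrow> carrier R}" by (intro CollectI exI[of _ "\<lambda>p. \<zero>\<^bsub>R\<^esub>"]) (auto simp: Pi_iff)
    fix v assume "v \<in> {vec (comb a) | a. a \<in> P \<rightarrow> carrier R}"
    then obtain a where a: "a \<in> P \<rightarrow> carrier R" "v = vec (comb a)" by blast
    show "v \<in> carrier ?V" unfolding a(2) by (rule vec_closed) (rule comb_closed[OF a(1)])
    show "r \<odot>\<^bsub>?V\<^esub> v \<in> {vec (comb a) | a. a \<in> P \<rightarrow> carrier R}" if r: "r \<in> carrier (opp R)" for r
    proof (intro CollectI exI[of _ "\<lambda>p. a p \<otimes>\<^bsub>R\<^esub> r"] conjI)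
      have aR: "a p \<in> carrier R" if "p \<in> P" for p using a that by (auto simp: Pi_iff)
      show "(\<lambda>p. a p \<otimes>\<^bsub>R\<^esub> r) \<in> P \<rightarrow> carrier R" using a r by (auto simp: Pi_iff)
      show "r \<odot>\<^bsub>?V\<^esub> v = vec (comb (\<lambda>p. a p \<otimes>\<^bsub>R\<^esub> r))"
      proof
        fix i
        have "r \<odot>\<^bsub>M\<^esub> comb a i = comb (\<lambda>p. a p \<otimes>\<^bsub>R\<^esub> r) i" if i: "i < k"
          unfolding comb_def M.smult_finsum[OF r ay[OF a(1) i]]
          using M.smult_assoc[of r] y[OF _ i] r aR M.smult_closed
          by (intro M.M.finsum_cong') (auto simp: Pi_iff)
        then show "(r \<odot>\<^bsub>?V\<^esub> v) i = vec (comb (\<lambda>p. a p \<otimes>\<^bsub>R\<^esub> r)) i"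
          using M.smult_zero[OF r] by (simp add: power_module_def vec_def a(2))
      qed
    qed
    fix w assume "w \<in> {vec (comb a) | a. a \<in> P \<rightarrow> carrier R}"
    then obtain b where b: "b \<in> P \<rightarrow> carrier R" "w = vec (comb b)" by blast
    show "v \<oplus>\<^bsub>?V\<^esub> w \<in> {vec (comb a) | a. a \<in> P \<rightarrow> carrier R}"
    proof (intro CollectI exI[of _ "\<lambda>p. a p \<oplus>\<^bsub>R\<^esub> b p"] conjI)
      have aR: "a p \<in> carrier R" "b p \<in> carrier R" if "p \<in> P" for p using a b that by (auto simp: Pi_iff)
      show "(\<lambda>p. a p \<oplus>\<^bsub>R\<^esub> b p) \<in> P \<rightarrow> carrier R" using aR by (auto simp: Pi_iff)
      show "v \<oplus>\<^bsub>?V\<^esub> w = vec (comb (\<lambda>p. a p \<oplus>\<^bsub>R\<^esub> b p))"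
      proof
        fix i
        have "comb a i \<oplus>\<^bsub>M\<^esub> comb b i = comb (\<lambda>p. a p \<oplus>\<^bsub>R\<^esub> b p) i" if i: "i < k"
          unfolding comb_def M.M.finsum_addf[OF ay[OF a(1) i] ay[OF b(1) i], symmetric]
          using M.smult_l_distr y[OF _ i] aR M.smult_closed
          by (intro M.M.finsum_cong') (auto simp: Pi_iff)
        then show "(v \<oplus>\<^bsub>?V\<^esub> w) i = vec (comb (\<lambda>p. a p \<oplus>\<^bsub>R\<^esub> b p)) i"
          by (simp add: power_module_def vec_def a(2) b(2))
      qed
    qed
  qed
  define Q where "Q = quotient_module ?V W0"
  have Q: "right_module R Q" unfolding Q_def by (rule left_module_quotient[OF V W])
  interpret Q: left_module "opp R" Q by (rule Q)
  let ?c = "coset_of ?V W0"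
  have c_closed: "?c v \<in> carrier Q" if "v \<in> carrier ?V" for v using that by (simp add: Q_def quotient_module_def)
  note c_add = quotient_add[OF V W, folded Q_def] and c_smult = quotient_smult[OF V W, folded Q_def]
  interpret TM: tensor_pair R M N by (rule tensor_pair_right_left[OF M N])
  interpret TQ: tensor_pair R Q N by (rule tensor_pair_right_left[OF Q N])
  interpret GM: comm_group "tensor_group R M N" by (rule TM.comm_group_TG)
  interpret GQ: comm_group "tensor_group R Q N" by (rule TQ.comm_group_TG)
  let ?pM = "pure_tensor R M N" and ?pQ = "pure_tensor R Q N"
  define inj where "inj i x = (\<lambda>l :: nat. if l = i then x else \<zero>\<^bsub>M\<^esub>)" for i and x :: 'm
  have inj_closed: "inj i x \<in> carrier ?V" if "i < k" "x \<in> carrier M" for i x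
    using that by (auto simp: inj_def power_module_def)
  have vec_sum: "vec x = finsum ?V (\<lambda>i. inj i (x i)) {..<k}" if x: "\<And>i. i < k \<Longrightarrow> x i \<in> carrier M" for x
  proof
    fix l
    let ?ev = "\<lambda>v :: nat \<Rightarrow> 'm. v l"
    have "?ev \<in> hom (add_monoid ?V) (add_monoid M)"
    proof (rule homI)
      fix v assume "v \<in> carrier (add_monoid ?V)"
      then show "v l \<in> carrier (add_monoid M)" by (cases "l < k") (auto simp: power_module_def)
    qed (simp add: power_module_def)
    then have "finsum ?V (\<lambda>i. inj i (x i)) {..<k} l = finsum M (\<lambda>i. inj i (x i) l) {..<k}"
      using add_hom_finsum[of ?V M ?ev "\<lambda>i. inj i (x i)" "{..<k}"] V.M.abelian_group_axioms M.M.abelian_group_axioms inj_closed x by (auto simp: Pi_iff)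
    also have "\<dots> = vec x l"
    proof (cases "l < k")
      case True
      have "finsum M (\<lambda>i. inj i (x i) l) {..<k} = finsum M (\<lambda>i. if l = i then x i else \<zero>\<^bsub>M\<^esub>) {..<k}"
        by (rule M.M.finsum_cong') (use x in \<open>auto simp: inj_def\<close>)
      also have "\<dots> = x l" by (rule M.M.finsum_singleton) (use True x in \<open>auto simp: Pi_iff\<close>)
      finally show ?thesis using True by (simp add: vec_def)
    next
      case False
      then show ?thesis by (auto simp: vec_def inj_def intro!: M.M.add.finprod_one_eqI)
    qed
    finally show "vec x l = finsum ?V (\<lambda>i. inj i (x i)) {..<k} l" ..
  qed
  have pure_hom: "(\<lambda>q. ?pQ q n) \<in> hom (add_monoid Q) (tensor_group R Q N)" if "n \<in> carrier N" for n
    using that balanced_mapD[OF TQ.pure_balanced] by (intro homI) auto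
  have c_hom: "?c \<in> hom (add_monoid ?V) (add_monoid Q)"
    by (intro homI) (simp_all add: c_closed c_add)
  have pure_vec: "?pQ (?c (vec x)) n = finprod (tensor_group R Q N) (\<lambda>i. ?pQ (?c (inj i (x i))) n) {..<k}"
    if x: "\<And>i. i < k \<Longrightarrow> x i \<in> carrier M" and n: "n \<in> carrier N" for x n
  proof -
    have e: "vec x = finsum ?V (\<lambda>i. inj i (x i)) {..<k}" by (rule vec_sum[OF x])
    have "?c (vec x) = finsum Q (\<lambda>i. ?c (inj i (x i))) {..<k}"
      unfolding e
      by (rule add_hom_finsum[OF V.M.abelian_group_axioms Q.M.abelian_group_axioms c_hom]) (use inj_closed x in \<open>auto simp: Pi_iff\<close>)
    then show ?thesis
      using hom_finprod[OF Q.M.a_comm_group TQ.comm_group_TG pure_hom[OF n], of "\<lambda>i. ?c (inj i (x i))" "{..<k}"] inj_closed x c_closed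
      unfolding finsum_def by (auto simp: Pi_iff)
  qed
  have bal: "balanced_map R M N (tensor_group R Q N) (\<lambda>m n. ?pQ (?c (inj i m)) n)" if i: "i < k" for i
  proof (rule balanced_mapI)
    fix m m' n n' r assume m: "m \<in> carrier M" and n: "n \<in> carrier N"
    note mc = c_closed[OF inj_closed[OF i m]]
    show "?pQ (?c (inj i m)) n \<in> carrier (tensor_group R Q N)" by (rule TQ.pure_closed[OF mc n])
    show "?pQ (?c (inj i m)) (n \<oplus>\<^bsub>N\<^esub> n') = ?pQ (?c (inj i m)) n \<otimes>\<^bsub>tensor_group R Q N\<^esub> ?pQ (?c (inj i m)) n'" if "n' \<in> carrier N"
      by (rule balanced_mapD(3)[OF TQ.pure_balanced mc n that])
    show "?pQ (?c (inj i (m \<oplus>\<^bsub>M\<^esub> m'))) n = ?pQ (?c (inj i m)) n \<otimes>\<^bsub>tensor_group R Q N\<^esub> ?pQ (?c (inj i m')) n" if m': "m' \<in> carrier M"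
    proof -
      have "inj i (m \<oplus>\<^bsub>M\<^esub> m') = inj i m \<oplus>\<^bsub>?V\<^esub> inj i m'" by (auto simp: inj_def power_module_def)
      then show ?thesis
        using balanced_mapD(2)[OF TQ.pure_balanced mc c_closed[OF inj_closed[OF i m']] n]
          c_add[OF inj_closed[OF i m] inj_closed[OF i m']] by simp
    qed
    show "?pQ (?c (inj i (r \<odot>\<^bsub>M\<^esub> m))) n = ?pQ (?c (inj i m)) (r \<odot>\<^bsub>N\<^esub> n)" if r: "r \<in> carrier R"
    proof -
      have r': "r \<in> carrier (opp R)" using r by simp
      have "inj i (r \<odot>\<^bsub>M\<^esub> m) = r \<odot>\<^bsub>?V\<^esub> inj i m" using M.smult_zero[OF r'] by (auto simp: inj_def power_module_def)
      then show ?thesis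
        using balanced_mapD(4)[OF TQ.pure_balanced r mc n] c_smult[OF r' inj_closed[OF i m]] by simp
    qed
  qed
  have "?c (vec z) = \<zero>\<^bsub>Q\<^esub>"
  proof (rule faithfully_flat_detect[OF ff Q c_closed[OF vec_closed[of z, OF z]]])
    fix n assume n: "n \<in> carrier N"
    obtain b where b: "b \<in> P \<rightarrow> carrier N"
      and eq: "\<And>i. i < k \<Longrightarrow> ?pM (z i) n = finprod (tensor_group R M N) (\<lambda>p. ?pM (y p i) (b p)) P"
      using sys[OF n] by blast
    have summand: "?pQ (?c (inj i (z i))) n = finprod (tensor_group R Q N) (\<lambda>p. ?pQ (?c (inj i (y p i))) (b p)) P" if i: "i < k" for i
    proof -
      let ?L = "tensor_lift (tensor_group R Q N) (\<lambda>m n. ?pQ (?c (inj i m)) n)"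
      note Lh = TM.tensor_lift_hom[OF TQ.comm_group_TG bal[OF i]] and Lp = TM.tensor_lift_pure[OF TQ.comm_group_TG bal[OF i]]
      have "?pQ (?c (inj i (z i))) n = ?L (?pM (z i) n)" by (rule Lp[OF z[OF i] n, symmetric])
      also have "\<dots> = finprod (tensor_group R Q N) (\<lambda>p. ?L (?pM (y p i) (b p))) P"
        unfolding eq[OF i]
        by (rule hom_finprod[OF TM.comm_group_TG TQ.comm_group_TG Lh]) (use y i b in \<open>auto simp: Pi_iff intro!: TM.pure_closed\<close>)
      also have "\<dots> = finprod (tensor_group R Q N) (\<lambda>p. ?pQ (?c (inj i (y p i))) (b p)) P"
        by (rule GQ.finprod_cong') (use y i b inj_closed c_closed in \<open>auto simp: Pi_iff intro!: TQ.pure_closed Lp\<close>)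
      finally show ?thesis .
    qed
    have cl: "?pQ (?c (inj i (y p i))) (b p) \<in> carrier (tensor_group R Q N)" if "i < k" "p \<in> P" for i p
      using that y b inj_closed c_closed by (auto simp: Pi_iff intro!: TQ.pure_closed)
    have "?pQ (?c (vec z)) n = finprod (tensor_group R Q N) (\<lambda>i. ?pQ (?c (inj i (z i))) n) {..<k}"
      by (rule pure_vec[of z, OF z n])
    also have "\<dots> = finprod (tensor_group R Q N) (\<lambda>i. finprod (tensor_group R Q N) (\<lambda>p. ?pQ (?c (inj i (y p i))) (b p)) P) {..<k}"
      by (rule GQ.finprod_cong') (use cl in \<open>auto simp: summand Pi_iff intro!: GQ.finprod_closed\<close>)
    also have "\<dots> = finprod (tensor_group R Q N) (\<lambda>p. finprod (tensor_group R Q N) (\<lambda>i. ?pQ (?c (inj i (y p i))) (b p)) {..<k}) P"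
      by (rule GQ.finprod_swap) (use P cl in \<open>auto simp: Pi_iff\<close>)
    also have "\<dots> = \<one>\<^bsub>tensor_group R Q N\<^esub>"
    proof (rule GQ.finprod_one_eqI)
      fix p assume p: "p \<in> P"
      have bp: "b p \<in> carrier N" using b p by (auto simp: Pi_iff)
      have yp: "y p i \<in> carrier M" if "i < k" for i using y p that by blast
      (* The column number p is the right-hand side for the unit vector number p. *)
      define \<delta> where "\<delta> = (\<lambda>p'. if p = p' then \<one>\<^bsub>R\<^esub> else \<zero>\<^bsub>R\<^esub>)"
      have "vec (y p) = vec (comb \<delta>)"
      proof
        fix i
        have "comb \<delta> i = y p i" if i: "i < k"
        proof -
          have "comb \<delta> i = finsum M (\<lambda>p'. if p = p' then y p' i else \<zero>\<^bsub>M\<^esub>) P"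
            unfolding comb_def \<delta>_def
            by (rule M.M.finsum_cong') (use y i M.smult_one M.zero_smult in \<open>auto simp: Pi_iff\<close>)
          also have "\<dots> = y p i" by (rule M.M.finsum_singleton) (use p P y i in \<open>auto simp: Pi_iff\<close>)
          finally show ?thesis .
        qed
        then show "vec (y p) i = vec (comb \<delta>) i" by (simp add: vec_def)
      qed
      then have "vec (y p) \<in> W0" unfolding W0_def by (intro CollectI exI[of _ \<delta>]) (auto simp: \<delta>_def)
      then have "?c (vec (y p)) = \<zero>\<^bsub>Q\<^esub>"
        using quotient_eq_zero[OF V W vec_closed[of "y p"]] yp unfolding Q_def by blast
      then show "finprod (tensor_group R Q N) (\<lambda>i. ?pQ (?c (inj i (y p i))) (b p)) {..<k} = \<one>\<^bsub>tensor_group R Q N\<^esub>"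
        using pure_vec[of "y p" "b p"] yp bp TQ.pure_zero_left[OF bp] by simp
    qed
    finally show "?pQ (?c (vec z)) n = \<one>\<^bsub>tensor_group R Q N\<^esub>" .
  qed
  then have "vec z \<in> W0"
    using quotient_eq_zero[OF V W vec_closed[of z, OF z]] unfolding Q_def by blast
  then obtain a where a: "a \<in> P \<rightarrow> carrier R" "vec z = vec (comb a)" unfolding W0_def by blast
  have "z i = comb a i" if "i < k" for i using fun_cong[OF a(2), of i] that by (simp add: vec_def)
  then show ?thesis using a(1) unfolding comb_def by blast
qed

corollary faithfully_flat_descent_finite:
  fixes M :: "('r, 'm, 'y) module_scheme" and R :: "('r, 'x) ring_scheme" and N :: "('r, 'n, 'z) module_scheme"
  assumes ff: "faithfully_flat TYPE((nat \<Rightarrow> 'm) set) R N" and M: "right_module R M"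
    and P: "finite P" and I: "finite I" and z: "\<And>i. i \<in> I \<Longrightarrow> z i \<in> carrier M"
    and y: "\<And>p i. \<lbrakk>p \<in> P; i \<in> I\<rbrakk> \<Longrightarrow> y p i \<in> carrier M"
    and sys: "\<And>n. n \<in> carrier N \<Longrightarrow> \<exists>b. b \<in> P \<rightarrow> carrier N \<and> (\<forall>i\<in>I. pure_tensor R M N (z i) n =
      finprod (tensor_group R M N) (\<lambda>p. pure_tensor R M N (y p i) (b p)) P)"
  shows "\<exists>a. a \<in> P \<rightarrow> carrier R \<and> (\<forall>i\<in>I. z i = finsum M (\<lambda>p. a p \<odot>\<^bsub>M\<^esub> y p i) P)"
proof -
  obtain h where h: "bij_betw h {..<card I} I"
    using ex_bij_betw_nat_finite[OF I] by (auto simp: atLeast0LessThan)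
  have hI: "h i \<in> I" if "i < card I" for i using h that by (auto simp: bij_betw_def)
  have "\<exists>a. a \<in> P \<rightarrow> carrier R \<and> (\<forall>i<card I. z (h i) = finsum M (\<lambda>p. a p \<odot>\<^bsub>M\<^esub> y p (h i)) P)"
  proof (rule faithfully_flat_descent[OF ff M P])
    fix n assume "n \<in> carrier N"
    from sys[OF this] show "\<exists>b. b \<in> P \<rightarrow> carrier N \<and> (\<forall>i<card I. pure_tensor R M N (z (h i)) n =
      finprod (tensor_group R M N) (\<lambda>p. pure_tensor R M N (y p (h i)) (b p)) P)"
      using hI by blast
  qed (use hI z y in auto)
  moreover have "\<exists>j<card I. i = h j" if "i \<in> I" for i using h that by (auto simp: bij_betw_def)
  ultimately show ?thesis by metis
qed

section \<open>Coordinates of a coaction\<close>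

context hopf_algebra
begin

abbreviation "functionals \<equiv> module_hom K H (scalar_algebra K)"

lemma functional_closed: "\<lbrakk>\<theta> \<in> functionals; h \<in> carrier H\<rbrakk> \<Longrightarrow> \<theta> h \<in> carrier K"
  using module_hom_closed[of \<theta> K H "scalar_algebra K" h] by (simp add: scalar_algebra_def)

definition H_basis :: "'h set \<Rightarrow> ('h \<Rightarrow> 'h \<Rightarrow> 'k) \<Rightarrow> bool" where
  "H_basis X \<psi> \<longleftrightarrow> X \<subseteq> carrier H \<and> (\<forall>e. \<psi> e \<in> functionals) \<and>
    (\<forall>h \<in> carrier H. finite {e. \<psi> e h \<noteq> \<zero>\<^bsub>K\<^esub>} \<and> {e. \<psi> e h \<noteq> \<zero>\<^bsub>K\<^esub>} \<subseteq> X \<and>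
      h = finsum H (\<lambda>e. \<psi> e h \<odot>\<^bsub>H\<^esub> e) {e. \<psi> e h \<noteq> \<zero>\<^bsub>K\<^esub>})"

lemma field_K: "field K" by unfold_locales

lemma ex_H_basis: "\<exists>X \<psi>. H_basis X \<psi>"
proof -
  interpret K: field K by (rule field_K)
  interpret V: vector_subspace K H "{\<zero>\<^bsub>H\<^esub>}"
    by unfold_locales auto
  obtain X \<psi> where X: "X \<subseteq> carrier H" "\<forall>e. \<psi> e \<in> functionals"
    and v: "\<And>v. v \<in> carrier H \<Longrightarrow> finite {e. \<psi> e v \<noteq> \<zero>\<^bsub>K\<^esub>} \<and> {e. \<psi> e v \<noteq> \<zero>\<^bsub>K\<^esub>} \<subseteq> X \<and>
      v \<ominus>\<^bsub>H\<^esub> finsum H (\<lambda>e. \<psi> e v \<odot>\<^bsub>H\<^esub> e) {e. \<psi> e v \<noteq> \<zero>\<^bsub>K\<^esub>} \<in> {\<zero>\<^bsub>H\<^esub>}"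
    using V.relative_basis by blast
  have "v = finsum H (\<lambda>e. \<psi> e v \<odot>\<^bsub>H\<^esub> e) {e. \<psi> e v \<noteq> \<zero>\<^bsub>K\<^esub>}" if h: "v \<in> carrier H" for v
  proof -
    let ?s = "finsum H (\<lambda>e. \<psi> e v \<odot>\<^bsub>H\<^esub> e) {e. \<psi> e v \<noteq> \<zero>\<^bsub>K\<^esub>}"
    have s: "?s \<in> carrier H"
      by (rule finsum_closed) (use X v[OF h] functional_closed h in \<open>auto simp: Pi_iff\<close>)
    have "v \<ominus>\<^bsub>H\<^esub> ?s = \<zero>\<^bsub>H\<^esub>" using v[OF h] by blast
    then show ?thesis using s h minus_equality[of v "\<ominus>\<^bsub>H\<^esub> ?s"] by (simp add: a_minus_def minus_minus)
  qed
  then show ?thesis unfolding H_basis_def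
    by (intro exI[of _ X] exI[of _ \<psi>] conjI ballI X) (simp_all add: v)
qed

lemma H_basisD:
  assumes "H_basis X \<psi>"
  shows "X \<subseteq> carrier H" "\<psi> e \<in> functionals" "h \<in> carrier H \<Longrightarrow> finite {e. \<psi> e h \<noteq> \<zero>\<^bsub>K\<^esub>}"
    "h \<in> carrier H \<Longrightarrow> {e. \<psi> e h \<noteq> \<zero>\<^bsub>K\<^esub>} \<subseteq> X"
    "h \<in> carrier H \<Longrightarrow> finsum H (\<lambda>e. \<psi> e h \<odot>\<^bsub>H\<^esub> e) {e. \<psi> e h \<noteq> \<zero>\<^bsub>K\<^esub>} = h"
  using assms unfolding H_basis_def by auto

end

context comodule_algebra
begin

abbreviation "functionals \<equiv> module_hom K H (scalar_algebra K)"

text \<open>\<open>coord \<theta>\<close> is \<open>id \<otimes> \<theta> : B \<otimes> H \<rightarrow> B\<close>, and \<open>coact \<theta> b\<close> is the \<open>\<theta>\<close>-component of \<open>\<rho> b\<close>. A subcomodule is a subspace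
  that is closed under all \<open>coact \<theta>\<close>, and a colinear map is a linear map that commutes with them
  (\<open>colinear_iff\<close>), so both can be treated without tensors.\<close>

definition coord where "coord \<theta> = tensor_sum B (\<lambda>b h. \<theta> h \<odot>\<^bsub>B\<^esub> b)"
definition coact where "coact \<theta> b = cosum B \<rho> (\<lambda>b0 b1. \<theta> b1 \<odot>\<^bsub>B\<^esub> b0) b"

lemma coord_bilinear:
  assumes \<theta>: "\<theta> \<in> functionals" shows "bilinear_map K B H B (\<lambda>b h. \<theta> h \<odot>\<^bsub>B\<^esub> b)"
  by (rule lins lin_comp[OF \<theta>] H.functional_closed[OF \<theta>] | assumption)+

lemma lin_coord: "\<theta> \<in> functionals \<Longrightarrow> coord \<theta> \<in> module_hom K BH B"
  unfolding coord_def by (rule BH.lin_tensor_sum[OF B.k_module coord_bilinear])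

lemma coord_pure: "\<lbrakk>\<theta> \<in> functionals; b \<in> carrier B; h \<in> carrier H\<rbrakk> \<Longrightarrow> coord \<theta> (pure_tensor K B H b h) = \<theta> h \<odot>\<^bsub>B\<^esub> b"
  unfolding coord_def by (rule BH.tensor_sum_pure[OF B.k_module coord_bilinear])

lemma coact_coord: "coact \<theta> b = coord \<theta> (\<rho> b)"
  unfolding coact_def coord_def cosum_def ..

lemma coact_closed: "\<lbrakk>\<theta> \<in> functionals; b \<in> carrier B\<rbrakk> \<Longrightarrow> coact \<theta> b \<in> carrier B"
  unfolding coact_coord by (rule module_hom_closed[OF lin_coord rho_closed])

lemma lin_coact: "\<theta> \<in> functionals \<Longrightarrow> coact \<theta> \<in> module_hom K B B"
  unfolding coact_coord by (rule lin_comp[OF lin_coord lin_rho])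

lemma coact_counit: "b \<in> carrier B \<Longrightarrow> coact \<epsilon> b = b"
  unfolding coact_def by (rule cosum_counit[OF B.k_module _ lin_id])

text \<open>Expansion of \<open>t \<in> B \<otimes> H\<close> along a basis of \<open>H\<close>. The sum is taken over any \<open>E\<close> that is large enough, so
  that two tensors can be expanded over the same index set.\<close>

lemma coord_expand:
  assumes X: "H.H_basis X \<psi>" and t: "t \<in> carrier BH"
  shows "\<exists>E0. finite E0 \<and> E0 \<subseteq> X \<and> (\<forall>e. e \<notin> E0 \<longrightarrow> coord (\<psi> e) t = \<zero>\<^bsub>B\<^esub>) \<and>
    (\<forall>E. finite E \<and> E0 \<subseteq> E \<and> E \<subseteq> carrier H \<longrightarrow> finsum BH (\<lambda>e. pure_tensor K B H (coord (\<psi> e) t) e) E = t)"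
  using t
proof (induct rule: BH.T_induct)
  note b = H.H_basisD[OF X]
  have ab: "abelian_monoid BH" by (rule abelian_group.axioms(1)[OF BH.abelian_group_T])
  {
    case (pure m h)
    let ?S = "{e. \<psi> e h \<noteq> \<zero>\<^bsub>K\<^esub>}"
    have c: "coord (\<psi> e) (pure_tensor K B H m h) = \<psi> e h \<odot>\<^bsub>B\<^esub> m" for e
      using coord_pure[OF b(2)] pure by blast
    have k: "\<psi> e h \<in> carrier K" for e using H.functional_closed[OF b(2)] pure by blast
    have "finsum BH (\<lambda>e. pure_tensor K B H (coord (\<psi> e) (pure_tensor K B H m h)) e) E = pure_tensor K B H m h"
      if E: "finite E" "?S \<subseteq> E" "E \<subseteq> carrier H" for E
    proof -
      have "finsum BH (\<lambda>e. pure_tensor K B H (coord (\<psi> e) (pure_tensor K B H m h)) e) E =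
          finsum BH (\<lambda>e. pure_tensor K B H m (\<psi> e h \<odot>\<^bsub>H\<^esub> e)) E"
        by (rule abelian_monoid.finsum_cong'[OF ab]) (use E pure k in \<open>auto simp: c BH.pure_swap Pi_iff intro!: BH.pure_T\<close>)
      also have "\<dots> = pure_tensor K B H m (finsum H (\<lambda>e. \<psi> e h \<odot>\<^bsub>H\<^esub> e) E)"
        by (rule module_hom_finsum[symmetric, OF H.abgroup BH.abelian_group_T BH.lin_pure_right[OF lin_id pure(1)]])
          (use E k in auto)
      also have "finsum H (\<lambda>e. \<psi> e h \<odot>\<^bsub>H\<^esub> e) E = finsum H (\<lambda>e. \<psi> e h \<odot>\<^bsub>H\<^esub> e) ?S"
        by (rule H.add.finprod_mono_neutral_cong_right) (use E k in auto)
      also have "\<dots> = h" using b(5) pure by blast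
      finally show ?thesis .
    qed
    then show ?case
      using b(3,4)[OF pure(2)] pure by (intro exI[of _ ?S]) (simp add: c)
  next
    case (add s t)
    from add(3) obtain E0 where
      E0: "finite E0" "E0 \<subseteq> X" "\<forall>e. e \<notin> E0 \<longrightarrow> coord (\<psi> e) s = \<zero>\<^bsub>B\<^esub>"
        "\<forall>E. finite E \<and> E0 \<subseteq> E \<and> E \<subseteq> carrier H \<longrightarrow> finsum BH (\<lambda>e. pure_tensor K B H (coord (\<psi> e) s) e) E = s"
      by (elim exE conjE)
    from add(4) obtain E1 where
      E1: "finite E1" "E1 \<subseteq> X" "\<forall>e. e \<notin> E1 \<longrightarrow> coord (\<psi> e) t = \<zero>\<^bsub>B\<^esub>"
        "\<forall>E. finite E \<and> E1 \<subseteq> E \<and> E \<subseteq> carrier H \<longrightarrow> finsum BH (\<lambda>e. pure_tensor K B H (coord (\<psi> e) t) e) E = t"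
      by (elim exE conjE)
    have cl: "coord (\<psi> e) s \<in> carrier B" "coord (\<psi> e) t \<in> carrier B" for e
      by (rule module_hom_closed[OF lin_coord[OF b(2)] add(1)], rule module_hom_closed[OF lin_coord[OF b(2)] add(2)])
    have c: "coord (\<psi> e) (s \<oplus>\<^bsub>BH\<^esub> t) = coord (\<psi> e) s \<oplus>\<^bsub>B\<^esub> coord (\<psi> e) t" for e
      by (rule module_hom_add[OF lin_coord[OF b(2)] add(1,2)])
    have "finsum BH (\<lambda>e. pure_tensor K B H (coord (\<psi> e) (s \<oplus>\<^bsub>BH\<^esub> t)) e) E = s \<oplus>\<^bsub>BH\<^esub> t"
      if E: "finite E" "E0 \<union> E1 \<subseteq> E" "E \<subseteq> carrier H" for E
    proof -
      have "finsum BH (\<lambda>e. pure_tensor K B H (coord (\<psi> e) (s \<oplus>\<^bsub>BH\<^esub> t)) e) E =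
        finsum BH (\<lambda>e. pure_tensor K B H (coord (\<psi> e) s) e \<oplus>\<^bsub>BH\<^esub> pure_tensor K B H (coord (\<psi> e) t) e) E"
        by (rule abelian_monoid.finsum_cong'[OF ab]) (use E cl in \<open>auto simp: c BH.pure_add_left Pi_iff subset_iff intro!: BH.pure_T\<close>)
      also have "\<dots> = finsum BH (\<lambda>e. pure_tensor K B H (coord (\<psi> e) s) e) E \<oplus>\<^bsub>BH\<^esub>
          finsum BH (\<lambda>e. pure_tensor K B H (coord (\<psi> e) t) e) E"
        by (rule abelian_monoid.finsum_addf[OF ab]) (use E cl in \<open>auto simp: Pi_iff subset_iff intro!: BH.pure_T\<close>)
      finally show ?thesis using E0(4) E1(4) E by simp
    qed
    then show ?case
      using E0 E1 by (intro exI[of _ "E0 \<union> E1"]) (simp add: c)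
  }
qed

lemma coord_eqI:
  assumes X: "H.H_basis X \<psi>" and s: "s \<in> carrier BH" and t: "t \<in> carrier BH"
    and eq: "\<And>e. coord (\<psi> e) s = coord (\<psi> e) t"
  shows "s = t"
proof -
  obtain E0 where E0: "finite E0" "E0 \<subseteq> X"
    and s': "\<forall>E. finite E \<and> E0 \<subseteq> E \<and> E \<subseteq> carrier H \<longrightarrow> finsum BH (\<lambda>e. pure_tensor K B H (coord (\<psi> e) s) e) E = s"
    using coord_expand[OF X s] by blast
  obtain E1 where E1: "finite E1" "E1 \<subseteq> X"
    and t': "\<forall>E. finite E \<and> E1 \<subseteq> E \<and> E \<subseteq> carrier H \<longrightarrow> finsum BH (\<lambda>e. pure_tensor K B H (coord (\<psi> e) t) e) E = t"
    using coord_expand[OF X t] by blast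
  have E: "finite (E0 \<union> E1)" "E0 \<union> E1 \<subseteq> carrier H" using E0 E1 H.H_basisD(1)[OF X] by auto
  have "s = finsum BH (\<lambda>e. pure_tensor K B H (coord (\<psi> e) s) e) (E0 \<union> E1)"
    by (rule s'[rule_format, symmetric]) (use E in blast)
  also have "\<dots> = t" unfolding eq by (rule t'[rule_format]) (use E in blast)
  finally show ?thesis .
qed

lemma cosum_coord:
  assumes X: "H.H_basis X \<psi>" and b: "b \<in> carrier B"
  obtains E0 where "finite E0" "E0 \<subseteq> X" "\<And>e. e \<notin> E0 \<Longrightarrow> coact (\<psi> e) b = \<zero>\<^bsub>B\<^esub>"
    "finsum BH (\<lambda>e. pure_tensor K B H (coact (\<psi> e) b) e) E0 = \<rho> b"
proof -
  obtain E0 where E0: "finite E0" "E0 \<subseteq> X" "\<forall>e. e \<notin> E0 \<longrightarrow> coord (\<psi> e) (\<rho> b) = \<zero>\<^bsub>B\<^esub>"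
    and E: "\<forall>E. finite E \<and> E0 \<subseteq> E \<and> E \<subseteq> carrier H \<longrightarrow> finsum BH (\<lambda>e. pure_tensor K B H (coord (\<psi> e) (\<rho> b)) e) E = \<rho> b"
    using coord_expand[OF X rho_closed[OF b]] by blast
  have "E0 \<subseteq> carrier H" using E0 H.H_basisD(1)[OF X] by blast
  then show thesis using that[of E0] E0 E unfolding coact_coord by blast
qed

lemma cosum_eq_finsum:
  assumes X: "H.H_basis X \<psi>" and b: "b \<in> carrier B" and W: "module K W" and \<phi>: "bilinear_map K B H W \<phi>"
    and E0: "finite E0" "E0 \<subseteq> X" "finsum BH (\<lambda>e. pure_tensor K B H (coact (\<psi> e) b) e) E0 = \<rho> b"
  shows "cosum W \<rho> \<phi> b = finsum W (\<lambda>e. \<phi> (coact (\<psi> e) b) e) E0"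
proof -
  interpret W: module K W by fact
  have cl: "coact (\<psi> e) b \<in> carrier B" for e by (rule coact_closed[OF H.H_basisD(2)[OF X] b])
  have EH: "E0 \<subseteq> carrier H" using E0 H.H_basisD(1)[OF X] by blast
  have "cosum W \<rho> \<phi> b = tensor_sum W \<phi> (finsum BH (\<lambda>e. pure_tensor K B H (coact (\<psi> e) b) e) E0)"
    unfolding cosum_def E0(3) ..
  also have "\<dots> = finsum W (\<lambda>e. tensor_sum W \<phi> (pure_tensor K B H (coact (\<psi> e) b) e)) E0"
    by (rule module_hom_finsum[OF BH.abelian_group_T W.abgroup BH.lin_tensor_sum[OF W \<phi>]])
      (use cl EH in \<open>auto intro!: BH.pure_T\<close>)
  also have "\<dots> = finsum W (\<lambda>e. \<phi> (coact (\<psi> e) b) e) E0"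
    by (rule W.M.finsum_cong') (use cl EH in \<open>auto simp: BH.tensor_sum_pure[OF W \<phi>] intro!: bilinear_map_closed[OF \<phi>]\<close>)
  finally show ?thesis .
qed

end

text \<open>Through \<open>coact\<close> the convolution algebra of functionals acts on \<open>B\<close> (\<open>coact_coact\<close>), so a component of
  a component is again a component.\<close>

definition (in hopf_algebra) conv where
  "conv \<eta> \<theta> = cosum (scalar_algebra K) \<Delta> (\<lambda>a b. \<theta> b \<odot>\<^bsub>scalar_algebra K\<^esub> \<eta> a)"

lemma (in hopf_algebra) scalar_module_K: "module K (scalar_algebra K)"
  by (rule scalar_module) (rule is_cring)

lemma (in hopf_algebra) conv_functional:
  assumes "\<eta> \<in> functionals" "\<theta> \<in> functionals" shows "conv \<eta> \<theta> \<in> functionals"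
  unfolding conv_def
  by (rule lins scalar_module_K assms lin_comp[OF assms(1)] lin_comp[OF assms(2)] functional_closed module_hom_closed[OF assms(1)] | assumption)+

lemma (in comodule_algebra) coact_coact:
  assumes \<eta>: "\<eta> \<in> functionals" and \<theta>: "\<theta> \<in> functionals" and b: "b \<in> carrier B"
  shows "coact \<eta> (coact \<theta> b) = coact (H.conv \<eta> \<theta>) b"
proof -
  note W = B.k_module
  note fl = H.functional_closed[OF \<eta>] H.functional_closed[OF \<theta>] lin_comp[OF \<eta>] lin_comp[OF \<theta>]
  have "coact \<eta> (coact \<theta> b) = cosum B \<rho> (\<lambda>b0 b1. coact \<eta> (\<theta> b1 \<odot>\<^bsub>B\<^esub> b0)) b"
    unfolding coact_def[of \<theta>] by (rule hom_cosum[OF _ W lin_coact[OF \<eta>]]; (rule lins fl b | assumption)+)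
  also have "\<dots> = cosum B \<rho> (\<lambda>b0 b1. \<theta> b1 \<odot>\<^bsub>B\<^esub> coact \<eta> b0) b"
    by (rule cosum_cong[OF W b]) (simp_all add: module_hom_smult[OF lin_coact[OF \<eta>]] fl coact_closed[OF \<eta>])
  also have "\<dots> = cosum B \<rho> (\<lambda>b0 b1. cosum B \<rho> (\<lambda>x y. \<theta> b1 \<odot>\<^bsub>B\<^esub> (\<eta> y \<odot>\<^bsub>B\<^esub> x)) b0) b"
    unfolding coact_def by (rule cosum_cong, rule W, rule b, rule hom_cosum; (rule lins fl b | assumption)+)
  also have "\<dots> = cosum B \<rho> (\<lambda>b0 b1. cosum B \<Delta> (\<lambda>y z. \<theta> z \<odot>\<^bsub>B\<^esub> (\<eta> y \<odot>\<^bsub>B\<^esub> b0)) b1) b"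
    by (rule cosum_coassoc; (rule lins fl b | assumption)+)
  also have "\<dots> = cosum B \<rho> (\<lambda>b0 b1. cosum B \<Delta> (\<lambda>y z. (\<theta> z \<odot>\<^bsub>scalar_algebra K\<^esub> \<eta> y) \<odot>\<^bsub>B\<^esub> b0) b1) b"
    by (rule cosum_cong, rule W, rule b, rule H.self.cosum_cong, rule W, assumption,
        simp add: scalar_algebra_def fl B.smult_assoc1; (rule lins fl b | assumption | simp add: scalar_algebra_def fl)+)
  also have "\<dots> = cosum B \<rho> (\<lambda>b0 b1. H.conv \<eta> \<theta> b1 \<odot>\<^bsub>B\<^esub> b0) b"
    unfolding H.conv_def
    by (rule cosum_cong, rule W, rule b, rule H.self.hom_cosum[where f = "\<lambda>k. k \<odot>\<^bsub>B\<^esub> _", symmetric];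
        (rule lins fl b H.scalar_module_K module_hom_closed[OF \<eta>] | assumption
          | rule H.functional_closed[OF H.conv_functional[OF \<eta> \<theta>], unfolded H.conv_def])+)
  finally show ?thesis unfolding coact_def .
qed

section \<open>Extending colinear maps\<close>

context bijective_comodule_algebra
begin

abbreviation "coactH \<equiv> H.self.coact"

text \<open>Colinearity of \<open>f\<close> at \<open>h\<close> is the equation \<open>\<rho> (f h) = delta f h\<close>.\<close>

definition delta where "delta f h = cosum BH \<Delta> (\<lambda>a b. ptBH (f a) b) h"

text \<open>If \<open>f\<close> is colinear on a subcomodule that contains \<open>h\<close>, then this is \<open>f h \<otimes> 1\<close> (\<open>kap_D\<close>). For an
  arbitrary linear \<open>f\<close>, its preimage under the Galois map is a substitute for \<open>f h\<close> in \<open>B \<otimes>\<^sub>A B\<close> that is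
  colinear in \<open>h\<close> for the coaction on the left tensor factor (\<open>shift_kap\<close>).\<close>

definition kap where "kap f h = cosum BH \<Delta> (\<lambda>a b. kappa (f a) b) h"

text \<open>The action of \<open>\<theta>\<close> on the left factor of \<open>B \<otimes>\<^sub>A B\<close>, transported along the Galois map (\<open>shift_galois\<close>).\<close>

definition shift where "shift \<theta> = galois_shift BH (\<lambda>c k l. \<theta> l \<odot>\<^bsub>BH\<^esub> ptBH c k)"

lemma kappa_rules:
  "\<lbrakk>b \<in> carrier B; g \<in> carrier H\<rbrakk> \<Longrightarrow> kappa b g \<in> carrier BH"
  "\<lbrakk>f \<in> module_hom K V B; g \<in> carrier H\<rbrakk> \<Longrightarrow> (\<lambda>x. kappa (f x) g) \<in> module_hom K V BH"
  "\<lbrakk>h \<in> module_hom K V H; b \<in> carrier B\<rbrakk> \<Longrightarrow> (\<lambda>x. kappa b (h x)) \<in> module_hom K V BH"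
  using bilinear_kappa unfolding bilinear_map_def
  by (auto intro: bilinear_map_closed[OF bilinear_kappa] lin_comp[where F = "\<lambda>x. kappa x g"] lin_comp[where F = "\<lambda>x. kappa b x"])

lemma galois_rules:
  "\<lbrakk>x \<in> carrier B; y \<in> carrier B\<rbrakk> \<Longrightarrow> galois x y \<in> carrier BH"
  "\<lbrakk>f \<in> module_hom K V B; y \<in> carrier B\<rbrakk> \<Longrightarrow> (\<lambda>x. galois (f x) y) \<in> module_hom K V BH"
  "\<lbrakk>f \<in> module_hom K V B; x \<in> carrier B\<rbrakk> \<Longrightarrow> (\<lambda>z. galois x (f z)) \<in> module_hom K V BH"
  using bilinear_galois unfolding bilinear_map_def
  by (auto intro: galois_closed lin_comp[where F = "\<lambda>x. galois x y"] lin_comp[where F = "\<lambda>y. galois x y"])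

context
  fixes \<theta> assumes \<theta>: "\<theta> \<in> functionals"
begin

lemmas fl = H.functional_closed[OF \<theta>] lin_comp[OF \<theta>]

lemma shift_trilinear: "trilinear BH (\<lambda>c k l. \<theta> l \<odot>\<^bsub>BH\<^esub> ptBH c k)"
  by (rule trilinearI; (rule lins fl \<theta> | assumption)+)

lemma lin_shift: "shift \<theta> \<in> module_hom K BH BH"
  unfolding shift_def by (rule lin_galois_shift[OF BH.module_T shift_trilinear])

lemma shift_galois:
  assumes x: "x \<in> carrier B" and y: "y \<in> carrier B"
  shows "shift \<theta> (galois x y) = galois (coact \<theta> x) y"
proof -
  note W = BH.module_T
  have "galois (coact \<theta> x) y = cosum BH \<rho> (\<lambda>x0 x1. galois (\<theta> x1 \<odot>\<^bsub>B\<^esub> x0) y) x"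
    unfolding coact_def by (rule hom_cosum[where f = "\<lambda>z. galois z y"]; (rule lins galois_rules fl x y | assumption)+)
  also have "\<dots> = cosum BH \<rho> (\<lambda>x0 x1. \<theta> x1 \<odot>\<^bsub>BH\<^esub> galois x0 y) x"
    by (rule cosum_cong[OF W x])
      (use module_hom_smult[OF galois_rules(2)[OF lin_id y]] fl y in \<open>auto intro!: galois_closed lins\<close>)
  also have "\<dots> = cosum BH \<rho> (\<lambda>x0 x1. cosum BH \<rho> (\<lambda>y0 y1. \<theta> x1 \<odot>\<^bsub>BH\<^esub> ptBH (x0 \<otimes>\<^bsub>B\<^esub> y0) y1) y) x"
    unfolding galois_def by (rule cosum_cong, rule W, rule x, rule hom_cosum; (rule lins fl x y | assumption)+)
  also have "\<dots> = shift \<theta> (galois x y)"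
    unfolding shift_def by (rule galois_shift_galois[OF W shift_trilinear x y, symmetric])
  finally show ?thesis ..
qed

lemma shift_kap:
  assumes f: "f \<in> module_hom K H B" and h: "h \<in> carrier H"
  shows "shift \<theta> (kap f h) = kap f (coactH \<theta> h)"
proof -
  note W = BH.module_T and lf = module_hom_closed[OF f] lin_comp[OF f] kappa_rules
  have "shift \<theta> (kap f h) = cosum BH \<Delta> (\<lambda>a b. shift \<theta> (kappa (f a) b)) h"
    unfolding kap_def by (rule H.self.hom_cosum[OF _ W lin_shift]; (rule lins lf h | assumption)+)
  also have "\<dots> = cosum BH \<Delta> (\<lambda>a b. cosum BH \<Delta> (\<lambda>g1 g2. cosum BH \<rho> (\<lambda>b0 b1. \<theta> g2 \<odot>\<^bsub>BH\<^esub> ptBH b0 (Si g1 \<otimes>\<^bsub>H\<^esub> b1)) (f a)) b) h"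
    unfolding shift_def
    by (rule H.self.cosum_cong, rule W, rule h, rule galois_shift_kappa[OF W shift_trilinear]; (rule lins lf fl h | assumption)+)
  also have "\<dots> = cosum BH \<Delta> (\<lambda>a b. cosum BH \<Delta> (\<lambda>g1 g2. \<theta> g2 \<odot>\<^bsub>BH\<^esub> kappa (f a) g1) b) h"
    unfolding kappa_def
    by (rule H.self.cosum_cong, rule W, rule h, rule H.self.cosum_cong, rule W, assumption, rule hom_cosum[symmetric];
        (rule lins lf fl h | assumption)+)
  also have "\<dots> = cosum BH \<Delta> (\<lambda>u g2. cosum BH \<Delta> (\<lambda>a g1. \<theta> g2 \<odot>\<^bsub>BH\<^esub> kappa (f a) g1) u) h"
    by (rule H.self.cosum_coassoc[symmetric]; (rule lins lf fl h | assumption)+)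
  also have "\<dots> = cosum BH \<Delta> (\<lambda>u g2. \<theta> g2 \<odot>\<^bsub>BH\<^esub> kap f u) h"
    unfolding kap_def
    by (rule H.self.cosum_cong, rule W, rule h, rule H.self.hom_cosum[symmetric]; (rule lins lf fl h | assumption)+)
  also have "\<dots> = cosum BH \<Delta> (\<lambda>u g2. kap f (\<theta> g2 \<odot>\<^bsub>H\<^esub> u)) h"
  proof (rule H.self.cosum_cong[OF W h])
    have lin: "kap f \<in> module_hom K H BH" unfolding kap_def by (rule lins lf | assumption)+
    fix u g2 assume "u \<in> carrier H" "g2 \<in> carrier H"
    then show "\<theta> g2 \<odot>\<^bsub>BH\<^esub> kap f u = kap f (\<theta> g2 \<odot>\<^bsub>H\<^esub> u)" "kap f (\<theta> g2 \<odot>\<^bsub>H\<^esub> u) \<in> carrier BH"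
      using module_hom_smult[OF lin] module_hom_closed[OF lin] fl by auto
  qed
  also have "\<dots> = kap f (coactH \<theta> h)"
    unfolding H.self.coact_def
    by (rule H.self.hom_cosum[symmetric]; (rule lins lf fl h | assumption | unfold kap_def)+)
  finally show ?thesis .
qed

end

lemma lin_kap: assumes f: "f \<in> module_hom K H B" shows "kap f \<in> module_hom K H BH"
  unfolding kap_def by (rule lins module_hom_closed[OF f] lin_comp[OF f] kappa_rules | assumption)+

lemma lin_delta: assumes f: "f \<in> module_hom K H B" shows "delta f \<in> module_hom K H BH"
  unfolding delta_def by (rule lins module_hom_closed[OF f] lin_comp[OF f] | assumption)+

lemma coord_delta:
  assumes f: "f \<in> module_hom K H B" and \<theta>: "\<theta> \<in> functionals" and h: "h \<in> carrier H"
  shows "coord \<theta> (delta f h) = f (coactH \<theta> h)"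
proof -
  note W = B.k_module and lf = module_hom_closed[OF f] lin_comp[OF f] H.functional_closed[OF \<theta>] lin_comp[OF \<theta>]
  have "coord \<theta> (delta f h) = cosum B \<Delta> (\<lambda>a b. coord \<theta> (ptBH (f a) b)) h"
    unfolding delta_def by (rule H.self.hom_cosum[OF _ W lin_coord[OF \<theta>]]; (rule lins lf h | assumption)+)
  also have "\<dots> = cosum B \<Delta> (\<lambda>a b. f (\<theta> b \<odot>\<^bsub>H\<^esub> a)) h"
    by (rule H.self.cosum_cong[OF W h]) (simp_all add: coord_pure[OF \<theta>] lf module_hom_smult[OF f])
  also have "\<dots> = f (coactH \<theta> h)"
    unfolding H.self.coact_def by (rule H.self.hom_cosum[OF _ W f, symmetric]; (rule lins lf h | assumption)+)
  finally show ?thesis .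
qed

lemma galois_one: "x \<in> carrier B \<Longrightarrow> galois x \<one>\<^bsub>B\<^esub> = ptBH x \<one>\<^bsub>H\<^esub>"
proof -
  assume x: "x \<in> carrier B"
  have "galois x \<one>\<^bsub>B\<^esub> = ptBH (x \<otimes>\<^bsub>B\<^esub> \<one>\<^bsub>B\<^esub>) \<one>\<^bsub>H\<^esub>"
    unfolding galois_def by (rule cosum_one; (rule lins x | assumption)+)
  then show ?thesis using x by simp
qed

lemma galois_mult:
  assumes x: "x \<in> carrier B" and y: "y \<in> carrier B"
  shows "galois x y = ptBH x \<one>\<^bsub>H\<^esub> \<otimes>\<^bsub>BH\<^esub> \<rho> y"
proof -
  note W = BH.module_T
  have "ptBH x \<one>\<^bsub>H\<^esub> \<otimes>\<^bsub>BH\<^esub> \<rho> y = ptBH x \<one>\<^bsub>H\<^esub> \<otimes>\<^bsub>BH\<^esub> cosum BH \<rho> ptBH y" by (simp add: cosum_pure y)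
  also have "\<dots> = cosum BH \<rho> (\<lambda>y0 y1. ptBH x \<one>\<^bsub>H\<^esub> \<otimes>\<^bsub>BH\<^esub> ptBH y0 y1) y"
    by (rule hom_cosum; (rule lins x y | assumption)+)
  also have "\<dots> = galois x y"
    unfolding galois_def by (rule cosum_cong[OF W y]) (simp_all add: BH.mult_pure x BH.pure_T)
  finally show ?thesis ..
qed

lemma galois_mult_right:
  assumes x: "x \<in> carrier B" and y: "y \<in> carrier B" and n: "n \<in> carrier B"
  shows "galois x (y \<otimes>\<^bsub>B\<^esub> n) = galois x y \<otimes>\<^bsub>BH\<^esub> \<rho> n"
  using assms by (simp add: galois_mult rho_mult BHalg.m_assoc rho_closed BH.pure_T)

lemma coact_A_right:
  assumes \<theta>: "\<theta> \<in> functionals" and a: "a \<in> carrier A" and b: "b \<in> carrier B"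
  shows "coact \<theta> (b \<otimes>\<^bsub>B\<^esub> a) = coact \<theta> b \<otimes>\<^bsub>B\<^esub> a"
proof -
  note fl = H.functional_closed[OF \<theta>] lin_comp[OF \<theta>] A_B[OF a]
  have "coact \<theta> (b \<otimes>\<^bsub>B\<^esub> a) = cosum B \<rho> (\<lambda>b0 b1. \<theta> b1 \<odot>\<^bsub>B\<^esub> (b0 \<otimes>\<^bsub>B\<^esub> a)) b"
    unfolding coact_def by (rule cosum_A_right; (rule lins fl a b | assumption)+)
  also have "\<dots> = cosum B \<rho> (\<lambda>b0 b1. (\<theta> b1 \<odot>\<^bsub>B\<^esub> b0) \<otimes>\<^bsub>B\<^esub> a) b"
    by (rule cosum_cong[OF B.k_module b]) (simp_all add: fl B.smult_mult_left)
  also have "\<dots> = coact \<theta> b \<otimes>\<^bsub>B\<^esub> a"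
    unfolding coact_def by (rule hom_cosum[where f = "\<lambda>z. z \<otimes>\<^bsub>B\<^esub> a", symmetric]; (rule lins fl a b | assumption)+)
  finally show ?thesis .
qed

end

text \<open>A colinear map on a subcomodule \<open>D\<close> of \<open>H\<close>, together with an arbitrary linear extension to \<open>H\<close>.\<close>

locale partial_integral = bijective_comodule_algebra K H \<Delta> \<epsilon> S B \<rho> + D: vector_subspace K H D
  for K :: "('k, 'x) ring_scheme" (structure) and H :: "('k, 'h, 'y) module_scheme" (structure)
    and \<Delta> \<epsilon> S and B :: "('k, 'b, 'z) module_scheme" (structure) and \<rho> and D +
  fixes f :: "'h \<Rightarrow> 'b"
  assumes lin_f: "f \<in> module_hom K H B"
    and D_coact: "\<lbrakk>\<theta> \<in> functionals; d \<in> D\<rbrakk> \<Longrightarrow> coactH \<theta> d \<in> D"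
    and f_colinear: "d \<in> D \<Longrightarrow> \<rho> (f d) = delta f d"
begin

lemmas f_rules = module_hom_closed[OF lin_f] lin_comp[OF lin_f]

lemma D_H: "d \<in> D \<Longrightarrow> d \<in> carrier H"
  using D.D_V by blast

lemma cosum_f:
  assumes W: "module K W" and \<phi>: "bilinear_map K B H W \<phi>" and d: "d \<in> D"
  shows "cosum W \<rho> \<phi> (f d) = cosum W \<Delta> (\<lambda>a b. \<phi> (f a) b) d"
proof -
  note L = BH.lin_tensor_sum[OF W \<phi>] and dH = D_H[OF d]
  have "cosum W \<rho> \<phi> (f d) = tensor_sum W \<phi> (cosum BH \<Delta> (\<lambda>a b. ptBH (f a) b) d)"
    unfolding cosum_def using f_colinear[OF d, unfolded delta_def cosum_def] by simp
  also have "\<dots> = cosum W \<Delta> (\<lambda>a b. tensor_sum W \<phi> (ptBH (f a) b)) d"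
    by (rule H.self.hom_cosum[OF _ W L dH]; (rule lins f_rules | assumption)+)
  also have "\<dots> = cosum W \<Delta> (\<lambda>a b. \<phi> (f a) b) d"
    by (rule H.self.cosum_cong[OF W dH]) (simp_all add: f_rules BH.tensor_sum_pure[OF W \<phi>] bilinear_map_closed[OF \<phi>])
  finally show ?thesis .
qed

text \<open>\<open>\<Sum> f d\<^sub>1 \<otimes> S\<^sup>-\<^sup>1 d\<^sub>3 d\<^sub>2\<close>, where \<open>S\<^sup>-\<^sup>1 d\<^sub>3 d\<^sub>2\<close> cancels.\<close>

lemma kap_D:
  assumes d: "d \<in> D" shows "kap f d = ptBH (f d) \<one>\<^bsub>H\<^esub>"
proof -
  note W = BH.module_T and dH = D_H[OF d]
  interpret BHa: abelian_group BH by (rule BH.abelian_group_T)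
  obtain X \<psi> where X: "H.H_basis X \<psi>" using H.ex_H_basis by blast
  obtain E where E: "finite E" "E \<subseteq> X" and "\<And>e. e \<notin> E \<Longrightarrow> coactH (\<psi> e) d = \<zero>\<^bsub>H\<^esub>"
    and E': "finsum H.HH (\<lambda>e. pure_tensor K H H (coactH (\<psi> e) d) e) E = \<Delta> d"
    by (rule H.self.cosum_coord[OF X dH]) (rule that)
  note E = E E'
  have EH: "e \<in> carrier H" if "e \<in> E" for e using E(2) H.H_basisD(1)[OF X] that by blast
  have cD: "coactH (\<psi> e) d \<in> D" for e by (rule D_coact[OF H.H_basisD(2)[OF X] d])
  define \<Psi> where "\<Psi> a g = cosum BH \<Delta> (\<lambda>p q. ptBH (f p) (Si g \<otimes>\<^bsub>H\<^esub> q)) a" for a g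
  have bil: "bilinear_map K H H BH \<Psi>" unfolding \<Psi>_def by (rule lins f_rules | assumption)+
  have eq: "kappa (f a) g = \<Psi> a g" if "a \<in> D" "g \<in> carrier H" for a g
    unfolding kappa_def \<Psi>_def by (rule cosum_f[OF W]; (rule lins that | assumption)+)
  have "kap f d = finsum BH (\<lambda>e. kappa (f (coactH (\<psi> e) d)) e) E"
    unfolding kap_def by (rule H.self.cosum_eq_finsum[OF X dH W _ E]; (rule lins f_rules kappa_rules | assumption)+)
  also have "\<dots> = finsum BH (\<lambda>e. \<Psi> (coactH (\<psi> e) d) e) E"
    by (rule abelian_monoid.finsum_cong'[OF abelian_group.axioms(1)[OF BH.abelian_group_T]])
      (use EH cD D_H in \<open>auto simp: eq intro!: bilinear_map_closed[OF bil]\<close>)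
  also have "\<dots> = cosum BH \<Delta> \<Psi> d"
    by (rule H.self.cosum_eq_finsum[OF X dH W bil E, symmetric])
  also have "\<dots> = cosum BH \<Delta> (\<lambda>p t. cosum BH \<Delta> (\<lambda>q b. ptBH (f p) (Si b \<otimes>\<^bsub>H\<^esub> q)) t) d"
    unfolding \<Psi>_def by (rule H.self.cosum_coassoc; (rule lins f_rules dH | assumption)+)
  also have "\<dots> = cosum BH \<Delta> (\<lambda>p t. \<epsilon> t \<odot>\<^bsub>BH\<^esub> ptBH (f p) \<one>\<^bsub>H\<^esub>) d"
    by (rule H.self.cosum_cong, rule W, rule dH, rule H.Si_left_sum; (rule lins f_rules dH | assumption)+)
  also have "\<dots> = ptBH (f d) \<one>\<^bsub>H\<^esub>"
    by (rule H.self.cosum_counit; (rule lins f_rules dH | assumption)+)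
  finally show ?thesis .
qed

end

section \<open>Hopf-Galois extensions\<close>

lemma right_mult_simps [simp]:
  "carrier (right_mult_module B) = carrier B" "\<zero>\<^bsub>right_mult_module B\<^esub> = \<zero>\<^bsub>B\<^esub>"
  "x \<oplus>\<^bsub>right_mult_module B\<^esub> y = x \<oplus>\<^bsub>B\<^esub> y" "r \<odot>\<^bsub>right_mult_module B\<^esub> x = x \<otimes>\<^bsub>B\<^esub> r"
  by (simp_all add: right_mult_module_def)

lemma left_mult_simps [simp]:
  "carrier (left_mult_module B) = carrier B" "\<zero>\<^bsub>left_mult_module B\<^esub> = \<zero>\<^bsub>B\<^esub>"
  "x \<oplus>\<^bsub>left_mult_module B\<^esub> y = x \<oplus>\<^bsub>B\<^esub> y" "r \<odot>\<^bsub>left_mult_module B\<^esub> x = r \<otimes>\<^bsub>B\<^esub> x"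
  by (simp_all add: left_mult_module_def)

lemma finsum_right_mult: "finsum (right_mult_module B) f I = finsum B f I"
  by (simp add: finsum_def finprod_def right_mult_module_def)

lemma (in comodule_algebra) finite_coact:
  assumes X: "H.H_basis X \<psi>" and b: "b \<in> carrier B"
  shows "finite {e. coact (\<psi> e) b \<noteq> \<zero>\<^bsub>B\<^esub>}"
proof -
  obtain E0 where E0: "finite E0" "E0 \<subseteq> X" and z: "\<And>e. e \<notin> E0 \<Longrightarrow> coact (\<psi> e) b = \<zero>\<^bsub>B\<^esub>"
    and "finsum BH (\<lambda>e. pure_tensor K B H (coact (\<psi> e) b) e) E0 = \<rho> b"
    by (rule cosum_coord[OF X b]) (rule that)
  have "{e. coact (\<psi> e) b \<noteq> \<zero>\<^bsub>B\<^esub>} \<subseteq> E0" using z by blast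
  then show ?thesis using E0(1) by (rule finite_subset)
qed

locale galois_extension = bijective_comodule_algebra K H \<Delta> \<epsilon> S B \<rho>
  for K :: "('k, 'x) ring_scheme" (structure) and H :: "('k, 'h, 'y) module_scheme" (structure)
    and \<Delta> \<epsilon> S and B :: "('k, 'b, 'z) module_scheme" (structure) and \<rho> +
  assumes galois: "hopf_galois K H B \<rho>"
    and flat: "faithfully_flat TYPE((nat \<Rightarrow> 'b) set) (coinvariants K H B \<rho>) (left_mult_module B)"
begin

abbreviation "RB \<equiv> right_mult_module B"
abbreviation "LB \<equiv> left_mult_module B"
abbreviation "TA \<equiv> tensor_group A RB LB"
abbreviation "ptA \<equiv> pure_tensor A RB LB"
abbreviation "GM \<equiv> galois_map K H B \<rho>"

lemma left_module_LB: "left_module A LB"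
  using flat unfolding faithfully_flat_def by blast

lemma right_module_RB: "right_module A RB"
proof -
  interpret Aa: k_algebra K A by (rule k_algebra_A)
  have "\<exists>y\<in>carrier B. y \<oplus>\<^bsub>B\<^esub> x = \<zero>\<^bsub>B\<^esub>" if "x \<in> carrier B" for x
    using that B.l_neg by (intro bexI[of _ "\<ominus>\<^bsub>B\<^esub> x"]) auto
  then have "abelian_group RB"
    by (intro abelian_groupI) (simp_all add: B.a_ac)
  then show ?thesis
    unfolding left_module_def left_module_axioms_def
    using ring_opp[OF Aa.ring_axioms] by (simp add: A_B B.r_distr B.l_distr B.m_assoc)
qed

sublocale TA: tensor_pair A RB LB
  by (rule tensor_pair_right_left[OF right_module_RB left_module_LB])

lemma galois_balanced: "balanced_map A RB LB (add_monoid BH) galois"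
proof (rule balanced_mapI)
  note W = BH.module_T
  show "galois m n \<in> carrier (add_monoid BH)" if "m \<in> carrier RB" "n \<in> carrier LB" for m n
    using that by (simp add: galois_closed)
  show "galois (m \<oplus>\<^bsub>RB\<^esub> m') n = galois m n \<otimes>\<^bsub>add_monoid BH\<^esub> galois m' n"
    if "m \<in> carrier RB" "m' \<in> carrier RB" "n \<in> carrier LB" for m m' n
    using module_hom_add[OF galois_rules(2)[OF lin_id]] that by simp
  show "galois m (n \<oplus>\<^bsub>LB\<^esub> n') = galois m n \<otimes>\<^bsub>add_monoid BH\<^esub> galois m n'"
    if "m \<in> carrier RB" "n \<in> carrier LB" "n' \<in> carrier LB" for m n n'
    using module_hom_add[OF galois_rules(3)[OF lin_id]] that by simp
  fix a x y assume a: "a \<in> carrier A" and "x \<in> carrier RB" "y \<in> carrier LB"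
  then have x: "x \<in> carrier B" and y: "y \<in> carrier B" by simp_all
  have "galois x (a \<otimes>\<^bsub>B\<^esub> y) = cosum BH \<rho> (\<lambda>y0 y1. ptBH (x \<otimes>\<^bsub>B\<^esub> (a \<otimes>\<^bsub>B\<^esub> y0)) y1) y"
    unfolding galois_def by (rule cosum_A_left; (rule lins a A_B[OF a] x y | assumption)+)
  also have "\<dots> = galois (x \<otimes>\<^bsub>B\<^esub> a) y"
    unfolding galois_def by (rule cosum_cong[OF W y]) (simp_all add: A_B[OF a] x B.m_assoc BH.pure_T)
  finally show "galois (a \<odot>\<^bsub>RB\<^esub> x) y = galois x (a \<odot>\<^bsub>LB\<^esub> y)" by simp
qed

lemma GM_lift: "GM = tensor_lift (add_monoid BH) galois"
  unfolding galois_map_def galois_def cosum_def ..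

lemmas GM_hom = TA.tensor_lift_hom[OF BH.comm_group_add_T galois_balanced, folded GM_lift]
lemmas GM_pure = TA.tensor_lift_pure[OF BH.comm_group_add_T galois_balanced, folded GM_lift, simplified]

lemma GM_inj: "\<lbrakk>s \<in> carrier TA; t \<in> carrier TA; GM s = GM t\<rbrakk> \<Longrightarrow> s = t"
  using galois unfolding hopf_galois_def bij_betw_def by (auto dest: inj_onD)

lemma GM_sum:
  assumes "x \<in> I \<rightarrow> carrier B" "y \<in> I \<rightarrow> carrier B"
  shows "GM (finprod TA (\<lambda>i. ptA (x i) (y i)) I) = finsum BH (\<lambda>i. galois (x i) (y i)) I"
proof -
  have "GM (finprod TA (\<lambda>i. ptA (x i) (y i)) I) = finprod (add_monoid BH) (\<lambda>i. GM (ptA (x i) (y i))) I"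
    by (rule hom_finprod[OF TA.comm_group_TG BH.comm_group_add_T GM_hom])
      (use assms in \<open>auto simp: Pi_iff intro!: TA.pure_closed\<close>)
  also have "\<dots> = finprod (add_monoid BH) (\<lambda>i. galois (x i) (y i)) I"
    by (rule comm_monoid.finprod_cong'[OF comm_group.axioms(1)[OF BH.comm_group_add_T]]) (use assms in \<open>auto simp: Pi_iff GM_pure galois_closed\<close>)
  finally show ?thesis unfolding finsum_def .
qed

lemma galois_surj:
  assumes w: "w \<in> carrier BH"
  shows "\<exists>(n :: nat) x y. x \<in> {..<n} \<rightarrow> carrier B \<and> y \<in> {..<n} \<rightarrow> carrier B \<and>
    finsum BH (\<lambda>i. galois (x i) (y i)) {..<n} = w"
proof -
  have "GM ` carrier TA = carrier BH" using galois unfolding hopf_galois_def bij_betw_def by blast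
  then obtain t where t: "t \<in> carrier TA" "w = GM t" using w by (metis imageE)
  obtain n :: nat and x y where xy: "x \<in> {..<n} \<rightarrow> carrier RB" "y \<in> {..<n} \<rightarrow> carrier LB"
    and "t = finprod TA (\<lambda>i. ptA (x i) (y i)) {..<n}"
    using TA.sum_of_pures[OF t(1)] by blast
  then have "finsum BH (\<lambda>i. galois (x i) (y i)) {..<n} = w"
    using GM_sum[of x "{..<n}" y] t(2) by simp
  then show ?thesis using xy by (intro exI[of _ n] exI[of _ x] exI[of _ y]) simp
qed

end

section \<open>Extending a partial integral by one element\<close>

locale galois_partial_integral = galois_extension K H \<Delta> \<epsilon> S B \<rho> + partial_integral K H \<Delta> \<epsilon> S B \<rho> D f
  for K :: "('k, 'x) ring_scheme" (structure) and H :: "('k, 'h, 'y) module_scheme" (structure)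
    and \<Delta> \<epsilon> S and B :: "('k, 'b, 'z) module_scheme" (structure) and \<rho> D f
begin

text \<open>Let \<open>\<psi>'\<^sub>e\<close> be coordinates of \<open>H/D\<close>, and for each \<open>e\<close> let \<open>\<Sum>\<^sub>i x\<^sub>e\<^sub>i \<otimes> y\<^sub>e\<^sub>i\<close> be the preimage of
  \<open>kap f e - f e \<otimes> 1\<close> under the Galois map. Then \<open>M h = f h \<otimes> 1 + \<Sum> \<psi>'\<^sub>e h x\<^sub>e\<^sub>i \<otimes> y\<^sub>e\<^sub>i\<close> is the preimage of \<open>kap f h\<close>
  for every \<open>h\<close>, because \<open>kap f d = f d \<otimes> 1\<close> on \<open>D\<close>. So \<open>M\<close> is colinear for the left factor. The map \<open>g\<close> is
  sought in the form \<open>g h = f h + \<Sum> \<psi>'\<^sub>e h x\<^sub>e\<^sub>i a\<^sub>e\<^sub>i\<close> with \<open>a\<^sub>e\<^sub>i\<close> in \<open>A\<close>, which agrees with \<open>f\<close> on \<open>D\<close>. Its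
  colinearity at \<open>v\<close> is a system of linear equations for the \<open>a\<^sub>e\<^sub>i\<close>, and the colinearity of \<open>M\<close> says that
  the \<open>y\<^sub>e\<^sub>i\<close> solve this system in \<open>B \<otimes>\<^sub>A B\<close>.\<close>

lemma extend_at:
  assumes h0: "h0 \<in> carrier H"
  shows "\<exists>g. g \<in> module_hom K H B \<and> (\<forall>d \<in> D. g d = f d) \<and>
    (\<forall>\<theta> \<in> functionals. \<rho> (g (coactH \<theta> h0)) = delta g (coactH \<theta> h0))"
proof -
  note W = BH.module_T
  have abBH: "abelian_monoid BH" by (rule abelian_group.axioms(1)[OF BH.abelian_group_T])
  note BHs_cong = abelian_monoid.finsum_cong'[OF abBH] and BHs_closed = abelian_monoid.finsum_closed[OF abBH]
  obtain X \<psi> where X: "H.H_basis X \<psi>" using H.ex_H_basis by blast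
  note \<psi> = H.H_basisD(2)[OF X]
  obtain X' \<psi>' where X': "X' \<subseteq> carrier H" and \<psi>': "\<And>e. \<psi>' e \<in> functionals"
    and \<psi>'D: "\<And>e d. d \<in> D \<Longrightarrow> \<psi>' e d = \<zero>\<^bsub>K\<^esub>"
    and fin': "\<And>v. v \<in> carrier H \<Longrightarrow> finite {e. \<psi>' e v \<noteq> \<zero>\<^bsub>K\<^esub>}"
    and sub': "\<And>v. v \<in> carrier H \<Longrightarrow> {e. \<psi>' e v \<noteq> \<zero>\<^bsub>K\<^esub>} \<subseteq> X'"
    and exp': "\<And>v. v \<in> carrier H \<Longrightarrow> v \<ominus>\<^bsub>H\<^esub> finsum H (\<lambda>e. \<psi>' e v \<odot>\<^bsub>H\<^esub> e) {e. \<psi>' e v \<noteq> \<zero>\<^bsub>K\<^esub>} \<in> D"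
    using D.relative_basis by blast
  note k' = H.functional_closed[OF \<psi>']
  (* The part of kap f that the unknowns have to account for. It vanishes on D. *)
  define L where "L h = kap f h \<ominus>\<^bsub>BH\<^esub> ptBH (f h) \<one>\<^bsub>H\<^esub>" for h
  have linL: "L \<in> module_hom K H BH"
    unfolding L_def by (rule BHH.M.lin_diff lins lin_comp[OF lin_kap[OF lin_f]] f_rules | assumption)+
  have LD: "L d = \<zero>\<^bsub>BH\<^esub>" if "d \<in> D" for d
    using kap_D[OF that] D_H[OF that] f_rules by (simp add: L_def a_minus_def BHH.M.M.r_neg BH.pure_T)
  have L_exp: "L v = finsum BH (\<lambda>e. \<psi>' e v \<odot>\<^bsub>BH\<^esub> L e) {e. \<psi>' e v \<noteq> \<zero>\<^bsub>K\<^esub>}" if v: "v \<in> carrier H" for v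
  proof -
    let ?s = "finsum H (\<lambda>e. \<psi>' e v \<odot>\<^bsub>H\<^esub> e) {e. \<psi>' e v \<noteq> \<zero>\<^bsub>K\<^esub>}"
    have c: "(\<lambda>e. \<psi>' e v \<odot>\<^bsub>H\<^esub> e) \<in> {e. \<psi>' e v \<noteq> \<zero>\<^bsub>K\<^esub>} \<rightarrow> carrier H"
      using sub'[OF v] X' k'[OF v] by auto
    have s: "?s \<in> carrier H" by (rule H.finsum_closed[OF c])
    have "v = (v \<ominus>\<^bsub>H\<^esub> ?s) \<oplus>\<^bsub>H\<^esub> ?s" using v s by (simp add: a_minus_def H.a_assoc H.l_neg)
    then have "L v = L (v \<ominus>\<^bsub>H\<^esub> ?s) \<oplus>\<^bsub>BH\<^esub> L ?s"
      using module_hom_add[OF linL H.minus_closed[OF v s] s] by simp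
    also have "\<dots> = L ?s" using LD[OF exp'[OF v]] module_hom_closed[OF linL s] by simp
    also have "\<dots> = finsum BH (\<lambda>e. L (\<psi>' e v \<odot>\<^bsub>H\<^esub> e)) {e. \<psi>' e v \<noteq> \<zero>\<^bsub>K\<^esub>}"
      by (rule module_hom_finsum[OF H.abgroup BH.abelian_group_T linL c])
    also have "\<dots> = finsum BH (\<lambda>e. \<psi>' e v \<odot>\<^bsub>BH\<^esub> L e) {e. \<psi>' e v \<noteq> \<zero>\<^bsub>K\<^esub>}"
      by (rule BHs_cong)
        (use sub'[OF v] X' k'[OF v] module_hom_closed[OF linL] in \<open>auto simp: module_hom_smult[OF linL] subset_iff\<close>)
    finally show ?thesis .
  qed
  define Q where "Q e nxy \<longleftrightarrow> (case nxy of (n :: nat, x, y) \<Rightarrow> x \<in> {..<n} \<rightarrow> carrier B \<and> y \<in> {..<n} \<rightarrow> carrier B \<and>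
    finsum BH (\<lambda>i. galois (x i) (y i)) {..<n} = L e)" for e nxy
  have "\<forall>e \<in> carrier H. \<exists>nxy. Q e nxy"
  proof
    fix e assume "e \<in> carrier H"
    from galois_surj[OF module_hom_closed[OF linL this]] show "\<exists>nxy. Q e nxy"
      unfolding Q_def by (elim exE) (rule_tac x = "(n, x, y)" in exI, simp)
  qed
  then have "\<exists>N. \<forall>e \<in> carrier H. Q e (N e)" by (rule bchoice)
  then obtain N where N: "\<And>e. e \<in> carrier H \<Longrightarrow> Q e (N e)" by blast
  define n where "n e = fst (N e)" for e
  define x where "x p = fst (snd (N (fst p))) (snd p)" for p
  define y where "y p = snd (snd (N (fst p))) (snd p)" for p
  have xy: "x (e, i) \<in> carrier B" "y (e, i) \<in> carrier B" if "e \<in> carrier H" "i < n e" for e i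
    using N[OF that(1)] that(2) by (simp_all add: Q_def x_def y_def n_def split_def Pi_iff)
  have xyL: "finsum BH (\<lambda>i. galois (x (e, i)) (y (e, i))) {..<n e} = L e" if "e \<in> carrier H" for e
    using N[OF that] by (simp_all add: Q_def x_def y_def n_def split_def Pi_iff)
  have M_galois: "galois (f v) \<one>\<^bsub>B\<^esub> \<oplus>\<^bsub>BH\<^esub>
      finsum BH (\<lambda>p. galois (\<psi>' (fst p) v \<odot>\<^bsub>B\<^esub> x p) (y p)) (Sigma S' (\<lambda>e. {..<n e})) = kap f v"
    if v: "v \<in> carrier H" and S': "finite S'" "{e. \<psi>' e v \<noteq> \<zero>\<^bsub>K\<^esub>} \<subseteq> S'" "S' \<subseteq> carrier H" for v S'
  proof -
    have sm: "galois (\<psi>' e v \<odot>\<^bsub>B\<^esub> x (e, i)) (y (e, i)) = \<psi>' e v \<odot>\<^bsub>BH\<^esub> galois (x (e, i)) (y (e, i))"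
      if "e \<in> S'" "i < n e" for e i
      using module_hom_smult[OF galois_rules(2)[OF lin_id]] k'[OF v] xy S' that by (auto simp: subset_iff)
    have "finsum BH (\<lambda>p. galois (\<psi>' (fst p) v \<odot>\<^bsub>B\<^esub> x p) (y p)) (Sigma S' (\<lambda>e. {..<n e})) =
        finsum BH (\<lambda>e. finsum BH (\<lambda>i. galois (\<psi>' e v \<odot>\<^bsub>B\<^esub> x (e, i)) (y (e, i))) {..<n e}) S'"
    proof -
      have gcl: "galois (\<psi>' e v \<odot>\<^bsub>B\<^esub> x (e, i)) (y (e, i)) \<in> carrier BH" if "e \<in> S'" "i < n e" for e i
        by (rule galois_closed) (use S' that xy k'[OF v] in \<open>auto simp: subset_iff\<close>)
      show ?thesis
        unfolding finsum_def
        by (subst comm_monoid.finprod_Sigma[OF comm_group.axioms(1)[OF BH.comm_group_add_T] S'(1)])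
          (use gcl in simp_all)
    qed
    also have "\<dots> = finsum BH (\<lambda>e. \<psi>' e v \<odot>\<^bsub>BH\<^esub> L e) S'"
    proof (rule BHs_cong[OF refl])
      fix e assume e: "e \<in> S'"
      then have eH: "e \<in> carrier H" using S' by blast
      have "finsum BH (\<lambda>i. galois (\<psi>' e v \<odot>\<^bsub>B\<^esub> x (e, i)) (y (e, i))) {..<n e} =
          finsum BH (\<lambda>i. \<psi>' e v \<odot>\<^bsub>BH\<^esub> galois (x (e, i)) (y (e, i))) {..<n e}"
        by (rule BHs_cong) (use sm e eH xy k'[OF v] in \<open>auto intro!: galois_closed\<close>)
      also have "\<dots> = \<psi>' e v \<odot>\<^bsub>BH\<^esub> L e"
        unfolding xyL[OF eH, symmetric]
        by (rule module_hom_finsum[symmetric, OF BH.abelian_group_T BH.abelian_group_T BHH.M.lin_smult[OF k'[OF v] lin_id]])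
          (use xy eH in \<open>auto intro!: galois_closed\<close>)
      finally show "finsum BH (\<lambda>i. galois (\<psi>' e v \<odot>\<^bsub>B\<^esub> x (e, i)) (y (e, i))) {..<n e} = \<psi>' e v \<odot>\<^bsub>BH\<^esub> L e" .
    qed (use S' k'[OF v] module_hom_closed[OF linL] in \<open>auto simp: subset_iff\<close>)
    also have "\<dots> = finsum BH (\<lambda>e. \<psi>' e v \<odot>\<^bsub>BH\<^esub> L e) {e. \<psi>' e v \<noteq> \<zero>\<^bsub>K\<^esub>}"
      unfolding finsum_def
      by (rule comm_monoid.finprod_mono_neutral_cong_right[OF comm_group.axioms(1)[OF BH.comm_group_add_T]])
        (use S' k'[OF v] module_hom_closed[OF linL] in \<open>auto simp: subset_iff\<close>)
    also have "\<dots> = L v" by (rule L_exp[OF v, symmetric])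
    finally show ?thesis
      using v f_rules(1) module_hom_closed[OF lin_kap[OF lin_f] v] BH.pure_T[of "f v" "\<one>\<^bsub>H\<^esub>"]
      by (simp add: galois_one L_def BHH.M.M.add_minus_cancel)
  qed
  obtain E where E: "finite E" "E \<subseteq> X" and "\<And>e. e \<notin> E \<Longrightarrow> coactH (\<psi> e) h0 = \<zero>\<^bsub>H\<^esub>"
    and E': "finsum H.HH (\<lambda>e. pure_tensor K H H (coactH (\<psi> e) h0) e) E = \<Delta> h0"
    by (rule H.self.cosum_coord[OF X h0]) (rule that)
  note E = E E'
  (* All components of h0 are linear combinations of these finitely many ones. *)
  define Vs where "Vs = (\<lambda>e. coactH (\<psi> e) h0) ` E"
  have Vs: "finite Vs" "\<And>v. v \<in> Vs \<Longrightarrow> v \<in> carrier H"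
    unfolding Vs_def using E H.self.coact_closed[OF \<psi> h0] by auto
  define GH where "GH v = {e. coactH (\<psi> e) v \<noteq> \<zero>\<^bsub>H\<^esub>}" for v
  define GB where "GB b = {e. coact (\<psi> e) b \<noteq> \<zero>\<^bsub>B\<^esub>}" for b
  have GH: "\<And>v. v \<in> carrier H \<Longrightarrow> finite (GH v)" "\<And>v e. \<lbrakk>v \<in> carrier H; e \<notin> GH v\<rbrakk> \<Longrightarrow> coactH (\<psi> e) v = \<zero>\<^bsub>H\<^esub>"
    using H.self.finite_coact[OF X] by (auto simp: GH_def)
  have GB: "\<And>b. b \<in> carrier B \<Longrightarrow> finite (GB b)" "\<And>b e. \<lbrakk>b \<in> carrier B; e \<notin> GB b\<rbrakk> \<Longrightarrow> coact (\<psi> e) b = \<zero>\<^bsub>B\<^esub>"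
    using finite_coact[OF X] by (auto simp: GB_def)
  have cH: "coactH (\<psi> g) v \<in> carrier H" if "v \<in> carrier H" for v g by (rule H.self.coact_closed[OF \<psi> that])
  have cB: "coact (\<psi> g) b \<in> carrier B" if "b \<in> carrier B" for b g by (rule coact_closed[OF \<psi> that])
  (* The finitely many indices of unknowns that occur in the equations for the elements of Vs. *)
  define S' where "S' = (\<Union>v\<in>Vs. {e. \<psi>' e v \<noteq> \<zero>\<^bsub>K\<^esub>} \<union> (\<Union>g\<in>GH v. {e. \<psi>' e (coactH (\<psi> g) v) \<noteq> \<zero>\<^bsub>K\<^esub>}))"
  have S'fin: "finite S'" unfolding S'_def using Vs GH(1) fin' cH by auto
  have S'H: "S' \<subseteq> carrier H" unfolding S'_def using sub' X' Vs(2) cH by (blast dest: subsetD)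
  have \<psi>'0: "\<psi>' e \<zero>\<^bsub>H\<^esub> = \<zero>\<^bsub>K\<^esub>" for e using \<psi>'D[OF D.D_zero] .
  have S'1: "{e. \<psi>' e v \<noteq> \<zero>\<^bsub>K\<^esub>} \<subseteq> S'" if "v \<in> Vs" for v unfolding S'_def using that by blast
  have S'2: "{e. \<psi>' e (coactH (\<psi> g) v) \<noteq> \<zero>\<^bsub>K\<^esub>} \<subseteq> S'" if v: "v \<in> Vs" for v g
  proof (cases "g \<in> GH v")
    case False
    then have "coactH (\<psi> g) v = \<zero>\<^bsub>H\<^esub>" using GH(2)[OF Vs(2)[OF v]] by blast
    then show ?thesis using \<psi>'0 by auto
  qed (use v in \<open>auto simp: S'_def\<close>)
  define P where "P = Sigma S' (\<lambda>e. {..<n e})"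
  have Pfin: "finite P" unfolding P_def using S'fin by auto
  have xP: "x p \<in> carrier B" and yP: "y p \<in> carrier B" if "p \<in> P" for p
    using that S'H xy unfolding P_def by auto
  have xPb: "\<forall>p\<in>P. x p \<in> carrier B" and yPb: "\<forall>p\<in>P. y p \<in> carrier B" using xP yP by blast+
  define G0 where "G0 = (\<Union>v\<in>Vs. GH v \<union> GB (f v)) \<union> (\<Union>p\<in>P. GB (x p))"
  have G0fin: "finite G0" unfolding G0_def using Vs GH(1) GB(1) f_rules(1) Pfin xPb by auto
  (* The equation for v and the basis functional number g reads z (v, g) = sum of Y p (v, g) a p. It says that
     the component number g of the map at v is its value at the component number g of v. *)
  define z where "z vg = f (coactH (\<psi> (snd vg)) (fst vg)) \<ominus>\<^bsub>B\<^esub> coact (\<psi> (snd vg)) (f (fst vg))" for vg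
  define Y where "Y p vg = \<psi>' (fst p) (fst vg) \<odot>\<^bsub>B\<^esub> coact (\<psi> (snd vg)) (x p) \<ominus>\<^bsub>B\<^esub>
      \<psi>' (fst p) (coactH (\<psi> (snd vg)) (fst vg)) \<odot>\<^bsub>B\<^esub> x p" for p vg
  have Ycl: "Y p (v, g) \<in> carrier B" if "p \<in> P" "v \<in> carrier H" for p v g
    unfolding Y_def using that xPb k' cH cB by simp
  have zcl: "z (v, g) \<in> carrier B" if "v \<in> carrier H" for v g
    unfolding z_def using that f_rules(1) cH cB by simp
  (* The image under the Galois map of the equation with a p replaced by y p. *)
  have key: "galois (z (v, g)) \<one>\<^bsub>B\<^esub> = finsum BH (\<lambda>p. galois (Y p (v, g)) (y p)) P" if v: "v \<in> Vs" for v g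
  proof -
    have vH: "v \<in> carrier H" by (rule Vs(2)[OF v])
    let ?c = "coactH (\<psi> g) v"
    have cvH: "?c \<in> carrier H" by (rule cH[OF vH])
    let ?s1 = "finsum BH (\<lambda>p. galois (\<psi>' (fst p) v \<odot>\<^bsub>B\<^esub> coact (\<psi> g) (x p)) (y p)) P"
    let ?s2 = "finsum BH (\<lambda>p. galois (\<psi>' (fst p) ?c \<odot>\<^bsub>B\<^esub> x p) (y p)) P"
    have t1: "galois (\<psi>' (fst p) v \<odot>\<^bsub>B\<^esub> coact (\<psi> g) (x p)) (y p) \<in> carrier BH"
      and t2: "galois (\<psi>' (fst p) ?c \<odot>\<^bsub>B\<^esub> x p) (y p) \<in> carrier BH" if "p \<in> P" for p
      using that xPb yPb k' vH cvH cB by (auto intro!: galois_closed)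
    have s: "?s1 \<in> carrier BH" "?s2 \<in> carrier BH" using t1 t2 by (auto intro!: BHs_closed)
    have a: "galois (f ?c) \<one>\<^bsub>B\<^esub> \<in> carrier BH" "galois (coact (\<psi> g) (f v)) \<one>\<^bsub>B\<^esub> \<in> carrier BH"
      using cvH vH f_rules(1) cB by (auto intro!: galois_closed)
    have "shift (\<psi> g) (kap f v) = shift (\<psi> g) (galois (f v) \<one>\<^bsub>B\<^esub> \<oplus>\<^bsub>BH\<^esub>
        finsum BH (\<lambda>p. galois (\<psi>' (fst p) v \<odot>\<^bsub>B\<^esub> x p) (y p)) P)"
      using M_galois[OF vH S'fin S'1[OF v] S'H] by (simp add: P_def)
    also have "\<dots> = shift (\<psi> g) (galois (f v) \<one>\<^bsub>B\<^esub>) \<oplus>\<^bsub>BH\<^esub>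
        shift (\<psi> g) (finsum BH (\<lambda>p. galois (\<psi>' (fst p) v \<odot>\<^bsub>B\<^esub> x p) (y p)) P)"
      by (rule module_hom_add[OF lin_shift[OF \<psi>]])
        (use vH f_rules(1) k' xPb yPb in \<open>auto intro!: galois_closed BHs_closed\<close>)
    also have "shift (\<psi> g) (finsum BH (\<lambda>p. galois (\<psi>' (fst p) v \<odot>\<^bsub>B\<^esub> x p) (y p)) P) =
        finsum BH (\<lambda>p. shift (\<psi> g) (galois (\<psi>' (fst p) v \<odot>\<^bsub>B\<^esub> x p) (y p))) P"
      by (rule module_hom_finsum[OF BH.abelian_group_T BH.abelian_group_T lin_shift[OF \<psi>]])
        (use vH k' xPb yPb in \<open>auto intro!: galois_closed\<close>)
    also have "\<dots> = ?s1"
      by (rule BHs_cong)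
        (use vH k' xPb yPb t1 in \<open>auto simp: shift_galois[OF \<psi>] module_hom_smult[OF lin_coact[OF \<psi>]]\<close>)
    also have "shift (\<psi> g) (galois (f v) \<one>\<^bsub>B\<^esub>) = galois (coact (\<psi> g) (f v)) \<one>\<^bsub>B\<^esub>"
      by (rule shift_galois[OF \<psi>]) (use vH f_rules(1) in auto)
    also have "shift (\<psi> g) (kap f v) = kap f ?c" by (rule shift_kap[OF \<psi> lin_f vH])
    also have "kap f ?c = galois (f ?c) \<one>\<^bsub>B\<^esub> \<oplus>\<^bsub>BH\<^esub> ?s2"
      using M_galois[OF cvH S'fin S'2[OF v] S'H] by (simp add: P_def)
    finally have e: "galois (f ?c) \<one>\<^bsub>B\<^esub> \<oplus>\<^bsub>BH\<^esub> ?s2 = galois (coact (\<psi> g) (f v)) \<one>\<^bsub>B\<^esub> \<oplus>\<^bsub>BH\<^esub> ?s1" .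
    have gdiff: "galois (u \<ominus>\<^bsub>B\<^esub> w) r = galois u r \<ominus>\<^bsub>BH\<^esub> galois w r"
      if "u \<in> carrier B" "w \<in> carrier B" "r \<in> carrier B" for u w r
    proof -
      note l = galois_rules(2)[OF lin_id that(3)]
      have "galois u r = galois (u \<ominus>\<^bsub>B\<^esub> w) r \<oplus>\<^bsub>BH\<^esub> galois w r"
        using module_hom_add[OF l B.minus_closed[OF that(1,2)] that(2)] that
        by (simp add: a_minus_def B.a_assoc B.l_neg)
      then show ?thesis using galois_closed that
        by (simp add: a_minus_def BHH.M.M.a_assoc BHH.M.M.r_neg)
    qed
    have "finsum BH (\<lambda>p. galois (Y p (v, g)) (y p)) P = finsum BH (\<lambda>p.
        galois (\<psi>' (fst p) v \<odot>\<^bsub>B\<^esub> coact (\<psi> g) (x p)) (y p) \<ominus>\<^bsub>BH\<^esub> galois (\<psi>' (fst p) ?c \<odot>\<^bsub>B\<^esub> x p) (y p)) P"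
      by (rule BHs_cong)
        (use vH cvH k' xPb yPb cB t1 t2 in \<open>auto simp: Y_def gdiff intro!: BHH.M.M.minus_closed\<close>)
    also have "\<dots> = ?s1 \<ominus>\<^bsub>BH\<^esub> ?s2"
    proof -
      have "finsum BH (\<lambda>p. \<ominus>\<^bsub>BH\<^esub> galois (\<psi>' (fst p) ?c \<odot>\<^bsub>B\<^esub> x p) (y p)) P = \<ominus>\<^bsub>BH\<^esub> ?s2"
        by (rule module_hom_finsum[symmetric, OF BH.abelian_group_T BH.abelian_group_T BHH.M.lin_minus[OF lin_id]]) (use t2 in auto)
      then show ?thesis unfolding a_minus_def
        using abelian_monoid.finsum_addf[OF abBH, of "\<lambda>p. galois (\<psi>' (fst p) v \<odot>\<^bsub>B\<^esub> coact (\<psi> g) (x p)) (y p)" P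
          "\<lambda>p. \<ominus>\<^bsub>BH\<^esub> galois (\<psi>' (fst p) ?c \<odot>\<^bsub>B\<^esub> x p) (y p)"] t1 t2 by auto
    qed
    also have "\<dots> = galois (f ?c) \<one>\<^bsub>B\<^esub> \<ominus>\<^bsub>BH\<^esub> galois (coact (\<psi> g) (f v)) \<one>\<^bsub>B\<^esub>"
      by (rule BHH.M.M.minus_eq_minusI[OF a s(2,1) e])
    also have "\<dots> = galois (z (v, g)) \<one>\<^bsub>B\<^esub>"
      using cvH vH f_rules(1) cB by (simp add: z_def gdiff)
    finally show ?thesis ..
  qed
  have "\<exists>a. a \<in> P \<rightarrow> carrier A \<and> (\<forall>i\<in>Vs \<times> G0. z i = finsum RB (\<lambda>p. a p \<odot>\<^bsub>RB\<^esub> Y p i) P)"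
  proof (rule faithfully_flat_descent_finite[OF flat right_module_RB Pfin])
    show "finite (Vs \<times> G0)" using Vs(1) G0fin by simp
    show "z i \<in> carrier RB" if "i \<in> Vs \<times> G0" for i using that zcl Vs(2) by auto
    show "Y p i \<in> carrier RB" if "p \<in> P" "i \<in> Vs \<times> G0" for p i
      using Ycl[OF that(1), of "fst i" "snd i"] that(2) Vs(2) by auto
    fix m assume "m \<in> carrier LB"
    then have m: "m \<in> carrier B" by simp
    have "ptA (z i) m = finprod TA (\<lambda>p. ptA (Y p i) (y p \<otimes>\<^bsub>B\<^esub> m)) P" if i: "i \<in> Vs \<times> G0" for i
    proof (rule GM_inj)
      obtain v g where vg: "i = (v, g)" "v \<in> Vs" using i by blast
      have vH: "v \<in> carrier H" by (rule Vs(2)[OF vg(2)])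
      have zB: "z i \<in> carrier B" unfolding vg by (rule zcl[OF vH])
      have YB: "Y p i \<in> carrier B" if "p \<in> P" for p unfolding vg by (rule Ycl[OF that vH])
      interpret gTA: comm_group TA by (rule TA.comm_group_TG)
      show "ptA (z i) m \<in> carrier TA" using TA.pure_closed zB m by simp
      show "finprod TA (\<lambda>p. ptA (Y p i) (y p \<otimes>\<^bsub>B\<^esub> m)) P \<in> carrier TA"
        by (rule gTA.finprod_closed) (use YB yP m in \<open>auto intro!: TA.pure_closed\<close>)
      have "GM (ptA (z i) m) = galois (z i) (\<one>\<^bsub>B\<^esub> \<otimes>\<^bsub>B\<^esub> m)" using GM_pure zB m by simp
      also have "\<dots> = galois (z i) \<one>\<^bsub>B\<^esub> \<otimes>\<^bsub>BH\<^esub> \<rho> m" by (rule galois_mult_right) (use zB m in auto)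
      also have "\<dots> = finsum BH (\<lambda>p. galois (Y p i) (y p)) P \<otimes>\<^bsub>BH\<^esub> \<rho> m" using key[OF vg(2)] vg(1) by simp
      also have "\<dots> = finsum BH (\<lambda>p. galois (Y p i) (y p) \<otimes>\<^bsub>BH\<^esub> \<rho> m) P"
        by (rule module_hom_finsum[OF BH.abelian_group_T BH.abelian_group_T BHalg.lin_mult_left[OF lin_id rho_closed[OF m]]])
          (use YB yP in \<open>auto intro!: galois_closed\<close>)
      also have "\<dots> = finsum BH (\<lambda>p. galois (Y p i) (y p \<otimes>\<^bsub>B\<^esub> m)) P"
        by (rule BHs_cong) (use YB yP m in \<open>auto simp: galois_mult_right[symmetric] intro!: galois_closed\<close>)
      also have "\<dots> = GM (finprod TA (\<lambda>p. ptA (Y p i) (y p \<otimes>\<^bsub>B\<^esub> m)) P)"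
        by (rule GM_sum[symmetric]) (use YB yP m in auto)
      finally show "GM (ptA (z i) m) = GM (finprod TA (\<lambda>p. ptA (Y p i) (y p \<otimes>\<^bsub>B\<^esub> m)) P)" .
    qed
    then show "\<exists>b. b \<in> P \<rightarrow> carrier LB \<and> (\<forall>i\<in>Vs \<times> G0. ptA (z i) m = finprod TA (\<lambda>p. ptA (Y p i) (b p)) P)"
      using yP m by (intro exI[of _ "\<lambda>p. y p \<otimes>\<^bsub>B\<^esub> m"]) auto
  qed
  then obtain a where a: "\<And>p. p \<in> P \<Longrightarrow> a p \<in> carrier A"
    and az: "\<And>v g. \<lbrakk>v \<in> Vs; g \<in> G0\<rbrakk> \<Longrightarrow> z (v, g) = finsum B (\<lambda>p. Y p (v, g) \<otimes>\<^bsub>B\<^esub> a p) P"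
    by (auto simp: finsum_right_mult Pi_iff)
  note aB = A_B[OF a]
  have aPb: "\<forall>p\<in>P. a p \<in> carrier B" using aB by blast
  define g where "g h = f h \<oplus>\<^bsub>B\<^esub> finsum B (\<lambda>p. (\<psi>' (fst p) h \<odot>\<^bsub>B\<^esub> x p) \<otimes>\<^bsub>B\<^esub> a p) P" for h
  have lin_g: "g \<in> module_hom K H B"
    unfolding g_def
    by (intro B.lin_add B.lin_finsum B.lin_mult_left B.lin_scalar lin_f \<psi>' xP aB)
  have gD: "g d = f d" if d: "d \<in> D" for d
  proof -
    have "finsum B (\<lambda>p. (\<psi>' (fst p) d \<odot>\<^bsub>B\<^esub> x p) \<otimes>\<^bsub>B\<^esub> a p) P = \<zero>\<^bsub>B\<^esub>"
      by (rule B.add.finprod_one_eqI) (use \<psi>'D[OF d] xPb aPb in simp)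
    then show ?thesis using f_rules(1)[OF D_H[OF d]] by (simp add: g_def)
  qed
  have coact_g: "coact (\<psi> e) (g v) = g (coactH (\<psi> e) v)" if v: "v \<in> Vs" for v e
  proof -
    have vH: "v \<in> carrier H" by (rule Vs(2)[OF v])
    let ?c = "coactH (\<psi> e) v"
    have cvH: "?c \<in> carrier H" by (rule cH[OF vH])
    let ?s1 = "finsum B (\<lambda>p. (\<psi>' (fst p) v \<odot>\<^bsub>B\<^esub> coact (\<psi> e) (x p)) \<otimes>\<^bsub>B\<^esub> a p) P"
    let ?s2 = "finsum B (\<lambda>p. (\<psi>' (fst p) ?c \<odot>\<^bsub>B\<^esub> x p) \<otimes>\<^bsub>B\<^esub> a p) P"
    have t0: "(\<psi>' (fst p) v \<odot>\<^bsub>B\<^esub> x p) \<otimes>\<^bsub>B\<^esub> a p \<in> carrier B"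
      and t1: "(\<psi>' (fst p) v \<odot>\<^bsub>B\<^esub> coact (\<psi> e) (x p)) \<otimes>\<^bsub>B\<^esub> a p \<in> carrier B"
      and t2: "(\<psi>' (fst p) ?c \<odot>\<^bsub>B\<^esub> x p) \<otimes>\<^bsub>B\<^esub> a p \<in> carrier B" if "p \<in> P" for p
      using that xPb aPb k' vH cvH cB by auto
    have "coact (\<psi> e) (g v) = coact (\<psi> e) (f v) \<oplus>\<^bsub>B\<^esub> coact (\<psi> e) (finsum B (\<lambda>p. (\<psi>' (fst p) v \<odot>\<^bsub>B\<^esub> x p) \<otimes>\<^bsub>B\<^esub> a p) P)"
      unfolding g_def by (rule module_hom_add[OF lin_coact[OF \<psi>]]) (use f_rules(1)[OF vH] t0 in auto)
    also have "coact (\<psi> e) (finsum B (\<lambda>p. (\<psi>' (fst p) v \<odot>\<^bsub>B\<^esub> x p) \<otimes>\<^bsub>B\<^esub> a p) P) =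
        finsum B (\<lambda>p. coact (\<psi> e) ((\<psi>' (fst p) v \<odot>\<^bsub>B\<^esub> x p) \<otimes>\<^bsub>B\<^esub> a p)) P"
      by (rule module_hom_finsum[OF B.abgroup B.abgroup lin_coact[OF \<psi>]]) (use t0 in auto)
    also have "\<dots> = ?s1"
      by (rule B.finsum_cong')
        (use t1 k' vH xPb aPb a in \<open>auto simp: coact_A_right[OF \<psi>] module_hom_smult[OF lin_coact[OF \<psi>]]\<close>)
    finally have L: "coact (\<psi> e) (g v) = coact (\<psi> e) (f v) \<oplus>\<^bsub>B\<^esub> ?s1" .
    show ?thesis
    proof (cases "e \<in> G0")
      case True
      have s: "?s1 \<in> carrier B" "?s2 \<in> carrier B" using t1 t2 by (auto intro!: B.finsum_closed)
      have ff: "f ?c \<in> carrier B" "coact (\<psi> e) (f v) \<in> carrier B" using f_rules(1) cvH vH cB by auto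
      have "finsum B (\<lambda>p. Y p (v, e) \<otimes>\<^bsub>B\<^esub> a p) P \<oplus>\<^bsub>B\<^esub> ?s2 =
          finsum B (\<lambda>p. Y p (v, e) \<otimes>\<^bsub>B\<^esub> a p \<oplus>\<^bsub>B\<^esub> (\<psi>' (fst p) ?c \<odot>\<^bsub>B\<^esub> x p) \<otimes>\<^bsub>B\<^esub> a p) P"
        by (rule B.finsum_addf[symmetric]) (use Ycl[OF _ vH] aPb t2 in auto)
      also have "\<dots> = ?s1"
      proof (rule B.finsum_cong'[OF refl])
        fix p assume p: "p \<in> P"
        have "Y p (v, e) \<otimes>\<^bsub>B\<^esub> a p \<oplus>\<^bsub>B\<^esub> (\<psi>' (fst p) ?c \<odot>\<^bsub>B\<^esub> x p) \<otimes>\<^bsub>B\<^esub> a p =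
          (Y p (v, e) \<oplus>\<^bsub>B\<^esub> \<psi>' (fst p) ?c \<odot>\<^bsub>B\<^esub> x p) \<otimes>\<^bsub>B\<^esub> a p"
          by (rule B.l_distr[symmetric]) (use Ycl[OF p vH] k'[OF cvH] xP[OF p] aB[OF p] in auto)
        also have "Y p (v, e) \<oplus>\<^bsub>B\<^esub> \<psi>' (fst p) ?c \<odot>\<^bsub>B\<^esub> x p = \<psi>' (fst p) v \<odot>\<^bsub>B\<^esub> coact (\<psi> e) (x p)"
          using k'[OF cvH] k'[OF vH] xP[OF p] cB by (simp add: Y_def a_minus_def B.a_assoc B.l_neg)
        finally show "Y p (v, e) \<otimes>\<^bsub>B\<^esub> a p \<oplus>\<^bsub>B\<^esub> (\<psi>' (fst p) ?c \<odot>\<^bsub>B\<^esub> x p) \<otimes>\<^bsub>B\<^esub> a p =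
          (\<psi>' (fst p) v \<odot>\<^bsub>B\<^esub> coact (\<psi> e) (x p)) \<otimes>\<^bsub>B\<^esub> a p" .
      qed (use t1 in auto)
      finally have zs: "z (v, e) \<oplus>\<^bsub>B\<^esub> ?s2 = ?s1" using az[OF v True] by simp
      have "coact (\<psi> e) (f v) \<oplus>\<^bsub>B\<^esub> ?s1 = f ?c \<oplus>\<^bsub>B\<^esub> ?s2"
      proof -
        have "coact (\<psi> e) (f v) \<oplus>\<^bsub>B\<^esub> ?s1 = (coact (\<psi> e) (f v) \<oplus>\<^bsub>B\<^esub> (f ?c \<ominus>\<^bsub>B\<^esub> coact (\<psi> e) (f v))) \<oplus>\<^bsub>B\<^esub> ?s2"
          unfolding zs[symmetric] using s ff by (simp add: z_def B.a_assoc)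
        then show ?thesis using ff by (simp add: B.add_minus_cancel)
      qed
      then show ?thesis unfolding L by (simp add: g_def)
    next
      case False
      then have f0: "coact (\<psi> e) (f v) = \<zero>\<^bsub>B\<^esub>" "?c = \<zero>\<^bsub>H\<^esub>" and x0: "\<And>p. p \<in> P \<Longrightarrow> coact (\<psi> e) (x p) = \<zero>\<^bsub>B\<^esub>"
        using GB(2) GH(2) v vH f_rules(1) xPb unfolding G0_def by auto
      have "?s1 = \<zero>\<^bsub>B\<^esub>"
        by (rule B.add.finprod_one_eqI) (use x0 k'[OF vH] aPb in simp)
      moreover have "g \<zero>\<^bsub>H\<^esub> = \<zero>\<^bsub>B\<^esub>" by (rule module_hom_zero[OF H.abgroup B.abgroup lin_g])
      ultimately show ?thesis unfolding L f0 by simp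
    qed
  qed
  have colV: "\<rho> (g v) = delta g v" if v: "v \<in> Vs" for v
  proof (rule coord_eqI[OF X])
    have vH: "v \<in> carrier H" by (rule Vs(2)[OF v])
    show "\<rho> (g v) \<in> carrier BH" by (rule rho_closed[OF module_hom_closed[OF lin_g vH]])
    show "delta g v \<in> carrier BH" by (rule module_hom_closed[OF lin_delta[OF lin_g] vH])
    show "coord (\<psi> e) (\<rho> (g v)) = coord (\<psi> e) (delta g v)" for e
      unfolding coord_delta[OF lin_g \<psi> vH] coact_coord[symmetric] by (rule coact_g[OF v])
  qed
  have "\<rho> (g (coactH \<theta> h0)) = delta g (coactH \<theta> h0)" if \<theta>: "\<theta> \<in> functionals" for \<theta>
  proof -
    have EH: "e \<in> carrier H" if "e \<in> E" for e using E(2) H.H_basisD(1)[OF X] that by blast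
    have vH: "coactH (\<psi> e) h0 \<in> carrier H" for e by (rule cH[OF h0])
    have \<theta>K: "\<theta> e \<in> carrier K" if "e \<in> E" for e using H.functional_closed[OF \<theta> EH[OF that]] .
    have e: "coactH \<theta> h0 = finsum H (\<lambda>e. \<theta> e \<odot>\<^bsub>H\<^esub> coactH (\<psi> e) h0) E"
      unfolding H.self.coact_def[of \<theta>]
      by (rule H.self.cosum_eq_finsum[OF X h0 H.k_module H.self.coord_bilinear[OF \<theta>] E])
    have lin: "(\<lambda>h. \<rho> (g h)) \<in> module_hom K H BH" by (rule lin_comp[OF lin_rho lin_g])
    have exp: "F (coactH \<theta> h0) = finsum BH (\<lambda>e. \<theta> e \<odot>\<^bsub>BH\<^esub> F (coactH (\<psi> e) h0)) E" if F: "F \<in> module_hom K H BH" for F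
    proof -
      have "F (coactH \<theta> h0) = finsum BH (\<lambda>e. F (\<theta> e \<odot>\<^bsub>H\<^esub> coactH (\<psi> e) h0)) E"
        unfolding e by (rule module_hom_finsum[OF H.abgroup BH.abelian_group_T F]) (use \<theta>K vH in auto)
      also have "\<dots> = finsum BH (\<lambda>e. \<theta> e \<odot>\<^bsub>BH\<^esub> F (coactH (\<psi> e) h0)) E"
        by (rule BHs_cong) (use \<theta>K vH module_hom_closed[OF F] in \<open>auto simp: module_hom_smult[OF F]\<close>)
      finally show ?thesis .
    qed
    have "finsum BH (\<lambda>e. \<theta> e \<odot>\<^bsub>BH\<^esub> \<rho> (g (coactH (\<psi> e) h0))) E = finsum BH (\<lambda>e. \<theta> e \<odot>\<^bsub>BH\<^esub> delta g (coactH (\<psi> e) h0)) E"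
      by (rule BHs_cong)
        (use \<theta>K vH colV module_hom_closed[OF lin_delta[OF lin_g]] in \<open>auto simp: Vs_def\<close>)
    then show ?thesis using exp[OF lin] exp[OF lin_delta[OF lin_g]] by simp
  qed
  then show ?thesis using lin_g gD by blast
qed

end

section \<open>Existence of a total integral\<close>

lemma (in comodule_algebra) coact_one:
  assumes \<theta>: "\<theta> \<in> functionals" shows "coact \<theta> \<one>\<^bsub>B\<^esub> = \<theta> \<one>\<^bsub>H\<^esub> \<odot>\<^bsub>B\<^esub> \<one>\<^bsub>B\<^esub>"
  unfolding coact_def by (rule cosum_one[OF B.k_module coord_bilinear[OF \<theta>]])

context bijective_comodule_algebra
begin

lemma colinear_iff:
  assumes g: "g \<in> module_hom K H B" and h: "h \<in> carrier H"
  shows "\<rho> (g h) = delta g h \<longleftrightarrow> (\<forall>\<theta> \<in> functionals. coact \<theta> (g h) = g (coactH \<theta> h))"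
proof
  assume "\<rho> (g h) = delta g h"
  then show "\<forall>\<theta> \<in> functionals. coact \<theta> (g h) = g (coactH \<theta> h)"
    using coord_delta[OF g _ h] by (simp add: coact_coord)
next
  assume eq: "\<forall>\<theta> \<in> functionals. coact \<theta> (g h) = g (coactH \<theta> h)"
  obtain X \<psi> where X: "H.H_basis X \<psi>" using H.ex_H_basis by blast
  show "\<rho> (g h) = delta g h"
  proof (rule coord_eqI[OF X])
    show "\<rho> (g h) \<in> carrier BH" by (rule rho_closed[OF module_hom_closed[OF g h]])
    show "delta g h \<in> carrier BH" by (rule module_hom_closed[OF lin_delta[OF g] h])
    show "coord (\<psi> e) (\<rho> (g h)) = coord (\<psi> e) (delta g h)" for e
      using eq coord_delta[OF g H.H_basisD(2)[OF X] h] H.H_basisD(2)[OF X] by (simp add: coact_coord)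
  qed
qed

text \<open>Graphs of colinear maps on subcomodules of \<open>H\<close> that contain \<open>1\<close>, with value \<open>1\<close> there. Extension
  of maps is inclusion of graphs.\<close>

definition colinear_graph :: "('h \<times> 'b) set \<Rightarrow> bool" where
  "colinear_graph G \<longleftrightarrow> G \<subseteq> carrier H \<times> carrier B \<and>
    (\<forall>h b h' b'. (h, b) \<in> G \<and> (h', b') \<in> G \<longrightarrow> (h \<oplus>\<^bsub>H\<^esub> h', b \<oplus>\<^bsub>B\<^esub> b') \<in> G) \<and>
    (\<forall>c \<in> carrier K. \<forall>h b. (h, b) \<in> G \<longrightarrow> (c \<odot>\<^bsub>H\<^esub> h, c \<odot>\<^bsub>B\<^esub> b) \<in> G) \<and>
    (\<forall>b. (\<zero>\<^bsub>H\<^esub>, b) \<in> G \<longrightarrow> b = \<zero>\<^bsub>B\<^esub>) \<and>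
    (\<one>\<^bsub>H\<^esub>, \<one>\<^bsub>B\<^esub>) \<in> G \<and>
    (\<forall>\<theta> \<in> functionals. \<forall>h b. (h, b) \<in> G \<longrightarrow> (coactH \<theta> h, coact \<theta> b) \<in> G)"

lemma colinear_graphI:
  assumes "\<And>h b. (h, b) \<in> G \<Longrightarrow> h \<in> carrier H \<and> b \<in> carrier B"
    "\<And>h b h' b'. \<lbrakk>(h, b) \<in> G; (h', b') \<in> G\<rbrakk> \<Longrightarrow> (h \<oplus>\<^bsub>H\<^esub> h', b \<oplus>\<^bsub>B\<^esub> b') \<in> G"
    "\<And>c h b. \<lbrakk>c \<in> carrier K; (h, b) \<in> G\<rbrakk> \<Longrightarrow> (c \<odot>\<^bsub>H\<^esub> h, c \<odot>\<^bsub>B\<^esub> b) \<in> G"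
    "\<And>b. (\<zero>\<^bsub>H\<^esub>, b) \<in> G \<Longrightarrow> b = \<zero>\<^bsub>B\<^esub>"
    "(\<one>\<^bsub>H\<^esub>, \<one>\<^bsub>B\<^esub>) \<in> G"
    "\<And>\<theta> h b. \<lbrakk>\<theta> \<in> functionals; (h, b) \<in> G\<rbrakk> \<Longrightarrow> (coactH \<theta> h, coact \<theta> b) \<in> G"
  shows "colinear_graph G"
  unfolding colinear_graph_def using assms by (intro conjI ballI allI impI subsetI) auto

lemma colinear_graphD:
  assumes "colinear_graph G"
  shows "(h, b) \<in> G \<Longrightarrow> h \<in> carrier H" "(h, b) \<in> G \<Longrightarrow> b \<in> carrier B"
    "\<lbrakk>(h, b) \<in> G; (h', b') \<in> G\<rbrakk> \<Longrightarrow> (h \<oplus>\<^bsub>H\<^esub> h', b \<oplus>\<^bsub>B\<^esub> b') \<in> G"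
    "\<lbrakk>c \<in> carrier K; (h, b) \<in> G\<rbrakk> \<Longrightarrow> (c \<odot>\<^bsub>H\<^esub> h, c \<odot>\<^bsub>B\<^esub> b) \<in> G"
    "(\<zero>\<^bsub>H\<^esub>, b) \<in> G \<Longrightarrow> b = \<zero>\<^bsub>B\<^esub>"
    "(\<one>\<^bsub>H\<^esub>, \<one>\<^bsub>B\<^esub>) \<in> G"
    "\<lbrakk>\<theta> \<in> functionals; (h, b) \<in> G\<rbrakk> \<Longrightarrow> (coactH \<theta> h, coact \<theta> b) \<in> G"
proof -
  note c = assms[unfolded colinear_graph_def]
  show "(h, b) \<in> G \<Longrightarrow> h \<in> carrier H" "(h, b) \<in> G \<Longrightarrow> b \<in> carrier B"
    using c[THEN conjunct1] by auto
  show "\<lbrakk>(h, b) \<in> G; (h', b') \<in> G\<rbrakk> \<Longrightarrow> (h \<oplus>\<^bsub>H\<^esub> h', b \<oplus>\<^bsub>B\<^esub> b') \<in> G"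
    using c[THEN conjunct2, THEN conjunct1] by simp
  show "\<lbrakk>c \<in> carrier K; (h, b) \<in> G\<rbrakk> \<Longrightarrow> (c \<odot>\<^bsub>H\<^esub> h, c \<odot>\<^bsub>B\<^esub> b) \<in> G"
    using c[THEN conjunct2, THEN conjunct2, THEN conjunct1] by simp
  show "(\<zero>\<^bsub>H\<^esub>, b) \<in> G \<Longrightarrow> b = \<zero>\<^bsub>B\<^esub>"
    using c[THEN conjunct2, THEN conjunct2, THEN conjunct2, THEN conjunct1] by simp
  show "(\<one>\<^bsub>H\<^esub>, \<one>\<^bsub>B\<^esub>) \<in> G"
    using c[THEN conjunct2, THEN conjunct2, THEN conjunct2, THEN conjunct2, THEN conjunct1] .
  show "\<lbrakk>\<theta> \<in> functionals; (h, b) \<in> G\<rbrakk> \<Longrightarrow> (coactH \<theta> h, coact \<theta> b) \<in> G"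
    using c[THEN conjunct2, THEN conjunct2, THEN conjunct2, THEN conjunct2, THEN conjunct2] by simp
qed

lemma counit_functional: "\<epsilon> \<in> functionals"
  using H.counit_hom unfolding alg_hom_def by blast

lemma graph_unique:
  assumes G: "colinear_graph G" and "(h, b) \<in> G" "(h, b') \<in> G" shows "b = b'"
proof -
  note g = colinear_graphD[OF G]
  have c: "h \<in> carrier H" "b \<in> carrier B" "b' \<in> carrier B" using assms g(1,2) by blast+
  have "(\<ominus>\<^bsub>K\<^esub> \<one>\<^bsub>K\<^esub> \<odot>\<^bsub>H\<^esub> h, \<ominus>\<^bsub>K\<^esub> \<one>\<^bsub>K\<^esub> \<odot>\<^bsub>B\<^esub> b') \<in> G" by (rule g(4)) (use assms in auto)
  from g(3)[OF assms(2) this] have "(\<zero>\<^bsub>H\<^esub>, b \<ominus>\<^bsub>B\<^esub> b') \<in> G"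
    using c by (simp add: H.smult_l_minus B.smult_l_minus H.r_neg a_minus_def)
  from g(5)[OF this] have "b \<ominus>\<^bsub>B\<^esub> b' = \<zero>\<^bsub>B\<^esub>" .
  then show ?thesis using c B.add_minus_cancel[of b' b] by simp
qed

lemma unit_graph: "colinear_graph {(c \<odot>\<^bsub>H\<^esub> \<one>\<^bsub>H\<^esub>, c \<odot>\<^bsub>B\<^esub> \<one>\<^bsub>B\<^esub>) | c. c \<in> carrier K}" (is "colinear_graph ?G")
proof (rule colinear_graphI)
  show "h \<in> carrier H \<and> b \<in> carrier B" if "(h, b) \<in> ?G" for h b using that by auto
  show "(h \<oplus>\<^bsub>H\<^esub> h', b \<oplus>\<^bsub>B\<^esub> b') \<in> ?G" if hb: "(h, b) \<in> ?G" "(h', b') \<in> ?G" for h b h' b'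
  proof -
    from hb obtain c c' where "c \<in> carrier K" "c' \<in> carrier K" "h = c \<odot>\<^bsub>H\<^esub> \<one>\<^bsub>H\<^esub>" "b = c \<odot>\<^bsub>B\<^esub> \<one>\<^bsub>B\<^esub>"
      "h' = c' \<odot>\<^bsub>H\<^esub> \<one>\<^bsub>H\<^esub>" "b' = c' \<odot>\<^bsub>B\<^esub> \<one>\<^bsub>B\<^esub>" by auto
    then show ?thesis by (auto intro!: exI[of _ "c \<oplus>\<^bsub>K\<^esub> c'"] simp: H.smult_l_distr B.smult_l_distr)
  qed
  show "(c \<odot>\<^bsub>H\<^esub> h, c \<odot>\<^bsub>B\<^esub> b) \<in> ?G" if c: "c \<in> carrier K" and "(h, b) \<in> ?G" for c h b
  proof -
    from that obtain c' where "c' \<in> carrier K" "h = c' \<odot>\<^bsub>H\<^esub> \<one>\<^bsub>H\<^esub>" "b = c' \<odot>\<^bsub>B\<^esub> \<one>\<^bsub>B\<^esub>" by auto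
    then show ?thesis using c by (auto intro!: exI[of _ "c \<otimes>\<^bsub>K\<^esub> c'"] simp: H.smult_assoc1 B.smult_assoc1)
  qed
  show "b = \<zero>\<^bsub>B\<^esub>" if "(\<zero>\<^bsub>H\<^esub>, b) \<in> ?G" for b
  proof -
    from that obtain c where c: "c \<in> carrier K" "c \<odot>\<^bsub>H\<^esub> \<one>\<^bsub>H\<^esub> = \<zero>\<^bsub>H\<^esub>" "b = c \<odot>\<^bsub>B\<^esub> \<one>\<^bsub>B\<^esub>" by auto
    have "c = c \<odot>\<^bsub>scalar_algebra K\<^esub> \<epsilon> \<one>\<^bsub>H\<^esub>" using c(1) H.counit_one by (simp add: scalar_algebra_def)
    also have "\<dots> = \<epsilon> (c \<odot>\<^bsub>H\<^esub> \<one>\<^bsub>H\<^esub>)" by (rule module_hom_smult[OF counit_functional c(1), symmetric]) simp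
    also have "\<dots> = \<zero>\<^bsub>K\<^esub>"
      using c(2) module_hom_zero[OF H.abgroup module.abgroup[OF H.scalar_module_K] counit_functional]
      by (simp add: scalar_algebra_def)
    finally show ?thesis using c(3) by simp
  qed
  show "(\<one>\<^bsub>H\<^esub>, \<one>\<^bsub>B\<^esub>) \<in> ?G" by (auto intro!: exI[of _ "\<one>\<^bsub>K\<^esub>"])
  show "(coactH \<theta> h, coact \<theta> b) \<in> ?G" if \<theta>: "\<theta> \<in> functionals" and "(h, b) \<in> ?G" for \<theta> h b
  proof -
    from that obtain c where c: "c \<in> carrier K" "h = c \<odot>\<^bsub>H\<^esub> \<one>\<^bsub>H\<^esub>" "b = c \<odot>\<^bsub>B\<^esub> \<one>\<^bsub>B\<^esub>" by auto
    have k: "\<theta> \<one>\<^bsub>H\<^esub> \<in> carrier K" by (rule H.functional_closed[OF \<theta>]) simp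
    have "coactH \<theta> h = (c \<otimes>\<^bsub>K\<^esub> \<theta> \<one>\<^bsub>H\<^esub>) \<odot>\<^bsub>H\<^esub> \<one>\<^bsub>H\<^esub>" "coact \<theta> b = (c \<otimes>\<^bsub>K\<^esub> \<theta> \<one>\<^bsub>H\<^esub>) \<odot>\<^bsub>B\<^esub> \<one>\<^bsub>B\<^esub>"
      using c k module_hom_smult[OF H.self.lin_coact[OF \<theta>] c(1)] module_hom_smult[OF lin_coact[OF \<theta>] c(1)]
      by (simp_all add: H.self.coact_one[OF \<theta>] coact_one[OF \<theta>] H.smult_assoc1 B.smult_assoc1)
    then show ?thesis using c(1) k by auto
  qed
qed

lemma chain_graph:
  assumes ne: "C \<noteq> {}" and C: "subset.chain {G. colinear_graph G} C"
  shows "colinear_graph (\<Union>C)"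
proof (rule colinear_graphI)
  have g: "colinear_graph G" if "G \<in> C" for G using C that by (auto simp: subset.chain_def)
  show "h \<in> carrier H \<and> b \<in> carrier B" if "(h, b) \<in> \<Union>C" for h b
    using that colinear_graphD(1,2)[OF g] by blast
  show "(h \<oplus>\<^bsub>H\<^esub> h', b \<oplus>\<^bsub>B\<^esub> b') \<in> \<Union>C" if hb: "(h, b) \<in> \<Union>C" "(h', b') \<in> \<Union>C" for h b h' b'
  proof -
    from hb obtain G G' where G: "G \<in> C" "(h, b) \<in> G" "G' \<in> C" "(h', b') \<in> G'" by blast
    then have "G \<subseteq> G' \<or> G' \<subseteq> G" using C by (auto simp: subset_chain_def)
    then obtain G'' where "G'' \<in> C" "(h, b) \<in> G''" "(h', b') \<in> G''" using G by blast
    then show ?thesis using colinear_graphD(3)[OF g] by blast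
  qed
  show "(c \<odot>\<^bsub>H\<^esub> h, c \<odot>\<^bsub>B\<^esub> b) \<in> \<Union>C" if "c \<in> carrier K" "(h, b) \<in> \<Union>C" for c h b
    using that colinear_graphD(4)[OF g] by blast
  show "b = \<zero>\<^bsub>B\<^esub>" if "(\<zero>\<^bsub>H\<^esub>, b) \<in> \<Union>C" for b
    using that colinear_graphD(5)[OF g] by blast
  show "(\<one>\<^bsub>H\<^esub>, \<one>\<^bsub>B\<^esub>) \<in> \<Union>C" using ne colinear_graphD(6)[OF g] by blast
  show "(coactH \<theta> h, coact \<theta> b) \<in> \<Union>C" if "\<theta> \<in> functionals" "(h, b) \<in> \<Union>C" for \<theta> h b
    using that colinear_graphD(7)[OF g] by blast
qed

text \<open>The linear extension to \<open>H\<close> is the composite with a linear projection onto the domain.\<close>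

lemma graph_extend:
  assumes G: "colinear_graph G"
  shows "\<exists>f. partial_integral K H \<Delta> \<epsilon> S B \<rho> (fst ` G) f \<and> (\<forall>h b. (h, b) \<in> G \<longrightarrow> f h = b)"
proof -
  note g = colinear_graphD[OF G]
  let ?D = "fst ` G"
  define f0 where "f0 h = (THE b. (h, b) \<in> G)" for h
  have f0: "f0 h = b" if "(h, b) \<in> G" for h b
    unfolding f0_def by (rule the_equality) (use that graph_unique[OF G] in auto)
  have D: "(h, f0 h) \<in> G" if "h \<in> ?D" for h using that f0 by auto
  have "(\<zero>\<^bsub>K\<^esub> \<odot>\<^bsub>H\<^esub> \<one>\<^bsub>H\<^esub>, \<zero>\<^bsub>K\<^esub> \<odot>\<^bsub>B\<^esub> \<one>\<^bsub>B\<^esub>) \<in> G" by (rule g(4)[OF _ g(6)]) simp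
  then have z: "(\<zero>\<^bsub>H\<^esub>, \<zero>\<^bsub>B\<^esub>) \<in> G" by simp
  have vs: "vector_subspace K H ?D"
  proof (intro vector_subspace.intro vector_subspace_axioms.intro H.field_K H.k_module)
    show "?D \<subseteq> carrier H" using g(1) by auto
    show "\<zero>\<^bsub>H\<^esub> \<in> ?D" using z by force
    show "h \<oplus>\<^bsub>H\<^esub> h' \<in> ?D" if "h \<in> ?D" "h' \<in> ?D" for h h' using g(3)[OF D[OF that(1)] D[OF that(2)]] by force
    show "c \<odot>\<^bsub>H\<^esub> h \<in> ?D" if "c \<in> carrier K" "h \<in> ?D" for c h using g(4)[OF that(1) D[OF that(2)]] by force
  qed
  interpret D: vector_subspace K H ?D by (rule vs)
  obtain \<psi> where \<psi>0: "\<And>e d. d \<in> ?D \<Longrightarrow> \<psi> e d = \<zero>\<^bsub>K\<^esub>"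
    and r: "(\<lambda>v. v \<ominus>\<^bsub>H\<^esub> finsum H (\<lambda>e. \<psi> e v \<odot>\<^bsub>H\<^esub> e) {e. \<psi> e v \<noteq> \<zero>\<^bsub>K\<^esub>}) \<in> module_hom K H H"
    and rD: "\<And>v. v \<in> carrier H \<Longrightarrow> v \<ominus>\<^bsub>H\<^esub> finsum H (\<lambda>e. \<psi> e v \<odot>\<^bsub>H\<^esub> e) {e. \<psi> e v \<noteq> \<zero>\<^bsub>K\<^esub>} \<in> ?D"
    using D.relative_basis by blast
  define ret where "ret v = v \<ominus>\<^bsub>H\<^esub> finsum H (\<lambda>e. \<psi> e v \<odot>\<^bsub>H\<^esub> e) {e. \<psi> e v \<noteq> \<zero>\<^bsub>K\<^esub>}" for v
  have ret: "ret \<in> module_hom K H H" "\<And>v. v \<in> carrier H \<Longrightarrow> ret v \<in> ?D" using r rD by (simp_all add: ret_def[abs_def])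
  have ret_D: "ret d = d" if "d \<in> ?D" for d
    using \<psi>0[OF that] g(1)[OF D[OF that]] by (simp add: ret_def a_minus_def)
  define f where "f v = f0 (ret v)" for v
  have fG: "f h = b" if "(h, b) \<in> G" for h b
    using that f0[OF that] ret_D[of h] by (force simp: f_def)
  have lin: "f \<in> module_hom K H B"
  proof (rule module_homI)
    show "f v \<in> carrier B" if "v \<in> carrier H" for v
      using g(2)[OF D[OF ret(2)[OF that]]] by (simp add: f_def)
    show "f (v \<oplus>\<^bsub>H\<^esub> w) = f v \<oplus>\<^bsub>B\<^esub> f w" if "v \<in> carrier H" "w \<in> carrier H" for v w
      unfolding f_def module_hom_add[OF ret(1) that]
      by (rule f0[OF g(3)[OF D[OF ret(2)[OF that(1)]] D[OF ret(2)[OF that(2)]]]])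
    show "f (c \<odot>\<^bsub>H\<^esub> v) = c \<odot>\<^bsub>B\<^esub> f v" if "c \<in> carrier K" "v \<in> carrier H" for c v
      unfolding f_def module_hom_smult[OF ret(1) that]
      by (rule f0[OF g(4)[OF that(1) D[OF ret(2)[OF that(2)]]]])
  qed
  have D_coact: "coactH \<theta> d \<in> ?D" if "\<theta> \<in> functionals" "d \<in> ?D" for \<theta> d
    using g(7)[OF that(1) D[OF that(2)]] by force
  have "\<rho> (f d) = delta f d" if d: "d \<in> ?D" for d
  proof -
    have "coact \<theta> (f d) = f (coactH \<theta> d)" if "\<theta> \<in> functionals" for \<theta>
      using fG[OF g(7)[OF that D[OF d]]] fG[OF D[OF d]] by simp
    then show ?thesis using colinear_iff[OF lin g(1)[OF D[OF d]]] by blast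
  qed
  then have "partial_integral K H \<Delta> \<epsilon> S B \<rho> ?D f"
    by (intro partial_integral.intro partial_integral_axioms.intro bijective_comodule_algebra_axioms vs lin D_coact)
  then show ?thesis using fG by blast
qed

end

text \<open>Let \<open>f\<close> have a maximal graph, let \<open>h0\<close> be arbitrary, and let \<open>g\<close> extend \<open>f\<close> as in \<open>extend_at\<close>. The elements
  all of whose components satisfy the colinearity equation for \<open>g\<close> form a subcomodule \<open>C\<close>. It contains the
  domain of \<open>f\<close> and \<open>h0\<close>, and \<open>g\<close> is colinear on it. By maximality \<open>C\<close> is the domain of \<open>f\<close>.\<close>

lemma (in galois_extension) total_integral_exists: "\<exists>j. total_integral K H \<Delta> \<epsilon> S B \<rho> j"
proof -
  have "\<exists>M\<in>{G. colinear_graph G}. \<forall>X\<in>{G. colinear_graph G}. M \<subseteq> X \<longrightarrow> X = M"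
    by (rule subset_Zorn_nonempty) (use unit_graph chain_graph in blast)+
  then obtain M where M: "colinear_graph M" and max: "\<And>X. \<lbrakk>colinear_graph X; M \<subseteq> X\<rbrakk> \<Longrightarrow> X = M" by auto
  obtain f where f: "partial_integral K H \<Delta> \<epsilon> S B \<rho> (fst ` M) f" and fM: "\<And>h b. (h, b) \<in> M \<Longrightarrow> f h = b"
    using graph_extend[OF M] by blast
  let ?D = "fst ` M"
  interpret gp: galois_partial_integral K H \<Delta> \<epsilon> S B \<rho> ?D f
    by (intro galois_partial_integral.intro galois_extension_axioms f)
  note m = colinear_graphD[OF M]
  have MD: "(d, f d) \<in> M" if "d \<in> ?D" for d using that fM by auto
  have "h0 \<in> ?D" if h0: "h0 \<in> carrier H" for h0
  proof -
    obtain g where g: "g \<in> module_hom K H B" and gf: "\<And>d. d \<in> ?D \<Longrightarrow> g d = f d"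
      and col: "\<forall>\<theta> \<in> functionals. \<rho> (g (coactH \<theta> h0)) = delta g (coactH \<theta> h0)"
      using gp.extend_at[OF h0] by blast
    define C where "C = {x \<in> carrier H. \<forall>\<theta> \<in> functionals. \<rho> (g (coactH \<theta> x)) = delta g (coactH \<theta> x)}"
    have CH: "x \<in> carrier H" if "x \<in> C" for x using that by (simp add: C_def)
    have Cg: "coact \<theta> (g x) = g (coactH \<theta> x)" if x: "x \<in> C" and \<theta>: "\<theta> \<in> functionals" for x \<theta>
    proof -
      (* x is its own component along the counit. *)
      have "\<rho> (g (coactH \<epsilon> x)) = delta g (coactH \<epsilon> x)" using x counit_functional by (simp add: C_def)
      then show ?thesis using colinear_iff[OF g CH[OF x]] \<theta> H.self.coact_counit[OF CH[OF x]] by simp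
    qed
    have C_coact: "coactH \<theta> x \<in> C" if x: "x \<in> C" and \<theta>: "\<theta> \<in> functionals" for x \<theta>
      using x H.self.coact_coact[OF _ \<theta> CH[OF x]] H.conv_functional[OF _ \<theta>] H.self.coact_closed[OF \<theta> CH[OF x]]
      unfolding C_def by simp
    have l1: "(\<lambda>x. \<rho> (g (coactH \<theta> x))) \<in> module_hom K H BH" and l2: "(\<lambda>x. delta g (coactH \<theta> x)) \<in> module_hom K H BH"
      if "\<theta> \<in> functionals" for \<theta>
      by (rule lin_comp[OF lin_rho lin_comp[OF g H.self.lin_coact[OF that]]],
          rule lin_comp[OF lin_delta[OF g] H.self.lin_coact[OF that]])
    have C_add: "x \<oplus>\<^bsub>H\<^esub> y \<in> C" if "x \<in> C" "y \<in> C" for x y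
      using that module_hom_add[OF l1 CH CH] module_hom_add[OF l2 CH CH] unfolding C_def by simp
    have C_smult: "c \<odot>\<^bsub>H\<^esub> x \<in> C" if "c \<in> carrier K" "x \<in> C" for c x
      using that module_hom_smult[OF l1 that(1) CH] module_hom_smult[OF l2 that(1) CH] unfolding C_def by simp
    have DC: "d \<in> C" if d: "d \<in> ?D" for d
    proof -
      have c: "\<rho> (g d) = delta g d" if d: "d \<in> ?D" for d
      proof -
        have "coact \<theta> (g d) = g (coactH \<theta> d)" if "\<theta> \<in> functionals" for \<theta>
          using fM[OF m(7)[OF that MD[OF d]]] gf[OF d] gf[OF gp.D_coact[OF that d]] by simp
        then show ?thesis using colinear_iff[OF g gp.D_H[OF d]] by blast
      qed
      show ?thesis unfolding C_def using c[OF gp.D_coact[OF _ d]] gp.D_H[OF d] by blast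
    qed
    have oneD: "\<one>\<^bsub>H\<^esub> \<in> ?D" using m(6) by force
    let ?G = "(\<lambda>x. (x, g x)) ` C"
    have "colinear_graph ?G"
    proof (rule colinear_graphI)
      show "h \<in> carrier H \<and> b \<in> carrier B" if "(h, b) \<in> ?G" for h b
        using that CH module_hom_closed[OF g] by auto
      show "(h \<oplus>\<^bsub>H\<^esub> h', b \<oplus>\<^bsub>B\<^esub> b') \<in> ?G" if "(h, b) \<in> ?G" "(h', b') \<in> ?G" for h b h' b'
        using that C_add CH module_hom_add[OF g] by auto
      show "(c \<odot>\<^bsub>H\<^esub> h, c \<odot>\<^bsub>B\<^esub> b) \<in> ?G" if "c \<in> carrier K" "(h, b) \<in> ?G" for c h b
        using that C_smult CH module_hom_smult[OF g] by auto
      show "b = \<zero>\<^bsub>B\<^esub>" if "(\<zero>\<^bsub>H\<^esub>, b) \<in> ?G" for b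
        using that module_hom_zero[OF H.abgroup B.abgroup g] by auto
      show "(\<one>\<^bsub>H\<^esub>, \<one>\<^bsub>B\<^esub>) \<in> ?G"
        using DC[OF oneD] gf[OF oneD] fM[OF m(6)] by (intro image_eqI[of _ _ "\<one>\<^bsub>H\<^esub>"]) auto
      show "(coactH \<theta> h, coact \<theta> b) \<in> ?G" if "\<theta> \<in> functionals" "(h, b) \<in> ?G" for \<theta> h b
        using that C_coact Cg by auto
    qed
    moreover have "M \<subseteq> ?G"
    proof
      fix p assume p: "p \<in> M"
      then have "fst p \<in> ?D" "p = (fst p, g (fst p))" using fM[of "fst p" "snd p"] gf[of "fst p"] by auto
      then show "p \<in> ?G" using DC by blast
    qed
    ultimately have "?G = M" by (rule max)
    moreover have "h0 \<in> C" using col h0 by (simp add: C_def)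
    ultimately show ?thesis by force
  qed
  then have "total_integral K H \<Delta> \<epsilon> S B \<rho> f"
    using gp.f_colinear fM[OF m(6)]
    by (intro total_integral.intro total_integral_axioms.intro bijective_comodule_algebra_axioms gp.lin_f)
      (simp_all add: delta_def)
  then show ?thesis by blast
qed

section \<open>Dual bases\<close>

text \<open>A map \<open>f\<close> to a quotient \<open>g : M \<rightarrow> N\<close> lifts to \<open>p \<mapsto> \<Sum> \<xi>\<^sub>i p m\<^sub>i\<close>, for any choice of preimages \<open>m\<^sub>i\<close> of \<open>f e\<^sub>i\<close>.\<close>

lemma projective_module_dual_basis:
  fixes e :: "'i \<Rightarrow> 'p" and I :: "'i set"
  assumes P: "left_module R P"
    and e: "\<And>i. i \<in> I \<Longrightarrow> e i \<in> carrier P"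
    and \<xi>: "\<And>i. i \<in> I \<Longrightarrow> \<xi> i \<in> module_hom R P (left_mult_module R)"
    and ex: "\<And>p. p \<in> carrier P \<Longrightarrow>
      \<exists>J. finite J \<and> J \<subseteq> I \<and> (\<forall>i \<in> I - J. \<xi> i p = \<zero>\<^bsub>R\<^esub>) \<and> finsum P (\<lambda>i. \<xi> i p \<odot>\<^bsub>P\<^esub> e i) J = p"
  shows "projective_module TYPE('m) TYPE('n) R P"
  unfolding projective_module_def
proof (intro conjI allI impI P)
  interpret P: left_module R P by (rule P)
  fix M :: "('a, 'm) module" and N :: "('a, 'n) module" and g f
  assume "left_module R M \<and> left_module R N \<and> g \<in> module_hom R M N \<and> g ` carrier M = carrier N \<and>
    f \<in> module_hom R P N"
  then have M: "left_module R M" and N: "left_module R N" and g: "g \<in> module_hom R M N"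
    and surj: "g ` carrier M = carrier N" and f: "f \<in> module_hom R P N" by auto
  interpret M: left_module R M by (rule M)
  interpret N: left_module R N by (rule N)
  have "\<forall>i \<in> I. \<exists>m. m \<in> carrier M \<and> g m = f (e i)"
    using surj module_hom_closed[OF f e] by (metis imageE)
  from bchoice[OF this] obtain m where m: "\<And>i. i \<in> I \<Longrightarrow> m i \<in> carrier M" "\<And>i. i \<in> I \<Longrightarrow> g (m i) = f (e i)"
    by auto
  have \<xi>R: "\<xi> i p \<in> carrier R" if "i \<in> I" "p \<in> carrier P" for i p
    using module_hom_closed[OF \<xi> that(2)] that by simp
  have \<xi>_add: "\<xi> i (p \<oplus>\<^bsub>P\<^esub> p') = \<xi> i p \<oplus>\<^bsub>R\<^esub> \<xi> i p'" if "i \<in> I" "p \<in> carrier P" "p' \<in> carrier P" for i p p'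
    using module_hom_add[OF \<xi> that(2,3)] that by simp
  have \<xi>_smult: "\<xi> i (r \<odot>\<^bsub>P\<^esub> p) = r \<otimes>\<^bsub>R\<^esub> \<xi> i p" if "i \<in> I" "r \<in> carrier R" "p \<in> carrier P" for i r p
    using module_hom_smult[OF \<xi> that(2,3)] that by simp
  define h where "h p = finsum M (\<lambda>i. \<xi> i p \<odot>\<^bsub>M\<^esub> m i) {i \<in> I. \<xi> i p \<noteq> \<zero>\<^bsub>R\<^esub>}" for p
  have hJ: "h p = finsum M (\<lambda>i. \<xi> i p \<odot>\<^bsub>M\<^esub> m i) J"
    if "finite J" "J \<subseteq> I" "\<forall>i \<in> I - J. \<xi> i p = \<zero>\<^bsub>R\<^esub>" "p \<in> carrier P" for p J
    unfolding h_def
    by (rule M.M.add.finprod_mono_neutral_cong_left)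
      (use that m \<xi>R in \<open>auto simp: subset_iff M.zero_smult intro!: M.smult_closed\<close>)
  have tM: "\<xi> i p \<odot>\<^bsub>M\<^esub> m i \<in> carrier M" if "i \<in> I" "p \<in> carrier P" for i p
    using that \<xi>R m by (auto intro!: M.smult_closed)
  have h: "h \<in> module_hom R P M"
  proof (rule module_homI)
    show "h p \<in> carrier M" if "p \<in> carrier P" for p
      unfolding h_def using that tM by (intro M.M.finsum_closed) auto
    show "h (p \<oplus>\<^bsub>P\<^esub> p') = h p \<oplus>\<^bsub>M\<^esub> h p'" if p: "p \<in> carrier P" and p': "p' \<in> carrier P" for p p'
    proof -
      obtain J where J: "finite J" "J \<subseteq> I" "\<forall>i \<in> I - J. \<xi> i p = \<zero>\<^bsub>R\<^esub>" using ex[OF p] by blast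
      obtain J' where J': "finite J'" "J' \<subseteq> I" "\<forall>i \<in> I - J'. \<xi> i p' = \<zero>\<^bsub>R\<^esub>" using ex[OF p'] by blast
      let ?J = "J \<union> J'"
      have f: "finite ?J" "?J \<subseteq> I" using J J' by auto
      have "h (p \<oplus>\<^bsub>P\<^esub> p') = finsum M (\<lambda>i. \<xi> i (p \<oplus>\<^bsub>P\<^esub> p') \<odot>\<^bsub>M\<^esub> m i) ?J"
        by (rule hJ[OF f]) (use J J' p p' in \<open>auto simp: \<xi>_add\<close>)
      also have "\<dots> = finsum M (\<lambda>i. \<xi> i p \<odot>\<^bsub>M\<^esub> m i \<oplus>\<^bsub>M\<^esub> \<xi> i p' \<odot>\<^bsub>M\<^esub> m i) ?J"
        by (rule M.M.finsum_cong')
          (use f p p' tM \<xi>R m in \<open>auto simp: \<xi>_add M.smult_l_distr subset_iff\<close>)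
      also have "\<dots> = finsum M (\<lambda>i. \<xi> i p \<odot>\<^bsub>M\<^esub> m i) ?J \<oplus>\<^bsub>M\<^esub> finsum M (\<lambda>i. \<xi> i p' \<odot>\<^bsub>M\<^esub> m i) ?J"
        by (rule M.M.finsum_addf) (use f p p' tM in \<open>auto simp: subset_iff\<close>)
      also have "finsum M (\<lambda>i. \<xi> i p \<odot>\<^bsub>M\<^esub> m i) ?J = h p" by (rule hJ[OF f, symmetric]) (use J p in auto)
      also have "finsum M (\<lambda>i. \<xi> i p' \<odot>\<^bsub>M\<^esub> m i) ?J = h p'" by (rule hJ[OF f, symmetric]) (use J' p' in auto)
      finally show ?thesis .
    qed
    show "h (r \<odot>\<^bsub>P\<^esub> p) = r \<odot>\<^bsub>M\<^esub> h p" if r: "r \<in> carrier R" and p: "p \<in> carrier P" for r p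
    proof -
      obtain J where J: "finite J" "J \<subseteq> I" "\<forall>i \<in> I - J. \<xi> i p = \<zero>\<^bsub>R\<^esub>" using ex[OF p] by blast
      have "h (r \<odot>\<^bsub>P\<^esub> p) = finsum M (\<lambda>i. \<xi> i (r \<odot>\<^bsub>P\<^esub> p) \<odot>\<^bsub>M\<^esub> m i) J"
        by (rule hJ[OF J(1,2)]) (use J r p in \<open>auto simp: \<xi>_smult P.smult_closed\<close>)
      also have "\<dots> = finsum M (\<lambda>i. r \<odot>\<^bsub>M\<^esub> (\<xi> i p \<odot>\<^bsub>M\<^esub> m i)) J"
        by (rule M.M.finsum_cong')
          (use J r p tM \<xi>R m in \<open>auto simp: \<xi>_smult M.smult_assoc subset_iff intro!: M.smult_closed\<close>)
      also have "\<dots> = r \<odot>\<^bsub>M\<^esub> finsum M (\<lambda>i. \<xi> i p \<odot>\<^bsub>M\<^esub> m i) J"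
        by (rule M.smult_finsum[OF r, symmetric]) (use J p tM in auto)
      finally show ?thesis using hJ[OF J p] by simp
    qed
  qed
  have "g (h p) = f p" if p: "p \<in> carrier P" for p
  proof -
    obtain J where J: "finite J" "J \<subseteq> I" "\<forall>i \<in> I - J. \<xi> i p = \<zero>\<^bsub>R\<^esub>"
      and Jp: "finsum P (\<lambda>i. \<xi> i p \<odot>\<^bsub>P\<^esub> e i) J = p" using ex[OF p] by blast
    have "g (h p) = finsum N (\<lambda>i. g (\<xi> i p \<odot>\<^bsub>M\<^esub> m i)) J"
      unfolding hJ[OF J p] by (rule module_hom_finsum[OF M.M.abelian_group_axioms N.M.abelian_group_axioms g]) (use J p tM in auto)
    also have "\<dots> = finsum N (\<lambda>i. f (\<xi> i p \<odot>\<^bsub>P\<^esub> e i)) J"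
      by (rule N.M.finsum_cong')
        (use J p e \<xi>R m in \<open>auto simp: module_hom_smult[OF g] module_hom_smult[OF f] subset_iff
          intro!: N.smult_closed P.smult_closed module_hom_closed[OF f]\<close>)
    also have "\<dots> = f (finsum P (\<lambda>i. \<xi> i p \<odot>\<^bsub>P\<^esub> e i) J)"
      by (rule module_hom_finsum[OF P.M.abelian_group_axioms N.M.abelian_group_axioms f, symmetric])
        (use J p e \<xi>R in \<open>auto intro!: P.smult_closed\<close>)
    finally show ?thesis unfolding Jp .
  qed
  with h show "\<exists>h\<in>module_hom R P M. \<forall>x\<in>carrier P. g (h x) = f x" by blast
qed

section \<open>The bialgebroid as a module over the enveloping algebra of the coinvariants\<close>

context bijective_comodule_algebra
begin

sublocale AA: k_algebra K A
  by (rule k_algebra_A)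

sublocale Aop: k_algebra K "opp A"
  by (rule k_algebra_opp[OF k_algebra_A])

sublocale Ae: tensor_algebras K A "opp A"
  by unfold_locales

abbreviation "Ae \<equiv> enveloping_algebra K A"
abbreviation "ptAe \<equiv> pure_tensor K A (opp A)"
abbreviation "\<iota> \<equiv> enveloping_map K B"
abbreviation "GammaM \<equiv> ehresmann_schauenburg_module K H B \<rho>"

lemma lin_A_of_B: "f \<in> module_hom K B W \<Longrightarrow> f \<in> module_hom K A W"
  unfolding module_hom_def hom_def by (auto simp: A_B)

lemma lin_B_to_A: "\<lbrakk>f \<in> module_hom K V B; \<And>v. v \<in> carrier V \<Longrightarrow> f v \<in> carrier A\<rbrakk> \<Longrightarrow> f \<in> module_hom K V A"
  unfolding module_hom_def hom_def by auto

lemma bilinear_iota: "bilinear_map K A A Be ptBe"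
  using Be.bilinear_pure unfolding bilinear_map_opp unfolding bilinear_map_def
  by (auto intro!: lin_A_of_B simp: A_B)

lemma lin_iota: "\<iota> \<in> module_hom K Ae Be"
  unfolding enveloping_map_def
  by (rule Ae.lin_tensor_sum[OF Be.module_T]) (simp add: bilinear_map_opp bilinear_iota)

lemma iota_pure: "\<lbrakk>a \<in> carrier A; a' \<in> carrier A\<rbrakk> \<Longrightarrow> \<iota> (ptAe a a') = ptBe a a'"
  unfolding enveloping_map_def
  by (rule Ae.tensor_sum_pure[OF Be.module_T]) (simp_all add: bilinear_map_opp bilinear_iota)

lemma iota_closed: "s \<in> carrier Ae \<Longrightarrow> \<iota> s \<in> carrier Be"
  by (rule module_hom_closed[OF lin_iota])

lemma iota_mult:
  assumes s: "s \<in> carrier Ae" and s': "s' \<in> carrier Ae"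
  shows "\<iota> (s \<otimes>\<^bsub>Ae\<^esub> s') = \<iota> s \<otimes>\<^bsub>Be\<^esub> \<iota> s'"
  using s
proof (induct rule: Ae.T_induct)
  case (pure a a')
  show ?case using s'
  proof (induct rule: Ae.T_induct)
    case p2: (pure c c')
    have "c \<otimes>\<^bsub>B\<^esub> c' \<in> carrier A" if "c \<in> carrier A" "c' \<in> carrier A" for c c'
      using AA.m_closed[OF that] by simp
    then show ?case using pure p2 by (simp add: Ae.mult_pure Be.mult_pure iota_pure A_B)
  next
    case (add s t)
    have [simp]: "ptAe a a' \<in> carrier Ae" using pure by (intro Ae.pure_T)
    show ?case using add by (simp add: Ae.mult_T_r_distr Ae.mult_T_closed Be.mult_T_r_distr iota_closed module_hom_add[OF lin_iota])
  qed
next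
  case (add s t)
  then show ?case using s'
    by (simp add: Ae.mult_T_l_distr Ae.mult_T_closed Be.mult_T_l_distr iota_closed module_hom_add[OF lin_iota])
qed

lemma iota_one: "\<iota> \<one>\<^bsub>Ae\<^esub> = \<one>\<^bsub>Be\<^esub>"
  using iota_pure[of "\<one>\<^bsub>A\<^esub>" "\<one>\<^bsub>A\<^esub>"] AA.one_closed by (simp add: Ae.one_T Be.one_T)

lemma Gamma_closed: "t \<in> \<Gamma> \<Longrightarrow> t \<in> carrier Be"
  by (simp add: Gamma_iff)

lemma lin_Gamma: "(\<lambda>t. ptBeH t \<one>\<^bsub>H\<^esub>) \<in> module_hom K Be BeH"
  by (rule BeH.lin_pure_left[OF lin_id]) simp

lemma Gamma_add: "\<lbrakk>s \<in> \<Gamma>; t \<in> \<Gamma>\<rbrakk> \<Longrightarrow> s \<oplus>\<^bsub>Be\<^esub> t \<in> \<Gamma>"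
  by (simp add: Gamma_iff module_hom_add[OF lin_diag] module_hom_add[OF lin_Gamma] Bek.a_closed)

lemma Gamma_smult_K: "\<lbrakk>c \<in> carrier K; t \<in> \<Gamma>\<rbrakk> \<Longrightarrow> c \<odot>\<^bsub>Be\<^esub> t \<in> \<Gamma>"
  by (simp add: Gamma_iff module_hom_smult[OF lin_diag] module_hom_smult[OF lin_Gamma] Be.smult_T_closed)

lemma Gamma_zero: "\<zero>\<^bsub>Be\<^esub> \<in> \<Gamma>"
  by (simp add: Gamma_iff module_hom_zero[OF Be.abelian_group_T BeH.abelian_group_T lin_diag]
      module_hom_zero[OF Be.abelian_group_T BeH.abelian_group_T lin_Gamma] Bek.zero_closed)

lemma iota_Gamma:
  assumes s: "s \<in> carrier Ae" and t: "t \<in> \<Gamma>" shows "\<iota> s \<otimes>\<^bsub>Be\<^esub> t \<in> \<Gamma>"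
  using s
proof (induct rule: Ae.T_induct)
  case (pure a a')
  then show ?case using Gamma_mult_A[OF _ _ t] by (simp add: iota_pure)
next
  case (add s s')
  then show ?case using t
    by (simp add: module_hom_add[OF lin_iota] Be.mult_T_l_distr iota_closed Gamma_closed Gamma_add)
qed

lemma GammaM_simps [simp]:
  "carrier GammaM = \<Gamma>" "\<zero>\<^bsub>GammaM\<^esub> = \<zero>\<^bsub>Be\<^esub>" "x \<oplus>\<^bsub>GammaM\<^esub> y = x \<oplus>\<^bsub>Be\<^esub> y"
  "s \<odot>\<^bsub>GammaM\<^esub> x = \<iota> s \<otimes>\<^bsub>Be\<^esub> x"
  by (simp_all add: ehresmann_schauenburg_module_def)

lemma left_module_GammaM: "left_module Ae GammaM"
proof -
  have "\<exists>y\<in>\<Gamma>. y \<oplus>\<^bsub>Be\<^esub> x = \<zero>\<^bsub>Be\<^esub>" if x: "x \<in> \<Gamma>" for x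
  proof (rule bexI)
    have "(\<ominus>\<^bsub>K\<^esub> \<one>\<^bsub>K\<^esub>) \<odot>\<^bsub>Be\<^esub> x = \<ominus>\<^bsub>Be\<^esub> x"
      using Gamma_closed[OF x] by (simp add: Bek.smult_l_minus)
    then show "(\<ominus>\<^bsub>K\<^esub> \<one>\<^bsub>K\<^esub>) \<odot>\<^bsub>Be\<^esub> x \<oplus>\<^bsub>Be\<^esub> x = \<zero>\<^bsub>Be\<^esub>" using Gamma_closed[OF x] by (simp add: Bek.l_neg)
    show "(\<ominus>\<^bsub>K\<^esub> \<one>\<^bsub>K\<^esub>) \<odot>\<^bsub>Be\<^esub> x \<in> \<Gamma>" by (rule Gamma_smult_K[OF _ x]) simp
  qed
  then have "abelian_group GammaM"
    by (intro abelian_groupI) (simp_all add: Gamma_add Gamma_zero Gamma_closed Bek.a_ac)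
  then show ?thesis
    unfolding left_module_def left_module_axioms_def
    using Ae.ring_T
    by (simp add: iota_Gamma module_hom_add[OF lin_iota] Be.mult_T_l_distr Be.mult_T_r_distr iota_closed Gamma_closed
        iota_mult iota_one Bek.m_assoc)
qed

text \<open>\<open>s \<otimes> t : B\<^bsup>e\<^esup> \<rightarrow> A\<^bsup>e\<^esup>\<close>. It is left \<open>A\<^bsup>e\<^esup>\<close>-linear if \<open>s\<close> is left and \<open>t\<close> is right \<open>A\<close>-linear (\<open>texp_iota\<close>).\<close>

definition texp where "texp s t = tensor_sum Ae (\<lambda>b b'. ptAe (s b) (t b'))"

context
  fixes s t :: "'b \<Rightarrow> 'b"
  assumes lin_s: "s \<in> module_hom K B A" and lin_t: "t \<in> module_hom K B A"
begin

lemma bilinear_texp: "bilinear_map K B B Ae (\<lambda>b b'. ptAe (s b) (t b'))"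
  by (intro bilinear_mapI Ae.lin_pure_left Ae.lin_pure_right)
    (use lin_s lin_t module_hom_closed[OF lin_s] module_hom_closed[OF lin_t] in \<open>simp_all add: module_hom_opp\<close>)

lemma lin_texp: "texp s t \<in> module_hom K Be Ae"
  unfolding texp_def by (rule Be_lin_sum[OF Ae.module_T bilinear_texp])

lemma texp_pure: "\<lbrakk>b \<in> carrier B; b' \<in> carrier B\<rbrakk> \<Longrightarrow> texp s t (ptBe b b') = ptAe (s b) (t b')"
  unfolding texp_def by (rule Be_sum_pure[OF Ae.module_T bilinear_texp])

lemma texp_iota:
  assumes s_A: "\<And>a b. \<lbrakk>a \<in> carrier A; b \<in> carrier B\<rbrakk> \<Longrightarrow> s (a \<otimes>\<^bsub>B\<^esub> b) = a \<otimes>\<^bsub>B\<^esub> s b"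
    and t_A: "\<And>a b. \<lbrakk>a \<in> carrier A; b \<in> carrier B\<rbrakk> \<Longrightarrow> t (b \<otimes>\<^bsub>B\<^esub> a) = t b \<otimes>\<^bsub>B\<^esub> a"
    and w: "w \<in> carrier Ae" and v: "v \<in> carrier Be"
  shows "texp s t (\<iota> w \<otimes>\<^bsub>Be\<^esub> v) = w \<otimes>\<^bsub>Ae\<^esub> texp s t v"
  using w
proof (induct rule: Ae.T_induct)
  case (pure a a')
  show ?case using v
  proof (induct rule: Be.T_induct)
    case p2: (pure b b')
    then show ?case using pure module_hom_closed[OF lin_s] module_hom_closed[OF lin_t]
      by (simp add: iota_pure Be.mult_pure Ae.mult_pure texp_pure A_B s_A t_A)
  next
    case (add v v')
    have [simp]: "ptAe a a' \<in> carrier Ae" using pure by (intro Ae.pure_T)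
    show ?case using add
      by (simp add: Be.mult_T_r_distr Be.mult_T_closed Ae.mult_T_r_distr iota_closed module_hom_add[OF lin_texp] module_hom_closed[OF lin_texp])
  qed
next
  case (add w w')
  then show ?case using v
    by (simp add: module_hom_add[OF lin_iota] Be.mult_T_l_distr Be.mult_T_closed Ae.mult_T_l_distr iota_closed module_hom_add[OF lin_texp] module_hom_closed[OF lin_texp])
qed

end

text \<open>Dual bases of \<open>B\<close> as a left and as a right module over \<open>A\<close> combine to a dual basis of \<open>B\<^bsup>e\<^esup>\<close> over
  \<open>A\<^bsup>e\<^esup>\<close>, because \<open>(s b \<otimes> t b') (y \<otimes> x) = s b y \<otimes> x t b'\<close> in \<open>B\<^bsup>e\<^esup>\<close>. The sum is taken over any \<open>J' \<times> J'\<close> that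
  is large enough, since two summands need a common index set in the induction.\<close>

lemma Be_dual_basis:
  assumes y: "\<And>p. p \<in> I \<Longrightarrow> y p \<in> carrier B" and x: "\<And>p. p \<in> I \<Longrightarrow> x p \<in> carrier B"
    and s: "\<And>p. p \<in> I \<Longrightarrow> s p \<in> module_hom K B A" and t: "\<And>p. p \<in> I \<Longrightarrow> t p \<in> module_hom K B A"
    and left: "\<And>b. b \<in> carrier B \<Longrightarrow> \<exists>J. finite J \<and> J \<subseteq> I \<and> (\<forall>p \<in> I - J. s p b = \<zero>\<^bsub>B\<^esub>) \<and>
      finsum B (\<lambda>p. s p b \<otimes>\<^bsub>B\<^esub> y p) J = b"
    and right: "\<And>b. b \<in> carrier B \<Longrightarrow> \<exists>J. finite J \<and> J \<subseteq> I \<and> (\<forall>p \<in> I - J. t p b = \<zero>\<^bsub>B\<^esub>) \<and>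
      finsum B (\<lambda>p. x p \<otimes>\<^bsub>B\<^esub> t p b) J = b"
    and v: "v \<in> carrier Be"
  shows "\<exists>J. finite J \<and> J \<subseteq> I \<and> (\<forall>p \<in> I \<times> I - J \<times> J. texp (s (fst p)) (t (snd p)) v = \<zero>\<^bsub>Ae\<^esub>) \<and>
    (\<forall>J'. finite J' \<and> J \<subseteq> J' \<and> J' \<subseteq> I \<longrightarrow>
      finsum Be (\<lambda>p. \<iota> (texp (s (fst p)) (t (snd p)) v) \<otimes>\<^bsub>Be\<^esub> ptBe (y (fst p)) (x (snd p))) (J' \<times> J') = v)"
  using v
proof (induct rule: Be.T_induct)
  have abBe: "abelian_monoid Be" by (rule abelian_group.axioms(1)[OF Be.abelian_group_T])
  note sA = module_hom_closed[OF s] and tA = module_hom_closed[OF t]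
  note sB = A_B[OF sA] and tB = A_B[OF tA]
  have ptAe0: "ptAe \<zero>\<^bsub>B\<^esub> a = \<zero>\<^bsub>Ae\<^esub>" "ptAe a \<zero>\<^bsub>B\<^esub> = \<zero>\<^bsub>Ae\<^esub>" if a: "a \<in> carrier A" for a
    using module_hom_zero[OF AA.abgroup Ae.abelian_group_T Ae.lin_pure_left[OF lin_id, of a]]
      module_hom_zero[OF Aop.abgroup Ae.abelian_group_T Ae.lin_pure_right[OF lin_id, of a]] a by simp_all
  {
    case (pure b b')
    then have b: "b \<in> carrier B" and b': "b' \<in> carrier B" by simp_all
    obtain J1 where J1: "finite J1" "J1 \<subseteq> I" "\<forall>p \<in> I - J1. s p b = \<zero>\<^bsub>B\<^esub>"
      and e1: "finsum B (\<lambda>p. s p b \<otimes>\<^bsub>B\<^esub> y p) J1 = b" using left[OF b] by blast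
    obtain J2 where J2: "finite J2" "J2 \<subseteq> I" "\<forall>p \<in> I - J2. t p b' = \<zero>\<^bsub>B\<^esub>"
      and e2: "finsum B (\<lambda>p. x p \<otimes>\<^bsub>B\<^esub> t p b') J2 = b'" using right[OF b'] by blast
    have eq: "finsum Be (\<lambda>p. \<iota> (texp (s (fst p)) (t (snd p)) (ptBe b b')) \<otimes>\<^bsub>Be\<^esub> ptBe (y (fst p)) (x (snd p))) (J' \<times> J') = ptBe b b'"
      if J': "finite J'" "J1 \<union> J2 \<subseteq> J'" "J' \<subseteq> I" for J'
    proof -
      have c: "s p b \<otimes>\<^bsub>B\<^esub> y p \<in> carrier B" "x p \<otimes>\<^bsub>B\<^esub> t p b' \<in> carrier B" if "p \<in> J'" for p
        using that J' sB[OF _ b] tB[OF _ b'] y x by auto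
      have tm: "\<iota> (texp (s p) (t r) (ptBe b b')) \<otimes>\<^bsub>Be\<^esub> ptBe (y p) (x r) = ptBe (s p b \<otimes>\<^bsub>B\<^esub> y p) (x r \<otimes>\<^bsub>B\<^esub> t r b')"
        if "p \<in> J'" "r \<in> J'" for p r
      proof -
        have I: "p \<in> I" "r \<in> I" using that J' by auto
        show ?thesis
          using b b' x[OF I(2)] y[OF I(1)] sA[OF I(1) b] tA[OF I(2) b'] sB[OF I(1) b] tB[OF I(2) b']
          by (simp add: texp_pure[OF s[OF I(1)] t[OF I(2)]] iota_pure Be.mult_pure)
      qed
      have "finsum Be (\<lambda>p. \<iota> (texp (s (fst p)) (t (snd p)) (ptBe b b')) \<otimes>\<^bsub>Be\<^esub> ptBe (y (fst p)) (x (snd p))) (J' \<times> J') =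
          finsum Be (\<lambda>p. ptBe (s (fst p) b \<otimes>\<^bsub>B\<^esub> y (fst p)) (x (snd p) \<otimes>\<^bsub>B\<^esub> t (snd p) b')) (J' \<times> J')"
        by (rule abelian_monoid.finsum_cong'[OF abBe]) (use tm c in \<open>auto intro!: Be.pure_T\<close>)
      also have "\<dots> = finsum Be (\<lambda>p. finsum Be (\<lambda>r. ptBe (s p b \<otimes>\<^bsub>B\<^esub> y p) (x r \<otimes>\<^bsub>B\<^esub> t r b')) J') J'"
        unfolding finsum_def
        by (subst comm_monoid.finprod_Sigma[OF comm_group.axioms(1)[OF Be.comm_group_add_T] J'(1)])
          (use c J'(1) in \<open>auto intro!: Be.pure_T\<close>)
      also have "\<dots> = finsum Be (\<lambda>p. ptBe (s p b \<otimes>\<^bsub>B\<^esub> y p) b') J'"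
      proof (rule abelian_monoid.finsum_cong'[OF abBe refl])
        fix p assume p: "p \<in> J'"
        have "finsum Be (\<lambda>r. ptBe (s p b \<otimes>\<^bsub>B\<^esub> y p) (x r \<otimes>\<^bsub>B\<^esub> t r b')) J' =
            ptBe (s p b \<otimes>\<^bsub>B\<^esub> y p) (finsum B (\<lambda>r. x r \<otimes>\<^bsub>B\<^esub> t r b') J')"
          by (rule module_hom_finsum[OF B.abgroup Be.abelian_group_T Be.lin_pure_right[OF _ c(1)[OF p]], symmetric])
            (use c in \<open>auto simp: module_hom_opp lin_id\<close>)
        also have "finsum B (\<lambda>r. x r \<otimes>\<^bsub>B\<^esub> t r b') J' = finsum B (\<lambda>r. x r \<otimes>\<^bsub>B\<^esub> t r b') J2"
          by (rule B.add.finprod_mono_neutral_cong_right) (use J' J2 c x in auto)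
        finally show "finsum Be (\<lambda>r. ptBe (s p b \<otimes>\<^bsub>B\<^esub> y p) (x r \<otimes>\<^bsub>B\<^esub> t r b')) J' = ptBe (s p b \<otimes>\<^bsub>B\<^esub> y p) b'"
          unfolding e2 .
      qed (use c b' in \<open>auto intro!: Be.pure_T\<close>)
      also have "\<dots> = ptBe (finsum B (\<lambda>p. s p b \<otimes>\<^bsub>B\<^esub> y p) J') b'"
        by (rule module_hom_finsum[OF B.abgroup Be.abelian_group_T Be.lin_pure_left[OF lin_id], symmetric])
          (use c b' in auto)
      also have "finsum B (\<lambda>p. s p b \<otimes>\<^bsub>B\<^esub> y p) J' = finsum B (\<lambda>p. s p b \<otimes>\<^bsub>B\<^esub> y p) J1"
        by (rule B.add.finprod_mono_neutral_cong_right) (use J' J1 c y in auto)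
      finally show ?thesis unfolding e1 .
    qed
    have z: "texp (s (fst p)) (t (snd p)) (ptBe b b') = \<zero>\<^bsub>Ae\<^esub>"
      if p: "p \<in> I \<times> I - (J1 \<union> J2) \<times> (J1 \<union> J2)" for p
    proof -
      have I: "fst p \<in> I" "snd p \<in> I" using p by auto
      have "s (fst p) b = \<zero>\<^bsub>B\<^esub> \<or> t (snd p) b' = \<zero>\<^bsub>B\<^esub>"
        using p J1(3) J2(3) by (cases p) auto
      then show ?thesis
        using texp_pure[OF s[OF I(1)] t[OF I(2)] b b'] ptAe0 sA[OF I(1) b] tA[OF I(2) b'] by auto
    qed
    show ?case
      by (rule exI[of _ "J1 \<union> J2"]) (use J1 J2 eq z in auto)
  next
    case (add v w)
    let ?t = "\<lambda>u p. \<iota> (texp (s (fst p)) (t (snd p)) u) \<otimes>\<^bsub>Be\<^esub> ptBe (y (fst p)) (x (snd p))"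
    from add(3) obtain J1 where J1: "finite J1" "J1 \<subseteq> I" "\<forall>p \<in> I \<times> I - J1 \<times> J1. texp (s (fst p)) (t (snd p)) v = \<zero>\<^bsub>Ae\<^esub>"
      "\<forall>J'. finite J' \<and> J1 \<subseteq> J' \<and> J' \<subseteq> I \<longrightarrow> finsum Be (?t v) (J' \<times> J') = v" by (elim exE conjE)
    from add(4) obtain J2 where J2: "finite J2" "J2 \<subseteq> I" "\<forall>p \<in> I \<times> I - J2 \<times> J2. texp (s (fst p)) (t (snd p)) w = \<zero>\<^bsub>Ae\<^esub>"
      "\<forall>J'. finite J' \<and> J2 \<subseteq> J' \<and> J' \<subseteq> I \<longrightarrow> finsum Be (?t w) (J' \<times> J') = w" by (elim exE conjE)
    have cl: "texp (s p) (t r) u \<in> carrier Ae" if "p \<in> I" "r \<in> I" "u \<in> carrier Be" for p r u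
      by (rule module_hom_closed[OF lin_texp[OF s[OF that(1)] t[OF that(2)]] that(3)])
    have ad: "texp (s p) (t r) (v \<oplus>\<^bsub>Be\<^esub> w) = texp (s p) (t r) v \<oplus>\<^bsub>Ae\<^esub> texp (s p) (t r) w" if "p \<in> I" "r \<in> I" for p r
      by (rule module_hom_add[OF lin_texp[OF s[OF that(1)] t[OF that(2)]] add(1,2)])
    have yx: "ptBe (y p) (x r) \<in> carrier Be" if "p \<in> I" "r \<in> I" for p r
      using x[OF that(2)] y[OF that(1)] by (simp add: Be.pure_T)
    have tcl: "?t u p \<in> carrier Be" if "p \<in> I \<times> I" "u \<in> carrier Be" for p u
      using that cl yx by (intro Be.mult_T_closed iota_closed) auto
    have tad: "?t (v \<oplus>\<^bsub>Be\<^esub> w) p = ?t v p \<oplus>\<^bsub>Be\<^esub> ?t w p" if "p \<in> I \<times> I" for p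
    proof -
      have I: "fst p \<in> I" "snd p \<in> I" using that by auto
      show ?thesis unfolding ad[OF I]
        using add(1,2) yx[OF I] cl[OF I] by (simp add: module_hom_add[OF lin_iota] Be.mult_T_l_distr iota_closed)
    qed
    have eq: "finsum Be (?t (v \<oplus>\<^bsub>Be\<^esub> w)) (J' \<times> J') = v \<oplus>\<^bsub>Be\<^esub> w" if J': "finite J'" "J1 \<union> J2 \<subseteq> J'" "J' \<subseteq> I" for J'
    proof -
      have sub: "p \<in> I \<times> I" if "p \<in> J' \<times> J'" for p using that J'(3) by auto
      have "finsum Be (?t (v \<oplus>\<^bsub>Be\<^esub> w)) (J' \<times> J') = finsum Be (\<lambda>p. ?t v p \<oplus>\<^bsub>Be\<^esub> ?t w p) (J' \<times> J')"
        by (rule abelian_monoid.finsum_cong'[OF abBe refl _ tad[OF sub]])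
          (use sub tcl add(1,2) Bek.a_closed in blast)+
      also have "\<dots> = finsum Be (?t v) (J' \<times> J') \<oplus>\<^bsub>Be\<^esub> finsum Be (?t w) (J' \<times> J')"
        by (rule abelian_monoid.finsum_addf[OF abBe]) (use sub tcl add(1,2) in blast)+
      also have "finsum Be (?t v) (J' \<times> J') = v" by (rule J1(4)[rule_format]) (use J' in blast)
      also have "finsum Be (?t w) (J' \<times> J') = w" by (rule J2(4)[rule_format]) (use J' in blast)
      finally show ?thesis .
    qed
    have z: "texp (s (fst p)) (t (snd p)) (v \<oplus>\<^bsub>Be\<^esub> w) = \<zero>\<^bsub>Ae\<^esub>" if p: "p \<in> I \<times> I - (J1 \<union> J2) \<times> (J1 \<union> J2)" for p
    proof -
      have I: "fst p \<in> I" "snd p \<in> I" using p by auto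
      have "p \<in> I \<times> I - J1 \<times> J1" "p \<in> I \<times> I - J2 \<times> J2" using p by auto
      then have "texp (s (fst p)) (t (snd p)) v = \<zero>\<^bsub>Ae\<^esub>" "texp (s (fst p)) (t (snd p)) w = \<zero>\<^bsub>Ae\<^esub>"
        using J1(3) J2(3) by blast+
      then show ?thesis unfolding ad[OF I]
        by (simp add: abelian_monoid.l_zero abelian_group.axioms(1)[OF Ae.abelian_group_T] abelian_monoid.zero_closed)
    qed
    show ?case
      by (intro exI[of _ "J1 \<union> J2"] conjI ballI allI impI z eq) (use J1 J2 in blast)+
  }
qed

end

section \<open>Projectivity\<close>

lemma (in bijective_comodule_algebra) coact_A_left:
  assumes \<theta>: "\<theta> \<in> functionals" and a: "a \<in> carrier A" and b: "b \<in> carrier B"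
  shows "coact \<theta> (a \<otimes>\<^bsub>B\<^esub> b) = a \<otimes>\<^bsub>B\<^esub> coact \<theta> b"
proof -
  note fl = H.functional_closed[OF \<theta>] lin_comp[OF \<theta>] A_B[OF a]
  have "coact \<theta> (a \<otimes>\<^bsub>B\<^esub> b) = cosum B \<rho> (\<lambda>b0 b1. \<theta> b1 \<odot>\<^bsub>B\<^esub> (a \<otimes>\<^bsub>B\<^esub> b0)) b"
    unfolding coact_def by (rule cosum_A_left; (rule lins fl a b | assumption)+)
  also have "\<dots> = cosum B \<rho> (\<lambda>b0 b1. a \<otimes>\<^bsub>B\<^esub> (\<theta> b1 \<odot>\<^bsub>B\<^esub> b0)) b"
    by (rule cosum_cong[OF B.k_module b]) (simp_all add: fl B.smult_mult_right)
  also have "\<dots> = a \<otimes>\<^bsub>B\<^esub> coact \<theta> b"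
    unfolding coact_def by (rule hom_cosum[where f = "\<lambda>z. a \<otimes>\<^bsub>B\<^esub> z", symmetric]; (rule lins fl a b | assumption)+)
  finally show ?thesis .
qed

locale galois_integral = galois_extension K H \<Delta> \<epsilon> S B \<rho> + total_integral K H \<Delta> \<epsilon> S B \<rho> j
  for K :: "('k, 'x) ring_scheme" (structure) and H :: "('k, 'h, 'y) module_scheme" (structure)
    and \<Delta> \<epsilon> S and B :: "('k, 'b, 'z) module_scheme" (structure) and \<rho> j
begin

lemma P_iota:
  assumes w: "w \<in> carrier Ae" and v: "v \<in> carrier Be"
  shows "P (\<iota> w \<otimes>\<^bsub>Be\<^esub> v) = \<iota> w \<otimes>\<^bsub>Be\<^esub> P v"
  using w
proof (induct rule: Ae.T_induct)
  case (pure a a')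
  then show ?case using P_A[OF _ _ v] by (simp add: iota_pure)
next
  case (add w w')
  then show ?case using v
    by (simp add: module_hom_add[OF lin_iota] Be.mult_T_l_distr Be.mult_T_closed iota_closed P_closed module_hom_add[OF lin_P])
qed

lemma finsum_Gamma:
  assumes "f \<in> I \<rightarrow> \<Gamma>" shows "finsum GammaM f I = finsum Be f I"
proof -
  interpret G: left_module Ae GammaM by (rule left_module_GammaM)
  have "(\<lambda>x. x) \<in> hom (add_monoid GammaM) (add_monoid Be)"
    by (auto simp: hom_def Gamma_closed)
  from add_hom_finsum[OF G.M.abelian_group_axioms Be.abelian_group_T this] show ?thesis
    using assms by simp
qed

text \<open>The projection \<open>P\<close> is \<open>A\<^bsup>e\<^esup>\<close>-linear and fixes \<open>\<Gamma>\<close>, so it maps the dual basis of \<open>B\<^bsup>e\<^esup>\<close> to one of \<open>\<Gamma>\<close>.\<close>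

lemma projective_if_dual_bases:
  assumes y: "\<And>p. p \<in> I \<Longrightarrow> y p \<in> carrier B" and x: "\<And>p. p \<in> I \<Longrightarrow> x p \<in> carrier B"
    and s: "\<And>p. p \<in> I \<Longrightarrow> s p \<in> module_hom K B A" and t: "\<And>p. p \<in> I \<Longrightarrow> t p \<in> module_hom K B A"
    and left: "\<And>b. b \<in> carrier B \<Longrightarrow> \<exists>J. finite J \<and> J \<subseteq> I \<and> (\<forall>p \<in> I - J. s p b = \<zero>\<^bsub>B\<^esub>) \<and>
      finsum B (\<lambda>p. s p b \<otimes>\<^bsub>B\<^esub> y p) J = b"
    and right: "\<And>b. b \<in> carrier B \<Longrightarrow> \<exists>J. finite J \<and> J \<subseteq> I \<and> (\<forall>p \<in> I - J. t p b = \<zero>\<^bsub>B\<^esub>) \<and>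
      finsum B (\<lambda>p. x p \<otimes>\<^bsub>B\<^esub> t p b) J = b"
    and s_A: "\<And>p a b. \<lbrakk>p \<in> I; a \<in> carrier A; b \<in> carrier B\<rbrakk> \<Longrightarrow> s p (a \<otimes>\<^bsub>B\<^esub> b) = a \<otimes>\<^bsub>B\<^esub> s p b"
    and t_A: "\<And>p a b. \<lbrakk>p \<in> I; a \<in> carrier A; b \<in> carrier B\<rbrakk> \<Longrightarrow> t p (b \<otimes>\<^bsub>B\<^esub> a) = t p b \<otimes>\<^bsub>B\<^esub> a"
  shows "projective_module TYPE('m) TYPE('n) Ae GammaM"
proof (rule projective_module_dual_basis[where I = "I \<times> I"
      and e = "\<lambda>p. P (ptBe (y (fst p)) (x (snd p)))" and \<xi> = "\<lambda>p. texp (s (fst p)) (t (snd p))"])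
  show "left_module Ae GammaM" by (rule left_module_GammaM)
  have yx: "ptBe (y (fst p)) (x (snd p)) \<in> carrier Be" if "p \<in> I \<times> I" for p
    using that x y by (auto intro!: Be.pure_T)
  then show "P (ptBe (y (fst p)) (x (snd p))) \<in> carrier GammaM" if "p \<in> I \<times> I" for p
    using P_Gamma that by simp
  have lin: "texp (s (fst p)) (t (snd p)) \<in> module_hom K Be Ae" if "p \<in> I \<times> I" for p
    by (rule lin_texp[OF s t]) (use that in auto)
  show "texp (s (fst p)) (t (snd p)) \<in> module_hom Ae GammaM (left_mult_module Ae)" if p: "p \<in> I \<times> I" for p
  proof (rule module_homI)
    have I: "fst p \<in> I" "snd p \<in> I" using p by auto
    show "texp (s (fst p)) (t (snd p)) v \<in> carrier (left_mult_module Ae)" if "v \<in> carrier GammaM" for v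
      using module_hom_closed[OF lin[OF p]] that by (simp add: Gamma_closed)
    show "texp (s (fst p)) (t (snd p)) (v \<oplus>\<^bsub>GammaM\<^esub> w) =
        texp (s (fst p)) (t (snd p)) v \<oplus>\<^bsub>left_mult_module Ae\<^esub> texp (s (fst p)) (t (snd p)) w"
      if "v \<in> carrier GammaM" "w \<in> carrier GammaM" for v w
      using module_hom_add[OF lin[OF p]] that by (simp add: Gamma_closed)
    show "texp (s (fst p)) (t (snd p)) (r \<odot>\<^bsub>GammaM\<^esub> v) = r \<odot>\<^bsub>left_mult_module Ae\<^esub> texp (s (fst p)) (t (snd p)) v"
      if "r \<in> carrier Ae" "v \<in> carrier GammaM" for r v
      using texp_iota[OF s[OF I(1)] t[OF I(2)] s_A[OF I(1)] t_A[OF I(2)] that(1)] that(2) by (simp add: Gamma_closed)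
  qed
  fix v assume "v \<in> carrier GammaM"
  then have v: "v \<in> \<Gamma>" by simp
  then have vB: "v \<in> carrier Be" by (rule Gamma_closed)
  let ?\<xi> = "\<lambda>p. texp (s (fst p)) (t (snd p)) v" and ?e = "\<lambda>p. ptBe (y (fst p)) (x (snd p))"
  have "\<exists>J. finite J \<and> J \<subseteq> I \<and> (\<forall>p \<in> I \<times> I - J \<times> J. ?\<xi> p = \<zero>\<^bsub>Ae\<^esub>) \<and>
    (\<forall>J'. finite J' \<and> J \<subseteq> J' \<and> J' \<subseteq> I \<longrightarrow>
      finsum Be (\<lambda>p. \<iota> (?\<xi> p) \<otimes>\<^bsub>Be\<^esub> ?e p) (J' \<times> J') = v)"
    by (rule Be_dual_basis[OF y x s t left right vB])
  then obtain J where J: "finite J" "J \<subseteq> I" "\<forall>p \<in> I \<times> I - J \<times> J. ?\<xi> p = \<zero>\<^bsub>Ae\<^esub>"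
    "\<forall>J'. finite J' \<and> J \<subseteq> J' \<and> J' \<subseteq> I \<longrightarrow> finsum Be (\<lambda>p. \<iota> (?\<xi> p) \<otimes>\<^bsub>Be\<^esub> ?e p) (J' \<times> J') = v"
    by (elim exE conjE)
  have sub: "p \<in> I \<times> I" if "p \<in> J \<times> J" for p using that J(2) by auto
  have \<xi>c: "?\<xi> p \<in> carrier Ae" if "p \<in> J \<times> J" for p by (rule module_hom_closed[OF lin[OF sub[OF that]] vB])
  have tc: "\<iota> (?\<xi> p) \<otimes>\<^bsub>Be\<^esub> ?e p \<in> carrier Be" if "p \<in> J \<times> J" for p
    by (intro Be.mult_T_closed iota_closed \<xi>c yx sub that)
  have "finsum GammaM (\<lambda>p. ?\<xi> p \<odot>\<^bsub>GammaM\<^esub> P (?e p)) (J \<times> J) = finsum Be (\<lambda>p. ?\<xi> p \<odot>\<^bsub>GammaM\<^esub> P (?e p)) (J \<times> J)"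
  proof (rule finsum_Gamma, rule Pi_I)
    fix p assume p: "p \<in> J \<times> J"
    show "?\<xi> p \<odot>\<^bsub>GammaM\<^esub> P (?e p) \<in> \<Gamma>"
      using iota_Gamma[OF \<xi>c[OF p] P_Gamma[OF yx[OF sub[OF p]]]] by simp
  qed
  also have "\<dots> = finsum Be (\<lambda>p. P (\<iota> (?\<xi> p) \<otimes>\<^bsub>Be\<^esub> ?e p)) (J \<times> J)"
  proof (rule abelian_monoid.finsum_cong'[OF abelian_group.axioms(1)[OF Be.abelian_group_T] refl])
    show "(\<lambda>p. P (\<iota> (?\<xi> p) \<otimes>\<^bsub>Be\<^esub> ?e p)) \<in> J \<times> J \<rightarrow> carrier Be" by (rule Pi_I) (rule P_closed[OF tc])
    fix p assume p: "p \<in> J \<times> J"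
    show "?\<xi> p \<odot>\<^bsub>GammaM\<^esub> P (?e p) = P (\<iota> (?\<xi> p) \<otimes>\<^bsub>Be\<^esub> ?e p)"
      using P_iota[OF \<xi>c[OF p] yx[OF sub[OF p]]] by simp
  qed
  also have "\<dots> = P (finsum Be (\<lambda>p. \<iota> (?\<xi> p) \<otimes>\<^bsub>Be\<^esub> ?e p) (J \<times> J))"
    by (rule module_hom_finsum[OF Be.abelian_group_T Be.abelian_group_T lin_P, symmetric]) (rule Pi_I, rule tc)
  also have "finsum Be (\<lambda>p. \<iota> (?\<xi> p) \<otimes>\<^bsub>Be\<^esub> ?e p) (J \<times> J) = v" by (rule J(4)[rule_format]) (use J in blast)
  also have "P v = v" by (rule P_Gamma_id[OF v])
  finally show "\<exists>J. finite J \<and> J \<subseteq> I \<times> I \<and> (\<forall>p\<in>I \<times> I - J. ?\<xi> p = \<zero>\<^bsub>Ae\<^esub>) \<and>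
      finsum GammaM (\<lambda>p. ?\<xi> p \<odot>\<^bsub>GammaM\<^esub> P (?e p)) J = v"
    using J by (intro exI[of _ "J \<times> J"]) auto
qed

lemma Si_functional: "\<theta> \<in> functionals \<Longrightarrow> (\<lambda>h. \<theta> (Si h)) \<in> functionals"
  by (rule lin_comp[OF _ H.lin_Si])

text \<open>The right-hand analogue of \<open>b = \<Sum> q b\<^sub>0 b\<^sub>1\<close>, expanded along a basis: as \<open>S\<close> and \<open>S\<^sup>-\<^sup>1\<close> cancel, the sum is
  \<open>\<Sum> j (b\<^sub>2 S\<^sup>-\<^sup>1 b\<^sub>1) b\<^sub>0 = j 1 b\<close>. The terms are those that occur in \<open>F_galois_right\<close>.\<close>

lemma right_expansion:
  assumes X: "H.H_basis X \<psi>" and b: "b \<in> carrier B"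
  shows "\<exists>E. finite E \<and> E \<subseteq> X \<and> (\<forall>e. e \<notin> E \<longrightarrow> coact (\<lambda>h. \<psi> e (Si h)) b = \<zero>\<^bsub>B\<^esub>) \<and>
    finsum B (\<lambda>e. cosum B \<rho> (\<lambda>c0 c1. j (S e \<otimes>\<^bsub>H\<^esub> Si c1) \<otimes>\<^bsub>B\<^esub> c0) (coact (\<lambda>h. \<psi> e (Si h)) b)) E = b"
proof -
  note W = B.k_module and \<psi> = H.H_basisD(2)[OF X]
  (* Expand the tensor u = sum of b0 and the inverse antipode of b1, instead of the coaction itself. *)
  define u where "u = cosum BH \<rho> (\<lambda>b0 b1. ptBH b0 (Si b1)) b"
  have u: "u \<in> carrier BH" unfolding u_def by (rule lins b | assumption)+
  have cu: "coord (\<psi> e) u = coact (\<lambda>h. \<psi> e (Si h)) b" for e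
  proof -
    note fl = H.functional_closed[OF \<psi>] lin_comp[OF \<psi>]
    have "coord (\<psi> e) u = cosum B \<rho> (\<lambda>b0 b1. coord (\<psi> e) (ptBH b0 (Si b1))) b"
      unfolding u_def by (rule hom_cosum[OF BH.module_T W lin_coord[OF \<psi>] b]) (rule lins | assumption)+
    also have "\<dots> = coact (\<lambda>h. \<psi> e (Si h)) b"
      unfolding coact_def by (rule cosum_cong[OF W b]) (simp_all add: coord_pure[OF \<psi>] H.Si_closed fl)
    finally show ?thesis .
  qed
  obtain E where E: "finite E" "E \<subseteq> X" "\<forall>e. e \<notin> E \<longrightarrow> coord (\<psi> e) u = \<zero>\<^bsub>B\<^esub>"
    "\<forall>E'. finite E' \<and> E \<subseteq> E' \<and> E' \<subseteq> carrier H \<longrightarrow> finsum BH (\<lambda>e. ptBH (coord (\<psi> e) u) e) E' = u"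
    using coord_expand[OF X u] by (elim exE conjE)
  have EH: "E \<subseteq> carrier H" using E(2) H.H_basisD(1)[OF X] by blast
  have Eu: "finsum BH (\<lambda>e. ptBH (coord (\<psi> e) u) e) E = u" by (rule E(4)[rule_format]) (use E EH in blast)
  define \<Phi> where "\<Phi> c e = cosum B \<rho> (\<lambda>c0 c1. j (S e \<otimes>\<^bsub>H\<^esub> Si c1) \<otimes>\<^bsub>B\<^esub> c0) c" for c e
  have b\<Phi>: "bilinear_map K B H B \<Phi>" unfolding \<Phi>_def by (rule lins | assumption)+
  have cl: "coord (\<psi> e) u \<in> carrier B" for e by (rule module_hom_closed[OF lin_coord[OF \<psi>] u])
  have "finsum B (\<lambda>e. \<Phi> (coord (\<psi> e) u) e) E = finsum B (\<lambda>e. tensor_sum B \<Phi> (ptBH (coord (\<psi> e) u) e)) E"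
    by (rule B.finsum_cong') (use cl EH in \<open>auto simp: BH.tensor_sum_pure[OF W b\<Phi>] subset_iff intro!: bilinear_map_closed[OF b\<Phi>]\<close>)
  also have "\<dots> = tensor_sum B \<Phi> u"
    by (subst (2) Eu[symmetric],
        rule module_hom_finsum[OF BH.abelian_group_T B.abgroup BH.lin_tensor_sum[OF W b\<Phi>], symmetric])
      (use cl EH in \<open>auto intro!: BH.pure_T\<close>)
  also have "\<dots> = cosum B \<rho> (\<lambda>b0 b1. tensor_sum B \<Phi> (ptBH b0 (Si b1))) b"
    unfolding u_def by (rule hom_cosum[OF BH.module_T W BH.lin_tensor_sum[OF W b\<Phi>] b]) (rule lins | assumption)+
  also have "\<dots> = cosum B \<rho> (\<lambda>b0 b1. cosum B \<rho> (\<lambda>c0 c1. j (b1 \<otimes>\<^bsub>H\<^esub> Si c1) \<otimes>\<^bsub>B\<^esub> c0) b0) b"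
  proof (rule cosum_cong[OF W b])
    fix b0 b1 assume b0: "b0 \<in> carrier B" and b1: "b1 \<in> carrier H"
    show "tensor_sum B \<Phi> (ptBH b0 (Si b1)) = cosum B \<rho> (\<lambda>c0 c1. j (b1 \<otimes>\<^bsub>H\<^esub> Si c1) \<otimes>\<^bsub>B\<^esub> c0) b0"
      using BH.tensor_sum_pure[OF W b\<Phi> b0 H.Si_closed[OF b1]] b1 by (simp add: \<Phi>_def H.S_Si)
    show "cosum B \<rho> (\<lambda>c0 c1. j (b1 \<otimes>\<^bsub>H\<^esub> Si c1) \<otimes>\<^bsub>B\<^esub> c0) b0 \<in> carrier B"
      by (rule lins b0 b1 | assumption)+
  qed
  also have "\<dots> = cosum B \<rho> (\<lambda>c0 t. cosum B \<Delta> (\<lambda>c1 b1. j (b1 \<otimes>\<^bsub>H\<^esub> Si c1) \<otimes>\<^bsub>B\<^esub> c0) t) b"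
    by (rule cosum_coassoc; (rule lins b | assumption)+)
  also have "\<dots> = cosum B \<rho> (\<lambda>c0 t. \<epsilon> t \<odot>\<^bsub>B\<^esub> (j \<one>\<^bsub>H\<^esub> \<otimes>\<^bsub>B\<^esub> c0)) b"
    by (rule cosum_cong, rule W, rule b, rule H.Si_right_sum; (rule lins b | assumption)+)
  also have "\<dots> = j \<one>\<^bsub>H\<^esub> \<otimes>\<^bsub>B\<^esub> b"
    by (rule cosum_counit; (rule lins b | assumption)+)
  finally have "finsum B (\<lambda>e. \<Phi> (coord (\<psi> e) u) e) E = b" using b by (simp add: j_one)
  then show ?thesis using E(1-3) unfolding cu \<Phi>_def by (intro exI[of _ E]) simp
qed

text \<open>The index set consists of pairs of a basis element \<open>e\<close> of \<open>H\<close> and the number of a summand in a preimage of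
  \<open>1 \<otimes> e\<close> under the Galois map. The functionals are \<open>F\<close> with one argument in this preimage and the other one
  the component along \<open>e\<close>.\<close>

theorem projective_GammaM: "projective_module TYPE('m) TYPE('n) Ae GammaM"
proof -
  obtain X \<psi> where X: "H.H_basis X \<psi>" using H.ex_H_basis by blast
  note \<psi> = H.H_basisD(2)[OF X]
  have XH: "e \<in> carrier H" if "e \<in> X" for e using H.H_basisD(1)[OF X] that by blast
  (* x and y list a preimage of 1 tensor e with n summands. *)
  define Q where "Q e nxy \<longleftrightarrow> (case nxy of (n :: nat, x, y) \<Rightarrow> x \<in> {..<n} \<rightarrow> carrier B \<and> y \<in> {..<n} \<rightarrow> carrier B \<and>
    finsum BH (\<lambda>i. galois (x i) (y i)) {..<n} = ptBH \<one>\<^bsub>B\<^esub> e)" for e nxy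
  have "\<forall>e \<in> X. \<exists>nxy. Q e nxy"
  proof
    fix e assume "e \<in> X"
    then have "ptBH \<one>\<^bsub>B\<^esub> e \<in> carrier BH" using XH by (simp add: BH.pure_T)
    from galois_surj[OF this] show "\<exists>nxy. Q e nxy"
      unfolding Q_def by (elim exE) (rule_tac x = "(n, x, y)" in exI, simp)
  qed
  then have "\<exists>N. \<forall>e \<in> X. Q e (N e)" by (rule bchoice)
  then obtain N where N: "\<And>e. e \<in> X \<Longrightarrow> Q e (N e)" by blast
  define n where "n e = fst (N e)" for e
  define x where "x p = fst (snd (N (fst p))) (snd p)" for p
  define y where "y p = snd (snd (N (fst p))) (snd p)" for p
  have xy: "(\<lambda>i. x (e, i)) \<in> {..<n e} \<rightarrow> carrier B" "(\<lambda>i. y (e, i)) \<in> {..<n e} \<rightarrow> carrier B"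
    "finsum BH (\<lambda>i. galois (x (e, i)) (y (e, i))) {..<n e} = ptBH \<one>\<^bsub>B\<^esub> e" if "e \<in> X" for e
    using N[OF that] by (simp_all add: Q_def x_def y_def n_def split_def Pi_iff)
  define I where "I = Sigma X (\<lambda>e. {..<n e})"
  have xI: "x p \<in> carrier B" and yI: "y p \<in> carrier B" and pX: "fst p \<in> X" if "p \<in> I" for p
    using that xy(1,2) by (auto simp: I_def Pi_iff)
  define s where "s p b = F (coact (\<psi> (fst p)) b) (x p)" for p b
  define t where "t p b = F (y p) (coact (\<lambda>h. \<psi> (fst p) (Si h)) b)" for p b
  have F0: "F \<zero>\<^bsub>B\<^esub> b = \<zero>\<^bsub>B\<^esub>" "F b \<zero>\<^bsub>B\<^esub> = \<zero>\<^bsub>B\<^esub>" if "b \<in> carrier B" for b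
    using bilinear_F that module_hom_zero[OF B.abgroup B.abgroup] unfolding bilinear_map_def by auto
  have \<psi>S: "(\<lambda>h. \<psi> e (Si h)) \<in> functionals" for e by (rule Si_functional[OF \<psi>])
  note cl = coact_closed[OF \<psi>] coact_closed[OF \<psi>S]
  have Jsum: "finsum B (\<lambda>p. f p) (Sigma E (\<lambda>e. {..<n e})) = finsum B (\<lambda>e. finsum B (\<lambda>i. f (e, i)) {..<n e}) E"
    if "finite E" "E \<subseteq> X" "\<And>p. p \<in> I \<Longrightarrow> f p \<in> carrier B" for E f
    unfolding finsum_def
    by (rule comm_monoid.finprod_Sigma[OF B.a_comm_monoid that(1)]) (use that(2,3) in \<open>auto simp: I_def\<close>)
  show ?thesis
  proof (rule projective_if_dual_bases[of I y x s t])
    show "y p \<in> carrier B" "x p \<in> carrier B" if "p \<in> I" for p using that xI yI by auto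
    show "s p \<in> module_hom K B A" if p: "p \<in> I" for p
    proof (rule lin_B_to_A)
      show "s p \<in> module_hom K B B"
        unfolding s_def using bilinear_F xI[OF p] lin_comp[OF _ lin_coact[OF \<psi>], of "\<lambda>b. F b (x p)"]
        unfolding bilinear_map_def by auto
      show "s p b \<in> carrier A" if "b \<in> carrier B" for b
        unfolding s_def by (rule F_A[OF cl(1)[OF that] xI[OF p]])
    qed
    show "t p \<in> module_hom K B A" if p: "p \<in> I" for p
    proof (rule lin_B_to_A)
      show "t p \<in> module_hom K B B"
        unfolding t_def using bilinear_F yI[OF p] lin_comp[OF _ lin_coact[OF \<psi>S], of "\<lambda>b. F (y p) b"]
        unfolding bilinear_map_def by auto
      show "t p b \<in> carrier A" if "b \<in> carrier B" for b
        unfolding t_def by (rule F_A[OF yI[OF p] cl(2)[OF that]])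
    qed
    show "s p (a \<otimes>\<^bsub>B\<^esub> b) = a \<otimes>\<^bsub>B\<^esub> s p b" if "p \<in> I" "a \<in> carrier A" "b \<in> carrier B" for p a b
      using that xI cl by (simp add: s_def coact_A_left[OF \<psi>] F_A_left)
    show "t p (b \<otimes>\<^bsub>B\<^esub> a) = t p b \<otimes>\<^bsub>B\<^esub> a" if "p \<in> I" "a \<in> carrier A" "b \<in> carrier B" for p a b
      using that yI cl by (simp add: t_def coact_A_right[OF \<psi>S] F_A_right)
    fix b assume b: "b \<in> carrier B"
    show "\<exists>J. finite J \<and> J \<subseteq> I \<and> (\<forall>p \<in> I - J. s p b = \<zero>\<^bsub>B\<^esub>) \<and> finsum B (\<lambda>p. s p b \<otimes>\<^bsub>B\<^esub> y p) J = b"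
    proof -
      obtain E where E: "finite E" "E \<subseteq> X" and z: "\<And>e. e \<notin> E \<Longrightarrow> coact (\<psi> e) b = \<zero>\<^bsub>B\<^esub>"
        and "finsum BH (\<lambda>e. ptBH (coact (\<psi> e) b) e) E = \<rho> b"
        by (rule cosum_coord[OF X b]) (rule that)
      note E = E this(4)
      let ?J = "Sigma E (\<lambda>e. {..<n e})"
      have "finsum B (\<lambda>p. s p b \<otimes>\<^bsub>B\<^esub> y p) ?J = finsum B (\<lambda>e. finsum B (\<lambda>i. s (e, i) b \<otimes>\<^bsub>B\<^esub> y (e, i)) {..<n e}) E"
        by (rule Jsum[OF E(1,2)]) (use xI yI cl b in \<open>auto simp: s_def F_closed\<close>)
      also have "\<dots> = finsum B (\<lambda>e. q (coact (\<psi> e) b) e) E"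
      proof (rule B.finsum_cong'[OF refl])
        show "(\<lambda>e. q (coact (\<psi> e) b) e) \<in> E \<rightarrow> carrier B" using E(2) XH cl b by (auto simp: q_closed)
        fix e assume "e \<in> E"
        then have e: "e \<in> X" using E(2) by blast
        show "finsum B (\<lambda>i. s (e, i) b \<otimes>\<^bsub>B\<^esub> y (e, i)) {..<n e} = q (coact (\<psi> e) b) e"
          using F_galois_left[OF cl(1)[OF b] XH[OF e] xy[OF e]] by (simp add: s_def)
      qed
      also have "\<dots> = cosum B \<rho> q b"
        by (rule cosum_eq_finsum[OF X b B.k_module _ E, symmetric]) (rule lins | assumption)+
      also have "\<dots> = b" by (rule q_self[OF b])
      finally have sum: "finsum B (\<lambda>p. s p b \<otimes>\<^bsub>B\<^esub> y p) ?J = b" .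
      have "s p b = \<zero>\<^bsub>B\<^esub>" if p: "p \<in> I - ?J" for p
      proof -
        have "fst p \<notin> E" using p by (auto simp: I_def)
        then show ?thesis using z F0(1) xI p by (simp add: s_def)
      qed
      then show ?thesis
        using sum E by (intro exI[of _ ?J]) (auto simp: I_def)
    qed
    show "\<exists>J. finite J \<and> J \<subseteq> I \<and> (\<forall>p \<in> I - J. t p b = \<zero>\<^bsub>B\<^esub>) \<and> finsum B (\<lambda>p. x p \<otimes>\<^bsub>B\<^esub> t p b) J = b"
    proof -
      obtain E where E: "finite E" "E \<subseteq> X" and z: "\<forall>e. e \<notin> E \<longrightarrow> coact (\<lambda>h. \<psi> e (Si h)) b = \<zero>\<^bsub>B\<^esub>"
        and exp: "finsum B (\<lambda>e. cosum B \<rho> (\<lambda>c0 c1. j (S e \<otimes>\<^bsub>H\<^esub> Si c1) \<otimes>\<^bsub>B\<^esub> c0) (coact (\<lambda>h. \<psi> e (Si h)) b)) E = b"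
        using right_expansion[OF X b] by (elim exE conjE)
      let ?J = "Sigma E (\<lambda>e. {..<n e})"
      have "finsum B (\<lambda>p. x p \<otimes>\<^bsub>B\<^esub> t p b) ?J = finsum B (\<lambda>e. finsum B (\<lambda>i. x (e, i) \<otimes>\<^bsub>B\<^esub> t (e, i) b) {..<n e}) E"
        by (rule Jsum[OF E(1,2)]) (use xI yI cl b in \<open>auto simp: t_def F_closed\<close>)
      also have "\<dots> = finsum B (\<lambda>e. cosum B \<rho> (\<lambda>c0 c1. j (S e \<otimes>\<^bsub>H\<^esub> Si c1) \<otimes>\<^bsub>B\<^esub> c0) (coact (\<lambda>h. \<psi> e (Si h)) b)) E"
      proof (rule B.finsum_cong'[OF refl])
        show "(\<lambda>e. cosum B \<rho> (\<lambda>c0 c1. j (S e \<otimes>\<^bsub>H\<^esub> Si c1) \<otimes>\<^bsub>B\<^esub> c0) (coact (\<lambda>h. \<psi> e (Si h)) b)) \<in> E \<rightarrow> carrier B"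
        proof
          fix e assume "e \<in> E"
          then have e: "e \<in> carrier H" using E(2) XH by blast
          show "cosum B \<rho> (\<lambda>c0 c1. j (S e \<otimes>\<^bsub>H\<^esub> Si c1) \<otimes>\<^bsub>B\<^esub> c0) (coact (\<lambda>h. \<psi> e (Si h)) b) \<in> carrier B"
            by (rule lins e cl(2)[OF b] | assumption)+
        qed
        fix e assume "e \<in> E"
        then have e: "e \<in> X" using E(2) by blast
        show "finsum B (\<lambda>i. x (e, i) \<otimes>\<^bsub>B\<^esub> t (e, i) b) {..<n e} =
            cosum B \<rho> (\<lambda>c0 c1. j (S e \<otimes>\<^bsub>H\<^esub> Si c1) \<otimes>\<^bsub>B\<^esub> c0) (coact (\<lambda>h. \<psi> e (Si h)) b)"
          using F_galois_right[OF cl(2)[OF b] XH[OF e] xy[OF e]] by (simp add: t_def)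
      qed
      also have "\<dots> = b" by (rule exp)
      finally have sum: "finsum B (\<lambda>p. x p \<otimes>\<^bsub>B\<^esub> t p b) ?J = b" .
      have "t p b = \<zero>\<^bsub>B\<^esub>" if p: "p \<in> I - ?J" for p
      proof -
        have "fst p \<notin> E" using p by (auto simp: I_def)
        then show ?thesis using z F0(2) yI p by (simp add: t_def)
      qed
      then show ?thesis
        using sum E by (intro exI[of _ ?J]) (auto simp: I_def)
    qed
  qed
qed

end

theorem proposition3p19:
  fixes K :: "('k, 'x) ring_scheme"
    and H :: "('k, 'h, 'y) module_scheme"
    and \<Delta> :: "'h \<Rightarrow> ('h \<times> 'h \<Rightarrow>\<^sub>0 int) set" and \<epsilon> :: "'h \<Rightarrow> 'k" and S :: "'h \<Rightarrow> 'h"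
    and B :: "('k, 'b, 'z) module_scheme"
    and \<rho> :: "'b \<Rightarrow> ('b \<times> 'h \<Rightarrow>\<^sub>0 int) set"
  assumes "field K"
    and "hopf_algebra K H \<Delta> \<epsilon> S"
    and "bij_betw S (carrier H) (carrier H)"
    and "comodule_algebra K H \<Delta> \<epsilon> S B \<rho>"
    and "faithfully_flat_galois K H B \<rho>"
  shows "projective_module TYPE('m) TYPE('n)
    (enveloping_algebra K (coinvariants K H B \<rho>))
    (ehresmann_schauenburg_module K H B \<rho>)"
proof -
  have bij: "bijective_hopf_algebra K H \<Delta> \<epsilon> S"
    by (intro bijective_hopf_algebra.intro bijective_hopf_algebra_axioms.intro assms)
  have "bijective_comodule_algebra K H \<Delta> \<epsilon> S B \<rho>"
    by (intro bijective_comodule_algebra.intro bij assms)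
  then have gal: "galois_extension K H \<Delta> \<epsilon> S B \<rho>"
    using assms(5) unfolding faithfully_flat_galois_def
    by (intro galois_extension.intro galois_extension_axioms.intro) auto
  obtain j where "total_integral K H \<Delta> \<epsilon> S B \<rho> j"
    using galois_extension.total_integral_exists[OF gal] by blast
  with gal have "galois_integral K H \<Delta> \<epsilon> S B \<rho> j"
    by (intro galois_integral.intro)
  then show ?thesis by (rule galois_integral.projective_GammaM)
qed

end
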